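(* Let $\nu$ be a locally finite positive measure on the interval $J=(l,r)$. Assume that $s(l)>-\infty$. (i) If $\frac{s-s(l)}{\rho}\in L^1_{\mathrm{loc}}(l+,\nu)$, then $$\int_JL^y_\zeta(Y)\,\nu(dy)<\infty\quad\mathsf P\text{-a.s. on }\left\{\lim_{t\uparrow\zeta}Y_t=l\right\}.$$ (ii) If $\frac{s-s(l)}{\rho}\notin L^1_{\mathrm{loc}}(l+,\nu)$, then $$\int_JL^y_\zeta(Y)\,\nu(dy)=\infty\quad\mathsf P\text{-a.s. on }\left\{\lim_{t\uparrow\zeta}Y_t=l\right\}.$$
   Context: Let $J=(l,r)$, $-\infty\le l<r\le\infty$, and let $\mu,\sigma\colon J\to\mathbb R$ be Borel functions with $\sigma(x)\ne0$ for all $x\in J$ and $\frac1{\sigma^2},\frac{\mu}{\sigma^2}\in L^1_{\mathrm{loc}}(J)$ (integrable on compact subsets of $J$ with respect to Lebesgue measure). On a filtered probability space $(\Omega,\mathcal F,(\mathcal F_t)_{t\in[0,\infty)},\mathsf P)$ with an $(\mathcal F_t,\mathsf P)$-Brownian motion $W$, let $Y=(Y_t)_{t\in[0,\infty)}$ be a solution of $dY_t=\mu(Y_t)\,dt+\sigma(Y_t)\,dW_t$, $Y_0=x_0\in J$, which may exit $J$ continuously at a finite time; $\zeta$ denotes its exit time from $J$. That is, $\mathsf P$-a.s. on $\{\zeta=\infty\}$ the trajectories do not exit $J$, and $\mathsf P$-a.s. on $\{\zeta<\infty\}$ either $\lim_{t\uparrow\zeta}Y_t=r$ or $\lim_{t\uparrow\zeta}Y_t=l$;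 on $\{\zeta<\infty\}$ the process $Y$ stays after $\zeta$ at the endpoint where it exits. $(L^y_t(Y);\,t\in[0,\zeta),\,y\in J)$ is an a.s. continuous in $t$ and càdlàg in $y$ version of the local time of the continuous semimartingale $Y$ on the stochastic interval $[0,\zeta)$, and $L^y_\zeta(Y):=\lim_{t\uparrow\zeta}L^y_t(Y)\in[0,\infty]$ (monotone limit). Fix $c\in J$ and put $\rho(x)=\exp\{-\int_c^x\frac{2\mu}{\sigma^2}(y)\,dy\}$ for $x\in J$ and $s(x)=\int_c^x\rho(y)\,dy$ for $x\in[l,r]$ (values $\pm\infty$ allowed at the endpoints). For a positive measure $\nu$ on $J$, $L^1_{\mathrm{loc}}(l+,\nu)$ is the set of Borel functions $f\colon J\to[-\infty,\infty]$ with $\int_{(l,z)}|f|\,d\nu<\infty$ for some $z\in J$. The event $\{\lim_{t\uparrow\zeta}Y_t=l\}$ includes trajectories with $\zeta=\infty$ and $\lim_{t\to\infty}Y_t=l$. *)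

theory Defs
  imports "HOL-Probability.Probability"
begin

section \<open>Filtered probability spaces and Brownian motion\<close>

text \<open>
  Time runs through \<open>[0,\<infinity>)\<close>, embedded in the reals. The \<open>\<sigma>\<close>-algebras \<open>F t\<close> with \<open>t < 0\<close> are never
  used; requiring monotonicity for them too is no restriction (let \<open>F t = F 0\<close> for \<open>t < 0\<close>).
  Neither completeness nor right-continuity of the filtration is assumed.
\<close>

definition filtered_prob_space :: "'a measure \<Rightarrow> (real \<Rightarrow> 'a measure) \<Rightarrow> bool" where
  "filtered_prob_space M F \<longleftrightarrow>
     prob_space M \<and> filtration (space M) F \<and> (\<forall>t. subalgebra M (F t))"

definition brownian_motion ::
  "'a measure \<Rightarrow> (real \<Rightarrow> 'a measure) \<Rightarrow> (real \<Rightarrow> 'a \<Rightarrow> real) \<Rightarrow> bool" where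
  "brownian_motion M F W \<longleftrightarrow>
     (\<forall>t\<ge>0. W t \<in> borel_measurable (F t)) \<and>
     (AE \<omega> in M. W 0 \<omega> = 0) \<and>
     (AE \<omega> in M. continuous_on {0..} (\<lambda>t. W t \<omega>)) \<and>
     (\<forall>s t. 0 \<le> s \<longrightarrow> s < t \<longrightarrow>
        distributed M lborel (\<lambda>\<omega>. W t \<omega> - W s \<omega>) (normal_density 0 (sqrt (t - s))) \<and>
        prob_space.indep_set M (sets (F s))
          (sets (vimage_algebra (space M) (\<lambda>\<omega>. W t \<omega> - W s \<omega>) borel)))"

section \<open>The It\^o integral\<close>

definition progressively_measurable ::
  "(real \<Rightarrow> 'a measure) \<Rightarrow> (real \<Rightarrow> 'a \<Rightarrow> real) \<Rightarrow> bool" where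
  "progressively_measurable F H \<longleftrightarrow>
     (\<forall>t\<ge>0. (\<lambda>(s, \<omega>). H s \<omega>) \<in> borel_measurable (restrict_space borel {0..t} \<Otimes>\<^sub>M F t))"

text \<open>
  Elementary integrands \<open>\<Sum>i<k. \<xi>\<^sub>i 1\<^bsub>(p\<^sub>i, p\<^sub>i\<^sub>+\<^sub>1]\<^esub>\<close>, given by the data \<open>(k, p, \<xi>)\<close>, with
  \<open>\<xi>\<^sub>i\<close> bounded and \<open>F p\<^sub>i\<close>-measurable.
\<close>

definition elementary ::
  "(real \<Rightarrow> 'a measure) \<Rightarrow> nat \<Rightarrow> (nat \<Rightarrow> real) \<Rightarrow> (nat \<Rightarrow> 'a \<Rightarrow> real) \<Rightarrow> bool" where
  "elementary F k p \<xi> \<longleftrightarrow>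
     0 \<le> p 0 \<and> (\<forall>i<k. p i \<le> p (Suc i)) \<and>
     (\<forall>i<k. \<xi> i \<in> borel_measurable (F (p i)) \<and> (\<exists>C. \<forall>\<omega>\<in>space (F (p i)). \<bar>\<xi> i \<omega>\<bar> \<le> C))"

definition elementary_process ::
  "nat \<Rightarrow> (nat \<Rightarrow> real) \<Rightarrow> (nat \<Rightarrow> 'a \<Rightarrow> real) \<Rightarrow> real \<Rightarrow> 'a \<Rightarrow> real" where
  "elementary_process k p \<xi> s \<omega> = (\<Sum>i<k. \<xi> i \<omega> * indicator {p i<..p (Suc i)} s)"

definition elementary_integral ::
  "(real \<Rightarrow> 'a \<Rightarrow> real) \<Rightarrow> nat \<Rightarrow> (nat \<Rightarrow> real) \<Rightarrow> (nat \<Rightarrow> 'a \<Rightarrow> real) \<Rightarrow> real \<Rightarrow> 'a \<Rightarrow> real" where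
  "elementary_integral W k p \<xi> t \<omega> = (\<Sum>i<k. \<xi> i \<omega> * (W (min t (p (Suc i))) \<omega> - W (min t (p i)) \<omega>))"

text \<open>
  \<open>ito_integral M F W H I\<close>: the process \<open>I\<close> is (a version of) \<open>(\<integral>\<^sub>0\<^sup>t H\<^sub>s dW\<^sub>s)\<^sub>t\<^sub>\<ge>\<^sub>0\<close>, for a progressively
  measurable \<open>H\<close> with \<open>\<integral>\<^sub>0\<^sup>t H\<^sub>s\<^sup>2 ds < \<infinity>\<close> almost surely. It is the continuous process that for each \<open>t\<close>
  is the limit in probability of the integrals of elementary integrands \<open>H\<^sup>n\<close> with
  \<open>\<integral>\<^sub>0\<^sup>t (H\<^sup>n\<^sub>s - H\<^sub>s)\<^sup>2 ds \<rightarrow> 0\<close> in probability; such \<open>I\<close> is unique up to indistinguishability.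
\<close>

definition ito_integral ::
  "'a measure \<Rightarrow> (real \<Rightarrow> 'a measure) \<Rightarrow> (real \<Rightarrow> 'a \<Rightarrow> real) \<Rightarrow>
   (real \<Rightarrow> 'a \<Rightarrow> real) \<Rightarrow> (real \<Rightarrow> 'a \<Rightarrow> real) \<Rightarrow> bool" where
  "ito_integral M F W H I \<longleftrightarrow>
     progressively_measurable F H \<and>
     (AE \<omega> in M. \<forall>t\<ge>0. (\<integral>\<^sup>+s\<in>{0..t}. ennreal ((H s \<omega>)\<^sup>2) \<partial>lborel) < \<infinity>) \<and>
     (\<forall>t\<ge>0. I t \<in> borel_measurable M) \<and>
     (AE \<omega> in M. continuous_on {0..} (\<lambda>t. I t \<omega>)) \<and>
     (\<exists>k p \<xi>. (\<forall>n. elementary F (k n) (p n) (\<xi> n)) \<and>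
        (\<forall>t\<ge>0. \<forall>\<epsilon>>0.
           (\<lambda>n. measure M {\<omega>\<in>space M. ennreal \<epsilon> <
              (\<integral>\<^sup>+s\<in>{0..t}. ennreal ((elementary_process (k n) (p n) (\<xi> n) s \<omega> - H s \<omega>)\<^sup>2) \<partial>lborel)})
             \<longlonglongrightarrow> 0 \<and>
           (\<lambda>n. measure M {\<omega>\<in>space M.
              \<epsilon> < \<bar>elementary_integral W (k n) (p n) (\<xi> n) t \<omega> - I t \<omega>\<bar>}) \<longlonglongrightarrow> 0))"

section \<open>It\^o processes and their local times\<close>

text \<open>The semimartingale \<open>dX\<^sub>t = b\<^sub>t dt + a\<^sub>t dW\<^sub>t\<close>.\<close>

definition ito_process ::
  "'a measure \<Rightarrow> (real \<Rightarrow> 'a measure) \<Rightarrow> (real \<Rightarrow> 'a \<Rightarrow> real) \<Rightarrow> (real \<Rightarrow> 'a \<Rightarrow> real) \<Rightarrow>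
   (real \<Rightarrow> 'a \<Rightarrow> real) \<Rightarrow> (real \<Rightarrow> 'a \<Rightarrow> real) \<Rightarrow> bool" where
  "ito_process M F W X b a \<longleftrightarrow>
     progressively_measurable F b \<and>
     (AE \<omega> in M. \<forall>t\<ge>0. set_integrable lborel {0..t} (\<lambda>s. b s \<omega>)) \<and>
     (\<exists>I. ito_integral M F W a I \<and>
        (AE \<omega> in M. \<forall>t\<ge>0. X t \<omega> = X 0 \<omega> + (LBINT s:{0..t}. b s \<omega>) + I t \<omega>))"

text \<open>
  The local time at level \<open>y\<close> is defined by Tanaka's formula
  \<open>L\<^sub>t = |X\<^sub>t - y| - |X\<^sub>0 - y| - \<integral>\<^sub>0\<^sup>t sgn(X\<^sub>s - y) dX\<^sub>s\<close>. The convention \<open>sgn(0) = -1\<close> (unlike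
  \<^const>\<open>sgn\<close>) is the one for which local time is right-continuous in \<open>y\<close>.
\<close>

definition sgn_left :: "real \<Rightarrow> real" where
  "sgn_left x = (if x > 0 then 1 else -1)"

definition ito_local_time ::
  "'a measure \<Rightarrow> (real \<Rightarrow> 'a measure) \<Rightarrow> (real \<Rightarrow> 'a \<Rightarrow> real) \<Rightarrow> (real \<Rightarrow> 'a \<Rightarrow> real) \<Rightarrow>
   (real \<Rightarrow> 'a \<Rightarrow> real) \<Rightarrow> (real \<Rightarrow> 'a \<Rightarrow> real) \<Rightarrow> real \<Rightarrow> (real \<Rightarrow> 'a \<Rightarrow> real) \<Rightarrow> bool" where
  "ito_local_time M F W X b a y \<Lambda> \<longleftrightarrow>
     ito_process M F W X b a \<and>
     (\<exists>I. ito_integral M F W (\<lambda>s \<omega>. sgn_left (X s \<omega> - y) * a s \<omega>) I \<and>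
        (AE \<omega> in M. \<forall>t\<ge>0.
           \<Lambda> t \<omega> = \<bar>X t \<omega> - y\<bar> - \<bar>X 0 \<omega> - y\<bar>
             - ((LBINT s:{0..t}. sgn_left (X s \<omega> - y) * b s \<omega>) + I t \<omega>)))"

section \<open>Solutions up to the exit time\<close>

text \<open>\<open>J = einterval l r\<close> and the solution takes values in \<open>[l,r]\<close>, hence in \<^typ>\<open>ereal\<close>.
  The infimum of the empty set is \<open>\<infinity>\<close>.\<close>

definition exit_time :: "(real \<Rightarrow> 'a \<Rightarrow> ereal) \<Rightarrow> ereal \<Rightarrow> ereal \<Rightarrow> 'a \<Rightarrow> ereal" where
  "exit_time Y a b \<omega> = Inf {ereal t | t. 0 \<le> t \<and> Y t \<omega> \<notin> {a<..<b}}"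

definition stop_at :: "('a \<Rightarrow> ereal) \<Rightarrow> (real \<Rightarrow> 'a \<Rightarrow> 'b) \<Rightarrow> real \<Rightarrow> 'a \<Rightarrow> 'b" where
  "stop_at \<tau> Z t \<omega> = Z (real_of_ereal (min (ereal t) (\<tau> \<omega>))) \<omega>"

text \<open>The coefficient process \<open>g(Y\<^sub>t) 1\<^bsub>{t < \<tau>}\<^esub>\<close>.\<close>

definition coeff_until ::
  "('a \<Rightarrow> ereal) \<Rightarrow> (real \<Rightarrow> real) \<Rightarrow> (real \<Rightarrow> 'a \<Rightarrow> ereal) \<Rightarrow> real \<Rightarrow> 'a \<Rightarrow> real" where
  "coeff_until \<tau> g Y t \<omega> = (if ereal t < \<tau> \<omega> then g (real_of_ereal (Y t \<omega>)) else 0)"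

text \<open>
  \<open>Y\<close> solves \<open>dY\<^sub>t = \<mu>(Y\<^sub>t) dt + \<sigma>(Y\<^sub>t) dW\<^sub>t\<close>, \<open>Y\<^sub>0 = x\<^sub>0\<close> up to its exit time \<open>\<zeta>\<close> from \<open>J\<close>: the equation
  holds for \<open>Y\<close> stopped on leaving \<open>(a,b)\<close>, for each \<open>[a,b] \<subseteq> J\<close> with \<open>a < x\<^sub>0 < b\<close>. After \<open>\<zeta>\<close> the
  process is constant. Since the paths are continuous in \<open>[l,r]\<close>, on \<open>{\<zeta> < \<infinity>}\<close> the limit of \<open>Y\<close> at
  \<open>\<zeta>\<close> is \<open>l\<close> or \<open>r\<close>.
\<close>

definition sde_solution ::
  "'a measure \<Rightarrow> (real \<Rightarrow> 'a measure) \<Rightarrow> (real \<Rightarrow> 'a \<Rightarrow> real) \<Rightarrow> ereal \<Rightarrow> ereal \<Rightarrow>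
   (real \<Rightarrow> real) \<Rightarrow> (real \<Rightarrow> real) \<Rightarrow> real \<Rightarrow> (real \<Rightarrow> 'a \<Rightarrow> ereal) \<Rightarrow> bool" where
  "sde_solution M F W l r \<mu> \<sigma> x0 Y \<longleftrightarrow>
     (\<forall>t\<ge>0. Y t \<in> borel_measurable (F t)) \<and>
     (\<forall>\<omega>\<in>space M. continuous_on {0..} (\<lambda>t. Y t \<omega>)) \<and>
     (AE \<omega> in M. \<forall>t\<ge>0. Y t \<omega> \<in> {l..r}) \<and>
     (AE \<omega> in M. Y 0 \<omega> = ereal x0) \<and>
     (AE \<omega> in M. \<forall>t. exit_time Y l r \<omega> \<le> ereal t \<longrightarrow>
        Y t \<omega> = Y (real_of_ereal (exit_time Y l r \<omega>)) \<omega>) \<and>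
     (\<forall>a b :: real. l < ereal a \<longrightarrow> a < x0 \<longrightarrow> x0 < b \<longrightarrow> ereal b < r \<longrightarrow>
        (let \<tau> = exit_time Y (ereal a) (ereal b) in
         ito_process M F W (\<lambda>t \<omega>. real_of_ereal (stop_at \<tau> Y t \<omega>))
           (coeff_until \<tau> \<mu> Y) (coeff_until \<tau> \<sigma> Y)))"

text \<open>
  \<open>L t y \<omega>\<close> stands for \<open>L\<^sup>y\<^sub>t(Y)(\<omega>)\<close>, relevant for \<open>t \<in> [0,\<zeta>)\<close> and \<open>y \<in> J\<close> only. Local time on
  \<open>[0,\<zeta>)\<close> is determined by localisation: stopped at \<open>\<tau>\<close> it is the local time of the
  semimartingale \<open>Y\<close> stopped at \<open>\<tau>\<close>.
\<close>

definition local_time_version ::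
  "'a measure \<Rightarrow> (real \<Rightarrow> 'a measure) \<Rightarrow> (real \<Rightarrow> 'a \<Rightarrow> real) \<Rightarrow> ereal \<Rightarrow> ereal \<Rightarrow>
   (real \<Rightarrow> real) \<Rightarrow> (real \<Rightarrow> real) \<Rightarrow> real \<Rightarrow> (real \<Rightarrow> 'a \<Rightarrow> ereal) \<Rightarrow>
   (real \<Rightarrow> real \<Rightarrow> 'a \<Rightarrow> real) \<Rightarrow> bool" where
  "local_time_version M F W l r \<mu> \<sigma> x0 Y L \<longleftrightarrow>
     (\<forall>y\<in>einterval l r. \<forall>a b :: real. l < ereal a \<longrightarrow> a < x0 \<longrightarrow> x0 < b \<longrightarrow> ereal b < r \<longrightarrow>
        (let \<tau> = exit_time Y (ereal a) (ereal b) in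
         ito_local_time M F W (\<lambda>t \<omega>. real_of_ereal (stop_at \<tau> Y t \<omega>))
           (coeff_until \<tau> \<mu> Y) (coeff_until \<tau> \<sigma> Y) y
           (stop_at \<tau> (\<lambda>t. L t y)))) \<and>
     (AE \<omega> in M.
        (\<forall>y\<in>einterval l r.
           continuous_on {t. 0 \<le> t \<and> ereal t < exit_time Y l r \<omega>} (\<lambda>t. L t y \<omega>)) \<and>
        (\<forall>t\<ge>0. ereal t < exit_time Y l r \<omega> \<longrightarrow>
           (\<forall>y\<in>einterval l r.
              continuous (at_right y) (\<lambda>z. L t z \<omega>) \<and>
              (\<exists>m. ((\<lambda>z. L t z \<omega>) \<longlongrightarrow> m) (at_left y)))))"

text \<open>The time variable is made \<^typ>\<open>ereal\<close>-valued so that \<open>t \<up> \<zeta>\<close> makes sense for \<open>\<zeta> \<le> \<infinity>\<close>.\<close>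

definition local_time_at_exit ::
  "(real \<Rightarrow> 'a \<Rightarrow> ereal) \<Rightarrow> ereal \<Rightarrow> ereal \<Rightarrow> (real \<Rightarrow> real \<Rightarrow> 'a \<Rightarrow> real) \<Rightarrow>
   real \<Rightarrow> 'a \<Rightarrow> ennreal" where
  "local_time_at_exit Y l r L y \<omega> =
     Lim (at_left (exit_time Y l r \<omega>)) (\<lambda>t. ennreal (L (real_of_ereal t) y \<omega>))"

definition tends_at_exit ::
  "(real \<Rightarrow> 'a \<Rightarrow> ereal) \<Rightarrow> ereal \<Rightarrow> ereal \<Rightarrow> ereal \<Rightarrow> 'a \<Rightarrow> bool" where
  "tends_at_exit Y l r e \<omega> \<longleftrightarrow>
     ((\<lambda>t. Y (real_of_ereal t) \<omega>) \<longlongrightarrow> e) (at_left (exit_time Y l r \<omega>))"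

section \<open>Scale function and integrability conditions\<close>

definition locally_integrable_on :: "real set \<Rightarrow> (real \<Rightarrow> real) \<Rightarrow> bool" where
  "locally_integrable_on J f \<longleftrightarrow> (\<forall>K. compact K \<longrightarrow> K \<subseteq> J \<longrightarrow> set_integrable lborel K f)"

definition scale_density :: "(real \<Rightarrow> real) \<Rightarrow> (real \<Rightarrow> real) \<Rightarrow> real \<Rightarrow> real \<Rightarrow> real" where
  "scale_density \<mu> \<sigma> c x = exp (- (LBINT y=ereal c..ereal x. 2 * \<mu> y / (\<sigma> y)\<^sup>2))"

text \<open>\<open>s(x) = \<integral>\<^sub>c\<^sup>x \<rho>(y) dy\<close> for \<open>x \<in> [l,r]\<close>, possibly \<open>\<plusminus>\<infinity>\<close> at the end points.\<close>

definition scale_fun :: "(real \<Rightarrow> real) \<Rightarrow> (real \<Rightarrow> real) \<Rightarrow> real \<Rightarrow> ereal \<Rightarrow> ereal" where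
  "scale_fun \<mu> \<sigma> c x =
     (if ereal c \<le> x
      then enn2ereal (\<integral>\<^sup>+y\<in>einterval (ereal c) x. ennreal (scale_density \<mu> \<sigma> c y) \<partial>lborel)
      else - enn2ereal (\<integral>\<^sup>+y\<in>einterval x (ereal c). ennreal (scale_density \<mu> \<sigma> c y) \<partial>lborel))"

definition locally_finite_measure_on :: "real set \<Rightarrow> real measure \<Rightarrow> bool" where
  "locally_finite_measure_on J \<nu> \<longleftrightarrow>
     sets \<nu> = sets (restrict_space borel J) \<and>
     (\<forall>K. compact K \<longrightarrow> K \<subseteq> J \<longrightarrow> emeasure \<nu> K < \<infinity>)"

text \<open>\<open>L\<^sup>1\<^sub>l\<^sub>o\<^sub>c(l+,\<nu>)\<close> for functions on \<open>J = (l,r)\<close>.\<close>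

definition L1_loc_left :: "ereal \<Rightarrow> ereal \<Rightarrow> real measure \<Rightarrow> (real \<Rightarrow> ereal) set" where
  "L1_loc_left l r \<nu> =
     {f. f \<in> borel_measurable (restrict_space borel (einterval l r)) \<and>
         (\<exists>z\<in>einterval l r. (\<integral>\<^sup>+x\<in>einterval l (ereal z). e2ennreal \<bar>f x\<bar> \<partial>\<nu>) < \<infinity>)}"

end

theory Submission
 imports Defs
begin

text \<open>
 Put \<open>U(x) = s(y) - s(min x y)\<close>. Ito's formula, extended to functions whose second derivative is merely integrable, shows
 that \<open>U(Y) - \<rho>(y) L\<^sup>y / 2\<close> is a local martingale up to \<open>\<zeta>\<close>, and \<open>0 \<le> U \<le> s(y) - s(l)\<close>. Hence
 \<open>E L\<^sup>y\<^sub>\<zeta> \<le> 2 (s(y) - s(l)) / \<rho>(y)\<close>, and (i) follows by Fubini, since only levels \<open>y\<close> below the maximum of the path matter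
 when \<open>Y\<close> tends to \<open>l\<close>. For (ii) stop when \<open>L\<^sup>y\<close> exceeds \<open>\<eta>\<close>: as \<open>U(Y)\<close> tends to \<open>s(y) - s(l)\<close> when \<open>Y\<close> tends to \<open>l\<close>, this gives
 \<open>P(Y \<rightarrow> l, L\<^sup>y\<^sub>\<zeta> \<le> \<eta>) \<le> \<rho>(y) \<eta> / (2 (s(y) - s(l)))\<close> for \<open>y \<le> x\<^sub>0\<close>, so \<open>L\<^sup>y\<^sub>\<zeta>\<close> is uniformly unlikely to be small compared to
 \<open>(s(y) - s(l)) / \<rho>(y)\<close>, which suffices for divergence by Jeulin's argument. The stochastic integrals are limits in
 probability of integrals of simple integrands, and every martingale bound is proved for those.
\<close>

text \<open>The filtration is neither complete nor right-continuous. Limits are therefore adapted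
  only up to null sets, and stopping times are avoided: simple integrals are switched off at grid
  points, and stopping at the level \<open>\<eta>\<close> of the local time means integrating the
  left-continuous adapted indicator of \<open>\<Lambda> s <= \<eta>\<close>. The density
  \<open>\<rho>\<close> has derivative \<open>- q * \<rho>\<close> with
  \<open>q = 2 \<mu> / \<sigma>^2\<close> merely integrable, so \<open>U\<close> is not piecewise
  C^2; this forces the extension of Ito's formula, by monotone classes in the second derivative,
  from the C^2 case obtained through Riemann sums. Local time is given by Tanaka's formula one level
  at a time, each with its own null set. Its growth in time comes from occupation integrals, and the
  joint measurability in level and path that Fubini requires is manufactured from dyadic levels by
  right-continuity. Since \<open>Y\<close> is an Ito process only when stopped inside J, every
  estimate is proved on intervals exhausting J, with bounds that do not depend on the interval, and
  reaches \<open>\<zeta>\<close> by Fatou's lemma.\<close>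

notation LIMSEQ (infix \<open>---->\<close> 60)

section \<open>Convergence in probability\<close>

context prob_space
begin

text \<open>Without completeness of the filtration a limit of adapted variables is adapted only up
  to an \<open>M\<close>-null set. This amounts to measurability with respect to \<open>N\<close>
  augmented by the null sets of \<open>M\<close>.\<close>

definition ae_measurable :: "'a measure => ('a => 'b::topological_space) => bool" where
 "ae_measurable N f \<longleftrightarrow> (\<exists>g\<in>borel_measurable N. AE w in M. f w = g w)"

lemma ae_measurableI: "f \<in> borel_measurable N ==> ae_measurable N f"
 unfolding ae_measurable_def by auto

lemma ae_measurable_cong:
 assumes "ae_measurable N f" "AE w in M. f w = g w" shows "ae_measurable N g"
proof -
 obtain h where "h \<in> borel_measurable N" "AE w in M. f w = h w"
  using assms unfolding ae_measurable_def by auto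
 moreover have "AE w in M. g w = h w" using calculation(2) assms(2) by eventually_elim auto
 ultimately show ?thesis unfolding ae_measurable_def by auto
qed

lemma ae_measurable_comp:
 assumes "ae_measurable N f" "\<phi> \<in> borel_measurable borel"
 shows "ae_measurable N (%w. \<phi> (f w))"
proof -
 obtain h where h: "h \<in> borel_measurable N" "AE w in M. f w = h w"
  using assms unfolding ae_measurable_def by auto
 have "(%w. \<phi> (h w)) \<in> borel_measurable N" using measurable_compose[OF h(1) assms(2)] .
 moreover have "AE w in M. \<phi> (f w) = \<phi> (h w)" using h(2) by eventually_elim auto
 ultimately show ?thesis unfolding ae_measurable_def by auto
qed

lemma ae_measurable_comp2:
 fixes f :: "'a => 'b::second_countable_topology" and g :: "'a => 'c::second_countable_topology"
 assumes "ae_measurable N f" "ae_measurable N g" "(%(x, y). \<phi> x y) \<in> borel_measurable borel"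
 shows "ae_measurable N (%w. \<phi> (f w) (g w))"
proof -
 have "ae_measurable N (%w. (f w, g w))"
 proof -
  obtain f' g' where h: "f' \<in> borel_measurable N" "AE w in M. f w = f' w"
    "g' \<in> borel_measurable N" "AE w in M. g w = g' w"
   using assms(1,2) unfolding ae_measurable_def by auto
  have "(%w. (f' w, g' w)) \<in> borel_measurable N"
   using h by (simp add: borel_prod[symmetric])
  moreover have "AE w in M. (f w, g w) = (f' w, g' w)" using h(2,4) by eventually_elim auto
  ultimately show ?thesis unfolding ae_measurable_def by (intro bexI[of _ "%w. (f' w, g' w)"])
 qed
 from ae_measurable_comp[OF this assms(3)] show ?thesis by simp
qed

lemma ae_measurable_add:
 fixes f g :: "'a => real"
 assumes "ae_measurable N f" "ae_measurable N g" shows "ae_measurable N (%w. f w + g w)"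
 by (rule ae_measurable_comp2[OF assms]) (simp add: split_beta' borel_prod[symmetric])

lemma ae_measurable_diff:
 fixes f g :: "'a => real"
 assumes "ae_measurable N f" "ae_measurable N g" shows "ae_measurable N (%w. f w - g w)"
 by (rule ae_measurable_comp2[OF assms]) (simp add: split_beta' borel_prod[symmetric])

lemma ae_measurable_mult:
 fixes f g :: "'a => real"
 assumes "ae_measurable N f" "ae_measurable N g" shows "ae_measurable N (%w. f w * g w)"
 by (rule ae_measurable_comp2[OF assms]) (simp add: split_beta' borel_prod[symmetric])

lemma ae_measurable_const: "ae_measurable N (%_. c)"
 by (rule ae_measurableI) simp

lemma ae_measurable_mono:
 assumes "ae_measurable N f" "sets N \<subseteq> sets N'" "space N = space N'"
 shows "ae_measurable N' f"
 using assms measurable_mono[of borel borel N N'] unfolding ae_measurable_def by auto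

lemma ae_measurable_lim:
 fixes f :: "nat => 'a => real"
 assumes "!!n. ae_measurable N (f n)" "AE w in M. (%n. f n w) ----> g w"
 shows "ae_measurable N g"
proof -
 have "\<forall>n. \<exists>h. h \<in> borel_measurable N \<and> (AE w in M. f n w = h w)"
  using assms(1) unfolding ae_measurable_def by blast
 then obtain h where h: "!!n. h n \<in> borel_measurable N" "!!n. AE w in M. f n w = h n w" by metis
 have "(%w. lim (%n. h n w)) \<in> borel_measurable N"
  using h(1) by (intro borel_measurable_lim_metric) auto
 moreover have "AE w in M. \<forall>n. f n w = h n w" using h(2) by (simp add: AE_all_countable)
 then have "AE w in M. g w = lim (%n. h n w)" using assms(2)
  by eventually_elim (simp add: limI)
 ultimately show ?thesis unfolding ae_measurable_def by auto
qed

text \<open>Convergence to 0 in probability for functions that need not be measurable: the exceptional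
 sets are measurable supersets.\<close>

abbreviation mostly :: "real => ('a => bool) => bool" where
 "mostly e P \<equiv> \<exists>B\<in>sets M. prob B <= e \<and> (\<forall>w\<in>space M - B. P w)"

text \<open>One number \<open>e\<close> bounds both the value and the exceptional probability, as in
  the Ky Fan metric, so that sums and limits need a single parameter.\<close>

definition vanishes :: "(nat => 'a => ennreal) => bool" where
 "vanishes X \<longleftrightarrow> (\<forall>e>0. \<exists>N. \<forall>n\<ge>N. mostly e (%w. X n w <= ennreal e))"

lemma vanishesD: "vanishes X ==> e > 0 ==> \<exists>N. \<forall>n\<ge>N. mostly e (%w. X n w <= ennreal e)"
 unfolding vanishes_def by auto

lemma AE_bad_set:
 assumes "AE w in M. P w"
 obtains B where "B \<in> sets M" "prob B = 0" "!!w. w \<in> space M - B ==> P w"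
proof -
 obtain N where N: "N \<in> null_sets M" "{w \<in> space M. \<not> P w} \<subseteq> N"
  using assms by (auto simp: eventually_ae_filter)
 show ?thesis by (rule that[of N]) (use N in \<open>auto simp: null_sets_def measure_def\<close>)
qed

lemma prob_Un_le: "A \<in> events ==> B \<in> events ==> prob A <= a ==> prob B <= b ==> prob (A \<union> B) <= a + b"
 using measure_Un_le[of A M B] by simp

lemma mostly_mono:
 assumes "mostly a P" "AE w in M. P w --> Q w" "a <= b" shows "mostly b Q"
proof -
 obtain B where B: "B \<in> events" "prob B <= a" "\<forall>w\<in>space M - B. P w" using assms(1) by blast
 from AE_bad_set[OF assms(2)] obtain N where N: "N \<in> events" "prob N = 0" "!!w. w \<in> space M - N ==> P w --> Q w" by blast
 show ?thesis by (rule bexI[of _ "B \<union> N"]) (use B N assms(3) prob_Un_le[OF B(1) N(1) B(2), of 0] in auto)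
qed

lemma mostly_conj:
 assumes "mostly a P" "mostly b Q" shows "mostly (a + b) (%w. P w \<and> Q w)"
proof -
 obtain B C where "B \<in> events" "prob B <= a" "\<forall>w\<in>space M - B. P w" "C \<in> events" "prob C <= b" "\<forall>w\<in>space M - C. Q w"
  using assms by blast
 then show ?thesis by (intro bexI[of _ "B \<union> C"]) (auto intro: prob_Un_le)
qed

text \<open>The events that some \<open>Z n\<close> with \<open>n <= N\<close> exceeds
  \<open>L\<close> increase with \<open>N\<close>, so a bound on their probabilities passes to the
  union. The slack \<open>d\<close> is there because maximal inequalities on finite sets of times
  hold only up to an approximation error.\<close>

lemma mostly_all:
 fixes Z :: "nat => 'a => ennreal"
 assumes Z: "!!n. ae_measurable M (Z n)" and b: "!!N d. 0 < d ==> mostly (e + d) (%w. \<forall>n\<le>N. Z n w <= L)"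
 shows "mostly e (%w. \<forall>n. Z n w <= L)"
proof -
 have "\<forall>n. \<exists>f. f \<in> borel_measurable M \<and> (AE w in M. Z n w = f w)" using Z unfolding ae_measurable_def by blast
 from choice[OF this] obtain Y where Y: "!!n. Y n \<in> borel_measurable M" "!!n. AE w in M. Z n w = Y n w" by blast
 have YAE: "AE w in M. \<forall>n. Z n w = Y n w" using Y(2) by (simp add: AE_all_countable)
 define A where "A N = {w\<in>space M. \<exists>n\<in>{..N}. Y n w > L}" for N :: nat
 have A: "A N \<in> events" for N unfolding A_def using Y(1) by measurable
 have pA: "prob (A N) <= e" for N
 proof (rule field_le_epsilon)
  fix d :: real assume "0 < d"
  have "mostly (e + d) (%w. w \<notin> A N)"
   by (rule mostly_mono[OF b[OF \<open>0 < d\<close>, of N] _ order_refl]) (use YAE in \<open>eventually_elim, auto simp: A_def linorder_not_le[symmetric]\<close>)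
  then obtain C where "C \<in> events" "prob C <= e + d" "A N \<subseteq> C" using sets.sets_into_space[OF A] by blast
  then show "prob (A N) <= e + d" using finite_measure_mono[of "A N" C] by linarith
 qed
 have "incseq A" unfolding A_def incseq_def by fastforce
 then have "(%N. prob (A N)) ----> prob (\<Union>N. A N)" using A by (intro finite_Lim_measure_incseq) auto
 then have pU: "prob (\<Union>N. A N) <= e" by (rule LIMSEQ_le_const2) (use pA in auto)
 show ?thesis
 proof (rule mostly_mono[OF _ _ order_refl])
  show "mostly e (%w. w \<in> space M - (\<Union>N. A N))" using A pU by (intro bexI[of _ "\<Union>N. A N"]) auto
  show "AE w in M. w \<in> space M - (\<Union>N. A N) --> (\<forall>n. Z n w <= L)"
   using YAE by eventually_elim (fastforce simp: A_def not_less)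
 qed
qed

lemma AE_from_bad_sets:
 assumes "!!e. e > 0 ==> mostly e P" shows "AE w in M. P w"
proof -
 have "\<exists>B. B \<in> sets M \<and> prob B <= (1/2)^n \<and> (\<forall>w\<in>space M - B. P w)" for n :: nat
  using assms[of "(1/2)^n"] by auto
 then obtain B where B: "!!n. B n \<in> sets M" "!!n. prob (B n) <= (1/2)^n"
   "!!n w. w \<in> space M - B n ==> P w" by metis
 have "(\<Inter>n. B n) \<in> sets M" using B(1) by auto
 have "prob (\<Inter>n. B n) <= (1/2)^n" for n
  using finite_measure_mono[of "\<Inter>n. B n" "B n"] B(1,2)[of n] by (meson INT_lower UNIV_I order_trans)
 moreover have "(%n. (1/2::real)^n) ----> 0" by (rule LIMSEQ_power_zero) simp
 ultimately have "prob (\<Inter>n. B n) <= 0" by (meson LIMSEQ_le_const)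
 then have "prob (\<Inter>n. B n) = 0" using measure_nonneg[of M "\<Inter>n. B n"] by linarith
 then have "(\<Inter>n. B n) \<in> null_sets M" using \<open>(\<Inter>n. B n) \<in> sets M\<close>
  by (simp add: null_sets_def emeasure_eq_measure)
 then show ?thesis by (rule AE_I') (use B(3) in blast)
qed

lemma vanishes_AE_le:
 assumes "vanishes Y" "\<exists>N. \<forall>n\<ge>N. AE w in M. X n w <= Y n w" shows "vanishes X"
 unfolding vanishes_def
proof (intro allI impI)
 fix e :: real assume "e > 0"
 from vanishesD[OF assms(1) this] obtain N where N: "!!n. n >= N ==> mostly e (%w. Y n w <= ennreal e)" by blast
 obtain N' where N': "!!n. n >= N' ==> AE w in M. X n w <= Y n w" using assms(2) by blast
 have "mostly e (%w. X n w <= ennreal e)" if n: "n >= max N N'" for n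
 proof (rule mostly_mono[OF N])
  have "n >= N'" using n by simp
  from N'[OF this] show "AE w in M. Y n w <= ennreal e --> X n w <= ennreal e" by eventually_elim auto
 qed (use n in auto)
 then show "\<exists>N. \<forall>n\<ge>N. mostly e (%w. X n w <= ennreal e)" by blast
qed

lemma vanishes_le: "vanishes Y ==> (!!n w. w \<in> space M ==> X n w <= Y n w) ==> vanishes X"
 by (rule vanishes_AE_le) auto

lemma vanishes_add:
 assumes "vanishes X" "vanishes Y" shows "vanishes (%n w. X n w + Y n w)"
 unfolding vanishes_def
proof (intro allI impI)
 fix e :: real assume e: "e > 0"
 then have e2: "e/2 > 0" by simp
 from vanishesD[OF assms(1) e2] obtain N where N: "!!n. n >= N ==> mostly (e/2) (%w. X n w <= ennreal (e/2))" by blast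
 from vanishesD[OF assms(2) e2] obtain N' where N': "!!n. n >= N' ==> mostly (e/2) (%w. Y n w <= ennreal (e/2))" by blast
 have s: "a + b <= ennreal e" if "a <= ennreal (e/2)" "b <= ennreal (e/2)" for a b
  using add_mono[OF that] e by (simp flip: ennreal_plus)
 have "mostly e (%w. X n w + Y n w <= ennreal e)" if "n >= max N N'" for n
  by (rule mostly_mono[OF mostly_conj[OF N N']]) (use that s in auto)
 then show "\<exists>N. \<forall>n\<ge>N. mostly e (%w. X n w + Y n w <= ennreal e)" by blast
qed

lemma vanishes_cmult:
 assumes "vanishes X" shows "vanishes (%n w. ennreal c * X n w)"
proof (cases "c <= 0")
 case True
 then show ?thesis unfolding vanishes_def by (auto simp: ennreal_neg intro!: exI[of _ 0] bexI[of _ "{}"])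
next
 case False
 show ?thesis unfolding vanishes_def
 proof (intro allI impI)
  fix e :: real assume "e > 0"
  define d where "d = min e (e / c)"
  have d: "d > 0" "d <= e" "c * d <= e" using \<open>e > 0\<close> False unfolding d_def
   by (auto simp: min_def field_simps)
  from vanishesD[OF assms(1) d(1)] obtain N where N: "!!n. n >= N ==> mostly d (%w. X n w <= ennreal d)" by blast
  have s: "ennreal c * a <= ennreal e" if "a <= ennreal d" for a
   using order_trans[OF mult_left_mono[OF that, of "ennreal c"], of "ennreal e"] ennreal_leI[OF d(3)] False d by (simp add: ennreal_mult)
  have "mostly e (%w. ennreal c * X n w <= ennreal e)" if "n >= N" for n
   by (rule mostly_mono[OF N[OF that]]) (use s d in auto)
  then show "\<exists>N. \<forall>n\<ge>N. mostly e (%w. ennreal c * X n w <= ennreal e)" by blast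
 qed
qed

text \<open>The events \<open>D n\<close>, that some term from index \<open>n\<close> on exceeds
  \<open>e\<close>, decrease to a null set, and they contain the event that the term
  \<open>n\<close> itself exceeds \<open>e\<close>.\<close>

lemma vanishes_AE:
 assumes meas: "!!n. ae_measurable M (X n)" and lim: "AE w in M. (%n. X n w) ----> 0"
 shows "vanishes X"
 unfolding vanishes_def
proof (intro allI impI)
 fix e :: real assume e: "e > 0"
 have "\<forall>n. \<exists>h. h \<in> borel_measurable M \<and> (AE w in M. X n w = h w)"
  using meas unfolding ae_measurable_def by blast
 then obtain h where h: "!!n. h n \<in> borel_measurable M" "!!n. AE w in M. X n w = h n w" by metis
 have AEh: "AE w in M. \<forall>n. X n w = h n w" using h(2) by (simp add: AE_all_countable)
 define C where "C n = {w\<in>space M. h n w > ennreal e}" for n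
 define D where "D n = (\<Union>m\<in>{n..}. C m)" for n
 have C[measurable]: "C n \<in> sets M" for n unfolding C_def using h(1)[of n] by measurable
 have D: "D n \<in> sets M" for n unfolding D_def by auto
 have "decseq D" unfolding D_def decseq_def by (auto intro: order_trans)
 then have conv: "(%n. prob (D n)) ----> prob (\<Inter>n. D n)" using D by (intro finite_Lim_measure_decseq) auto
 have "AE w in M. w \<notin> (\<Inter>n. D n)"
  using AEh lim
 proof eventually_elim
  case (elim w)
  then have "(%n. h n w) ----> 0" by simp
  then have "eventually (%n. h n w < ennreal e) sequentially" using e
   by (intro order_tendstoD(2)) auto
  then obtain N where "\<forall>n\<ge>N. h n w < ennreal e" by (auto simp: eventually_sequentially)
  then have "w \<notin> D N" unfolding D_def C_def by fastforce
  then show ?case by auto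
 qed
 then have "prob (\<Inter>n. D n) = 0" using D
  by (subst prob_eq_0) auto
 then have "eventually (%n. prob (D n) < e) sequentially" using conv e by (intro order_tendstoD(2)) auto
 then obtain N where N: "\<forall>n\<ge>N. prob (D n) < e" by (auto simp: eventually_sequentially)
 have "mostly e (%w. X n w <= ennreal e)" if "n >= N" for n
 proof (rule mostly_mono)
  show "mostly e (%w. w \<notin> D n)" by (rule bexI[OF _ D]) (use N that in \<open>auto simp: less_imp_le\<close>)
  show "AE w in M. w \<notin> D n --> X n w <= ennreal e"
   using h(2)[of n] AE_space by eventually_elim (auto simp: D_def C_def not_less)
 qed simp
 then show "\<exists>N. \<forall>n\<ge>N. mostly e (%w. X n w <= ennreal e)" by blast
qed

text \<open>A diagonal Borel-Cantelli argument: stage \<open>k\<close> controls only the sequences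
  with index at most \<open>k\<close>, and each single sequence is controlled from some stage on.
  One subsequence thus serves countably many sequences, typically one for each time horizon.\<close>

lemma vanishes_AE_subseq:
 fixes X :: "nat => nat => 'a => ennreal"
 assumes "!!m. vanishes (X m)"
 shows "\<exists>r. strict_mono (r :: nat => nat) \<and> (AE w in M. \<forall>m. (%k. X m (r k) w) ----> 0)"
proof -
 \<comment> \<open>The divisor \<open>Suc k\<close> pays for the union over the \<open>k + 1\<close>
   sequences treated at stage \<open>k\<close>; the total \<open>(1/2)^k\<close> is
   summable.\<close>
 define e where "e k = (1/2)^k / real (Suc k)" for k :: nat
 have e: "e k > 0" "e k <= (1/2)^k" for k unfolding e_def by (auto simp: divide_le_eq)
 define P where "P m k n \<longleftrightarrow> mostly (e k) (%w. X m n w <= ennreal (e k))" for m k n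
 have "\<exists>N. \<forall>n\<ge>N. P m k n" for m k
  unfolding P_def using vanishesD[OF assms e(1)] .
 then obtain N where N: "!!m k n. n >= N m k ==> P m k n" by metis
 \<comment> \<open>Each summand contains \<open>Suc\<close>, which makes \<open>r\<close> strictly
   increasing, and the last summand dominates every \<open>N m k\<close> with
   \<open>m <= k\<close>.\<close>
 define r where "r k = (\<Sum>j\<le>k. Suc (\<Sum>m\<le>j. N m j))" for k
 have r: "strict_mono r" unfolding r_def by (rule strict_mono_Suc_iff[THEN iffD2]) auto
 have rN: "r k >= N m k" if "m <= k" for m k
 proof -
  have "N m k <= (\<Sum>m\<le>k. N m k)" using that by (intro member_le_sum) auto
  also have "\<dots> <= r k" unfolding r_def by (cases k) auto
  finally show ?thesis .
 qed
 have "\<exists>B. B \<in> sets M \<and> prob B <= e k \<and> (\<forall>w\<in>space M - B. X m (r k) w <= ennreal (e k))" if "m <= k" for m k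
  using N[OF rN[OF that]] unfolding P_def by blast
 then obtain B where B: "!!m k. m <= k ==> B m k \<in> sets M \<and> prob (B m k) <= e k \<and> (\<forall>w\<in>space M - B m k. X m (r k) w <= ennreal (e k))"
  by metis
 define A where "A k = (\<Union>m\<in>{..k}. B m k)" for k
 have A: "A k \<in> sets M" for k unfolding A_def using B by auto
 have pA: "prob (A k) <= (1/2)^k" for k
 proof -
  have "prob (A k) <= (\<Sum>m\<le>k. prob (B m k))" unfolding A_def
   using B by (intro finite_measure_subadditive_finite) auto
  also have "\<dots> <= (\<Sum>m\<le>k. e k)" using B by (intro sum_mono) auto
  also have "\<dots> = (1/2)^k" unfolding e_def by simp
  finally show ?thesis .
 qed
 have "AE w in M. eventually (%k. w \<in> space M - A k) sequentially"
 proof (rule borel_cantelli_AE1)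
  show "summable (%k. prob (A k))"
   by (rule summable_comparison_test'[of "%k. (1/2)^k" 0]) (use pA in \<open>auto intro: summable_geometric\<close>)
 qed (use A in \<open>auto simp: emeasure_eq_measure\<close>)
 then have "AE w in M. \<forall>m. (%k. X m (r k) w) ----> 0"
 proof eventually_elim
  case (elim w)
  show ?case
  proof
   fix m
   have "eventually (%k. X m (r k) w <= ennreal ((1/2)^k)) sequentially"
    using elim eventually_ge_at_top[of m]
   proof eventually_elim
    case (elim k)
    then have "X m (r k) w <= ennreal (e k)" using B[of m k] unfolding A_def by auto
    also have "\<dots> <= ennreal ((1/2)^k)" using e by (intro ennreal_leI) auto
    finally show ?case .
   qed
   moreover have "(%k. ennreal ((1/2)^k)) ----> ennreal 0"
    by (intro tendsto_ennrealI LIMSEQ_power_zero) simp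
   ultimately show "(%k. X m (r k) w) ----> 0"
    using tendsto_sandwich[of "%_. 0" "%k. X m (r k) w" sequentially "%k. ennreal ((1/2)^k)" 0] by auto
  qed
 qed
 with r show ?thesis by auto
qed

text \<open>This is how stochastic integrals inherit adaptedness: along an almost surely convergent
  subsequence they are limits of adapted simple integrals.\<close>

lemma ae_measurable_vanishes_lim:
 fixes f :: "nat => 'a => real"
 assumes "!!n. ae_measurable N (f n)" "vanishes (%n w. ennreal \<bar>f n w - g w\<bar>)"
 shows "ae_measurable N g"
proof -
 obtain r where r: "strict_mono (r :: nat => nat)" "AE w in M. \<forall>m::nat. (%k. ennreal \<bar>f (r k) w - g w\<bar>) ----> 0"
  using vanishes_AE_subseq[of "%_ n w. ennreal \<bar>f n w - g w\<bar>"] assms(2) by blast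
 show ?thesis
 proof (rule ae_measurable_lim)
  show "AE w in M. (%n. f (r n) w) ----> g w" using r(2)
  proof eventually_elim
   case (elim w)
   then have "(%k. \<bar>f (r k) w - g w\<bar>) ----> 0"
    by (subst (asm) ennreal_0[symmetric], subst (asm) tendsto_ennreal_iff) auto
   then show ?case by (simp add: LIM_zero_iff tendsto_rabs_zero_iff)
  qed
 qed (rule assms)
qed

lemma vanishes_const_AE_0:
 assumes "vanishes (%n. X)" shows "AE w in M. X w = 0"
proof -
 obtain r where "strict_mono (r :: nat => nat)" "AE w in M. \<forall>m::nat. (%k::nat. X w) ----> 0"
  using vanishes_AE_subseq[of "%_ _. X"] assms by blast
 then show ?thesis by (auto simp: LIMSEQ_const_iff)
qed

end

section \<open>Simple integrals\<close>

lemma finite_grid: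
 assumes "finite Q" "Q \<subseteq> {0..T}" "0 \<in> Q" "T \<in> Q"
 obtains p :: "nat => real" and k where "p 0 = 0" "p k = T" "!!i. i < k ==> p i < p (Suc i)"
  "p ` {..k} = Q" "!!i. i < k ==> Q \<inter> {p i<..<p (Suc i)} = {}" "!!i j. i <= j ==> j <= k ==> p i <= p j"
proof -
 define xs where "xs = sorted_list_of_set Q"
 define p where "p i = xs ! i" for i
 define k where "k = length xs - 1"
 have xs: "set xs = Q" "sorted_wrt (<) xs" unfolding xs_def using assms(1) by auto
 have len: "length xs = Suc k" using xs assms(3) unfolding k_def by (cases xs) auto
 have mono: "p i < p j" if "i < j" "j <= k" for i j
  using sorted_wrt_nth_less[OF xs(2) that(1)] that len unfolding p_def by auto
 have mono': "p i <= p j" if "i <= j" "j <= k" for i j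
  using mono[of i j] that by (cases "i = j") auto
 have img: "p ` {..k} = Q"
 proof -
  have "Q = (!) xs ` {..<Suc k}" using xs(1) len by (auto simp: in_set_conv_nth)
  then show ?thesis unfolding p_def by (simp add: lessThan_Suc_atMost)
 qed
 obtain i0 where "i0 <= k" "p i0 = 0" using img assms(3) by force
 moreover have "p 0 >= 0" using img assms(2) by (metis atLeastAtMost_iff atMost_iff imageI le0 subset_iff)
 ultimately have p0: "p 0 = 0" using mono'[of 0 i0] by auto
 obtain i1 where "i1 <= k" "p i1 = T" using img assms(4) by force
 moreover have "p k <= T" using img assms(2) by (metis atLeastAtMost_iff atMost_iff imageI order_refl subset_iff)
 ultimately have pk: "p k = T" using mono'[of i1 k] by auto
 have gap: "Q \<inter> {p i<..<p (Suc i)} = {}" if "i < k" for i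
 proof (rule ccontr)
  assume "Q \<inter> {p i<..<p (Suc i)} \<noteq> {}"
  then obtain j where j: "j <= k" "p i < p j" "p j < p (Suc i)" using img by force
  have "\<not> j <= i" using mono'[of j i] j that by force
  moreover have "\<not> Suc i <= j" using mono'[of "Suc i" j] j by force
  ultimately show False by auto
 qed
 show ?thesis by (rule that[of p k]) (use p0 pk mono img gap mono' in auto)
qed

locale bm_space =
 fixes M :: "'a measure" and F :: "real => 'a measure" and W :: "real => 'a => real"
 assumes filtered: "filtered_prob_space M F" and bm: "brownian_motion M F W"

sublocale bm_space \<subseteq> prob_space M
 using filtered unfolding filtered_prob_space_def by auto

context bm_space
begin

lemma space_F: "space (F t) = space M"
 using filtered unfolding filtered_prob_space_def subalgebra_def by auto

lemma sets_F: "sets (F t) \<subseteq> sets M"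
 using filtered unfolding filtered_prob_space_def subalgebra_def by auto

lemma F_mono: "s <= t ==> sets (F s) \<subseteq> sets (F t)"
 using filtered filtration.sets_F_mono unfolding filtered_prob_space_def by blast

lemma measurable_F_mono: "f \<in> borel_measurable (F s) ==> s <= t ==> f \<in> borel_measurable (F t)"
 using measurable_mono[OF order_refl refl F_mono[of s t]] by (auto simp: space_F)

lemma measurable_F: "f \<in> borel_measurable (F s) ==> f \<in> borel_measurable M"
 using measurable_mono[OF order_refl refl sets_F[of s]] by (auto simp: space_F)

lemma W_measurable: "0 <= s ==> s <= t ==> W s \<in> borel_measurable (F t)"
 using bm measurable_F_mono unfolding brownian_motion_def by blast

lemma W_continuous: "AE w in M. continuous_on {0..} (%t. W t w)"
 using bm unfolding brownian_motion_def by blast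

lemma W_measurable_M [measurable]: "0 <= s ==> W s \<in> borel_measurable M"
 using W_measurable[of s s] measurable_F by auto

lemma increment_indep:
 fixes A :: "'a => real" and g :: "real => real"
 assumes st: "0 <= s" "s <= t" and A: "A \<in> borel_measurable (F s)" "integrable M A"
  and g: "g \<in> borel_measurable borel" "integrable M (%w. g (W t w - W s w))"
 shows "integrable M (%w. A w * g (W t w - W s w))"
  and "(\<integral>w. A w * g (W t w - W s w) \<partial>M) = (\<integral>w. A w \<partial>M) * (\<integral>w. g (W t w - W s w) \<partial>M)"
proof -
 have "integrable M (%w. A w * g (W t w - W s w)) \<and>
  (\<integral>w. A w * g (W t w - W s w) \<partial>M) = (\<integral>w. A w \<partial>M) * (\<integral>w. g (W t w - W s w) \<partial>M)"
 \<comment> \<open>The definition of Brownian motion speaks about strictly ordered times only; for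
   equal times the increment is the constant 0.\<close>
 proof (cases "s = t")
  case True
  then show ?thesis using A by (simp add: prob_space)
 next
  case False
  with st have st': "s < t" by simp
  let ?D = "%w. W t w - W s w"
  have D: "?D \<in> borel_measurable M" using st by simp
  have gD: "(%w. g (?D w)) \<in> borel_measurable M" using D g by measurable
  have ind: "indep_set (sets (F s)) (sets (vimage_algebra (space M) ?D borel))"
   using bm st' st unfolding brownian_motion_def by blast
  have "indep_var borel A borel (%w. g (?D w))"
   unfolding indep_var_eq
  proof (intro conjI)
   have a: "sigma_sets (space M) {A -` B \<inter> space M |B. B \<in> sets borel} \<subseteq> sets (F s)"
    using sets.sigma_sets_subset[of "{A -` B \<inter> space M |B. B \<in> sets borel}" "F s"] measurable_sets[OF A(1)]
    by (auto simp: space_F)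
   have m: "(%w. g (?D w)) \<in> borel_measurable (vimage_algebra (space M) ?D borel)"
    using measurable_compose[OF measurable_vimage_algebra1[of ?D "space M" borel] g(1)] by auto
   have b: "sigma_sets (space M) {(%w. g (?D w)) -` B \<inter> space M |B. B \<in> sets borel} \<subseteq> sets (vimage_algebra (space M) ?D borel)"
    using sets.sigma_sets_subset[of "{(%w. g (?D w)) -` B \<inter> space M |B. B \<in> sets borel}" "vimage_algebra (space M) ?D borel"] measurable_sets[OF m]
    by auto
   show "indep_set (sigma_sets (space M) {A -` B \<inter> space M |B. B \<in> sets borel})
     (sigma_sets (space M) {(%w. g (?D w)) -` B \<inter> space M |B. B \<in> sets borel})"
    using ind a b unfolding indep_sets2_eq by blast
  qed (use A gD in auto)
  then show ?thesis using indep_var_integrable indep_var_lebesgue_integral A g by blast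
 qed
 then show "integrable M (%w. A w * g (W t w - W s w))"
  and "(\<integral>w. A w * g (W t w - W s w) \<partial>M) = (\<integral>w. A w \<partial>M) * (\<integral>w. g (W t w - W s w) \<partial>M)" by auto
qed

lemma increment_moments:
 assumes st: "0 <= s" "s <= t"
 shows "has_bochner_integral M (%w. W t w - W s w) 0"
  and "has_bochner_integral M (%w. (W t w - W s w)^2) (t - s)"
  and "has_bochner_integral M (%w. (W t w - W s w)^4) (3 * (t - s)^2)"
proof -
 have "has_bochner_integral M (%w. W t w - W s w) 0 \<and>
   has_bochner_integral M (%w. (W t w - W s w)^2) (t - s) \<and>
   has_bochner_integral M (%w. (W t w - W s w)^4) (3 * (t - s)^2)"
 proof (cases "s = t")
  case True
  then show ?thesis by (simp add: has_bochner_integral_zero)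
 next
  case False
  with st have st': "s < t" by simp
  let ?D = "%w. W t w - W s w"
  have dist: "distributed M lborel ?D (normal_density 0 (sqrt (t - s)))"
   using bm st' st unfolding brownian_motion_def by blast
  have pos: "0 < sqrt (t - s)" using st' by simp
  have key: "has_bochner_integral M (%w. g (?D w)) x"
   if "has_bochner_integral lborel (%x. normal_density 0 (sqrt (t - s)) x * g x) x" "g \<in> borel_measurable borel" for g x
   using that distributed_integrable[OF dist, of g] distributed_integral[OF dist, of g]
   by (auto simp: has_bochner_integral_iff)
  have 1: "has_bochner_integral lborel (%x. normal_density 0 (sqrt (t - s)) x * x) 0"
   using normal_moment_odd[OF pos, of 0 0] by simp
  have 2: "has_bochner_integral lborel (%x. normal_density 0 (sqrt (t - s)) x * x^2) (t - s)"
   using normal_moment_even[OF pos, of 0 1] st' by (simp add: diff_divide_distrib)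
  have 3: "has_bochner_integral lborel (%x. normal_density 0 (sqrt (t - s)) x * x^4) (3 * (t - s)^2)"
  proof -
   have "(fact (2 * 2) / ((2 / (sqrt (t - s))^2)^2 * fact 2)) = 3 * (t - s)^2"
    using st' by (simp add: fact_numeral field_simps power2_eq_square)
   then show ?thesis using normal_moment_even[OF pos, of 0 2] by simp
  qed
  show ?thesis using key[OF 1] key[OF 2] key[OF 3] by simp
 qed
 then show "has_bochner_integral M (%w. W t w - W s w) 0"
  and "has_bochner_integral M (%w. (W t w - W s w)^2) (t - s)"
  and "has_bochner_integral M (%w. (W t w - W s w)^4) (3 * (t - s)^2)" by auto
qed

lemma increment_square_variance:
 assumes st: "0 <= s" "s <= t"
 shows "has_bochner_integral M (%w. (W t w - W s w)^2 - (t - s)) 0"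
  and "has_bochner_integral M (%w. ((W t w - W s w)^2 - (t - s))^2) (2 * (t - s)^2)"
proof -
 have c: "has_bochner_integral M (%w. c) c" for c :: real by (simp add: has_bochner_integral_iff prob_space)
 show "has_bochner_integral M (%w. (W t w - W s w)^2 - (t - s)) 0"
  using has_bochner_integral_diff[OF increment_moments(2)[OF st] c[of "t - s"]] by simp
 have "has_bochner_integral M (%w. (W t w - W s w)^4 - 2 * (t - s) * (W t w - W s w)^2 + (t - s)^2)
   (3 * (t - s)^2 - 2 * (t - s) * (t - s) + (t - s)^2)"
  by (intro has_bochner_integral_add has_bochner_integral_diff has_bochner_integral_mult_right
    increment_moments st c)
 then show "has_bochner_integral M (%w. ((W t w - W s w)^2 - (t - s))^2) (2 * (t - s)^2)"
  by (simp add: power2_eq_square algebra_simps power4_eq_xxxx)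
qed

text \<open>The summands are orthogonal because each centred function of an increment is independent
  of everything known at the start of its interval. The function \<open>g i\<close> is arbitrary
  because two cases occur: the increment itself, for simple integrals, and its square minus the
  elapsed time, for the quadratic variation.\<close>

lemma discrete_sum:
 fixes p :: "nat => real" and \<eta> :: "nat => 'a => real" and g :: "nat => real => real" and v C :: "nat => real"
 defines "Z i w \<equiv> g i (W (p (Suc i)) w - W (p i) w)"
 assumes p0: "0 <= p 0" and p: "!!i. i < k ==> p i <= p (Suc i)"
  and \<eta>: "!!i. i < k ==> \<eta> i \<in> borel_measurable (F (p i))"
  and C: "!!i w. i < k ==> w \<in> space M ==> \<bar>\<eta> i w\<bar> <= C i"
  and g: "!!i. i < k ==> g i \<in> borel_measurable borel"
  and Z0: "!!i. i < k ==> has_bochner_integral M (Z i) 0"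
  and Z2: "!!i. i < k ==> has_bochner_integral M (%w. (Z i w)^2) (v i)"
 shows "(%w. \<Sum>i<k. \<eta> i w * Z i w) \<in> borel_measurable (F (p k)) \<and>
   integrable M (%w. (\<Sum>i<k. \<eta> i w * Z i w)^2) \<and>
   has_bochner_integral M (%w. \<Sum>i<k. \<eta> i w * Z i w) 0 \<and>
   (\<integral>w. (\<Sum>i<k. \<eta> i w * Z i w)^2 \<partial>M) = (\<Sum>i<k. (\<integral>w. (\<eta> i w)^2 \<partial>M) * v i) \<and> 0 <= p k"
 using p \<eta> C g Z0 Z2
proof (induction k)
 case 0
 then show ?case using p0 by (simp add: has_bochner_integral_zero)
next
 case (Suc k)
 let ?S = "%w. \<Sum>i<k. \<eta> i w * Z i w"
 have IH: "?S \<in> borel_measurable (F (p k))" "integrable M (%w. (?S w)^2)"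
   "has_bochner_integral M ?S 0" "(\<integral>w. (?S w)^2 \<partial>M) = (\<Sum>i<k. (\<integral>w. (\<eta> i w)^2 \<partial>M) * v i)" "0 <= p k"
  using Suc.IH Suc.prems by auto
 have pk: "p k <= p (Suc k)" and \<eta>k: "\<eta> k \<in> borel_measurable (F (p k))" "!!w. w \<in> space M ==> \<bar>\<eta> k w\<bar> <= C k"
  and gk: "g k \<in> borel_measurable borel" and Zk: "has_bochner_integral M (Z k) 0" "has_bochner_integral M (%w. (Z k w)^2) (v k)"
  using Suc.prems by auto
 have \<eta>M: "\<eta> k \<in> borel_measurable M" using \<eta>k measurable_F by auto
 have i\<eta>: "integrable M (\<eta> k)" by (rule integrable_const_bound[of _ "C k"]) (use \<eta>k \<eta>M in auto)
 have i\<eta>2: "integrable M (%w. (\<eta> k w)^2)"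
 proof (rule integrable_const_bound[of _ "(C k)^2"])
  show "AE w in M. norm ((\<eta> k w)^2) <= (C k)^2"
   using \<eta>k(2) by (intro AE_I2) (auto simp: abs_le_square_iff[symmetric] intro: order_trans[OF _ abs_ge_self])
 qed (use \<eta>M in measurable)
 have iS\<eta>: "integrable M (%w. 2 * ?S w * \<eta> k w)"
 proof (rule Bochner_Integration.integrable_bound[of M "%w. 2 * \<bar>C k\<bar> * ?S w"])
  show "integrable M (%w. 2 * \<bar>C k\<bar> * ?S w)" using IH(3) by (auto simp: has_bochner_integral_iff)
  show "AE w in M. norm (2 * ?S w * \<eta> k w) <= norm (2 * \<bar>C k\<bar> * ?S w)"

  proof (rule AE_I2)
   fix w assume "w \<in> space M"
   then have "\<bar>\<eta> k w\<bar> <= \<bar>C k\<bar>" using \<eta>k(2)[of w] by linarith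
   then have "\<bar>?S w\<bar> * \<bar>\<eta> k w\<bar> <= \<bar>?S w\<bar> * \<bar>C k\<bar>" by (rule mult_left_mono) simp
   then show "norm (2 * ?S w * \<eta> k w) <= norm (2 * \<bar>C k\<bar> * ?S w)" by (simp add: abs_mult mult.commute mult.left_commute)
  qed
 qed (use \<eta>M measurable_F[OF IH(1)] in measurable)
 have Zdef: "Z k = (%w. g k (W (p (Suc k)) w - W (p k) w))" unfolding Z_def by auto
 have mS\<eta>: "(%w. 2 * ?S w * \<eta> k w) \<in> borel_measurable (F (p k))" using IH(1) \<eta>k(1) by measurable
 have a: "has_bochner_integral M (%w. 2 * ?S w * \<eta> k w * Z k w) 0"
  using increment_indep[OF IH(5) pk mS\<eta> iS\<eta> gk] Zk(1) unfolding Zdef has_bochner_integral_iff by simp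
 have b: "has_bochner_integral M (%w. \<eta> k w * Z k w) 0"
  using increment_indep[OF IH(5) pk \<eta>k(1) i\<eta> gk] Zk(1) unfolding Zdef has_bochner_integral_iff by simp
 have g2: "(%x. (g k x)^2) \<in> borel_measurable borel" using gk by measurable
 have \<eta>2: "(%w. (\<eta> k w)^2) \<in> borel_measurable (F (p k))" using \<eta>k by measurable
 have c: "has_bochner_integral M (%w. (\<eta> k w)^2 * (Z k w)^2) ((\<integral>w. (\<eta> k w)^2 \<partial>M) * v k)"
  using increment_indep[OF IH(5) pk \<eta>2 i\<eta>2 g2] Zk(2) unfolding Zdef has_bochner_integral_iff by simp
 have d: "has_bochner_integral M (%w. (?S w)^2) (\<Sum>i<k. (\<integral>w. (\<eta> i w)^2 \<partial>M) * v i)"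
  using IH(2,4) by (simp add: has_bochner_integral_iff)
 have "has_bochner_integral M (%w. (?S w)^2 + 2 * ?S w * \<eta> k w * Z k w + (\<eta> k w)^2 * (Z k w)^2)
   ((\<Sum>i<k. (\<integral>w. (\<eta> i w)^2 \<partial>M) * v i) + 0 + (\<integral>w. (\<eta> k w)^2 \<partial>M) * v k)"
  by (intro has_bochner_integral_add a c d)
 then have e: "has_bochner_integral M (%w. (\<Sum>i<Suc k. \<eta> i w * Z i w)^2) (\<Sum>i<Suc k. (\<integral>w. (\<eta> i w)^2 \<partial>M) * v i)"
  by (simp add: power2_sum power_mult_distrib algebra_simps)
 have f: "has_bochner_integral M (%w. \<Sum>i<Suc k. \<eta> i w * Z i w) 0"
  using has_bochner_integral_add[OF IH(3) b] by simp
 have "Z k \<in> borel_measurable (F (p (Suc k)))" unfolding Zdef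
 proof -
  have "W (p (Suc k)) \<in> borel_measurable (F (p (Suc k)))" "W (p k) \<in> borel_measurable (F (p (Suc k)))"
   using W_measurable[of "p (Suc k)" "p (Suc k)"] W_measurable[of "p k" "p (Suc k)"] IH(5) pk by auto
  then show "(%w. g k (W (p (Suc k)) w - W (p k) w)) \<in> borel_measurable (F (p (Suc k)))"
   using gk by measurable
 qed
 then have "(%w. \<Sum>i<Suc k. \<eta> i w * Z i w) \<in> borel_measurable (F (p (Suc k)))"
  using measurable_F_mono[OF IH(1) pk] measurable_F_mono[OF \<eta>k(1) pk] by simp
 then show ?case using e f IH(5) pk by (auto simp: has_bochner_integral_iff)
qed

text \<open>The bracket at time \<open>t\<close> of the integral of \<open>H\<close>. It takes
  values in \<open>ennreal\<close>, so that comparisons can be made before finiteness is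
  known.\<close>

definition energy :: "(real => 'a => real) => real => 'a => ennreal" where
 "energy H t w = (\<integral>\<^sup>+s\<in>{0..t}. ennreal ((H s w)^2) \<partial>lborel)"

text \<open>Integrand and integral are generated together, one block at a time, and the blocks may
  overlap in any order. This makes sums, multiples and restrictions to a time interval immediate; a
  common grid is recovered only where it is needed.\<close>

inductive simple :: "(real => 'a => real) => (real => 'a => real) => bool" where
 zero: "simple (%s w. 0) (%t w. 0)"
| step: "simple H E ==> 0 <= u ==> u <= v ==> \<xi> \<in> borel_measurable (F u) ==>
  (!!w. w \<in> space M ==> \<bar>\<xi> w\<bar> <= C) ==>
  simple (%s w. H s w + \<xi> w * indicator {u<..v} s)
   (%t w. E t w + \<xi> w * (W (min t v) w - W (min t u) w))"

text \<open>The grid form of a simple pair: on any interval with no point of \<open>D\<close> in its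
  interior the integrand is constant and already known at the left end. Every finite grid containing
  \<open>D\<close> inherits this, so grids can be refined at will.\<close>

definition mesh :: "(real => 'a => real) => (real => 'a => real) => real set => real => bool" where
 "mesh H E D C \<longleftrightarrow> finite D \<and> 0 <= C \<and> (\<forall>s. \<forall>w\<in>space M. \<bar>H s w\<bar> <= C) \<and>
   (\<forall>s t. 0 <= s --> s < t --> D \<inter> {s<..<t} = {} --> H t \<in> borel_measurable (F s) \<and>
    (\<forall>r w. s < r --> r <= t --> H r w = H t w) \<and> (\<forall>w. E t w - E s w = H t w * (W t w - W s w)))"

lemma meshD:
 assumes "mesh H E D C"
 shows "finite D" "0 <= C" "!!s w. w \<in> space M ==> \<bar>H s w\<bar> <= C"
  "!!s t. 0 <= s ==> s < t ==> D \<inter> {s<..<t} = {} ==> H t \<in> borel_measurable (F s)"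
  "!!s t r w. 0 <= s ==> s < r ==> r <= t ==> D \<inter> {s<..<t} = {} ==> H r w = H t w"
  "!!s t w. 0 <= s ==> s < t ==> D \<inter> {s<..<t} = {} ==> E t w - E s w = H t w * (W t w - W s w)"
proof -
 note m = assms[unfolded mesh_def]
 note g = m[THEN conjunct2, THEN conjunct2, THEN conjunct2, THEN spec, THEN spec, THEN mp, THEN mp, THEN mp]
 show "finite D" "0 <= C" by (rule m[THEN conjunct1] m[THEN conjunct2, THEN conjunct1])+
 show "\<bar>H s w\<bar> <= C" if "w \<in> space M" for s w
  by (rule m[THEN conjunct2, THEN conjunct2, THEN conjunct1, rule_format, OF that])
 fix s t :: real assume st: "0 <= s" "D \<inter> {s<..<t} = {}"
 show "H t \<in> borel_measurable (F s)" if "s < t" using g[OF st(1) that st(2)] by (rule conjunct1)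
 show "H r w = H t w" if "s < r" "r <= t" for r w using g[OF st(1) order_less_le_trans[OF that] st(2)] that by blast
 show "E t w - E s w = H t w * (W t w - W s w)" if "s < t" for w using g[OF st(1) that st(2)] by blast
qed

lemma simple_mesh: "simple H E ==> \<exists>D C. mesh H E D C"
proof (induction rule: simple.induct)
 case zero
 show ?case by (rule exI[of _ "{}"], rule exI[of _ 0]) (simp add: mesh_def)
next
 case (step H E u v \<xi> C)
 then obtain D C' where mesh: "mesh H E D C'" by blast
 note D = meshD[OF mesh]
 have "mesh (%s w. H s w + \<xi> w * indicator {u<..v} s) (%t w. E t w + \<xi> w * (W (min t v) w - W (min t u) w)) (insert u (insert v D)) (C' + \<bar>C\<bar>)"
  unfolding mesh_def
 proof (intro conjI allI impI ballI)
  show "finite (insert u (insert v D))" "0 <= C' + \<bar>C\<bar>" using D by auto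
  show "\<bar>H s w + \<xi> w * indicator {u<..v} s\<bar> <= C' + \<bar>C\<bar>" if "w \<in> space M" for s w
   using D(3)[OF that, of s] step(5)[OF that] by (auto simp: indicator_def)
  fix s t :: real assume st: "0 <= s" "s < t" "insert u (insert v D) \<inter> {s<..<t} = {}"
  then have st': "D \<inter> {s<..<t} = {}" and uv: "u <= s \<or> t <= u" "v <= s \<or> t <= v" by auto
  show "(%w. H t w + \<xi> w * indicator {u<..v} t) \<in> borel_measurable (F s)"
  proof (cases "u < t \<and> t <= v")
   case True
   then have "\<xi> \<in> borel_measurable (F s)" using uv step(4) measurable_F_mono by auto
   then show ?thesis using D(4)[OF st(1,2) st'] by (intro borel_measurable_add borel_measurable_times) auto
  next
   case False
   then have "indicator {u<..v} t = (0::real)" by auto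
   then show ?thesis using D(4)[OF st(1,2) st'] by simp
  qed
  show "H r w + \<xi> w * indicator {u<..v} r = H t w + \<xi> w * indicator {u<..v} t" if "s < r" "r <= t" for r w
   using D(5)[OF st(1) that st', of w] that uv by (auto simp: indicator_def)
  fix w
  have "W (min t v) w - W (min t u) w - (W (min s v) w - W (min s u) w) = indicator {u<..v} t * (W t w - W s w)"
   using uv st(2) step(3) by (auto simp: min_def indicator_def)
  then have "\<xi> w * (W (min t v) w - W (min t u) w) - \<xi> w * (W (min s v) w - W (min s u) w) = \<xi> w * (indicator {u<..v} t * (W t w - W s w))"
   by (simp only: right_diff_distrib[symmetric])
  then show "E t w + \<xi> w * (W (min t v) w - W (min t u) w) - (E s w + \<xi> w * (W (min s v) w - W (min s u) w)) =
    (H t w + \<xi> w * indicator {u<..v} t) * (W t w - W s w)"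
   using D(6)[OF st(1,2) st', of w] by (simp add: distrib_right mult.assoc)
 qed
 then show ?case by blast
qed

lemma simple_0: "simple H E ==> E 0 w = 0"
 by (induction rule: simple.induct) auto

lemma simple_adapted: "simple H E ==> 0 <= t ==> E t \<in> borel_measurable (F t)"
proof (induction rule: simple.induct)
 case (step H E u v \<xi> C)
 have 1: "E t \<in> borel_measurable (F t)" using step by auto
 show ?case
 proof (cases "t <= u")
  case True
  then show ?thesis using 1 step by (simp add: min_def)
 next
  case False
  then have "\<xi> \<in> borel_measurable (F t)" using measurable_F_mono[OF step(4)] by auto
  moreover have "W (min t v) \<in> borel_measurable (F t)" "W (min t u) \<in> borel_measurable (F t)"
   using step by (auto intro!: W_measurable)
  ultimately show ?thesis using 1 by measurable
 qed
qed simp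

lemma simple_continuous: "simple H E ==> AE w in M. continuous_on {0..} (%t. E t w)"
proof (induction rule: simple.induct)
 case (step H E u v \<xi> C)
 show ?case using step(6) W_continuous
 proof eventually_elim
  case (elim w)
  have "continuous_on {0..} (%t. W (min t c) w)" if "0 <= c" for c
   by (rule continuous_on_compose2[OF elim(2)]) (use that in \<open>auto intro!: continuous_intros\<close>)
  then show ?case using step(2,3) elim(1) by (auto intro!: continuous_intros)
 qed
qed auto

lemma simple_jointly_measurable:
 "simple H E ==> (%(s, w). H s w) \<in> borel_measurable (borel \<Otimes>\<^sub>M M)"
proof (induction rule: simple.induct)
 case (step H E u v \<xi> C)
 have "\<xi> \<in> borel_measurable M" using step measurable_F by auto
 then show ?case using step(6) by (simp add: split_beta')
qed simp

lemma energy_grid: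
 assumes p0: "p 0 = (0::real)" and p: "!!i. i < k ==> p i <= p (Suc i)"
  and const: "!!i s. i < k ==> p i < s ==> s <= p (Suc i) ==> H s w = h i"
 shows "energy H (p k) w = ennreal (\<Sum>i<k. (h i)^2 * (p (Suc i) - p i)) \<and> 0 <= p k"
proof -
 have "energy H (p k) w = ennreal (\<Sum>i<k. (h i)^2 * (p (Suc i) - p i)) \<and> 0 <= p k \<and>
   (%s. ennreal ((H s w)^2) * indicator {0..p k} s) \<in> borel_measurable lborel"
  using p const
 proof (induction k)
  case 0
  have "(%s. ennreal ((H s w)^2) * indicator {0..0} s) = (%s::real. ennreal ((H 0 w)^2) * indicator {0} s)"
   by (auto simp: indicator_def fun_eq_iff)
  then show ?case by (simp add: energy_def p0 nn_integral_cmult_indicator)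
 next
  case (Suc k)
  then have IH: "energy H (p k) w = ennreal (\<Sum>i<k. (h i)^2 * (p (Suc i) - p i))" "0 <= p k"
   "(%s. ennreal ((H s w)^2) * indicator {0..p k} s) \<in> borel_measurable lborel" by auto
  have le: "p k <= p (Suc k)" using Suc by auto
  have nn: "0 <= (\<Sum>i<k. (h i)^2 * (p (Suc i) - p i))" using Suc.prems by (intro sum_nonneg) auto
  have split: "(%s. ennreal ((H s w)^2) * indicator {0..p (Suc k)} s) =
    (%s. ennreal ((H s w)^2) * indicator {0..p k} s + ennreal ((h k)^2) * indicator {p k<..p (Suc k)} s)"
   using IH(2) le Suc.prems(2)[of k] by (auto simp: indicator_def fun_eq_iff)
  have "energy H (p (Suc k)) w = energy H (p k) w + (\<integral>\<^sup>+s. ennreal ((h k)^2) * indicator {p k<..p (Suc k)} s \<partial>lborel)"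
   unfolding energy_def split by (rule nn_integral_add[OF IH(3)]) simp
  also have "(\<integral>\<^sup>+s. ennreal ((h k)^2) * indicator {p k<..p (Suc k)} s \<partial>lborel) = ennreal ((h k)^2 * (p (Suc k) - p k))"
   using le by (subst nn_integral_cmult_indicator) (auto simp: ennreal_mult)
  finally show ?case unfolding split using IH le nn by (simp add: ennreal_plus)
 qed
 then show ?thesis by simp
qed

text \<open>Stopping without stopping times: the integrand is multiplied on each grid cell by the
  indicator that nothing has gone wrong so far, which is known at the left end of the cell. The
  result has mean 0 and energy at most \<open>K\<close> for every path, and its final value is
  \<open>E\<close> at the random grid point where the integrand was switched off.\<close>

lemma simple_cut:
 assumes simple: "simple H E" and t: "0 < t" and S: "finite S" "S \<subseteq> {0..t}" and K: "0 <= K"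
  and good: "!!s. 0 <= s ==> {w\<in>space M. good s w} \<in> sets (F s)"
 shows "\<exists>X. has_bochner_integral M X 0 \<and> integrable M (%w. (X w)^2) \<and> (\<integral>w. (X w)^2 \<partial>M) <= K \<and>
  (\<forall>w\<in>space M. \<exists>s\<in>{0..t}. X w = E s w \<and>
    (\<not> good s w \<or> energy H t w > ennreal K \<or> s = t) \<and> (\<forall>s'\<in>S. s' < s --> good s' w))"
proof -
 obtain D C where mesh: "mesh H E D C" using simple_mesh[OF simple] by blast
 note D = meshD[OF mesh]
 \<comment> \<open>The points of \<open>D\<close> make the integrand constant on cells, and those of
   \<open>S\<close> are the times at which \<open>good\<close> has to be tested.\<close>
 define Q where "Q = (D \<inter> {0..t}) \<union> S \<union> {0, t}"
 have Q: "finite Q" "Q \<subseteq> {0..t}" "0 \<in> Q" "t \<in> Q" using D S t unfolding Q_def by auto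
 obtain p :: "nat => real" and k where p: "p 0 = 0" "p k = t" "!!i. i < k ==> p i < p (Suc i)"
  "p ` {..k} = Q" "!!i. i < k ==> Q \<inter> {p i<..<p (Suc i)} = {}" "!!i j. i <= j ==> j <= k ==> p i <= p j"
  by (rule finite_grid[OF Q]) blast
 have p_range: "0 <= p i" "p i <= t" if "i <= k" for i using p(6)[of 0 i] p(6)[of i k] p(1,2) that by auto
 have gap: "D \<inter> {p i<..<p (Suc i)} = {}" if "i < k" for i
  using p(5)[OF that] p_range[of i] p_range[of "Suc i"] that unfolding Q_def by force
 define h where "h i = H (p (Suc i))" for i
 define d where "d i = p (Suc i) - p i" for i
 define Qs where "Qs i w = (\<Sum>j<i. (h j w)^2 * d j)" for i w
 \<comment> \<open>Permission for cell \<open>i\<close> counts the energy of that cell too, hence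
   \<open>Suc i\<close>. It is still decided at time \<open>p i\<close>, because the value
   \<open>h i\<close> on the cell is known there.\<close>
 define c where "c i w \<longleftrightarrow> Qs (Suc i) w <= K \<and> (\<forall>j\<le>i. good (p j) w)" for i w
 define \<eta> where "\<eta> i w = (if c i w then h i w else 0)" for i w
 define X where "X w = (\<Sum>i<k. \<eta> i w * (W (p (Suc i)) w - W (p i) w))" for w
 have d: "0 <= d i" if "i < k" for i using p(3)[OF that] unfolding d_def by simp
 have hm: "h i \<in> borel_measurable (F (p i))" if "i < k" for i
  unfolding h_def using D(4)[OF p_range(1) p(3) gap] that by auto
 have hm': "h j \<in> borel_measurable (F (p i))" if "j <= i" "i < k" for i j
  using measurable_F_mono[OF hm[of j]] p(6)[of j i] that by auto
 have Qsm: "Qs (Suc i) \<in> borel_measurable (F (p i))" if "i < k" for i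
  unfolding Qs_def using hm'[OF _ that] by (intro borel_measurable_sum borel_measurable_times borel_measurable_power) auto
 have cm: "{w\<in>space (F (p i)). c i w} \<in> sets (F (p i))" if "i < k" for i
 proof -
  have "{w\<in>space (F (p i)). Qs (Suc i) w <= K} \<in> sets (F (p i))" using Qsm[OF that] by measurable
  moreover have "{w\<in>space (F (p i)). \<forall>j\<in>{..i}. good (p j) w} \<in> sets (F (p i))"
  proof (rule sets.sets_Collect_finite_All)
   fix j assume "j \<in> {..i}"
   then have "j <= i" by simp
   then show "{w \<in> space (F (p i)). good (p j) w} \<in> sets (F (p i))"
    using good[OF p_range(1), of j] F_mono[OF p(6)[of j i]] that by (auto simp: space_F)
  qed auto
  ultimately have "{w\<in>space (F (p i)). Qs (Suc i) w <= K} \<inter> {w\<in>space (F (p i)). \<forall>j\<in>{..i}. good (p j) w} \<in> sets (F (p i))"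
   by (rule sets.Int)
  moreover have "{w\<in>space (F (p i)). Qs (Suc i) w <= K} \<inter> {w\<in>space (F (p i)). \<forall>j\<in>{..i}. good (p j) w} = {w\<in>space (F (p i)). c i w}"
   unfolding c_def by auto
  ultimately show ?thesis by simp
 qed
 have \<eta>m: "\<eta> i \<in> borel_measurable (F (p i))" if "i < k" for i
  unfolding \<eta>_def using cm[OF that] hm[OF that] by measurable
 have \<eta>b: "\<bar>\<eta> i w\<bar> <= C" if "w \<in> space M" for i w
  unfolding \<eta>_def h_def using D(2,3) that by auto
 have inc: "E (p (Suc i)) w - E (p i) w = h i w * (W (p (Suc i)) w - W (p i) w)" if "i < k" for i w
  unfolding h_def using D(6)[OF p_range(1) p(3) gap] that by auto
 have Ep: "E (p j) w = (\<Sum>i<j. h i w * (W (p (Suc i)) w - W (p i) w))" if "j <= k" for j w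
  using that
 proof (induction j)
  case 0 show ?case using simple_0[OF simple] p(1) by simp
 next
  case (Suc j) then show ?case using inc[of j w] by simp
 qed
 have en: "energy H t w = ennreal (Qs k w)" for w
  using energy_grid[of p k H w "%i. h i w"] p D(5)[OF p_range(1) _ _ gap] unfolding Qs_def d_def h_def
  by (simp add: less_imp_le)
 have Qmono: "Qs i w <= Qs j w" if "i <= j" "j <= k" for i j w
  unfolding Qs_def using that d by (intro sum_mono2) auto
 have cmono: "c i w" if "c j w" "i <= j" "j < k" for i j w
  using that Qmono[of "Suc i" "Suc j" w] unfolding c_def by auto
 \<comment> \<open>Either cell \<open>m\<close> is permitted and the whole sum is at most
   \<open>Qs (Suc m) w\<close>, or its term is 0 and the previous bound remains.\<close>
 have sumle: "(\<Sum>i<m. (\<eta> i w)^2 * d i) <= K" if "m <= k" for m w using that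
 proof (induction m)
  case (Suc m)
  show ?case
  proof (cases "c m w")
   case True
   have "(\<Sum>i<Suc m. (\<eta> i w)^2 * d i) <= Qs (Suc m) w"
    unfolding Qs_def \<eta>_def using Suc.prems d by (intro sum_mono) auto
   then show ?thesis using True unfolding c_def by simp
  next
   case False
   then show ?thesis using Suc by (simp add: \<eta>_def)
  qed
 qed (use K in simp)
 have p0: "0 <= p 0" using p(1) by simp
 have ds: "X \<in> borel_measurable (F (p k)) \<and> integrable M (%w. (X w)^2) \<and> has_bochner_integral M X 0 \<and>
   (\<integral>w. (X w)^2 \<partial>M) = (\<Sum>i<k. (\<integral>w. (\<eta> i w)^2 \<partial>M) * d i) \<and> 0 <= p k"
  unfolding X_def
  by (rule discrete_sum[where g="%_ x. x" and C="%_. C"])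
    (use p0 p(3)[THEN less_imp_le] p_range \<eta>m \<eta>b in \<open>auto intro!: increment_moments simp: d_def\<close>)
 have i\<eta>: "integrable M (%w. (\<eta> i w)^2)" if "i < k" for i
 proof (rule integrable_const_bound[of _ "C^2"])
  show "AE w in M. norm ((\<eta> i w)^2) <= C^2"
   using \<eta>b by (intro AE_I2) (auto simp: abs_le_square_iff[symmetric] intro: order_trans[OF _ abs_ge_self])
  show "(%w. (\<eta> i w)^2) \<in> borel_measurable M" using measurable_F[OF \<eta>m[OF that]] by measurable
 qed
 have "(\<integral>w. (X w)^2 \<partial>M) = (\<integral>w. (\<Sum>i<k. (\<eta> i w)^2 * d i) \<partial>M)"
  using ds i\<eta> by (subst Bochner_Integration.integral_sum) auto
 also have "\<dots> <= (\<integral>w. K \<partial>M)"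
  using sumle i\<eta> by (intro integral_mono Bochner_Integration.integrable_sum) auto
 finally have X2: "(\<integral>w. (X w)^2 \<partial>M) <= K" by (simp add: prob_space)
 show ?thesis
 proof (intro exI[of _ X] conjI ballI)
  fix w assume w: "w \<in> space M"
  \<comment> \<open>The first forbidden cell, or \<open>k\<close> if there is none. By
    \<open>cmono\<close> all later cells are forbidden as well, so the integral stays at
    \<open>E (p j)\<close>.\<close>
  define j where "j = (LEAST i. i = k \<or> \<not> c i w)"
  have j: "j = k \<or> \<not> c j w" unfolding j_def by (rule LeastI[of _ k]) simp
  have jk: "j <= k" unfolding j_def by (rule Least_le) simp
  have cj: "c i w" if "i < j" for i using not_less_Least[of i "%i. i = k \<or> \<not> c i w"] that unfolding j_def by auto
  have "X w = (\<Sum>i<j. \<eta> i w * (W (p (Suc i)) w - W (p i) w)) + (\<Sum>i\<in>{j..<k}. \<eta> i w * (W (p (Suc i)) w - W (p i) w))"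
   unfolding X_def using jk by (metis (no_types, lifting) add.commute finite_lessThan lessThan_atLeast0 sum.atLeastLessThan_concat zero_le)
  also have "(\<Sum>i\<in>{j..<k}. \<eta> i w * (W (p (Suc i)) w - W (p i) w)) = 0"
  proof (rule sum.neutral, intro ballI)
   fix i assume "i \<in> {j..<k}"
   then have "\<not> c i w" using cmono[of i w j] j by auto
   then show "\<eta> i w * (W (p (Suc i)) w - W (p i) w) = 0" unfolding \<eta>_def by simp
  qed
  also have "(\<Sum>i<j. \<eta> i w * (W (p (Suc i)) w - W (p i) w)) = E (p j) w"
   unfolding Ep[OF jk] using cj by (intro sum.cong) (auto simp: \<eta>_def)
  finally have XE: "X w = E (p j) w" by simp
  have 1: "\<not> good (p j) w \<or> energy H t w > ennreal K \<or> p j = t"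
  proof (cases "j = k")
   case True then show ?thesis using p by simp
  next
   case False
   then have "\<not> c j w" "j < k" using j jk by auto
   then consider "Qs (Suc j) w > K" | i where "i <= j" "\<not> good (p i) w" unfolding c_def by fastforce
   then show ?thesis
   proof cases
    case 1
    then have "Qs k w > K" using Qmono[of "Suc j" k w] \<open>j < k\<close> by auto
    then show ?thesis unfolding en using K by (simp add: ennreal_lessI)
   next
    case 2
    have "i = j"
    proof (rule ccontr)
     assume "i \<noteq> j"
     then have "c i w" using cj[of i] 2 by auto
     then show False using 2 unfolding c_def by auto
    qed
    then show ?thesis using 2 by auto
   qed
  qed
  have 2: "good s' w" if s': "s' \<in> S" "s' < p j" for s'
  proof -
   obtain i where i: "i <= k" "s' = p i" using p(4) s'(1) unfolding Q_def by (metis Un_iff atMost_iff imageE)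
   have "i < j" using s'(2) i p(6)[of j i] by (meson leD not_le)
   then show ?thesis using cj[of i] i unfolding c_def by auto
  qed
  show "\<exists>s\<in>{0..t}. X w = E s w \<and>
    (\<not> good s w \<or> energy H t w > ennreal K \<or> s = t) \<and> (\<forall>s'\<in>S. s' < s --> good s' w)"
   by (rule bexI[of _ "p j"]) (use XE 1 2 p_range[OF jk] in auto)
 qed (use ds X2 in auto)
qed

text \<open>Take \<open>\<bar>E s w\<bar> <= \<delta>\<close> as the condition \<open>good\<close>
  in \<open>simple_cut\<close>: if the energy stays below \<open>K\<close> and the cut integral is
  still at most \<open>\<delta>\<close>, then no cut occurred before \<open>t\<close> and every
  tested value is small. The probability is Chebyshev's bound for the cut integral.\<close>

lemma simple_maximal:
 assumes simple: "simple H E" and t: "0 < t" and S: "finite S" "S \<subseteq> {0..t}" and K: "0 <= K" and \<delta>: "0 < \<delta>"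
 shows "mostly (K / \<delta>^2) (%w. energy H t w <= ennreal K --> (\<forall>s\<in>S. \<bar>E s w\<bar> <= \<delta>))"
proof -
 have good: "{w\<in>space M. \<bar>E s w\<bar> <= \<delta>} \<in> sets (F s)" if "0 <= s" for s
 proof -
  have [measurable]: "E s \<in> borel_measurable (F s)" by (rule simple_adapted[OF simple that])
  have "{w\<in>space (F s). \<bar>E s w\<bar> <= \<delta>} \<in> sets (F s)" by measurable
  then show ?thesis by (simp add: space_F)
 qed
 obtain X where X: "has_bochner_integral M X 0" "integrable M (%w. (X w)^2)" "(\<integral>w. (X w)^2 \<partial>M) <= K"
  "\<forall>w\<in>space M. \<exists>s\<in>{0..t}. X w = E s w \<and>
    (\<not> \<bar>E s w\<bar> <= \<delta> \<or> energy H t w > ennreal K \<or> s = t) \<and> (\<forall>s'\<in>S. s' < s --> \<bar>E s' w\<bar> <= \<delta>)"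
  using simple_cut[OF simple t S K, of "%s w. \<bar>E s w\<bar> <= \<delta>"] good by auto
 have [measurable]: "X \<in> borel_measurable M" using X(1) by (auto simp: has_bochner_integral_iff)
 define B where "B = {w\<in>space M. \<delta>^2 <= (X w)^2 \<and> \<bar>X w\<bar> > \<delta>}"
 have B: "B \<in> sets M" unfolding B_def by measurable
 have "prob {w\<in>space M. \<delta>^2 <= (X w)^2} <= (\<integral>w. (X w)^2 \<partial>M) / \<delta>^2"
  by (rule integral_Markov_inequality_measure[OF X(2), of "{}"]) (use \<delta> in auto)
 moreover have "prob B <= prob {w\<in>space M. \<delta>^2 <= (X w)^2}"
  unfolding B_def by (rule finite_measure_mono) auto
 moreover have "(\<integral>w. (X w)^2 \<partial>M) / \<delta>^2 <= K / \<delta>^2" using X(3) by (simp add: divide_right_mono)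
 ultimately have pB: "prob B <= K / \<delta>^2" by simp
 show ?thesis
 proof (intro bexI[OF _ B] conjI pB ballI impI)
  fix w s assume w: "w \<in> space M - B" and e: "energy H t w <= ennreal K" and s: "s \<in> S"
  have XB: "\<not> \<bar>X w\<bar> > \<delta>"
  proof
   assume a: "\<bar>X w\<bar> > \<delta>"
   then have "\<delta>^2 <= (X w)^2" using \<delta> by (simp add: abs_le_square_iff[symmetric])
   then show False using a w unfolding B_def by auto
  qed
  have "w \<in> space M" using w by simp
  from bspec[OF X(4) this] obtain u where u: "u \<in> {0..t}" "X w = E u w"
    "\<not> \<bar>E u w\<bar> <= \<delta> \<or> energy H t w > ennreal K \<or> u = t" "\<forall>s'\<in>S. s' < u --> \<bar>E s' w\<bar> <= \<delta>" by blast
  have "u = t" using u(2,3) XB e by (auto simp: not_less)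
  then show "\<bar>E s w\<bar> <= \<delta>" using u s S XB by (cases "s = t") force+
 qed
qed

lemma simple_quadratic:
 assumes simple: "simple H E"
 shows "\<exists>D C. finite D \<and> 0 <= C \<and> (\<forall>w\<in>space M. \<forall>s. \<bar>H s w\<bar> <= C) \<and> (\<forall>(p :: nat => real) k d t. p 0 = 0 --> (\<forall>i<k. p i < p (Suc i)) -->
   (\<forall>i<k. D \<inter> {p i<..<p (Suc i)} = {}) --> (\<forall>i<k. p (Suc i) - p i <= d) --> 0 <= t --> t <= p k -->
   (let R = (%w. (E t w)^2 - enn2real (energy H t w)
      - (\<Sum>i<k. 2 * E (p i) w * (E (min t (p (Suc i))) w - E (min t (p i)) w)))
    in integrable M (%w. (R w)^2) \<and> R \<in> borel_measurable M \<and> (\<integral>w. (R w)^2 \<partial>M) <= 2 * C ^ 4 * d * t))"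
proof -
 obtain D C where mesh: "mesh H E D C" using simple_mesh[OF simple] by blast
 note D = meshD[OF mesh]
 show ?thesis
 proof (intro exI[of _ D] exI[of _ C] conjI allI impI D(1,2) ballI D(3))
  fix p :: "nat => real" and k d t
  assume p: "p 0 = 0" "\<forall>i<k. p i < p (Suc i)" "\<forall>i<k. D \<inter> {p i<..<p (Suc i)} = {}" "\<forall>i<k. p (Suc i) - p i <= d"
   and t: "0 <= t" "t <= p k"
  define R where "R w = (E t w)^2 - enn2real (energy H t w)
      - (\<Sum>i<k. 2 * E (p i) w * (E (min t (p (Suc i))) w - E (min t (p i)) w))" for w
  define p' where "p' i = min t (p i)" for i
  define h where "h i = H (p (Suc i))" for i
  have pm: "p i >= 0" if "i <= k" for i using that
  proof (induction i)
   case (Suc i) then show ?case using p(2)[rule_format, of i] by simp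
  qed (use p in simp)
  have p'0: "p' 0 = 0" "p' k = t" using p t unfolding p'_def by auto
  have p'm: "p' i <= p' (Suc i)" if "i < k" for i using p(2) that unfolding p'_def by (auto simp: min_def)
  have hconst: "H s w = h i w" if "i < k" "p i < s" "s <= p (Suc i)" for i s w
   unfolding h_def using D(5)[OF pm _ _ p(3)[rule_format]] that by auto
  have hm: "h i \<in> borel_measurable (F (p i))" if "i < k" for i
   unfolding h_def using D(4)[OF pm _ p(3)[rule_format]] p(2) that by auto
  have en: "enn2real (energy H t w) = (\<Sum>i<k. (h i w)^2 * (p' (Suc i) - p' i))" for w
  proof -
   have "energy H (p' k) w = ennreal (\<Sum>i<k. (h i w)^2 * (p' (Suc i) - p' i)) \<and> 0 <= p' k"
    by (rule energy_grid) (use p'0 p'm hconst in \<open>auto simp: p'_def min_def split: if_splits\<close>)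
   moreover have "0 <= (\<Sum>i<k. (h i w)^2 * (p' (Suc i) - p' i))" using p'm by (intro sum_nonneg) auto
   ultimately show ?thesis using p'0 by simp
  qed
  have inc: "E (p' (Suc i)) w - E (p' i) w = h i w * (W (p' (Suc i)) w - W (p' i) w)" if i: "i < k" for i w
  proof (cases "p i < t")
   case True
   have lt: "p i < p' (Suc i)" "p' (Suc i) <= p (Suc i)" "p' i = p i" using True p(2) i unfolding p'_def by auto
   then have gap: "D \<inter> {p i<..<p' (Suc i)} = {}" using p(3) i by force
   show ?thesis using D(6)[OF pm lt(1) gap, of w] i hconst[OF i lt(1,2)] lt(3) by simp
  next
   case False
   then have "p' (Suc i) = t" "p' i = t" using p(2)[rule_format, OF i] unfolding p'_def by auto
   then show ?thesis by simp
  qed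
  \<comment> \<open>Cells beyond \<open>t\<close> have collapsed to the point \<open>t\<close>,
    where \<open>h i\<close> need not be known yet; the value 0 keeps \<open>\<eta> i\<close>
    measurable at time \<open>p' i\<close>.\<close>
  define \<eta> where "\<eta> i w = (if p i < t then (h i w)^2 else 0)" for i w
  have \<eta>m: "\<eta> i \<in> borel_measurable (F (p' i))" if "i < k" for i
  proof (cases "p i < t")
   case True
   then have "p' i = p i" unfolding p'_def by auto
   moreover have "\<eta> i = (%w. (h i w)^2)" unfolding \<eta>_def using True by auto
   ultimately show ?thesis using hm[OF that] by simp
  next
   case False
   then have "\<eta> i = (%_. 0)" unfolding \<eta>_def by auto
   then show ?thesis by simp
  qed
  have \<eta>b: "\<bar>\<eta> i w\<bar> <= C^2" if "w \<in> space M" for i w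
   unfolding \<eta>_def h_def using D(3)[OF that] by (auto simp: abs_le_square_iff[symmetric] intro: order_trans[OF _ abs_ge_self])
  have Rsum: "R w = (\<Sum>i<k. \<eta> i w * ((W (p' (Suc i)) w - W (p' i) w)^2 - (p' (Suc i) - p' i)))" for w
  proof -
   have "(E t w)^2 = (\<Sum>i<k. (E (p' (Suc i)) w)^2 - (E (p' i) w)^2)"
    using p'0 simple_0[OF simple] by (subst sum_lessThan_telescope) simp
   then have "R w = (\<Sum>i<k. (E (p' (Suc i)) w)^2 - (E (p' i) w)^2 - (h i w)^2 * (p' (Suc i) - p' i)
     - 2 * E (p i) w * (E (p' (Suc i)) w - E (p' i) w))"
    unfolding R_def en by (simp add: sum_subtractf p'_def)
   also have "\<dots> = (\<Sum>i<k. \<eta> i w * ((W (p' (Suc i)) w - W (p' i) w)^2 - (p' (Suc i) - p' i)))"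
   proof (rule sum.cong[OF refl])
    fix i assume "i \<in> {..<k}"
    then have i: "i < k" by simp
    show "(E (p' (Suc i)) w)^2 - (E (p' i) w)^2 - (h i w)^2 * (p' (Suc i) - p' i)
     - 2 * E (p i) w * (E (p' (Suc i)) w - E (p' i) w) =
     \<eta> i w * ((W (p' (Suc i)) w - W (p' i) w)^2 - (p' (Suc i) - p' i))"
    proof (cases "p i < t")
     case True
     then have pi: "p' i = p i" unfolding p'_def by auto
     have "(E (p' (Suc i)) w)^2 - (E (p' i) w)^2 - 2 * E (p i) w * (E (p' (Suc i)) w - E (p' i) w)
      = (E (p' (Suc i)) w - E (p' i) w)^2" unfolding pi by (simp add: power2_eq_square algebra_simps)
     also have "\<dots> = (h i w)^2 * (W (p' (Suc i)) w - W (p' i) w)^2" unfolding inc[OF i] by (simp add: power_mult_distrib)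
     finally have "(E (p' (Suc i)) w)^2 - (E (p' i) w)^2 - 2 * E (p i) w * (E (p' (Suc i)) w - E (p' i) w)
      = (h i w)^2 * (W (p' (Suc i)) w - W (p' i) w)^2" .
     then show ?thesis using True unfolding \<eta>_def by (simp add: right_diff_distrib)
    next
     case False
     then have "p' (Suc i) = t" "p' i = t" using p(2)[rule_format, OF i] unfolding p'_def by auto
     then show ?thesis by simp
    qed
   qed
   finally show ?thesis .
  qed
  have ds: "R \<in> borel_measurable (F (p' k)) \<and> integrable M (%w. (R w)^2) \<and> has_bochner_integral M R 0 \<and>
   (\<integral>w. (R w)^2 \<partial>M) = (\<Sum>i<k. (\<integral>w. (\<eta> i w)^2 \<partial>M) * (2 * (p' (Suc i) - p' i)^2)) \<and> 0 <= p' k"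
   unfolding Rsum[abs_def]
  proof (rule discrete_sum[where g="%i x. x^2 - (p' (Suc i) - p' i)" and C="%_. C^2"])
   fix i assume i: "i < k"
   have "0 <= p' i" using pm[of i] i t unfolding p'_def by auto
   then show "has_bochner_integral M (%w. (W (p' (Suc i)) w - W (p' i) w)^2 - (p' (Suc i) - p' i)) 0"
    and "has_bochner_integral M (%w. ((W (p' (Suc i)) w - W (p' i) w)^2 - (p' (Suc i) - p' i))^2) (2 * (p' (Suc i) - p' i)^2)"
    using increment_square_variance p'm[OF i] by auto
  qed (use p'0 p'm \<eta>m \<eta>b in auto)
  have bd: "(\<integral>w. (\<eta> i w)^2 \<partial>M) * (2 * (p' (Suc i) - p' i)^2) <= 2 * C^4 * d * (p' (Suc i) - p' i)" if i: "i < k" for i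
  proof -
   have \<eta>2: "(\<eta> i w)^2 <= C^4" if "w \<in> space M" for w
    using \<eta>b[OF that, of i] abs_le_square_iff[of "\<eta> i w" "C^2"] by simp
   have "(\<integral>w. (\<eta> i w)^2 \<partial>M) <= (\<integral>w. C^4 \<partial>M)"
   proof (rule integral_mono)
    show "integrable M (%w. (\<eta> i w)^2)"
    proof (rule integrable_const_bound[of _ "C^4"])
     show "(%w. (\<eta> i w)^2) \<in> borel_measurable M" using measurable_F[OF \<eta>m[OF i]] by measurable
    qed (use \<eta>2 in \<open>auto intro!: AE_I2\<close>)
   qed (use \<eta>2 in auto)
   then have 1: "(\<integral>w. (\<eta> i w)^2 \<partial>M) <= C^4" by (simp add: prob_space)
   have "p' (Suc i) - p' i <= d" using p(2,4)[rule_format, OF i] unfolding p'_def by (auto simp: min_def)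
   then have 2: "(p' (Suc i) - p' i)^2 <= d * (p' (Suc i) - p' i)"
    using p'm[OF i] unfolding power2_eq_square by (intro mult_right_mono) auto
   have "(\<integral>w. (\<eta> i w)^2 \<partial>M) * (p' (Suc i) - p' i)^2 <= C^4 * (d * (p' (Suc i) - p' i))"
    using 1 2 by (intro mult_mono) auto
   then show ?thesis by simp
  qed
  have "(\<integral>w. (R w)^2 \<partial>M) <= (\<Sum>i<k. 2 * C^4 * d * (p' (Suc i) - p' i))"
   using ds bd by (auto intro!: sum_mono)
  also have "\<dots> = 2 * C^4 * d * t"
   using p'0 by (simp add: sum_distrib_left[symmetric] sum_lessThan_telescope)
  finally show "let R = (%w. (E t w)^2 - enn2real (energy H t w)
      - (\<Sum>i<k. 2 * E (p i) w * (E (min t (p (Suc i))) w - E (min t (p i)) w)))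
    in integrable M (%w. (R w)^2) \<and> R \<in> borel_measurable M \<and> (\<integral>w. (R w)^2 \<partial>M) <= 2 * C ^ 4 * d * t"
   unfolding Let_def R_def[symmetric] using ds measurable_F by blast
 qed
qed

lemma simple_scale: "simple H E ==> simple (%s w. c * H s w) (%t w. c * E t w)"
proof (induction rule: simple.induct)
 case zero then show ?case using simple.zero by simp
next
 case (step H E u v \<xi> C)
 have "simple (%s w. c * H s w + c * \<xi> w * indicator {u<..v} s)
   (%t w. c * E t w + c * \<xi> w * (W (min t v) w - W (min t u) w))"
  by (rule simple.step[where C="\<bar>c\<bar> * C"]) (use step in \<open>auto simp: abs_mult intro: mult_left_mono\<close>)
 then show ?case by (simp add: algebra_simps)
qed

lemma simple_add:
 assumes "simple G E'" shows "simple H E ==> simple (%s w. G s w + H s w) (%t w. E' t w + E t w)"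
proof (induction rule: simple.induct)
 case zero then show ?case using assms by simp
next
 case (step H E u v \<xi> C)
 have "simple (%s w. (G s w + H s w) + \<xi> w * indicator {u<..v} s)
   (%t w. (E' t w + E t w) + \<xi> w * (W (min t v) w - W (min t u) w))"
  by (rule simple.step[where C=C]) (use step in auto)
 then show ?case by (simp add: algebra_simps)
qed

text \<open>A restricted block is again a block, on \<open>(max u u', min v v']\<close>, unless the
  two intervals are disjoint. Adapted step functions times simple integrands, and so the integrands
  of all Riemann sums, are built from this.\<close>

lemma simple_restrict:
 assumes "0 <= u" "u <= v" "\<zeta> \<in> borel_measurable (F u)" "!!w. w \<in> space M ==> \<bar>\<zeta> w\<bar> <= K"
 shows "simple H E ==> simple (%s w. \<zeta> w * indicator {u<..v} s * H s w) (%t w. \<zeta> w * (E (min t v) w - E (min t u) w))"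
proof (induction rule: simple.induct)
 case zero then show ?case using simple.zero by simp
next
 case (step H E u' v' \<xi> C)
 let ?l = "max u u'" and ?r = "min v v'"
 show ?case
 proof (cases "?l <= ?r")
  case True
  have a: "indicator {?l<..?r} s = indicator {u<..v} s * (indicator {u'<..v'} s :: real)" for s
   by (auto simp: indicator_def)
  have b: "W (min t ?r) w - W (min t ?l) w = (W (min (min t v) v') w - W (min (min t v) u') w) - (W (min (min t u) v') w - W (min (min t u) u') w)" for t w
  proof -
   have "u <= v'" "u' <= v" using True by auto
   then have "min (min t v) v' = min t ?r" "min (min t v) u' = min t u'" "min (min t u) v' = min t u"
    by (auto simp: min_def)
   then show ?thesis by (cases "u <= u'") (auto simp: min_def max_def)
  qed
  have "simple (%s w. \<zeta> w * indicator {u<..v} s * H s w + \<zeta> w * \<xi> w * indicator {?l<..?r} s)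
    (%t w. \<zeta> w * (E (min t v) w - E (min t u) w) + \<zeta> w * \<xi> w * (W (min t ?r) w - W (min t ?l) w))"
  proof (rule simple.step[where C="K * \<bar>C\<bar>"])
   have "\<zeta> \<in> borel_measurable (F ?l)" "\<xi> \<in> borel_measurable (F ?l)"
    using measurable_F_mono[OF assms(3), of ?l] measurable_F_mono[OF step(4), of ?l] by auto
   then show "(%w. \<zeta> w * \<xi> w) \<in> borel_measurable (F ?l)" by measurable
   fix w assume w: "w \<in> space M"
   have "\<bar>\<zeta> w\<bar> * \<bar>\<xi> w\<bar> <= K * \<bar>C\<bar>" using assms(4)[OF w] step(5)[OF w] by (intro mult_mono) auto
   then show "\<bar>\<zeta> w * \<xi> w\<bar> <= K * \<bar>C\<bar>" by (simp add: abs_mult)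
  qed (use step True assms in auto)
  then show ?thesis unfolding a b by (simp add: algebra_simps)
 next
  case False
  then consider "v < u'" | "v' < u" using assms step by (auto simp: max_def min_def split: if_splits)
  then have "indicator {u<..v} s * (indicator {u'<..v'} s :: real) = 0 \<and>
   (W (min (min t v) v') w - W (min (min t v) u') w) - (W (min (min t u) v') w - W (min (min t u) u') w) = 0" for s t w
  proof cases
   case 1
   then have "min (min t v) v' = min t v" "min (min t v) u' = min t v" "min (min t u) v' = min t u" "min (min t u) u' = min t u"
    using assms step(3) by (auto simp: min_def)
   then show ?thesis using 1 by (auto simp: indicator_def)
  next
   case 2
   then have "min (min t v) v' = min t v'" "min (min t v) u' = min t u'" "min (min t u) v' = min t v'" "min (min t u) u' = min t u'"
    using assms step(3) by (auto simp: min_def)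
   then show ?thesis using 2 by (auto simp: indicator_def)
  qed
  then have ind: "indicator {u<..v} s * (indicator {u'<..v'} s :: real) = 0" and
   w: "W (min (min t v) v') w - W (min (min t v) u') w = W (min (min t u) v') w - W (min (min t u) u') w" for s t w by auto
  have 1: "\<zeta> w * indicator {u<..v} s * (H s w + \<xi> w * indicator {u'<..v'} s) = \<zeta> w * indicator {u<..v} s * H s w" for s w
  proof -
   have "\<zeta> w * indicator {u<..v} s * (H s w + \<xi> w * indicator {u'<..v'} s) = \<zeta> w * indicator {u<..v} s * H s w + \<zeta> w * \<xi> w * (indicator {u<..v} s * indicator {u'<..v'} s)"
    by (simp add: algebra_simps)
   then show ?thesis unfolding ind by simp
  qed
  have 2: "\<zeta> w * (E (min t v) w + \<xi> w * (W (min (min t v) v') w - W (min (min t v) u') w) -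
     (E (min t u) w + \<xi> w * (W (min (min t u) v') w - W (min (min t u) u') w))) = \<zeta> w * (E (min t v) w - E (min t u) w)" for t w
   unfolding w by simp
  show ?thesis unfolding 1 2 by (rule step.IH)
 qed
qed

end

section \<open>The stochastic integral\<close>

lemma dyadic_floor_le: "0 <= s ==> real (nat \<lfloor>s * 2 ^ n\<rfloor>) / 2 ^ n <= s"
 by (simp add: divide_le_eq)

lemma dyadic_floor_tendsto:
 assumes s: "0 <= (s :: real)" shows "(%n. real (nat \<lfloor>s * 2^n\<rfloor>) / 2^n) ----> s"
proof (rule tendsto_sandwich[of "%n. s - (1/2)^n" _ _ "%n. s"])
 show "\<forall>\<^sub>F n in sequentially. s - (1 / 2) ^ n <= real (nat \<lfloor>s * 2 ^ n\<rfloor>) / 2 ^ n"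
 proof (rule always_eventually, rule allI)
  fix n :: nat
  have "s * 2^n - 1 <= real_of_int \<lfloor>s * 2^n\<rfloor>" by linarith
  then have "(s * 2^n - 1) / 2^n <= real_of_int \<lfloor>s * 2^n\<rfloor> / 2^n" by (intro divide_right_mono) auto
  moreover have "(s * 2^n - 1) / 2^n = s - (1/2)^n" by (simp add: diff_divide_distrib power_divide)
  ultimately show "s - (1 / 2) ^ n <= real (nat \<lfloor>s * 2 ^ n\<rfloor>) / 2 ^ n" using s by simp
 qed
 show "\<forall>\<^sub>F n in sequentially. real (nat \<lfloor>s * 2 ^ n\<rfloor>) / 2 ^ n <= s"
  using s by (intro always_eventually allI) (simp add: divide_le_eq)
 have "(%n. s - (1/2::real)^n) ----> s - 0" by (intro tendsto_intros LIMSEQ_power_zero) simp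
 then show "(%n. s - (1/2::real)^n) ----> s" by simp
qed simp

lemma set_integral_dominated:
 fixes f :: "nat => real => real"
 assumes h: "set_integrable lborel A h" and f: "!!n. set_integrable lborel A (f n)"
  and lim: "!!x. x \<in> A ==> (%n. f n x) ----> g x" and le: "!!n x. x \<in> A ==> \<bar>f n x\<bar> <= h x"
 shows "(%n. LBINT x:A. f n x) ----> (LBINT x:A. g x)"
proof -
 have L: "(%n. indicator A x *\<^sub>R f n x) ----> indicator A x *\<^sub>R g x" for x using lim[of x] by (cases "x \<in> A") auto
 have m: "(%x. indicator A x *\<^sub>R f n x) \<in> borel_measurable lborel" for n using f unfolding set_integrable_def by blast
 show ?thesis unfolding set_lebesgue_integral_def
  by (rule integral_dominated_convergence[OF borel_measurable_LIMSEQ_real[OF L m] m h[unfolded set_integrable_def] AE_I2[OF L]])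
   (use le in \<open>auto simp: indicator_def\<close>)
qed

lemma ennreal_squeeze_0:
 assumes "Y ----> (0 :: ennreal)" "!!n. X n <= Y n" shows "X ----> 0"
 by (rule tendsto_sandwich[OF _ _ tendsto_const assms(1)]) (use assms(2) in auto)

lemma continuous_path_bounded:
 assumes "continuous_on {0..} (f :: real => real)" obtains C where "0 <= C" "!!s. s \<in> {0..t} ==> \<bar>f s\<bar> <= C"
proof -
 have "compact (f ` {0..t})" by (rule compact_continuous_image) (auto intro: continuous_on_subset[OF assms])
 then obtain C where "!!s. s \<in> {0..t} ==> \<bar>f s\<bar> <= C" using compact_imp_bounded bounded_iff by (metis imageI real_norm_def)
 then show ?thesis by (intro that[of "max 0 C"]) (auto simp: le_max_iff_disj)
qed

context bm_space
begin

text \<open>Integrands are kept only as jointly measurable functions, up to indistinguishability.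
  Their adaptedness is not recorded, since integrals draw theirs from the simple
  approximants.\<close>

definition jm :: "(real => 'a => real) => bool" where
 "jm H \<longleftrightarrow> (\<exists>G. (%(s, w). G s w) \<in> borel_measurable (borel \<Otimes>\<^sub>M M) \<and> (AE w in M. \<forall>s\<ge>0. H s w = G s w))"

lemma jmI: "(%(s, w). H s w) \<in> borel_measurable (borel \<Otimes>\<^sub>M M) ==> jm H"
 unfolding jm_def by (auto intro!: exI[of _ H])

lemma jm_cong:
 assumes "jm H" "AE w in M. \<forall>s\<ge>0. H s w = G s w" shows "jm G"
proof -
 obtain K where K: "(%(s, w). K s w) \<in> borel_measurable (borel \<Otimes>\<^sub>M M)" "AE w in M. \<forall>s\<ge>0. H s w = K s w"
  using assms(1) unfolding jm_def by auto
 have "AE w in M. \<forall>s\<ge>0. G s w = K s w" using K(2) assms(2) by eventually_elim auto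
 then show ?thesis using K(1) unfolding jm_def by auto
qed

lemma jm_comp2:
 assumes "jm H" "jm G" "(%(x, y). \<phi> x y :: real) \<in> borel_measurable borel"
 shows "jm (%s w. \<phi> (H s w) (G s w))"
proof -
 obtain H' where H': "(%(s, w). H' s w) \<in> borel_measurable (borel \<Otimes>\<^sub>M M)" "AE w in M. \<forall>s\<ge>0. H s w = H' s w"
  using assms(1) unfolding jm_def by auto
 obtain G' where G': "(%(s, w). G' s w) \<in> borel_measurable (borel \<Otimes>\<^sub>M M)" "AE w in M. \<forall>s\<ge>0. G s w = G' s w"
  using assms(2) unfolding jm_def by auto
 have "(%z. (case z of (s, w) => H' s w, case z of (s, w) => G' s w)) \<in> borel_measurable (borel \<Otimes>\<^sub>M M)"
  using H'(1) G'(1) by (simp add: borel_prod[symmetric])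
 from measurable_compose[OF this assms(3)]
 have "(%(s, w). \<phi> (H' s w) (G' s w)) \<in> borel_measurable (borel \<Otimes>\<^sub>M M)" by (simp add: split_beta')
 moreover have "AE w in M. \<forall>s\<ge>0. \<phi> (H s w) (G s w) = \<phi> (H' s w) (G' s w)"
  using H'(2) G'(2) by eventually_elim auto
 ultimately show ?thesis unfolding jm_def by (intro exI[of _ "%s w. \<phi> (H' s w) (G' s w)"]) auto
qed

lemma jm_comp: "jm H ==> \<phi> \<in> borel_measurable borel ==> jm (%s w. \<phi> (H s w))"
 by (rule jm_comp2[of H H "%x y. \<phi> x"]) (auto simp: split_beta' borel_prod[symmetric])

lemma jm_add: "jm H ==> jm G ==> jm (%s w. H s w + G s w)"
 by (rule jm_comp2) (auto simp: split_beta' borel_prod[symmetric])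

lemma jm_diff: "jm H ==> jm G ==> jm (%s w. H s w - G s w)"
 by (rule jm_comp2) (auto simp: split_beta' borel_prod[symmetric])

lemma jm_mult: "jm H ==> jm G ==> jm (%s w. H s w * G s w)"
 by (rule jm_comp2) (auto simp: split_beta' borel_prod[symmetric])

lemma jm_time: "f \<in> borel_measurable borel ==> jm (%s w. f s)"
 by (rule jmI) (simp add: split_beta')

lemma jm_const: "jm (%s w. c)"
 by (rule jmI) simp

lemma jm_rv: "ae_measurable M \<xi> ==> jm (%s w. \<xi> w)"
proof -
 assume "ae_measurable M \<xi>"
 then obtain f where f: "f \<in> borel_measurable M" "AE w in M. \<xi> w = f w" unfolding ae_measurable_def by auto
 have "jm (%s w. f w)" using f(1) by (intro jmI) (simp add: split_beta')
 then show ?thesis by (rule jm_cong) (use f(2) in auto)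
qed

lemma jm_lim:
 assumes "!!n. jm (H n)" "AE w in M. \<forall>s\<ge>0. (%n. H n s w) ----> G s w"
 shows "jm G"
proof -
 have "\<forall>n. \<exists>G. (%(s, w). G s w) \<in> borel_measurable (borel \<Otimes>\<^sub>M M) \<and> (AE w in M. \<forall>s\<ge>0. H n s w = G s w)"
  using assms(1) unfolding jm_def by blast
 from choice[OF this] obtain H' where H': "!!n. (%(s, w). H' n s w) \<in> borel_measurable (borel \<Otimes>\<^sub>M M)"
  "!!n. AE w in M. \<forall>s\<ge>0. H n s w = H' n s w" by blast
 have "(%z. lim (%n. case z of (s, w) => H' n s w)) \<in> borel_measurable (borel \<Otimes>\<^sub>M M)"
  using H'(1) by (intro borel_measurable_lim_metric) auto
 then have "(%(s, w). lim (%n. H' n s w)) \<in> borel_measurable (borel \<Otimes>\<^sub>M M)" by (simp add: split_beta')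
 moreover have "AE w in M. \<forall>n. \<forall>s\<ge>0. H n s w = H' n s w" using H'(2) by (simp add: AE_all_countable)
 then have "AE w in M. \<forall>s\<ge>0. G s w = lim (%n. H' n s w)" using assms(2)
  by eventually_elim (auto simp: limI)
 ultimately show ?thesis unfolding jm_def by (intro exI[of _ "%s w. lim (%n. H' n s w)"]) auto
qed

text \<open>Sampling at the dyadic time below \<open>s\<close> uses countably many random variables
  at each stage, so their measurable versions can be chosen with one null set; continuity of the
  paths gives the limit.\<close>

lemma jm_continuous:
 assumes "!!s. 0 <= s ==> ae_measurable M (X s)" "AE w in M. continuous_on {0..} (%s. X s w)"
 shows "jm X"
proof (rule jm_lim)
 fix n :: nat
 define a where "a s = real (nat \<lfloor>s * 2^n\<rfloor>) / 2^n" for s :: real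
 have "\<forall>i::nat. \<exists>f. f \<in> borel_measurable M \<and> (AE w in M. X (real i / 2^n) w = f w)"
 proof
  fix i :: nat
  show "\<exists>f. f \<in> borel_measurable M \<and> (AE w in M. X (real i / 2^n) w = f w)"
   using assms(1)[of "real i / 2^n"] unfolding ae_measurable_def by auto
 qed
 from choice[OF this] obtain Y where Y: "!!i::nat. Y i \<in> borel_measurable M"
  "!!i::nat. AE w in M. X (real i / 2^n) w = Y i w" by blast
 have "(%z. Y (nat \<lfloor>(fst z :: real) * 2^n\<rfloor>) (snd z)) \<in> borel_measurable (borel \<Otimes>\<^sub>M M)"
 proof (rule measurable_compose_countable)
  show "(%z. Y i (snd z)) \<in> borel_measurable (borel \<Otimes>\<^sub>M M)" for i using Y(1) by measurable
 qed measurable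
 then have "(%(s::real, w). Y (nat \<lfloor>s * 2^n\<rfloor>) w) \<in> borel_measurable (borel \<Otimes>\<^sub>M M)" by (simp add: split_beta')
 moreover have "AE w in M. \<forall>i. X (real i / 2^n) w = Y i w" using Y(2) by (simp add: AE_all_countable)
 then have "AE w in M. \<forall>s\<ge>0. X (a s) w = Y (nat \<lfloor>s * 2^n\<rfloor>) w"
 proof eventually_elim
  case (elim w)
  show ?case unfolding a_def using elim by blast
 qed
 ultimately show "jm (%s w. X (real (nat \<lfloor>s * 2^n\<rfloor>) / 2^n) w)" unfolding jm_def a_def by fastforce
next
 show "AE w in M. \<forall>s\<ge>0. (%n. X (real (nat \<lfloor>s * 2^n\<rfloor>) / 2^n) w) ----> X s w" using assms(2)
 proof eventually_elim
  case (elim w)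
  show ?case
  proof (intro allI impI)
   fix s :: real assume s: "0 <= s"
   from dyadic_floor_tendsto[OF s]
   show "(%n. X (real (nat \<lfloor>s * 2^n\<rfloor>) / 2^n) w) ----> X s w"
    by (intro continuous_on_tendsto_compose[OF elim]) (use s in auto)
  qed
 qed
qed

text \<open>Clipping the time to \<open>{0..t}\<close> turns progressive measurability, a statement
  about a restricted time interval and \<open>F t\<close>, into joint measurability on the whole
  line.\<close>

lemma progressive_clip:
 assumes "progressively_measurable F H" and t: "0 <= t"
 shows "(%(s, w). H (max 0 (min s t)) w) \<in> borel_measurable (borel \<Otimes>\<^sub>M M)"
proof -
 have P: "(%(s, w). H s w) \<in> borel_measurable (restrict_space borel {0..t} \<Otimes>\<^sub>M F t)"
  using assms unfolding progressively_measurable_def by simp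
 have "(%z. (max 0 (min (fst z) t), snd z)) \<in> measurable (borel \<Otimes>\<^sub>M M) (restrict_space borel {0..t} \<Otimes>\<^sub>M F t)"
 proof (rule measurable_Pair)
  show "(%z. max 0 (min (fst z) t)) \<in> borel \<Otimes>\<^sub>M M \<rightarrow>\<^sub>M restrict_space borel {0..t}"
   by (rule measurable_restrict_space2) (use t in auto)
  have "(%x. x) \<in> measurable M (F t)"
   by (rule measurableI) (use sets_F[of t] sets.sets_into_space in \<open>auto simp: space_F Int_absorb2\<close>)
  from measurable_compose[OF measurable_snd this]
  show "(%z. snd z) \<in> borel \<Otimes>\<^sub>M M \<rightarrow>\<^sub>M F t" .
 qed
 from measurable_compose[OF this P] show ?thesis by (simp add: split_beta')
qed

lemma jm_progressive:
 assumes "progressively_measurable F H" shows "jm H"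
proof (rule jm_lim)
 show "jm (%s. H (max 0 (min s (real n))))" for n :: nat by (rule jmI[OF progressive_clip[OF assms]]) simp
next
 show "AE w in M. \<forall>s\<ge>0. (%n. H (max 0 (min s (real n))) w) ----> H s w"
 proof (intro AE_I2 allI impI)
  fix s w assume "(0::real) <= s"
  have "eventually (%n. H (max 0 (min s (real n))) w = H s w) sequentially"
   using eventually_ge_at_top[of "nat \<lceil>s\<rceil>"]
  proof eventually_elim
   case (elim n)
   then have "s <= real n" by linarith
   then show ?case using \<open>0 <= s\<close> by (simp add: min_absorb1)
  qed
  then show "(%n. H (max 0 (min s (real n))) w) ----> H s w" by (rule tendsto_eventually)
 qed
qed

text \<open>Additivity and homogeneity of nonnegative integrals need a measurable path; this
  condition is what the pathwise energy estimates use, and joint measurability provides it almost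
  surely.\<close>

definition sec :: "(real => 'a => real) => 'a => bool" where
 "sec H w \<longleftrightarrow> (%s. indicator {0..} s * H s w) \<in> borel_measurable borel"

lemma jm_sec: assumes "jm H" shows "AE w in M. sec H w"
proof -
 obtain H' where H': "(%(s, w). H' s w) \<in> borel_measurable (borel \<Otimes>\<^sub>M M)" "AE w in M. \<forall>s\<ge>0. H s w = H' s w"
  using assms(1) unfolding jm_def by auto
 show ?thesis using H'(2) AE_space
 proof eventually_elim
  case (elim w)
  have "(%s. H' s w) \<in> borel_measurable borel"
   using measurable_compose[OF measurable_Pair2'[OF elim(2)] H'(1)] by simp
  moreover have "(%s. indicator {0..} s * H s w) = (%s. indicator {0..} s * H' s w)"
   using elim(1) by (auto simp: indicator_def)
  ultimately show ?case unfolding sec_def by simp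
 qed
qed

lemma sec_mult: "sec A w ==> sec B w ==> sec (%s w. A s w * B s w) w"
proof -
 assume that: "sec A w" "sec B w"
 have "(%s. (indicator {0..} s * A s w) * (indicator {0..} s * B s w)) \<in> borel_measurable borel"
  using that unfolding sec_def by (rule borel_measurable_times)
 moreover have "(%s. (indicator {0..} s * A s w) * (indicator {0..} s * B s w)) = (%s. indicator {0..} s * (A s w * B s w))"
  by (auto simp: indicator_def)
 ultimately show ?thesis unfolding sec_def by simp
qed

lemma sec_diff: "sec A w ==> sec B w ==> sec (%s w. A s w - B s w) w"
 unfolding sec_def by (simp add: right_diff_distrib)

lemma sec_borel: "(%s. A s w) \<in> borel_measurable borel ==> sec A w"
 unfolding sec_def by (rule borel_measurable_times) auto

lemma sec_scale: "sec A w ==> sec (%s w. c * A s w) w"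
 using sec_mult[OF sec_borel, of "%s w. c" w A] by simp

lemma energy_minus_commute: "energy (%s w. H s w - G s w) t w = energy (%s w. G s w - H s w) t w"
 unfolding energy_def by (simp add: power2_commute)

lemma energy_sec: "energy H t w = (\<integral>\<^sup>+s. ennreal ((indicator {0..} s * H s w)^2) * indicator {0..t} s \<partial>lborel)"
 unfolding energy_def by (rule nn_integral_cong) (auto simp: indicator_def)

lemma energy_mono: "s <= t ==> energy H s w <= energy H t w"
 unfolding energy_def by (rule nn_integral_mono) (auto simp: indicator_def)

lemma energy_le: "(!!s. 0 <= s ==> s <= t ==> \<bar>H s w\<bar> <= \<bar>G s w\<bar>) ==> energy H t w <= energy G t w"
 unfolding energy_def by (rule nn_integral_mono) (auto simp: indicator_def abs_le_square_iff intro!: ennreal_leI)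

lemma energy_cong: "(!!s. 0 <= s ==> s <= t ==> H s w = G s w) ==> energy H t w = energy G t w"
 unfolding energy_def by (rule nn_integral_cong) (auto simp: indicator_def)

lemma energy_0: "(!!s. 0 <= s ==> s <= t ==> H s w = 0) ==> energy H t w = 0"
 using energy_cong[of t H w "%s w. 0"] by (simp add: energy_def)

lemma energy_add:
 assumes "sec H w" "sec G w"
 shows "energy (%s w. H s w + G s w) t w <= 2 * energy H t w + 2 * energy G t w"
proof -
 have m: "(%s. indicator {0..} s * H s w) \<in> borel_measurable lborel" "(%s. indicator {0..} s * G s w) \<in> borel_measurable lborel"
  using assms unfolding sec_def by simp_all
 have "energy (%s w. H s w + G s w) t w <=
   (\<integral>\<^sup>+s. 2 * (ennreal ((indicator {0..} s * H s w)^2) * indicator {0..t} s) + 2 * (ennreal ((indicator {0..} s * G s w)^2) * indicator {0..t} s) \<partial>lborel)"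
  unfolding energy_def
 proof (rule nn_integral_mono)
  fix s
  have "(H s w + G s w)^2 <= 2 * (H s w)^2 + 2 * (G s w)^2"
   using zero_le_power2[of "H s w - G s w"] by (simp add: power2_eq_square algebra_simps)
  then have "ennreal ((H s w + G s w)^2) <= ennreal (2 * (H s w)^2 + 2 * (G s w)^2)" by (rule ennreal_leI)
  also have "\<dots> = 2 * ennreal ((H s w)^2) + 2 * ennreal ((G s w)^2)" by (simp add: ennreal_plus ennreal_mult)
  finally show "ennreal ((H s w + G s w)^2) * indicator {0..t} s <= 2 * (ennreal ((indicator {0..} s * H s w)^2) * indicator {0..t} s) + 2 * (ennreal ((indicator {0..} s * G s w)^2) * indicator {0..t} s)"
   by (auto simp: indicator_def)
 qed
 also have "\<dots> = 2 * energy H t w + 2 * energy G t w"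
  unfolding energy_sec using m by (simp add: nn_integral_add nn_integral_cmult)
 finally show ?thesis .
qed

lemma energy_scale:
 assumes "sec H w" shows "energy (%s w. c * H s w) t w = ennreal (c^2) * energy H t w"
proof -
 have m: "(%s. indicator {0..} s * H s w) \<in> borel_measurable lborel" using assms unfolding sec_def by simp
 have "energy (%s w. c * H s w) t w = (\<integral>\<^sup>+s. ennreal (c^2) * (ennreal ((indicator {0..} s * H s w)^2) * indicator {0..t} s) \<partial>lborel)"
  unfolding energy_sec by (rule nn_integral_cong) (auto simp: power_mult_distrib ennreal_mult indicator_def)
 also have "\<dots> = ennreal (c^2) * energy H t w" unfolding energy_sec by (rule nn_integral_cmult) (use m in simp)
 finally show ?thesis .
qed

lemma jm_energy: assumes "jm H" shows "ae_measurable M (energy H t)"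
proof -
 obtain G where G: "(%(s, w). G s w) \<in> borel_measurable (borel \<Otimes>\<^sub>M M)" "AE w in M. \<forall>s\<ge>0. H s w = G s w"
  using assms(1) unfolding jm_def by auto
 have "(%(w, s). G s w) \<in> borel_measurable (M \<Otimes>\<^sub>M borel)"
  using measurable_pair_swap[OF G(1)] by (simp add: split_beta')
 then have [measurable]: "(%z. G (snd z) (fst z)) \<in> borel_measurable (M \<Otimes>\<^sub>M lborel)" by (simp add: split_beta' cong: measurable_cong_sets)
 have "(%(w, s). ennreal ((G s w)^2) * indicator {0..t} s) \<in> borel_measurable (M \<Otimes>\<^sub>M lborel)"
  unfolding split_beta' by measurable
 from lborel.borel_measurable_nn_integral[OF this]
 have "energy G t \<in> borel_measurable M" unfolding energy_def[abs_def] .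
 moreover have "AE w in M. energy H t w = energy G t w" using G(2)
  by eventually_elim (rule energy_cong, simp)
 ultimately show ?thesis unfolding ae_measurable_def by auto
qed

text \<open>\<open>SI H I\<close>: \<open>I\<close> is a continuous version of the integral of \<open>H\<close> with respect to \<open>W\<close>.\<close>

definition SI :: "(real => 'a => real) => (real => 'a => real) => bool" where
 "SI H I \<longleftrightarrow> jm H \<and> (AE w in M. continuous_on {0..} (%t. I t w)) \<and>
  (\<exists>G E. (\<forall>n. simple (G n) (E n)) \<and> (\<forall>t\<ge>0. vanishes (%n w. energy (%s w. G n s w - H s w) t w) \<and>
    vanishes (%n w. ennreal \<bar>E n t w - I t w\<bar>)))"

lemma vanishes_0: "(!!n w. X n w = 0) ==> vanishes X"
 unfolding vanishes_def by (auto intro!: exI[of _ 0] bexI[of _ "{}"])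

lemma SI_I:
 assumes "jm H" "AE w in M. continuous_on {0..} (%t. I t w)" "!!n. simple (G n) (E n)"
  "!!t. t >= 0 ==> vanishes (%n w. energy (%s w. G n s w - H s w) t w)"
  "!!t. t >= 0 ==> vanishes (%n w. ennreal \<bar>E n t w - I t w\<bar>)"
 shows "SI H I"
 unfolding SI_def
proof (intro conjI assms(1,2))
 show "\<exists>G E. (\<forall>n. simple (G n) (E n)) \<and> (\<forall>t\<ge>0. vanishes (%n w. energy (%s w. G n s w - H s w) t w) \<and>
    vanishes (%n w. ennreal \<bar>E n t w - I t w\<bar>))"
  by (rule exI[of _ G], rule exI[of _ E]) (use assms(3-5) in auto)
qed

lemma simple_jm: "simple H E ==> jm H"
 by (intro jmI simple_jointly_measurable)

lemma SI_simple: assumes "simple H E" shows "SI H E"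
proof (rule SI_I[where G="%n. H" and E="%n. E"])
 show "vanishes (%n w. energy (%s w. H s w - H s w) t w)" for t by (rule vanishes_0) (simp add: energy_0)
qed (use assms simple_jm simple_continuous in \<open>auto intro!: vanishes_0\<close>)

lemma SI_jm: "SI H I ==> jm H" and SI_cont: "SI H I ==> AE w in M. continuous_on {0..} (%t. I t w)"
 unfolding SI_def by auto

lemma vanishes_cong_AE:
 assumes "vanishes X" "!!n. AE w in M. X n w = Y n w" shows "vanishes Y"
proof (rule vanishes_AE_le[OF assms(1)], intro exI[of _ 0] allI impI)
 fix n show "AE w in M. Y n w <= X n w" using assms(2)[of n] by eventually_elim simp
qed

lemma SI_cong:
 assumes "SI H I" "AE w in M. \<forall>s\<ge>0. H s w = H' s w" "AE w in M. \<forall>s\<ge>0. I s w = I' s w"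
 shows "SI H' I'"
proof -
 obtain G E where GE: "!!n. simple (G n) (E n)" "!!t. t >= 0 ==> vanishes (%n w. energy (%s w. G n s w - H s w) t w)"
   "!!t. t >= 0 ==> vanishes (%n w. ennreal \<bar>E n t w - I t w\<bar>)"
  using assms(1) unfolding SI_def by blast
 show ?thesis
 proof (rule SI_I[where G=G and E=E, OF _ _ GE(1)])
  show "jm H'" using jm_cong[OF SI_jm[OF assms(1)] assms(2)] .
  show "AE w in M. continuous_on {0..} (%t. I' t w)"
   using SI_cont[OF assms(1)] assms(3)
  proof eventually_elim
   case (elim w)
   then show ?case using continuous_on_cong[of "{0..}" "{0..}" "%t. I t w" "%t. I' t w"] by simp
  qed
  fix t :: real assume t: "0 <= t"
  show "vanishes (%n w. energy (%s w. G n s w - H' s w) t w)"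
  proof (rule vanishes_cong_AE[OF GE(2)[OF t]])
   fix n show "AE w in M. energy (%s w. G n s w - H s w) t w = energy (%s w. G n s w - H' s w) t w"
    using assms(2) by eventually_elim (rule energy_cong, simp)
  qed
  show "vanishes (%n w. ennreal \<bar>E n t w - I' t w\<bar>)"
  proof (rule vanishes_cong_AE[OF GE(3)[OF t]])
   fix n show "AE w in M. ennreal \<bar>E n t w - I t w\<bar> = ennreal \<bar>E n t w - I' t w\<bar>"
    using assms(3) by eventually_elim (use t in simp)
  qed
 qed
qed

lemma SI_ae_measurable:
 assumes "SI H I" "0 <= t" shows "ae_measurable (F t) (I t)"
proof -
 obtain G E where GE: "!!n. simple (G n) (E n)" "vanishes (%n w. ennreal \<bar>E n t w - I t w\<bar>)"
  using assms unfolding SI_def by blast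
 show ?thesis by (rule ae_measurable_vanishes_lim[OF ae_measurableI GE(2)]) (rule simple_adapted[OF GE(1) assms(2)])
qed

lemma ae_measurable_F: "ae_measurable (F t) f ==> ae_measurable M f"
 by (rule ae_measurable_mono[of "F t"]) (auto simp: space_F sets_F[THEN subsetD])

lemma SI_0: assumes "SI H I" shows "AE w in M. I 0 w = 0"
proof -
 obtain G E where GE: "!!n. simple (G n) (E n)" "!!t. 0 <= t ==> vanishes (%n w. ennreal \<bar>E n t w - I t w\<bar>)"
  using assms unfolding SI_def by blast
 have "vanishes (%(n::nat) w. ennreal \<bar>I 0 w\<bar>)" using GE(2)[of 0] simple_0[OF GE(1)] by simp
 from vanishes_const_AE_0[OF this] show ?thesis by eventually_elim (simp add: ennreal_eq_0_iff)
qed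

lemma energy_diff_AE:
 assumes "jm A" "jm B" "jm C"
 shows "AE w in M. \<forall>t. energy (%s w. A s w - C s w) t w <= 2 * energy (%s w. A s w - B s w) t w + 2 * energy (%s w. B s w - C s w) t w"
 using jm_sec[OF jm_diff[OF assms(1,2)]] jm_sec[OF jm_diff[OF assms(2,3)]]
proof eventually_elim
 case (elim w)
 show ?case using energy_add[OF elim] by simp
qed

lemma energy_add_AE:
 assumes "jm A" "jm B"
 shows "AE w in M. \<forall>t. energy (%s w. A s w + B s w) t w <= 2 * energy A t w + 2 * energy B t w"
 using jm_sec[OF assms(1)] jm_sec[OF assms(2)] by eventually_elim (simp add: energy_add)

lemma SI_add:
 assumes "SI H I" "SI H' I'"
 shows "SI (%s w. H s w + H' s w) (%t w. I t w + I' t w)"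
proof -
 obtain G E where GE: "!!n. simple (G n) (E n)" "!!t. t >= 0 ==> vanishes (%n w. energy (%s w. G n s w - H s w) t w)"
   "!!t. t >= 0 ==> vanishes (%n w. ennreal \<bar>E n t w - I t w\<bar>)"
  using assms(1) unfolding SI_def by blast
 obtain G' E' where GE': "!!n. simple (G' n) (E' n)" "!!t. t >= 0 ==> vanishes (%n w. energy (%s w. G' n s w - H' s w) t w)"
   "!!t. t >= 0 ==> vanishes (%n w. ennreal \<bar>E' n t w - I' t w\<bar>)"
  using assms(2) unfolding SI_def by blast
 note jm = SI_jm[OF assms(1)] SI_jm[OF assms(2)]
 show ?thesis
 proof (rule SI_I[OF jm_add[OF jm] _ simple_add[OF GE(1) GE'(1)]])
  show "AE w in M. continuous_on {0..} (%t. I t w + I' t w)"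
   using SI_cont[OF assms(1)] SI_cont[OF assms(2)] by eventually_elim (intro continuous_intros)
  fix t :: real assume t: "0 <= t"
  have "vanishes (%n w. ennreal 2 * energy (%s w. G n s w - H s w) t w + ennreal 2 * energy (%s w. G' n s w - H' s w) t w)"
   by (intro vanishes_add vanishes_cmult GE(2) GE'(2) t)
  then show "vanishes (%n w. energy (%s w. G n s w + G' n s w - (H s w + H' s w)) t w)"
  proof (rule vanishes_AE_le, intro exI allI impI)
   fix n
   show "AE w in M. energy (%s w. G n s w + G' n s w - (H s w + H' s w)) t w <=
     ennreal 2 * energy (%s w. G n s w - H s w) t w + ennreal 2 * energy (%s w. G' n s w - H' s w) t w"
    using energy_add_AE[OF jm_diff[OF simple_jm[OF GE(1)] jm(1)] jm_diff[OF simple_jm[OF GE'(1)] jm(2)], of n n]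
    by eventually_elim (simp add: algebra_simps)
  qed
  show "vanishes (%n w. ennreal \<bar>E n t w + E' n t w - (I t w + I' t w)\<bar>)"
  proof (rule vanishes_le[OF vanishes_add[OF GE(3)[OF t] GE'(3)[OF t]]])
   fix n w
   have "ennreal \<bar>E n t w + E' n t w - (I t w + I' t w)\<bar> <= ennreal (\<bar>E n t w - I t w\<bar> + \<bar>E' n t w - I' t w\<bar>)"
    by (rule ennreal_leI) linarith
   then show "ennreal \<bar>E n t w + E' n t w - (I t w + I' t w)\<bar> <= ennreal \<bar>E n t w - I t w\<bar> + ennreal \<bar>E' n t w - I' t w\<bar>"
    by (simp add: ennreal_plus)
  qed
 qed
qed

lemma SI_scale:
 assumes "SI H I" shows "SI (%s w. c * H s w) (%t w. c * I t w)"
proof -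
 obtain G E where GE: "!!n. simple (G n) (E n)" "!!t. t >= 0 ==> vanishes (%n w. energy (%s w. G n s w - H s w) t w)"
   "!!t. t >= 0 ==> vanishes (%n w. ennreal \<bar>E n t w - I t w\<bar>)"
  using assms(1) unfolding SI_def by blast
 note jm = SI_jm[OF assms(1)]
 show ?thesis
 proof (rule SI_I[OF jm_mult[OF jm_const jm] _ simple_scale[OF GE(1)]])
  show "AE w in M. continuous_on {0..} (%t. c * I t w)"
   using SI_cont[OF assms(1)] by eventually_elim (intro continuous_intros)
  fix t :: real assume t: "0 <= t"
  show "vanishes (%n w. energy (%s w. c * G n s w - c * H s w) t w)"
  proof (rule vanishes_cong_AE[OF vanishes_cmult[OF GE(2)[OF t], of "c^2"]])
   fix n
   show "AE w in M. ennreal (c^2) * energy (%s w. G n s w - H s w) t w = energy (%s w. c * G n s w - c * H s w) t w"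
    using jm_sec[OF jm_diff[OF simple_jm[OF GE(1)[of n]] jm]]
   proof eventually_elim
    case (elim w)
    show ?case using energy_scale[OF elim, of c t] by (simp add: right_diff_distrib)
   qed
  qed
  show "vanishes (%n w. ennreal \<bar>c * E n t w - c * I t w\<bar>)"
   using vanishes_cmult[OF GE(3)[OF t], of "\<bar>c\<bar>"]
   by (rule vanishes_le) (simp add: ennreal_mult[symmetric] abs_mult[symmetric] right_diff_distrib)
 qed
qed

lemma SI_diff:
 assumes "SI H I" "SI H' I'"
 shows "SI (%s w. H s w - H' s w) (%t w. I t w - I' t w)"
 using SI_add[OF assms(1) SI_scale[OF assms(2), of "-1"]] by simp

lemma SI_zero: "SI (%s w. 0) (%t w. 0)"
 by (rule SI_simple[OF simple.zero])

lemma SI_sum: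
 assumes "finite S" "!!i. i \<in> S ==> SI (H i) (I i)"
 shows "SI (%s w. \<Sum>i\<in>S. H i s w) (%t w. \<Sum>i\<in>S. I i t w)"
 using assms by (induction S rule: finite_induct) (auto intro: SI_zero SI_add)

lemma vanishes_sum:
 assumes "finite S" "!!i. i \<in> S ==> vanishes (X i)"
 shows "vanishes (%n w. \<Sum>i\<in>S. X i n w)"
 using assms by (induction S rule: finite_induct) (auto intro: vanishes_add vanishes_0)

text \<open>A supremum over uncountably many times, not assumed to be measurable;
  \<open>mostly\<close> and \<open>vanishes\<close> are designed to allow this.\<close>

definition sup_norm :: "(real => 'a => real) => real => 'a => ennreal" where
 "sup_norm I t w = (SUP s\<in>{0..t}. ennreal \<bar>I s w\<bar>)"

lemma sup_norm_le_iff: "0 <= e ==> sup_norm I t w <= ennreal e \<longleftrightarrow> (\<forall>s\<in>{0..t}. \<bar>I s w\<bar> <= e)"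
 unfolding sup_norm_def by (simp add: SUP_le_iff)

lemma le_sup_norm: "0 <= s ==> s <= t ==> ennreal \<bar>I s w\<bar> <= sup_norm I t w"
 unfolding sup_norm_def by (rule SUP_upper) simp

text \<open>Compare \<open>I\<close> with a simple integral that is within \<open>d\<close> of it:
  the simple integrand has energy at most \<open>2 K + 2 d\<close> and the threshold drops to
  \<open>\<delta> / 2\<close>, so Chebyshev gives \<open>(2 K + 2 d) / (\<delta> / 2)^2\<close>,
  whence the factor 8.\<close>

lemma SI_maximal_finite:
 assumes SI: "SI H I" and t: "0 < t" and B: "mostly \<beta> (%w. energy H t w <= ennreal K)"
  and K: "0 <= K" and \<delta>: "0 < \<delta>" and S: "finite S" "S \<subseteq> {0..t}" and e: "0 < e"
 shows "mostly (\<beta> + 8 * K / \<delta>^2 + e) (%w. \<forall>s\<in>S. \<bar>I s w\<bar> <= \<delta>)"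
proof -
 obtain G E where GE: "!!n. simple (G n) (E n)" "!!t. t >= 0 ==> vanishes (%n w. energy (%s w. G n s w - H s w) t w)"
   "!!t. t >= 0 ==> vanishes (%n w. ennreal \<bar>E n t w - I t w\<bar>)"
  using SI unfolding SI_def by blast
 \<comment> \<open>The bound \<open>\<delta> / 2\<close> serves the threshold. The other one makes
   the probability \<open>d\<close> of a bad approximation and the excess
   \<open>8 d / \<delta>^2\<close> together at most \<open>e\<close>.\<close>
 define d where "d = min (\<delta> / 2) (e / (1 + 8 / \<delta>^2))"
 have pos: "0 < 1 + 8 / \<delta>^2" using \<delta> by (simp add: add_pos_nonneg)
 have d: "0 < d" "d <= \<delta> / 2" "d * (1 + 8 / \<delta>^2) <= e"
  using \<delta> e pos unfolding pos_le_divide_eq[OF pos, symmetric] d_def by (simp_all only: min_less_iff_conj min.cobounded1 min.cobounded2 half_gt_zero divide_pos_pos simp_thms)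
 have "vanishes (%n w. energy (%s w. G n s w - H s w) t w + (\<Sum>s\<in>S. ennreal \<bar>E n s w - I s w\<bar>))"
  by (intro vanishes_add vanishes_sum GE S) (use t S in auto)
 from vanishesD[OF this d(1)] obtain n where
  n: "mostly d (%w. energy (%s w. G n s w - H s w) t w + (\<Sum>s\<in>S. ennreal \<bar>E n s w - I s w\<bar>) <= ennreal d)" by blast
 have "0 <= 2 * K + 2 * d" "0 < \<delta> / 2" using K d \<delta> by auto
 from simple_maximal[OF GE(1)[of n] t S this] have
  m: "mostly ((2 * K + 2 * d) / (\<delta> / 2)^2) (%w. energy (G n) t w <= ennreal (2 * K + 2 * d) --> (\<forall>s\<in>S. \<bar>E n s w\<bar> <= \<delta> / 2))" .
 show ?thesis
 proof (rule mostly_mono[OF mostly_conj[OF B mostly_conj[OF n m]]])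
  have "\<beta> + (d + (2 * K + 2 * d) / (\<delta> / 2)^2) = \<beta> + 8 * K / \<delta>^2 + d * (1 + 8 / \<delta>^2)"
   using \<delta> by (simp add: field_simps power_divide)
  then show "\<beta> + (d + (2 * K + 2 * d) / (\<delta> / 2)^2) <= \<beta> + 8 * K / \<delta>^2 + e" using d(3) by simp
  have "AE w in M. \<forall>t. energy (G n) t w <= 2 * energy (%s w. G n s w - H s w) t w + 2 * energy H t w"
   using energy_add_AE[OF jm_diff[OF simple_jm[OF GE(1)[of n]] SI_jm[OF SI]] SI_jm[OF SI]] by simp
  then show "AE w in M. energy H t w <= ennreal K \<and>
    energy (%s w. G n s w - H s w) t w + (\<Sum>s\<in>S. ennreal \<bar>E n s w - I s w\<bar>) <= ennreal d \<and>
    (energy (G n) t w <= ennreal (2 * K + 2 * d) --> (\<forall>s\<in>S. \<bar>E n s w\<bar> <= \<delta> / 2)) --> (\<forall>s\<in>S. \<bar>I s w\<bar> <= \<delta>)"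
  proof (eventually_elim, intro impI ballI, elim conjE)
   fix w s assume G: "\<forall>t. energy (G n) t w <= 2 * energy (%s w. G n s w - H s w) t w + 2 * energy H t w"
    and H: "energy H t w <= ennreal K" and s: "s \<in> S"
    and b: "energy (%s w. G n s w - H s w) t w + (\<Sum>s\<in>S. ennreal \<bar>E n s w - I s w\<bar>) <= ennreal d"
    and E: "energy (G n) t w <= ennreal (2 * K + 2 * d) --> (\<forall>s\<in>S. \<bar>E n s w\<bar> <= \<delta> / 2)"
   have "energy (%s w. G n s w - H s w) t w <= ennreal d" using b by (rule order_trans[rotated]) simp
   then have "energy (G n) t w <= 2 * ennreal d + 2 * ennreal K"
    using G H by (meson add_mono mult_left_mono order_trans zero_le)
   also have "\<dots> = ennreal (2 * K + 2 * d)" using K d by (simp add: ennreal_plus ennreal_mult add.commute)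
   finally have "\<bar>E n s w\<bar> <= \<delta> / 2" using E s by auto
   moreover have "ennreal \<bar>E n s w - I s w\<bar> <= (\<Sum>s\<in>S. ennreal \<bar>E n s w - I s w\<bar>)"
    using S s by (intro member_le_sum) auto
   from order_trans[OF add_increasing[OF zero_le this] b] have "\<bar>E n s w - I s w\<bar> <= d" using d(1) by (simp add: ennreal_le_iff)
   ultimately show "\<bar>I s w\<bar> <= \<delta>" using d(2) by linarith
  qed
 qed
qed

text \<open>Finite subsets exhaust the dyadic times in \<open>{0..t}\<close>, and these determine the continuous path.\<close>

lemma SI_maximal:
 assumes SI: "SI H I" and t: "0 < t" and B: "mostly \<beta> (%w. energy H t w <= ennreal K)" and K: "0 <= K" and \<delta>: "0 < \<delta>"
 shows "mostly (\<beta> + 8 * K / \<delta>^2) (%w. \<forall>s\<in>{0..t}. \<bar>I s w\<bar> <= \<delta>)"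
proof -
 define D where "D = (\<Union>n::nat. \<Union>i::nat. {real i / 2^n}) \<inter> {0..t}"
 have "countable D" unfolding D_def by auto
 moreover have "0 \<in> D" unfolding D_def using t by (auto intro!: exI[of _ 0])
 ultimately obtain r :: "nat => real" where r: "range r = D" using uncountable_def by (metis empty_iff)
 have rt: "r j \<in> {0..t}" for j using r unfolding D_def by auto
 have "mostly (\<beta> + 8 * K / \<delta>^2) (%w. \<forall>j. ennreal \<bar>I (r j) w\<bar> <= ennreal \<delta>)"
 proof (rule mostly_all)
  show "ae_measurable M (%w. ennreal \<bar>I (r j) w\<bar>)" for j
   using ae_measurable_comp[OF ae_measurable_F[OF SI_ae_measurable[OF SI, of "r j"]], of "%x. ennreal \<bar>x\<bar>"] rt[of j] by simp
  fix N d assume "(0 :: real) < d"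
  have "r ` {..N} \<subseteq> {0..t}" using rt by blast
  show "mostly (\<beta> + 8 * K / \<delta>^2 + d) (%w. \<forall>j\<le>N. ennreal \<bar>I (r j) w\<bar> <= ennreal \<delta>)"
   by (rule mostly_mono[OF SI_maximal_finite[OF SI t B K \<delta> _ \<open>r ` {..N} \<subseteq> {0..t}\<close> \<open>0 < d\<close>] AE_I2 order_refl]) (auto intro: ennreal_leI)
 qed
 then show ?thesis
 proof (rule mostly_mono[OF _ _ order_refl])
  show "AE w in M. (\<forall>j. ennreal \<bar>I (r j) w\<bar> <= ennreal \<delta>) --> (\<forall>s\<in>{0..t}. \<bar>I s w\<bar> <= \<delta>)" using SI_cont[OF SI]
  proof (eventually_elim, intro impI ballI)
   fix w s assume cont: "continuous_on {0..} (%t. I t w)" and J: "\<forall>j. ennreal \<bar>I (r j) w\<bar> <= ennreal \<delta>" and s: "s \<in> {0..t}"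
   have D: "\<bar>I d w\<bar> <= \<delta>" if "d \<in> D" for d
   proof -
    obtain j where "d = r j" using r \<open>d \<in> D\<close> by blast
    then show ?thesis using J \<delta> by simp
   qed
   have s0: "0 <= s" using s by simp
   have "real (nat \<lfloor>s * 2^n\<rfloor>) / 2^n <= t" for n using dyadic_floor_le[OF s0, of n] s by auto
   then have "real (nat \<lfloor>s * 2^n\<rfloor>) / 2^n \<in> D" for n unfolding D_def by auto
   then have b: "\<bar>I (real (nat \<lfloor>s * 2^n\<rfloor>) / 2^n) w\<bar> <= \<delta>" for n by (rule D)
   have "(%n. I (real (nat \<lfloor>s * 2^n\<rfloor>) / 2^n) w) ----> I s w"
    by (intro continuous_on_tendsto_compose[OF cont] dyadic_floor_tendsto[OF s0]) (use s in auto)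
   from tendsto_rabs[OF this] show "\<bar>I s w\<bar> <= \<delta>" by (rule LIMSEQ_le_const2) (use b in auto)
  qed
 qed
qed

text \<open>Continuity of the stochastic integral in its integrand: small energy in probability
  forces a small maximum in probability, by the maximal inequality.\<close>

lemma SI_vanishes:
 assumes SI: "!!n. SI (H n) (I n)" and v: "vanishes (%n w. energy (H n) t w)" and t: "0 < t"
 shows "vanishes (%n w. sup_norm (I n) t w)"
 unfolding vanishes_def
proof (intro allI impI)
 fix e :: real assume e: "e > 0"
 \<comment> \<open>Both \<open>K\<close> and \<open>8 * K / e^2\<close> are then at most
   \<open>e / 2\<close>.\<close>
 define K where "K = min (e / 2) (e^3 / 16)"
 have K: "0 < K" "K <= e / 2" "K <= e^3 / 16" using e unfolding K_def by auto
 have "8 * K / e^2 <= 8 * (e^3 / 16) / e^2" using K(3) by (intro divide_right_mono mult_left_mono) auto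
 also have "\<dots> = e / 2" using e by (simp add: power3_eq_cube power2_eq_square)
 finally have K3: "K + 8 * K / e^2 <= e" using K(2) by simp
 have "mostly e (%w. sup_norm (I n) t w <= ennreal e)" if "mostly K (%w. energy (H n) t w <= ennreal K)" for n
  by (rule mostly_mono[OF SI_maximal[OF SI t that _ e] _ K3]) (use K e in \<open>auto simp: sup_norm_le_iff\<close>)
 then show "\<exists>N. \<forall>n\<ge>N. mostly e (%w. sup_norm (I n) t w <= ennreal e)" using vanishesD[OF v K(1)] by blast
qed

text \<open>\<open>SI\<close> asks for convergence at each fixed time only. The maximal inequality,
  applied to the difference of \<open>I\<close> and its approximants, upgrades the same sequence to
  uniform convergence on bounded intervals.\<close>

lemma SI_simple_uniform:
 assumes SI: "SI H I"
 shows "\<exists>G E. (\<forall>n. simple (G n) (E n)) \<and> (\<forall>t>0. vanishes (%n w. energy (%s w. G n s w - H s w) t w) \<and>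
    vanishes (%n w. sup_norm (%s w. E n s w - I s w) t w))"
proof -
 obtain G E where GE: "!!n. simple (G n) (E n)" "!!t. t >= 0 ==> vanishes (%n w. energy (%s w. G n s w - H s w) t w)"
   "!!t. t >= 0 ==> vanishes (%n w. ennreal \<bar>E n t w - I t w\<bar>)"
  using SI unfolding SI_def by blast
 show ?thesis
 proof (rule exI[of _ G], rule exI[of _ E], intro conjI allI impI GE(1))
  fix t :: real assume t: "t > 0"
  show "vanishes (%n w. energy (%s w. G n s w - H s w) t w)" using GE(2) t by simp
  then show "vanishes (%n w. sup_norm (%s w. E n s w - I s w) t w)"
   by (rule SI_vanishes[OF SI_diff[OF SI_simple[OF GE(1)] SI] _ t])
 qed
qed

text \<open>A diagonal choice: the integrand \<open>H n\<close> is replaced by a simple one with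
  error at most \<open>1 / (n + 1)\<close> up to time \<open>n + 1\<close>, outside an event of that
  probability. The horizon grows with \<open>n\<close>, so one sequence serves all times.\<close>

lemma SI_complete:
 assumes SI: "!!n. SI (H n) (I n)" and jm: "jm K" and cont: "AE w in M. continuous_on {0..} (%t. J t w)"
  and vH: "!!t. 0 <= t ==> vanishes (%n w. energy (%s w. H n s w - K s w) t w)"
  and vI: "!!t. 0 <= t ==> vanishes (%n w. ennreal \<bar>I n t w - J t w\<bar>)"
 shows "SI K J"
proof -
 define Q where "Q n z \<longleftrightarrow> simple (fst z) (snd z) \<and> mostly (1 / real (Suc n)) (%w.
   energy (%s w. fst z s w - H n s w) (real (Suc n)) w + sup_norm (%s w. snd z s w - I n s w) (real (Suc n)) w <= ennreal (1 / real (Suc n)))" for n z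
 have "\<exists>z. Q n z" for n
 proof -
  obtain G E where GE: "!!m. simple (G m) (E m)" "!!t. t > 0 ==> vanishes (%m w. energy (%s w. G m s w - H n s w) t w)"
    "!!t. t > 0 ==> vanishes (%m w. sup_norm (%s w. E m s w - I n s w) t w)"
   using SI_simple_uniform[OF SI[of n]] by blast
  have v: "vanishes (%m w. energy (%s w. G m s w - H n s w) (real (Suc n)) w + sup_norm (%s w. E m s w - I n s w) (real (Suc n)) w)"
   by (intro vanishes_add GE(2,3)) auto
  have "0 < 1 / real (Suc n)" by simp
  from vanishesD[OF v this] obtain m where "mostly (1 / real (Suc n)) (%w.
    energy (%s w. G m s w - H n s w) (real (Suc n)) w + sup_norm (%s w. E m s w - I n s w) (real (Suc n)) w <= ennreal (1 / real (Suc n)))" by blast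
  then show ?thesis unfolding Q_def using GE(1) by (intro exI[of _ "(G m, E m)"]) simp
 qed
 then obtain z where Q: "!!n. Q n (z n)" by metis
 define G where "G n = fst (z n)" for n
 define E where "E n = snd (z n)" for n
 have s: "simple (G n) (E n)" and m: "mostly (1 / real (Suc n)) (%w.
   energy (%s w. G n s w - H n s w) (real (Suc n)) w + sup_norm (%s w. E n s w - I n s w) (real (Suc n)) w <= ennreal (1 / real (Suc n)))" for n
  using Q[of n] unfolding Q_def G_def E_def by blast+
 have small: "vanishes X" if X: "!!n w. t <= real (Suc n) ==>
   X n w <= energy (%s w. G n s w - H n s w) (real (Suc n)) w + sup_norm (%s w. E n s w - I n s w) (real (Suc n)) w" for X t
  unfolding vanishes_def
 proof (intro allI impI)
  fix e :: real assume e: "e > 0"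
  obtain N1 where N1: "1 / real (Suc N1) < e" using nat_approx_posE[OF e] by blast
  have "mostly e (%w. X n w <= ennreal e)" if n: "max N1 (nat \<lceil>t\<rceil>) <= n" for n
  proof (rule mostly_mono[OF m AE_I2])
   show le: "1 / real (Suc n) <= e" using N1 n
    by (smt (verit, best) frac_le max.bounded_iff of_nat_0_less_iff of_nat_le_iff Suc_le_mono zero_less_Suc)
   have t: "t <= real (Suc n)" using n by linarith
   fix w show "energy (%s w. G n s w - H n s w) (real (Suc n)) w + sup_norm (%s w. E n s w - I n s w) (real (Suc n)) w
     <= ennreal (1 / real (Suc n)) --> X n w <= ennreal e"
    using order_trans[OF X[OF t] order_trans[OF _ ennreal_leI[OF le]]] by blast
  qed
  then show "\<exists>N. \<forall>n\<ge>N. mostly e (%w. X n w <= ennreal e)" by blast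
 qed
 show ?thesis
 proof (rule SI_I[OF jm cont s])
  fix t :: real assume t: "0 <= t"
  have v1: "vanishes (%n w. energy (%s w. G n s w - H n s w) t w)"
   by (rule small[of t], rule order_trans[OF energy_mono]) auto
  have "vanishes (%n w. ennreal 2 * energy (%s w. G n s w - H n s w) t w + ennreal 2 * energy (%s w. H n s w - K s w) t w)"
   by (intro vanishes_add vanishes_cmult v1 vH t)
  then show "vanishes (%n w. energy (%s w. G n s w - K s w) t w)"
  proof (rule vanishes_AE_le, intro exI allI impI)
   fix n
   show "AE w in M. energy (%s w. G n s w - K s w) t w <= ennreal 2 * energy (%s w. G n s w - H n s w) t w + ennreal 2 * energy (%s w. H n s w - K s w) t w"
    using energy_diff_AE[OF simple_jm[OF s] SI_jm[OF SI] jm, of n n] by eventually_elim simp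
  qed
  have v2: "vanishes (%n w. ennreal \<bar>E n t w - I n t w\<bar>)"
  proof (rule small[of t])
   fix n w assume "t <= real (Suc n)"
   from le_sup_norm[OF t this, of "%s w. E n s w - I n s w" w]
   show "ennreal \<bar>E n t w - I n t w\<bar> <= energy (%s w. G n s w - H n s w) (real (Suc n)) w + sup_norm (%s w. E n s w - I n s w) (real (Suc n)) w"
    by (rule order_trans) simp
  qed
  show "vanishes (%n w. ennreal \<bar>E n t w - J t w\<bar>)"
   by (rule vanishes_le[OF vanishes_add[OF v2 vI[OF t]]]) (auto simp: ennreal_plus[symmetric] simp del: ennreal_plus intro!: ennreal_leI)
 qed
qed

lemma SI_AE_limit:
 assumes SI: "!!n. SI (H n) (I n)" and jm: "jm K" and cont: "AE w in M. continuous_on {0..} (%t. J t w)"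
  and H: "!!t. 0 <= t ==> AE w in M. (%n. energy (%s w. H n s w - K s w) t w) ----> 0"
  and I: "!!t. 0 <= t ==> AE w in M. (%n. I n t w) ----> J t w"
 shows "SI K J"
proof (rule SI_complete[OF SI jm cont])
 fix t :: real assume t: "0 <= t"
 show "vanishes (%n w. energy (%s w. H n s w - K s w) t w)"
  by (rule vanishes_AE[OF _ H[OF t]]) (intro jm_energy jm_diff jm SI_jm[OF SI])
 have am: "ae_measurable M (I n t)" for n by (rule ae_measurable_F[OF SI_ae_measurable[OF SI t]])
 show "vanishes (%n w. ennreal \<bar>I n t w - J t w\<bar>)"
 proof (rule vanishes_AE)
  show "ae_measurable M (%w. ennreal \<bar>I n t w - J t w\<bar>)" for n
   by (rule ae_measurable_comp[of M "%w. I n t w - J t w" "%x. ennreal \<bar>x\<bar>"])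
    (intro ae_measurable_diff am ae_measurable_lim[OF am I[OF t]], measurable)
  show "AE w in M. (%n. ennreal \<bar>I n t w - J t w\<bar>) ----> 0" using I[OF t]
  proof eventually_elim
   case (elim w)
   from tendsto_ennrealI[OF tendsto_rabs[OF LIM_zero[OF elim]]] show ?case by simp
  qed
 qed
qed

lemma sup_norm_finite: "continuous_on {0..} (%t. I t w) ==> sup_norm I t w < \<infinity>"
 by (rule continuous_path_bounded[of "%t. I t w" t], assumption, rule order_le_less_trans[OF iffD2[OF sup_norm_le_iff]]) auto

lemma sup_norm_triangle: "sup_norm I t w <= sup_norm J t w + sup_norm (%s w. I s w - J s w) t w"
 unfolding sup_norm_def[of I]
proof (rule SUP_least)
 fix s assume s: "s \<in> {0..t}"
 have "ennreal \<bar>I s w\<bar> <= ennreal \<bar>J s w\<bar> + ennreal \<bar>I s w - J s w\<bar>"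
  by (auto simp: ennreal_plus[symmetric] simp del: ennreal_plus intro!: ennreal_leI)
 also have "\<dots> <= sup_norm J t w + sup_norm (%s w. I s w - J s w) t w"
  using s by (intro add_mono le_sup_norm[of s t "%s w. I s w - J s w"] le_sup_norm) auto
 finally show "ennreal \<bar>I s w\<bar> <= sup_norm J t w + sup_norm (%s w. I s w - J s w) t w" .
qed

lemma sup_norm_tendsto_0D:
 assumes "(%n. sup_norm (X n) T w) ----> 0" "0 <= t" "t <= T"
 shows "(%n. X n t w) ----> 0"
proof -
 have "(%n. ennreal \<bar>X n t w\<bar>) ----> 0" by (rule ennreal_squeeze_0[OF assms(1) le_sup_norm[OF assms(2,3)]])
 then have "(%n. \<bar>X n t w\<bar>) ----> 0"
  by (subst (asm) ennreal_0[symmetric], subst (asm) tendsto_ennreal_iff) auto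
 then show ?thesis by (simp add: tendsto_rabs_zero_iff)
qed

lemma energy_mult_le:
 assumes "sec H w" shows "energy (%s w. X s w * H s w) t w <= sup_norm X t w * sup_norm X t w * energy H t w"
proof -
 have m: "(%s. indicator {0..} s * H s w) \<in> borel_measurable lborel" using assms unfolding sec_def by simp
 have "energy (%s w. X s w * H s w) t w <=
   (\<integral>\<^sup>+s. sup_norm X t w * sup_norm X t w * (ennreal ((indicator {0..} s * H s w)^2) * indicator {0..t} s) \<partial>lborel)"
  unfolding energy_def
 proof (rule nn_integral_mono)
  fix s
  show "ennreal ((X s w * H s w)^2) * indicator {0..t} s <= sup_norm X t w * sup_norm X t w * (ennreal ((indicator {0..} s * H s w)^2) * indicator {0..t} s)"
  proof (cases "s \<in> {0..t}")
   case True
   have "(X s w * H s w)^2 = \<bar>X s w\<bar> * \<bar>X s w\<bar> * (H s w)^2" by (simp add: power2_eq_square mult_ac)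
   then have "ennreal ((X s w * H s w)^2) = ennreal \<bar>X s w\<bar> * ennreal \<bar>X s w\<bar> * ennreal ((H s w)^2)"
    by (simp only: ennreal_mult abs_ge_zero mult_nonneg_nonneg zero_le_power2)
   also have "\<dots> <= sup_norm X t w * sup_norm X t w * ennreal ((H s w)^2)"
    using True by (intro mult_mono le_sup_norm) auto
   finally show ?thesis using True by simp
  qed simp
 qed
 also have "\<dots> = sup_norm X t w * sup_norm X t w * energy H t w"
  unfolding energy_sec by (rule nn_integral_cmult) (use m in simp)
 finally show ?thesis .
qed

lemma energy_mult_tendsto:
 assumes sec: "!!n. sec (X n) w" "sec X' w" "!!n. sec (H n) w" "sec H' w" and fin: "sup_norm X' t w < \<infinity>" "energy H' t w < \<infinity>"
  and X: "(%n. sup_norm (%s w. X n s w - X' s w) t w) ----> 0" and H: "(%n. energy (%s w. H n s w - H' s w) t w) ----> 0"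
 shows "(%n. energy (%s w. X n s w * H n s w - X' s w * H' s w) t w) ----> 0"
proof -
 define S where "S n = sup_norm (%s w. X n s w - X' s w) t w" for n
 define K where "K = sup_norm X' t w"
 define e where "e n = energy (%s w. H n s w - H' s w) t w" for n
 have le: "energy (%s w. X n s w * H n s w - X' s w * H' s w) t w <= 2 * ((K + S n) * (K + S n) * e n) + 2 * (S n * S n * energy H' t w)" for n
 proof -
  let ?P = "%s w. X n s w * (H n s w - H' s w)" and ?Q = "%s w. (X n s w - X' s w) * H' s w"
  have "energy (%s w. X n s w * H n s w - X' s w * H' s w) t w = energy (%s w. ?P s w + ?Q s w) t w"
   by (rule energy_cong) (simp add: algebra_simps)
  also have "\<dots> <= 2 * energy ?P t w + 2 * energy ?Q t w"
   by (rule energy_add) (intro sec_mult sec_diff sec)+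
  also have "\<dots> <= 2 * ((K + S n) * (K + S n) * e n) + 2 * (S n * S n * energy H' t w)"
   unfolding e_def S_def K_def
   by (intro add_mono mult_left_mono order_trans[OF energy_mult_le] mult_right_mono mult_mono sup_norm_triangle sec_diff sec) auto
  finally show ?thesis .
 qed
 have "(%n. 2 * ((K + S n) * (K + S n) * e n) + 2 * (S n * S n * energy H' t w)) ----> 2 * ((K + 0) * (K + 0) * 0) + 2 * (0 * 0 * energy H' t w)"
  using fin X H unfolding K_def S_def e_def
  by (intro tendsto_add tendsto_mult_ennreal tendsto_const) (auto simp: ennreal_mult_eq_top_iff)
 then have L: "(%n. 2 * ((K + S n) * (K + S n) * e n) + 2 * (S n * S n * energy H' t w)) ----> 0" by simp
 show ?thesis by (rule ennreal_squeeze_0[OF L le])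
qed

lemma energy_const: "0 <= t ==> energy (%s w. c) t w = ennreal (c^2 * t)"
 unfolding energy_def by (subst nn_integral_cmult_indicator) (auto simp: ennreal_mult)

lemma energy_bounded:
 assumes "0 <= t" "!!s. 0 <= s ==> s <= t ==> \<bar>H s w\<bar> <= c"
 shows "energy H t w <= ennreal (c^2 * t)"
proof -
 have "energy H t w <= energy (%s w. c) t w"
  by (rule energy_le) (use assms(2) in \<open>auto intro: order_trans[OF _ abs_ge_self]\<close>)
 then show ?thesis using energy_const[OF assms(1)] by simp
qed

lemma simple_energy_finite: "simple H E ==> w \<in> space M ==> energy H t w < \<infinity>"
proof -
 assume s: "simple H E" and w: "w \<in> space M"
 obtain C where "!!s w. w \<in> space M ==> \<bar>H s w\<bar> <= C" using simple_mesh[OF s] meshD(3) by blast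
 then have "energy H (max 0 t) w <= ennreal (C^2 * max 0 t)" by (intro energy_bounded) (use w in auto)
 moreover have "energy H t w <= energy H (max 0 t) w" by (rule energy_mono) simp
 ultimately have "energy H t w <= ennreal (C^2 * max 0 t)" by (rule order_trans[rotated])
 then show ?thesis using ennreal_less_top infinity_ennreal_def order_le_less_trans by metis
qed

text \<open>Finite energy is not part of \<open>SI\<close>. It follows because, outside an event of
  small probability, the integrand is at finite distance from a bounded simple one.\<close>

lemma SI_energy_finite: assumes SI: "SI H I" shows "AE w in M. \<forall>t. energy H t w < \<infinity>"
proof -
 obtain G E where GE: "!!n. simple (G n) (E n)" "!!t. t >= 0 ==> vanishes (%n w. energy (%s w. G n s w - H s w) t w)"
  using SI unfolding SI_def by blast
 have "AE w in M. energy H (real m) w < \<infinity>" for m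
 proof (rule AE_from_bad_sets)
  fix e :: real assume e: "e > 0"
  obtain n where n: "mostly e (%w. energy (%s w. G n s w - H s w) (real m) w <= ennreal e)"
   using vanishesD[OF GE(2) e, OF of_nat_0_le_iff] by blast
  note jm = SI_jm[OF SI] simple_jm[OF GE(1)[of n]]
  have "AE w in M. \<forall>t. energy H t w <= 2 * energy (%s w. H s w - G n s w) t w + 2 * energy (G n) t w"
   using energy_add_AE[OF jm_diff[OF jm] jm(2)] by simp
  then have "AE w in M. energy (%s w. G n s w - H s w) (real m) w <= ennreal e --> energy H (real m) w < \<infinity>" using AE_space
  proof (eventually_elim, intro impI)
   fix w assume w: "\<forall>t. energy H t w <= 2 * energy (%s w. H s w - G n s w) t w + 2 * energy (G n) t w" "w \<in> space M"
    and "energy (%s w. G n s w - H s w) (real m) w <= ennreal e"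
   then have "energy (%s w. H s w - G n s w) (real m) w < \<infinity>" using energy_minus_commute[of H "G n"] by (simp add: le_less_trans)
   then have "2 * energy (%s w. H s w - G n s w) (real m) w + 2 * energy (G n) (real m) w < \<infinity>"
    using simple_energy_finite[OF GE(1) w(2)] by (simp add: ennreal_mult_less_top)
   with w(1) show "energy H (real m) w < \<infinity>" by (meson order_le_less_trans)
  qed
  from mostly_mono[OF n this order_refl] show "mostly e (%w. energy H (real m) w < \<infinity>)" .
 qed
 then have "AE w in M. \<forall>m. energy H (real m) w < \<infinity>" by (simp add: AE_all_countable)
 then show ?thesis
 proof eventually_elim
  case (elim w)
  have "energy H t w <= energy H (real (nat \<lceil>t\<rceil>)) w" for t by (rule energy_mono) linarith
  then show ?case using elim order_le_less_trans by blast
 qed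
qed

text \<open>Tightness of a single random variable, read off from the almost sure convergence of
  \<open>X / (n + 1)\<close> to 0.\<close>

lemma AE_finite_bound:
 fixes X :: "'a => ennreal"
 assumes "ae_measurable M X" "AE w in M. X w < \<infinity>" "0 < e"
 shows "\<exists>K\<ge>0. mostly e (%w. X w <= ennreal K)"
proof -
 have "vanishes (%n w. ennreal (1 / real (Suc n)) * X w)"
 proof (rule vanishes_AE)
  show "ae_measurable M (%w. ennreal (1 / real (Suc n)) * X w)" for n
   by (rule ae_measurable_comp[OF assms(1)]) measurable
  show "AE w in M. (%n. ennreal (1 / real (Suc n)) * X w) ----> 0" using assms(2)
  proof eventually_elim
   case (elim w)
   obtain x where x: "X w = ennreal x" "0 <= x" using elim by (cases "X w") auto
   have "(%n. 1 / real (Suc n) * x) ----> 0 * x" by (intro tendsto_intros LIMSEQ_Suc[OF lim_1_over_n])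
   then have "(%n. ennreal (1 / real (Suc n) * x)) ----> ennreal 0" by (intro tendsto_ennrealI) simp
   moreover have "ennreal (1 / real (Suc n)) * X w = ennreal (1 / real (Suc n) * x)" for n
    unfolding x(1) by (rule ennreal_mult[symmetric]) (use x in auto)
   ultimately show ?case by simp
  qed
 qed
 from vanishesD[OF this assms(3)] obtain n where n: "mostly e (%w. ennreal (1 / real (Suc n)) * X w <= ennreal e)" by blast
 have "mostly e (%w. X w <= ennreal (real (Suc n) * e))"
 proof (rule mostly_mono[OF n AE_I2 order_refl], rule impI)
  fix w assume "ennreal (1 / real (Suc n)) * X w <= ennreal e"
  then have "ennreal (real (Suc n)) * (ennreal (1 / real (Suc n)) * X w) <= ennreal (real (Suc n)) * ennreal e"
   by (rule mult_left_mono) simp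
  moreover have "ennreal (real (Suc n)) * (ennreal (1 / real (Suc n)) * X w) = X w"
   unfolding mult.assoc[symmetric] by (simp add: ennreal_mult[symmetric] del: of_nat_Suc)
  ultimately show "X w <= ennreal (real (Suc n) * e)" using assms(3) by (simp add: ennreal_mult del: of_nat_Suc)
 qed
 then show ?thesis by (intro exI[of _ "real (Suc n) * e"] conjI) (use assms(3) in simp_all)
qed

lemma SI_restrict_bounded:
 assumes SI: "SI H I" and uv: "0 <= u" "u <= v" and \<xi>: "\<xi> \<in> borel_measurable (F u)" "!!w. w \<in> space M ==> \<bar>\<xi> w\<bar> <= K"
 shows "SI (%s w. \<xi> w * indicator {u<..v} s * H s w) (%t w. \<xi> w * (I (min t v) w - I (min t u) w))"
proof -
 obtain G E where GE: "!!n. simple (G n) (E n)" "!!t. t >= 0 ==> vanishes (%n w. energy (%s w. G n s w - H s w) t w)"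
   "!!t. t >= 0 ==> vanishes (%n w. ennreal \<bar>E n t w - I t w\<bar>)"
  using SI unfolding SI_def by blast
 have jx: "jm (%s w. \<xi> w * indicator {u<..v} s)"
  by (intro jm_mult jm_rv jm_time ae_measurableI measurable_F[OF \<xi>(1)]) simp
 show ?thesis
 proof (rule SI_I)
  show "jm (%s w. \<xi> w * indicator {u<..v} s * H s w)" by (intro jm_mult jx SI_jm[OF SI])
  show "AE w in M. continuous_on {0..} (%t. \<xi> w * (I (min t v) w - I (min t u) w))" using SI_cont[OF SI]
  proof eventually_elim
   case (elim w)
   have "continuous_on {0..} (%t. I (min t c) w)" if "0 <= c" for c
    by (rule continuous_on_compose2[OF elim]) (use that in \<open>auto intro!: continuous_intros\<close>)
   then show ?case using uv by (auto intro!: continuous_intros)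
  qed
  show "simple (%s w. \<xi> w * indicator {u<..v} s * G n s w) (%t w. \<xi> w * (E n (min t v) w - E n (min t u) w))" for n
   by (rule simple_restrict[OF uv \<xi> GE(1)])
  fix t :: real assume t: "0 <= t"
  show "vanishes (%n w. energy (%s w. \<xi> w * indicator {u<..v} s * G n s w - \<xi> w * indicator {u<..v} s * H s w) t w)"
  proof (rule vanishes_AE_le[OF vanishes_cmult[OF GE(2)[OF t], of "K^2"]], intro exI allI impI)
   fix n
   show "AE w in M. energy (%s w. \<xi> w * indicator {u<..v} s * G n s w - \<xi> w * indicator {u<..v} s * H s w) t w
     <= ennreal (K^2) * energy (%s w. G n s w - H s w) t w"
    using jm_sec[OF jm_diff[OF simple_jm[OF GE(1)[of n]] SI_jm[OF SI]]] AE_space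
   proof eventually_elim
    case (elim w)
    have "energy (%s w. \<xi> w * indicator {u<..v} s * G n s w - \<xi> w * indicator {u<..v} s * H s w) t w
      <= energy (%s w. K * (G n s w - H s w)) t w"
    proof (rule energy_le)
     fix s
     have "\<bar>\<xi> w * indicator {u<..v} s\<bar> <= \<bar>K\<bar>" using \<xi>(2)[OF elim(2)] by (auto simp: indicator_def)
     then have "\<bar>\<xi> w * indicator {u<..v} s\<bar> * \<bar>G n s w - H s w\<bar> <= \<bar>K\<bar> * \<bar>G n s w - H s w\<bar>" by (rule mult_right_mono) simp
     then show "\<bar>\<xi> w * indicator {u<..v} s * G n s w - \<xi> w * indicator {u<..v} s * H s w\<bar> <= \<bar>K * (G n s w - H s w)\<bar>"
      by (simp add: abs_mult[symmetric] right_diff_distrib)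
    qed
    then show ?case using energy_scale[OF elim(1)] by simp
   qed
  qed
  have mt: "0 <= min t v" "0 <= min t u" using t uv by auto
  show "vanishes (%n w. ennreal \<bar>\<xi> w * (E n (min t v) w - E n (min t u) w) - \<xi> w * (I (min t v) w - I (min t u) w)\<bar>)"
  proof (rule vanishes_le[OF vanishes_add[OF vanishes_cmult[OF GE(3)[OF mt(1)], of "\<bar>K\<bar>"] vanishes_cmult[OF GE(3)[OF mt(2)], of "\<bar>K\<bar>"]]])
   fix n w assume w: "w \<in> space M"
   let ?a = "E n (min t v) w - I (min t v) w" and ?b = "E n (min t u) w - I (min t u) w"
   have "\<bar>\<xi> w * (E n (min t v) w - E n (min t u) w) - \<xi> w * (I (min t v) w - I (min t u) w)\<bar> = \<bar>\<xi> w\<bar> * \<bar>?a - ?b\<bar>"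
    unfolding abs_mult[symmetric] by (simp add: algebra_simps)
   also have "\<dots> <= \<bar>K\<bar> * (\<bar>?a\<bar> + \<bar>?b\<bar>)" using \<xi>(2)[OF w] by (intro mult_mono abs_triangle_ineq4) auto
   finally have "ennreal \<bar>\<xi> w * (E n (min t v) w - E n (min t u) w) - \<xi> w * (I (min t v) w - I (min t u) w)\<bar> <= ennreal (\<bar>K\<bar> * \<bar>?a\<bar> + \<bar>K\<bar> * \<bar>?b\<bar>)"
    by (intro ennreal_leI) (simp add: distrib_left)
   then show "ennreal \<bar>\<xi> w * (E n (min t v) w - E n (min t u) w) - \<xi> w * (I (min t v) w - I (min t u) w)\<bar>
     <= ennreal \<bar>K\<bar> * ennreal \<bar>?a\<bar> + ennreal \<bar>K\<bar> * ennreal \<bar>?b\<bar>"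
    by (simp add: ennreal_plus ennreal_mult)
  qed
 qed
qed

lemma SI_restrict:
 assumes SI: "SI H I" and uv: "0 <= u" "u <= v" and \<xi>: "ae_measurable (F u) \<xi>"
 shows "SI (%s w. \<xi> w * indicator {u<..v} s * H s w) (%t w. \<xi> w * (I (min t v) w - I (min t u) w))"
proof -
 obtain \<zeta> where \<zeta>: "\<zeta> \<in> borel_measurable (F u)" "AE w in M. \<xi> w = \<zeta> w" using \<xi> unfolding ae_measurable_def by auto
 \<comment> \<open>Truncation at level \<open>n\<close> makes the factor bounded; for each path it
   agrees with the original factor from some \<open>n\<close> on, so energies and integrals converge
   trivially.\<close>
 define c where "c n x = max (- real n) (min (real n) x)" for n x
 have c[measurable]: "c n \<in> borel_measurable borel" for n unfolding c_def by measurable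
 have cev: "\<forall>\<^sub>F n in sequentially. c n x = x" for x
  using eventually_ge_at_top[of "nat \<lceil>\<bar>x\<bar>\<rceil>"]
 proof eventually_elim
  case (elim n)
  then have "\<bar>x\<bar> <= real n" by linarith
  then show ?case unfolding c_def by auto
 qed
 have "SI (%s w. \<zeta> w * indicator {u<..v} s * H s w) (%t w. \<zeta> w * (I (min t v) w - I (min t u) w))"
 proof (rule SI_AE_limit)
  show "SI (%s w. c n (\<zeta> w) * indicator {u<..v} s * H s w) (%t w. c n (\<zeta> w) * (I (min t v) w - I (min t u) w))" for n
   by (rule SI_restrict_bounded[OF SI uv, of _ "real n"]) (use \<zeta> in measurable, auto simp: c_def)
  show "jm (%s w. \<zeta> w * indicator {u<..v} s * H s w)"
   by (intro jm_mult jm_rv jm_time ae_measurableI SI_jm[OF SI] measurable_F[OF \<zeta>(1)]) simp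
  show "AE w in M. continuous_on {0..} (%t. \<zeta> w * (I (min t v) w - I (min t u) w))" using SI_cont[OF SI]
  proof eventually_elim
   case (elim w)
   have "continuous_on {0..} (%t. I (min t c) w)" if "0 <= c" for c
    by (rule continuous_on_compose2[OF elim]) (use that in \<open>auto intro!: continuous_intros\<close>)
   then show ?case using uv by (auto intro!: continuous_intros)
  qed
  have ev: "AE w in M. \<forall>\<^sub>F n in sequentially. c n (\<zeta> w) = \<zeta> w" using cev by simp
  fix t :: real
  show "AE w in M. (%n. energy (%s w. c n (\<zeta> w) * indicator {u<..v} s * H s w - \<zeta> w * indicator {u<..v} s * H s w) t w) ----> 0"
   using ev by (rule AE_mp) (auto intro!: AE_I2 tendsto_eventually elim!: eventually_mono simp: energy_0)
  show "AE w in M. (%n. c n (\<zeta> w) * (I (min t v) w - I (min t u) w)) ----> \<zeta> w * (I (min t v) w - I (min t u) w)"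
   using ev by (rule AE_mp) (auto intro!: AE_I2 tendsto_eventually elim!: eventually_mono)
 qed
 then show ?thesis
  by (rule SI_cong) (use \<zeta>(2) in \<open>eventually_elim, simp\<close>)+
qed

text \<open>A local martingale bounded below is a supermartingale. A simple approximant is cut when
  its energy gets too large, which leaves a mean-zero variable \<open>X\<close>. Even if the cut
  comes early, \<open>X\<close> is close to \<open>I\<close> at some time up to \<open>t\<close>, so
  \<open>C + X\<close> is almost nonnegative there; this is where the lower bound at all times
  enters.\<close>

lemma SI_supermartingale:
 assumes SI: "SI H I" and t: "0 < t" and C: "0 <= C" and nn: "AE w in M. \<forall>s\<in>{0..t}. 0 <= C + I s w"
 shows "(\<integral>\<^sup>+w. ennreal (C + I t w) \<partial>M) <= ennreal C"
proof -
 obtain J where J[measurable]: "J \<in> borel_measurable M" and IJ: "AE w in M. I t w = J w"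
  using ae_measurable_F[OF SI_ae_measurable[OF SI, of t]] t unfolding ae_measurable_def by auto
 obtain G E where GE: "!!m. simple (G m) (E m)" "!!t. t > 0 ==> vanishes (%m w. energy (%s w. G m s w - H s w) t w)"
    "!!t. t > 0 ==> vanishes (%m w. sup_norm (%s w. E m s w - I s w) t w)"
  using SI_simple_uniform[OF SI] by blast
 have fin: "AE w in M. energy H t w < \<infinity>" using SI_energy_finite[OF SI] by eventually_elim simp
 \<comment> \<open>Truncation at \<open>R\<close> makes a bad event cost at most \<open>R\<close>
   times its probability; \<open>R\<close> tends to infinity at the end, by monotone
   convergence.\<close>
 define f where "f R w = min R (max 0 (C + J w))" for R w
 have f[measurable]: "f R \<in> borel_measurable M" for R unfolding f_def by measurable
 have fb: "\<bar>f R w\<bar> <= R" if "0 <= R" for R w using that unfolding f_def by auto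
 have fi: "integrable M (f R)" if "0 <= R" for R
  by (rule integrable_const_bound[of _ R]) (use fb[OF that] in auto)
 have key: "(\<integral>w. f R w \<partial>M) <= C + e * (2 * R + 3)" if R: "0 <= R" and e: "0 < e" for R e
 proof -
  obtain K BG where K: "0 <= K" and BG: "BG \<in> events" "prob BG <= e" "\<forall>w\<in>space M - BG. energy H t w <= ennreal K"
   using AE_finite_bound[OF jm_energy[OF SI_jm[OF SI]] fin e] by blast
  \<comment> \<open>Outside the bad events the approximant has energy at most
    \<open>2 d + 2 K\<close>, and \<open>d <= e\<close> will hold, so the cut at \<open>K'\<close>
    is then not triggered.\<close>
  define K' where "K' = 2 * K + 2 * e + 1"
  have K': "0 < K'" using K e unfolding K'_def by simp
  \<comment> \<open>The second bound gives \<open>d * K' <= e^2\<close>, so that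
    \<open>d / a <= e\<close> for the weight \<open>a = e / K'\<close> introduced below.\<close>
  define d where "d = min e (e^2 / K')"
  have d: "0 < d" "d <= e" "d * K' <= e^2"
  proof -
   show "0 < d" "d <= e" using e K' unfolding d_def by auto
   have "d <= e^2 / K'" unfolding d_def by simp
   then show "d * K' <= e^2" using K' by (simp add: pos_le_divide_eq)
  qed
  have "vanishes (%m w. energy (%s w. G m s w - H s w) t w + sup_norm (%s w. E m s w - I s w) t w)"
   by (intro vanishes_add GE t)
  from vanishesD[OF this d(1)] obtain n B1 where B1: "B1 \<in> events" "prob B1 <= d"
   "!!w. w \<in> space M - B1 ==> energy (%s w. G n s w - H s w) t w + sup_norm (%s w. E n s w - I s w) t w <= ennreal d"
   by (meson order_refl)
  have "AE w in M. \<forall>t. energy (G n) t w <= 2 * energy (%s w. G n s w - H s w) t w + 2 * energy H t w"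
   using energy_add_AE[OF jm_diff[OF simple_jm[OF GE(1)[of n]] SI_jm[OF SI]] SI_jm[OF SI]] by simp
  with nn IJ have "AE w in M. (\<forall>s\<in>{0..t}. 0 <= C + I s w) \<and> I t w = J w \<and> (\<forall>t. energy (G n) t w <= 2 * energy (%s w. G n s w - H s w) t w + 2 * energy H t w)"
   by eventually_elim simp
  from AE_bad_set[OF this] obtain Z where Z: "Z \<in> events" "prob Z = 0"
   "!!w. w \<in> space M - Z ==> (\<forall>s\<in>{0..t}. 0 <= C + I s w) \<and> I t w = J w \<and>
     (\<forall>t. energy (G n) t w <= 2 * energy (%s w. G n s w - H s w) t w + 2 * energy H t w)" by blast
  obtain X where X: "has_bochner_integral M X 0" "integrable M (%w. (X w)^2)" "(\<integral>w. (X w)^2 \<partial>M) <= K'"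
   "\<forall>w\<in>space M. \<exists>s\<in>{0..t}. X w = E n s w \<and> (\<not> True \<or> energy (G n) t w > ennreal K' \<or> s = t) \<and> (\<forall>s'\<in>{}. s' < s --> True)"
   using simple_cut[OF GE(1)[of n] t, of "{}" K' "%_ _. True"] K' sets.top[of "F _"] by (auto simp: space_F)
  have B: "B1 \<union> Z \<in> events" "prob (B1 \<union> Z) <= d" using B1 Z prob_Un_le[OF B1(1) Z(1) B1(2), of 0] by auto
  \<comment> \<open>On the event where the approximation fails there is no lower bound for
    \<open>X\<close>. Adding \<open>a * X^2 + 1 / a\<close> makes it nonnegative; the mean of the
    first term is at most \<open>a * K' = e\<close>, and the second is paid only on an event of
    probability at most \<open>d\<close>.\<close>
  define a where "a = e / K'"
  have a: "0 < a" using e K' unfolding a_def by simp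
  let ?B = "B1 \<union> Z"
  \<comment> \<open>There are three kinds of paths: failed approximation, good approximation with
    large energy (the cut may be early, but \<open>C + d + X\<close> is nonnegative), and good
    approximation with the cut at \<open>t\<close>, where \<open>X\<close> is within
    \<open>d\<close> of \<open>I t\<close>.\<close>
  have bound: "f R w <= R * indicator (?B \<union> BG) w + (C + d) + X w + a * (X w)^2 + 1 / a * indicator ?B w" if w: "w \<in> space M" for w
  proof (cases "w \<in> ?B")
   case True
   have "f R w <= R" unfolding f_def by simp
   moreover have "0 <= X w + a * (X w)^2 + 1 / a"
   proof -
    have "X w + a * (X w)^2 + 1 / a = a * (X w + 1 / (2 * a))^2 + 3 / (4 * a)"
     using a by (simp add: power2_eq_square field_simps)
    also have "\<dots> >= 0" using a by (intro add_nonneg_nonneg) auto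
    finally show ?thesis .
   qed
   ultimately show ?thesis using True C d(1) by (simp add: indicator_def)
  next
   case False
   then have wZ: "w \<in> space M - Z" "w \<in> space M - B1" using w by auto
   from bspec[OF X(4) w] obtain s where s: "s \<in> {0..t}" "X w = E n s w" "energy (G n) t w > ennreal K' \<or> s = t" by blast
   have "sup_norm (%s w. E n s w - I s w) t w <= ennreal d" by (rule order_trans[OF _ B1(3)[OF wZ(2)]]) simp
   then have EI: "\<bar>E n s w - I s w\<bar> <= d" if "s \<in> {0..t}" for s using sup_norm_le_iff d(1) that by (meson less_imp_le)
   have CX: "0 <= C + d + X w" using EI[OF s(1)] Z(3)[OF wZ(1)] s(1,2) by (smt (verit, best))
   have a2: "0 <= a * (X w)^2" using a by simp
   show ?thesis
   proof (cases "w \<in> BG")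
    case True
    have "f R w <= R" unfolding f_def by simp
    then show ?thesis using CX a2 True False by (simp add: indicator_def)
   next
    case nBG: False
    have "energy (%s w. G n s w - H s w) t w <= ennreal d" by (rule order_trans[OF _ B1(3)[OF wZ(2)]]) simp
    moreover have "energy H t w <= ennreal K" using BG(3) nBG w by auto
    ultimately have "energy (G n) t w <= 2 * ennreal d + 2 * ennreal K" using Z(3)[OF wZ(1)]
     by (meson add_mono mult_left_mono order_trans zero_le)
    also have "\<dots> = ennreal (2 * d + 2 * K)" using K d by (simp add: ennreal_plus ennreal_mult)
    also have "\<dots> <= ennreal K'" using d unfolding K'_def by (intro ennreal_leI) simp
    finally have "s = t" using s(3) by auto
    then have "I t w <= X w + d" using EI[OF s(1)] s(2) by auto
    moreover have "I t w = J w" using Z(3)[OF wZ(1)] by blast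
    moreover have "0 <= C + I t w" using Z(3)[OF wZ(1), THEN conjunct1] t by simp
    ultimately have "I t w <= X w + d" "f R w <= C + I t w" unfolding f_def by simp_all
    then show ?thesis using a2 False nBG by (simp add: indicator_def)
   qed
  qed
  have iX: "integrable M X" "(\<integral>w. X w \<partial>M) = 0" using X(1) by (auto simp: has_bochner_integral_iff)
  have "(\<integral>w. f R w \<partial>M) <= (\<integral>w. R * indicator (?B \<union> BG) w + (C + d) + X w + a * (X w)^2 + 1 / a * indicator ?B w \<partial>M)"
   by (rule integral_mono) (use fi[OF R] iX X(2) bound B BG(1) in \<open>auto intro!: Bochner_Integration.integrable_add integrable_mult_right simp: emeasure_eq_measure\<close>)
  also have "\<dots> = R * prob (?B \<union> BG) + (C + d) + 0 + a * (\<integral>w. (X w)^2 \<partial>M) + 1 / a * prob ?B"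
  proof -
   have i1: "integrable M (%w. R * indicator (?B \<union> BG) w)" "integrable M (%w. 1 / a * indicator ?B w)"
    using B BG(1) by (auto intro!: integrable_mult_right simp: emeasure_eq_measure)
   have i2: "(\<integral>w. R * indicator (?B \<union> BG) w \<partial>M) = R * prob (?B \<union> BG)" "(\<integral>w. 1 / a * indicator ?B w \<partial>M) = 1 / a * prob ?B"
    using B(1) BG(1) by auto
   show ?thesis using i1 iX X(2)
    by (simp add: i2 prob_space sets.Int_space_eq2[OF B(1)] sets.Int_space_eq2[OF sets.Un[OF B(1) BG(1)]])
  qed
  also have "\<dots> <= R * (d + e) + (C + e) + 0 + a * K' + 1 / a * d"
  proof -
   have "prob (?B \<union> BG) <= d + e" by (rule prob_Un_le[OF B(1) BG(1) B(2) BG(2)])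
   then have "R * prob (?B \<union> BG) <= R * (d + e)" using R by (rule mult_left_mono)
   moreover have "a * (\<integral>w. (X w)^2 \<partial>M) <= a * K'" using X(3) a by (intro mult_left_mono) auto
   moreover have "1 / a * prob ?B <= 1 / a * d" using B(2) a by (intro mult_left_mono) auto
   ultimately show ?thesis using d by linarith
  qed
  also have "\<dots> <= R * (e + e) + (C + e) + e + e"
  proof -
   have "R * (d + e) <= R * (e + e)" using R d by (intro mult_left_mono) auto
   moreover have "a * K' = e" using K' unfolding a_def by simp
   moreover have "1 / a * d <= e"
   proof -
    have "1 / a * d = d * K' / e" unfolding a_def by simp
    also have "\<dots> <= e^2 / e" using d(3) e by (intro divide_right_mono) auto
    finally show ?thesis using e by (simp add: power2_eq_square)
   qed
   ultimately show ?thesis by linarith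
  qed
  also have "\<dots> = C + e * (2 * R + 3)" by (simp add: algebra_simps)
  finally show ?thesis .
 qed
 have fC: "(\<integral>w. f R w \<partial>M) <= C" if R: "0 <= R" for R
 proof (rule field_le_epsilon)
  fix e :: real assume e: "0 < e"
  have "(\<integral>w. f R w \<partial>M) <= C + e / (2 * R + 3) * (2 * R + 3)" by (rule key[OF R]) (use e R in auto)
  also have "\<dots> = C + e" using R by simp
  finally show "(\<integral>w. f R w \<partial>M) <= C + e" .
 qed
 have nf: "(\<integral>\<^sup>+w. ennreal (f R w) \<partial>M) <= ennreal C" if R: "0 <= R" for R
 proof -
  have "(\<integral>\<^sup>+w. ennreal (f R w) \<partial>M) = ennreal (\<integral>w. f R w \<partial>M)"
   by (rule nn_integral_eq_integral[OF fi[OF R]]) (use R in \<open>auto simp: f_def\<close>)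
  then show ?thesis using fC[OF R] by (simp add: ennreal_leI)
 qed
 have SUPf: "(SUP n. ennreal (f (real n) w)) = ennreal (C + J w)" for w
 proof (rule antisym)
  show "(SUP n. ennreal (f (real n) w)) <= ennreal (C + J w)"
  proof (rule SUP_least)
   fix n
   have "f (real n) w <= max 0 (C + J w)" unfolding f_def by (rule min.cobounded2)
   then have "ennreal (f (real n) w) <= ennreal (max 0 (C + J w))" by (rule ennreal_leI)
   also have "\<dots> = ennreal (C + J w)" by (cases "0 <= C + J w") (auto simp: ennreal_neg max_def)
   finally show "ennreal (f (real n) w) <= ennreal (C + J w)" .
  qed
  define n where "n = nat \<lceil>C + J w\<rceil>"
  have "C + J w <= real n" unfolding n_def by linarith
  then have "ennreal (C + J w) = ennreal (f (real n) w)"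
   unfolding f_def by (cases "0 <= C + J w") (simp_all add: ennreal_neg)
  then show "ennreal (C + J w) <= (SUP n. ennreal (f (real n) w))" by (intro SUP_upper2[of n]) auto
 qed
 have "(\<integral>\<^sup>+w. ennreal (C + I t w) \<partial>M) = (\<integral>\<^sup>+w. (SUP n. ennreal (f (real n) w)) \<partial>M)"
  unfolding SUPf by (rule nn_integral_cong_AE) (use IJ in \<open>eventually_elim, simp\<close>)
 also have "\<dots> = (SUP n. (\<integral>\<^sup>+w. ennreal (f (real n) w) \<partial>M))"
  by (rule nn_integral_monotone_convergence_SUP)
    (auto simp: incseq_def le_fun_def f_def intro!: ennreal_leI min.mono)
 also have "\<dots> <= ennreal C" by (rule SUP_least) (rule nf, simp)
 finally show ?thesis .
qed

end

section \<open>Step functions, refining grids and indefinite integrals\<close>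

lemma ennreal_tendsto_0I:
 fixes X :: "nat => ennreal"
 assumes "!!e. e > 0 ==> eventually (%n. X n <= ennreal e) sequentially"
 shows "X ----> 0"
proof (rule order_tendstoI)
 fix a :: ennreal assume "0 < a"
 then obtain b where b: "0 < b" "b < a" using dense by blast
 then obtain e where e: "0 < e" "ennreal e < a" by (cases b) (auto simp: top_unique)
 show "eventually (%n. X n < a) sequentially" using assms[OF e(1)] by eventually_elim (use e in auto)
qed auto

lemma ennreal_tendsto_0D:
 fixes X :: "nat => ennreal"
 assumes "X ----> 0" "e > 0"
 shows "eventually (%n. X n <= ennreal e) sequentially"
proof -
 have "eventually (%n. X n < ennreal e) sequentially" using assms by (intro order_tendstoD(2)) auto
 then show ?thesis by eventually_elim simp
qed

lemma step_sum:
 fixes p :: "nat => real" and c :: "nat => real"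
 assumes "!!i. i < k ==> p i <= p (Suc i)" "p 0 < s" "s <= p k"
 shows "\<exists>i<k. p i < s \<and> s <= p (Suc i) \<and> (\<Sum>j<k. c j * indicator {p j<..p (Suc j)} s) = c i"
 using assms
proof (induction k)
 case (Suc k)
 show ?case
 proof (cases "s <= p k")
  case True
  then obtain i where i: "i < k" "p i < s" "s <= p (Suc i)" "(\<Sum>j<k. c j * indicator {p j<..p (Suc j)} s) = c i"
   using Suc by auto
  then show ?thesis using True by (intro exI[of _ i]) auto
 next
  case False
  have mono: "p j <= p k" if "j <= k" for j using that
  proof (induction rule: inc_induct)
   case (step n)
   then show ?case using Suc.prems(1)[of n] by auto
  qed simp
  have "(\<Sum>j<k. c j * indicator {p j<..p (Suc j)} s) = 0"
  proof (rule sum.neutral, intro ballI)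
   fix j assume "j \<in> {..<k}"
   then have "p (Suc j) <= p k" using mono[of "Suc j"] by simp
   then show "c j * indicator {p j<..p (Suc j)} s = 0" using False by (simp add: indicator_def)
  qed
  then show ?thesis using False Suc by (intro exI[of _ k]) auto
 qed
qed simp

lemma step_sum_outside:
 fixes p :: "nat => real" and c :: "nat => real"
 assumes "s <= p 0" "!!i. i < k ==> p i <= p (Suc i)"
 shows "(\<Sum>j<k. c j * indicator {p j<..p (Suc j)} s) = 0"
proof (rule sum.neutral, intro ballI)
 have mono: "p 0 <= p j" if "j <= k" for j using that
 proof (induction j)
  case (Suc j)
  then show ?case using assms(2)[of j] by auto
 qed simp
 fix j assume "j \<in> {..<k}"
 then show "c j * indicator {p j<..p (Suc j)} s = 0" using mono[of j] assms(1) by (auto simp: indicator_def)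
qed

lemma refining_grid:
 fixes D :: "real set"
 assumes "finite D"
 shows "\<exists>(p :: nat => real) k. p 0 = 0 \<and> p k = real (Suc n) \<and> (\<forall>i<k. p i < p (Suc i)) \<and>
  (\<forall>i<k. D \<inter> {p i<..<p (Suc i)} = {}) \<and> (\<forall>i<k. p (Suc i) - p i <= 1 / real (Suc n)) \<and> (\<forall>i\<le>k. 0 <= p i)"
proof -
 let ?N = "Suc n"
 define Q where "Q = (D \<inter> {0..real ?N}) \<union> (%i. real i / real ?N) ` {..?N * ?N} \<union> {0, real ?N}"
 have "i <= ?N * ?N ==> real i / real ?N <= real ?N" for i
 proof -
  assume "i <= ?N * ?N"
  then have "real i <= real ?N * real ?N" by (metis of_nat_le_iff of_nat_mult)
  then show ?thesis by (simp add: divide_le_eq del: of_nat_Suc)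
 qed
 then have Q: "finite Q" "Q \<subseteq> {0..real ?N}" "0 \<in> Q" "real ?N \<in> Q" using assms unfolding Q_def by auto
 obtain p :: "nat => real" and k where p: "p 0 = 0" "p k = real ?N" "!!i. i < k ==> p i < p (Suc i)"
  "p ` {..k} = Q" "!!i. i < k ==> Q \<inter> {p i<..<p (Suc i)} = {}" "!!i j. i <= j ==> j <= k ==> p i <= p j"
  by (rule finite_grid[OF Q]) blast
 have p_range: "0 <= p i" "p i <= real ?N" if "i <= k" for i using p(6)[of 0 i] p(6)[of i k] p(1,2) that by auto
 have "p (Suc i) - p i <= 1 / real ?N" if i: "i < k" for i
 proof -
  define j where "j = nat \<lfloor>p i * real ?N\<rfloor>"
  have p0: "0 <= p i" using p_range[of i] i by simp
  have j1: "real j <= p i * real ?N" "p i * real ?N < real (Suc j)" unfolding j_def using p0 by (auto, linarith)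
  have "p i < real ?N" using p(3)[OF i] p_range[of "Suc i"] i by auto
  then have "p i * real ?N < real ?N * real ?N" by (intro mult_strict_right_mono) auto
  then have "real j < real (?N * ?N)" using j1 by (simp only: of_nat_mult)
  then have "Suc j <= ?N * ?N" by (simp only: of_nat_less_iff Suc_le_eq)
  then have "real (Suc j) / real ?N \<in> Q" unfolding Q_def by blast
  moreover have "p i < real (Suc j) / real ?N" using j1(2) by (simp add: pos_less_divide_eq del: of_nat_Suc)
  ultimately have "\<not> real (Suc j) / real ?N < p (Suc i)" using p(5)[OF i] unfolding disjoint_iff greaterThanLessThan_iff by blast
  then have "p (Suc i) <= real (Suc j) / real ?N" by simp
  also have "\<dots> <= p i + 1 / real ?N"
  proof -
   have "real (Suc j) <= p i * real ?N + 1" using j1(1) by simp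
   then have "real (Suc j) / real ?N <= (p i * real ?N + 1) / real ?N" by (intro divide_right_mono) auto
   then show ?thesis by (simp add: add_divide_distrib del: of_nat_Suc)
  qed
  finally show ?thesis by simp
 qed
 moreover have "D \<inter> {p i<..<p (Suc i)} = {}" if "i < k" for i
  using p(5)[OF that] p_range[of i] p_range[of "Suc i"] that unfolding Q_def by force
 ultimately show ?thesis using p p_range by blast
qed

lemma continuous_on_atLeast:
 fixes g :: "real => real"
 assumes "!!T. continuous_on {0..T} g" shows "continuous_on {0..} g"
 unfolding continuous_on_sequentially comp_def
proof (intro allI ballI impI, elim conjE)
 fix x a assume x: "\<forall>n::nat. x n \<in> {0..}" and xa: "x ----> a" and a: "a \<in> {0::real..}"
 have "bounded (range x)" using xa by (intro convergent_imp_bounded)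
 then obtain B where B: "!!n. \<bar>x n\<bar> <= B" by (auto simp: bounded_iff)
 show "(%n. g (x n)) ----> g a"
 proof (rule continuous_on_tendsto_compose[OF assms[of "max a B"] xa])
  show "a \<in> {0..max a B}" using a by simp
  show "eventually (%n. x n \<in> {0..max a B}) sequentially"
  proof (rule always_eventually, rule allI)
   fix n show "x n \<in> {0..max a B}" using B[of n] x by auto
  qed
 qed
qed

lemma indefinite_integral_continuous:
 fixes f :: "real => real"
 assumes "!!t. 0 <= t ==> set_integrable lborel {0..t} f"
 shows "continuous_on {0..} (%t. LBINT s:{0..t}. f s)"
proof (rule continuous_on_atLeast)
 fix T :: real
 show "continuous_on {0..T} (%t. LBINT s:{0..t}. f s)"
 proof (cases "0 <= T")
  case True
  have "f integrable_on {0..T}" using set_borel_integral_eq_integral(1)[OF assms[OF True]] .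
  then have "continuous_on {0..T} (%t. integral {0..t} f)" by (rule indefinite_integral_continuous_1)
  then show ?thesis
   by (rule continuous_on_eq) (use set_borel_integral_eq_integral(2)[OF assms] in auto)
 qed simp
qed

section \<open>Pathwise energies and the square of a stochastic integral\<close>

context bm_space
begin

lemma sec_measurable: "sec H w ==> (%s. indicator {0..t} s * H s w) \<in> borel_measurable lborel"
proof -
 assume "sec H w"
 then have "(%s. indicator {0..} s * H s w) \<in> borel_measurable lborel" unfolding sec_def by simp
 from borel_measurable_times[OF _ this, of "indicator {0..t}"]
 have "(%s. indicator {0..t} s * (indicator {0..} s * H s w)) \<in> borel_measurable lborel" by simp
 moreover have "(%s. indicator {0..t} s * (indicator {0..} s * H s w)) = (%s. indicator {0..t} s * H s w)"
  by (auto simp: indicator_def)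
 ultimately show ?thesis by simp
qed

lemma energy_alt: "energy H t w = (\<integral>\<^sup>+s. ennreal ((indicator {0..t} s * H s w)^2) \<partial>lborel)"
 unfolding energy_def by (rule nn_integral_cong) (auto simp: indicator_def)

lemma energy_finite_integral:
 assumes "sec H w" "energy H t w < \<infinity>"
 shows "set_integrable lborel {0..t} (%s. (H s w)^2)" "enn2real (energy H t w) = (LBINT s:{0..t}. (H s w)^2)"
proof -
 have eq: "(%s. (indicator {0..t} s * H s w)^2) = (%s. indicator {0..t} s *\<^sub>R (H s w)^2)" by (auto simp: indicator_def)
 have m: "(%s. (indicator {0..t} s * H s w)^2) \<in> borel_measurable lborel" using sec_measurable[OF assms(1), of t] by measurable
 have i: "integrable lborel (%s. (indicator {0..t} s * H s w)^2)"
  by (rule integrableI_nonneg[OF m]) (use assms(2) in \<open>auto simp: energy_alt\<close>)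
 show "set_integrable lborel {0..t} (%s. (H s w)^2)" using i unfolding eq set_integrable_def .
 have "energy H t w = ennreal (\<integral>s. (indicator {0..t} s * H s w)^2 \<partial>lborel)"
  unfolding energy_alt by (rule nn_integral_eq_integral[OF i]) simp
 then show "enn2real (energy H t w) = (LBINT s:{0..t}. (H s w)^2)" unfolding set_lebesgue_integral_def eq[symmetric] by simp
qed

lemma energy_continuous:
 assumes "sec H w" "!!t. energy H t w < \<infinity>" shows "continuous_on {0..} (%t. enn2real (energy H t w))"
 unfolding energy_finite_integral(2)[OF assms]
 by (rule indefinite_integral_continuous) (rule energy_finite_integral(1)[OF assms])

lemma energy_dominated:
 assumes "!!n. sec (D n) w" "sec G w" "!!n s. 0 <= s ==> s <= t ==> \<bar>D n s w\<bar> <= \<bar>G s w\<bar>" "energy G t w < \<infinity>"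
  "AE s in lborel. s \<in> {0..t} --> (%n. D n s w) ----> 0"
 shows "(%n. energy (D n) t w) ----> 0"
proof -
 have "(%n. \<integral>\<^sup>+s. ennreal ((indicator {0..t} s * D n s w)^2) \<partial>lborel) ----> (\<integral>\<^sup>+s. 0 \<partial>(lborel :: real measure))"
 proof (rule nn_integral_dominated_convergence[where w="%s. ennreal ((indicator {0..t} s * G s w)^2)"])
  show "(%s. ennreal ((indicator {0..t} s * D n s w)^2)) \<in> borel_measurable lborel" for n
   using sec_measurable[OF assms(1), of t n] by measurable
  show "(%s. ennreal ((indicator {0..t} s * G s w)^2)) \<in> borel_measurable lborel"
   using sec_measurable[OF assms(2), of t] by measurable
  show "AE s in lborel. ennreal ((indicator {0..t} s * D n s w)^2) <= ennreal ((indicator {0..t} s * G s w)^2)" for n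
   using assms(3)[of _ n] by (intro AE_I2 ennreal_leI) (auto simp: indicator_def abs_le_square_iff)
  show "(\<integral>\<^sup>+s. ennreal ((indicator {0..t} s * G s w)^2) \<partial>lborel) < \<infinity>" using assms(4) by (simp add: energy_alt)
  show "AE s in lborel. (%n. ennreal ((indicator {0..t} s * D n s w)^2)) ----> 0" using assms(5)
  proof eventually_elim
   case (elim s)
   show ?case
   proof (cases "s \<in> {0..t}")
    case True
    then have "(%n. (D n s w)^2) ----> 0^2" using elim by (intro tendsto_power) auto
    then have "(%n. ennreal ((D n s w)^2)) ----> ennreal 0" by (intro tendsto_ennrealI) simp
    then show ?thesis using True by simp
   qed simp
  qed
 qed simp
 then show ?thesis by (simp add: energy_alt)
qed

text \<open>Young's inequality \<open>2 h d <= x h^2 + d^2 / x\<close> absorbs the cross term. Since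
  energies live in \<open>ennreal\<close>, closeness is expressed by two additive bounds instead of
  a difference.\<close>

lemma energy_close:
 assumes s: "sec H w" "sec G w" and x: "0 < x"
 shows "energy H t w <= energy G t w + (ennreal x * energy H t w + ennreal (1 + 1 / x) * energy (%s w. G s w - H s w) t w)"
  and "energy G t w <= energy H t w + (ennreal x * energy H t w + ennreal (1 + 1 / x) * energy (%s w. G s w - H s w) t w)"
proof -
 have sd: "sec (%s w. G s w - H s w) w" by (rule sec_diff[OF s(2,1)])
 have le: "energy A t w <= energy B t w + (ennreal x * energy H t w + ennreal (1 + 1 / x) * energy (%s w. G s w - H s w) t w)"
  if AB: "!!s. (A s w)^2 <= (B s w)^2 + (x * (H s w)^2 + (1 + 1 / x) * (G s w - H s w)^2)" and B: "sec B w" for A B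
 proof -
  have "energy A t w <= (\<integral>\<^sup>+s. ennreal ((indicator {0..t} s * B s w)^2) + (ennreal x * ennreal ((indicator {0..t} s * H s w)^2) +
    ennreal (1 + 1 / x) * ennreal ((indicator {0..t} s * (G s w - H s w))^2)) \<partial>lborel)"
   unfolding energy_alt
  proof (rule nn_integral_mono)
   fix s
   have "ennreal ((indicator {0..t} s * A s w)^2) <= ennreal ((indicator {0..t} s * B s w)^2 + (x * (indicator {0..t} s * H s w)^2 + (1 + 1 / x) * (indicator {0..t} s * (G s w - H s w))^2))"
    using AB[of s] by (intro ennreal_leI) (auto simp: indicator_def)
   then show "ennreal ((indicator {0..t} s * A s w)^2) <= ennreal ((indicator {0..t} s * B s w)^2) + (ennreal x * ennreal ((indicator {0..t} s * H s w)^2) +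
     ennreal (1 + 1 / x) * ennreal ((indicator {0..t} s * (G s w - H s w))^2))"
    using x by (simp add: ennreal_plus ennreal_mult)
  qed
  then show ?thesis unfolding energy_alt using sec_measurable[OF B, of t] sec_measurable[OF s(1), of t] sec_measurable[OF sd, of t]
   by (simp add: nn_integral_add nn_integral_cmult)
 qed
 have am: "2 * (h * d) <= x * h^2 + 1 / x * d^2" for h d :: real
 proof -
  have "0 <= x * (h - d / x)^2" using x by simp
  also have "\<dots> = x * h^2 - 2 * (h * d) + 1 / x * d^2" using x by (simp add: power2_eq_square field_simps)
  finally show ?thesis by simp
 qed
 have "(H s w)^2 <= (G s w)^2 + (x * (H s w)^2 + (1 + 1 / x) * (G s w - H s w)^2)"
  "(G s w)^2 <= (H s w)^2 + (x * (H s w)^2 + (1 + 1 / x) * (G s w - H s w)^2)" for s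
  using am[of "H s w" "H s w - G s w"] am[of "H s w" "G s w - H s w"] zero_le_power2[of "G s w - H s w"]
  by (simp_all add: power2_eq_square algebra_simps)
 from le[of H G, OF this(1) s(2)] le[of G H, OF this(2) s(1)]
 show "energy H t w <= energy G t w + (ennreal x * energy H t w + ennreal (1 + 1 / x) * energy (%s w. G s w - H s w) t w)"
  "energy G t w <= energy H t w + (ennreal x * energy H t w + ennreal (1 + 1 / x) * energy (%s w. G s w - H s w) t w)" by auto
qed

lemma energy_tendsto:
 assumes s: "!!n. sec (G n) w" "sec H w" and fin: "energy H t w < \<infinity>"
  and lim: "(%n. energy (%s w. G n s w - H s w) t w) ----> 0"
 shows "(%n. enn2real (energy (G n) t w)) ----> enn2real (energy H t w)"
proof (rule tendstoI)
 fix e :: real assume e: "e > 0"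
 obtain a where a: "energy H t w = ennreal a" "0 <= a" using fin by (cases "energy H t w") auto
 \<comment> \<open>With distance at most \<open>x^2\<close> the total error in
   \<open>energy_close\<close> is \<open>x a + x^2 + x\<close>, which for \<open>x <= 1\<close> is
   at most \<open>x (a + 2)\<close>; the choice makes this at most \<open>e / 2\<close>.\<close>
 define x where "x = min 1 (e / (2 * (a + 2)))"
 have p: "0 < 2 * (a + 2)" using a by simp
 have "x <= e / (2 * (a + 2))" unfolding x_def by simp
 then have "x * (2 * (a + 2)) <= e" by (simp only: pos_le_divide_eq[OF p])
 moreover have "0 < x" "x <= 1" unfolding x_def using e p by auto
 ultimately have x: "0 < x" "x <= 1" "x * (a + 2) <= e / 2" by (simp_all add: algebra_simps)
 have x2: "x^2 <= x" "0 < x^2" using x by (simp_all add: power2_eq_square mult_left_le)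
 show "eventually (%n. dist (enn2real (energy (G n) t w)) (enn2real (energy H t w)) < e) sequentially"
  using ennreal_tendsto_0D[OF lim x2(2)]
 proof eventually_elim
  case (elim n)
  let ?d = "energy (%s w. G n s w - H s w) t w"
  have "ennreal x * energy H t w + ennreal (1 + 1 / x) * ?d <= ennreal x * ennreal a + ennreal (1 + 1 / x) * ennreal (x^2)"
   unfolding a(1) by (intro add_mono mult_left_mono elim) auto
  also have "\<dots> = ennreal (x * a + (1 + 1 / x) * x^2)" using x a by (simp add: ennreal_plus ennreal_mult)
  also have "x * a + (1 + 1 / x) * x^2 = x * a + (x^2 + x)" using x by (simp add: distrib_right power2_eq_square)
  also have "ennreal (x * a + (x^2 + x)) <= ennreal (e / 2)" using x2 x(3) by (intro ennreal_leI) (simp add: algebra_simps)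
  finally have R: "ennreal x * energy H t w + ennreal (1 + 1 / x) * ?d <= ennreal (e / 2)" .
  have le: "energy H t w <= energy (G n) t w + ennreal (e / 2)" "energy (G n) t w <= energy H t w + ennreal (e / 2)"
   using energy_close[OF s(2) s(1)[of n] x(1), of t] add_left_mono[OF R] by (meson order_trans)+
  then obtain g where g: "energy (G n) t w = ennreal g" "0 <= g"
   unfolding a(1) by (cases "energy (G n) t w") (auto simp: top_unique)
  have "a <= g + e / 2" "g <= a + e / 2"
   using le a g e by (simp_all add: ennreal_plus[symmetric] ennreal_le_iff del: ennreal_plus)
  then show ?case using a g e by (simp add: dist_real_def abs_le_iff)
 qed
qed

lemma SI_jm_I: "SI H I ==> jm I"
 by (rule jm_continuous) (auto intro: ae_measurable_F SI_ae_measurable SI_cont)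

lemma vanishes_L2:
 assumes X: "!!n. n >= N ==> X n \<in> borel_measurable M \<and> integrable M (%w. (X n w)^2) \<and> (\<integral>w. (X n w)^2 \<partial>M) <= c n"
  and c: "c ----> 0"
 shows "vanishes (%n w. ennreal \<bar>X n w\<bar>)"
 unfolding vanishes_def
proof (intro allI impI)
 fix e :: real assume e: "e > 0"
 have "eventually (%n. c n < e * e^2) sequentially" using c e by (intro order_tendstoD(2)) auto
 then obtain N' where N': "!!n. n >= N' ==> c n < e * e^2" by (auto simp: eventually_sequentially)
 show "\<exists>N. \<forall>n\<ge>N. \<exists>B\<in>events. prob B <= e \<and> (\<forall>w\<in>space M - B. ennreal \<bar>X n w\<bar> <= ennreal e)"
 proof (intro exI[of _ "max N N'"] allI impI)
  fix n assume n: "max N N' <= n"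
  have [measurable]: "X n \<in> borel_measurable M" using X n by auto
  let ?B = "{w\<in>space M. e^2 <= (X n w)^2}"
  have "prob ?B <= (\<integral>w. (X n w)^2 \<partial>M) / e^2"
   by (rule integral_Markov_inequality_measure[of M _ "{}"]) (use X n e in auto)
  also have "\<dots> <= e * e^2 / e^2" using X[of n] N'[of n] n by (intro divide_right_mono) auto
  finally have p: "prob ?B <= e" using e by simp
  show "\<exists>B\<in>events. prob B <= e \<and> (\<forall>w\<in>space M - B. ennreal \<bar>X n w\<bar> <= ennreal e)"
  proof (intro bexI[of _ ?B] conjI p ballI ennreal_leI)
   fix w assume "w \<in> space M - ?B"
   then have "(X n w)^2 < e^2" by auto
   then show "\<bar>X n w\<bar> <= e" using e abs_le_square_iff[of "X n w" e] by auto
  qed measurable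
 qed
qed

lemma SI_square_continuous:
 assumes SI: "SI H I" shows "AE w in M. continuous_on {0..} (%t. (I t w)^2 - enn2real (energy H t w))"
 using SI_cont[OF SI] SI_energy_finite[OF SI] jm_sec[OF SI_jm[OF SI]]
proof eventually_elim
 case (elim w)
 then show ?case by (intro continuous_intros energy_continuous) auto
qed

text \<open>The left-point Riemann sums of \<open>2 E dE\<close> along grids of mesh at most
  \<open>1 / (n + 1)\<close> that contain the jump times are integrals by
  \<open>SI_restrict\<close>. By \<open>simple_quadratic\<close> they converge in mean square to the
  square minus the bracket.\<close>

lemma SI_square_simple:
 assumes simple: "simple H E"
 shows "SI (%s w. 2 * E s w * H s w) (%t w. (E t w)^2 - enn2real (energy H t w))"
proof -
 note SI = SI_simple[OF simple]
 obtain D C where D: "finite D" "0 <= C" "\<forall>w\<in>space M. \<forall>s. \<bar>H s w\<bar> <= C" and quad: "\<forall>(p :: nat => real) k d t. p 0 = 0 --> (\<forall>i<k. p i < p (Suc i)) -->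
   (\<forall>i<k. D \<inter> {p i<..<p (Suc i)} = {}) --> (\<forall>i<k. p (Suc i) - p i <= d) --> 0 <= t --> t <= p k -->
   (let R = (%w. (E t w)^2 - enn2real (energy H t w)
      - (\<Sum>i<k. 2 * E (p i) w * (E (min t (p (Suc i))) w - E (min t (p i)) w)))
    in integrable M (%w. (R w)^2) \<and> R \<in> borel_measurable M \<and> (\<integral>w. (R w)^2 \<partial>M) <= 2 * C ^ 4 * d * t)"
  using simple_quadratic[OF simple] by blast
 define good where "good n z \<longleftrightarrow> (case z of (p, k) => p 0 = 0 \<and> p k = real (Suc n) \<and> (\<forall>i<k. p i < p (Suc i)) \<and>
  (\<forall>i<k. D \<inter> {p i<..<p (Suc i)} = {}) \<and> (\<forall>i<k. p (Suc i) - p i <= 1 / real (Suc n)) \<and> (\<forall>i\<le>k. 0 <= p i))"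
  for n and z :: "(nat => real) \<times> nat"
 have "\<forall>n. \<exists>z. good n z"
 proof
  fix n
  from refining_grid[OF D(1), of n] obtain p k where "good n (p, k)" unfolding good_def by auto
  then show "\<exists>z. good n z" by blast
 qed
 from choice[OF this] obtain z where z: "!!n. good n (z n)" by blast
 define p where "p n = fst (z n)" for n
 define k where "k n = snd (z n)" for n
 have g: "p n 0 = 0" "p n (k n) = real (Suc n)" "\<forall>i<k n. p n i < p n (Suc i)"
  "\<forall>i<k n. D \<inter> {p n i<..<p n (Suc i)} = {}" "\<forall>i<k n. p n (Suc i) - p n i <= 1 / real (Suc n)" "\<forall>i\<le>k n. 0 <= p n i" for n
  using z[of n] unfolding good_def p_def k_def by (auto simp: split_beta)
 have jE: "jm (%s w. 2 * E s w)" by (intro jm_mult jm_const SI_jm_I[OF SI])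
 show ?thesis
 proof (rule SI_complete)
  show SIn: "SI (%s w. \<Sum>i<k n. 2 * E (p n i) w * indicator {p n i<..p n (Suc i)} s * H s w)
    (%t w. \<Sum>i<k n. 2 * E (p n i) w * (E (min t (p n (Suc i))) w - E (min t (p n i)) w))" for n
  proof (rule SI_sum[OF _ SI_restrict[OF SI]])
   fix i assume i: "i \<in> {..<k n}"
   show "0 <= p n i" "p n i <= p n (Suc i)" using g(3,6)[of n] i by (auto intro: less_imp_le)
   have "E (p n i) \<in> borel_measurable (F (p n i))" using simple_adapted[OF simple] g(6)[of n] i by auto
   then show "ae_measurable (F (p n i)) (%w. 2 * E (p n i) w)" by (intro ae_measurableI) measurable
  qed simp
  show j: "jm (%s w. 2 * E s w * H s w)" by (intro jm_mult[OF jE] SI_jm[OF SI])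
  show "AE w in M. continuous_on {0..} (%t. (E t w)^2 - enn2real (energy H t w))" by (rule SI_square_continuous[OF SI])
  fix t :: real assume t: "0 <= t"
  show "vanishes (%n w. ennreal \<bar>(\<Sum>i<k n. 2 * E (p n i) w * (E (min t (p n (Suc i))) w - E (min t (p n i)) w)) -
    ((E t w)^2 - enn2real (energy H t w))\<bar>)"
  proof -
   define X where "X n w = (E t w)^2 - enn2real (energy H t w) - (\<Sum>i<k n. 2 * E (p n i) w * (E (min t (p n (Suc i))) w - E (min t (p n i)) w))" for n w
   have "vanishes (%n w. ennreal \<bar>X n w\<bar>)"
   proof (rule vanishes_L2[where N="nat \<lceil>t\<rceil>"])
    fix n assume "nat \<lceil>t\<rceil> <= n"
    then have "t <= p n (k n)" unfolding g(2) by linarith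
    from quad[rule_format, OF g(1) _ _ _ t this, of "1 / real (Suc n)"] g(3-5)[of n]
    show "X n \<in> borel_measurable M \<and> integrable M (%w. (X n w)^2) \<and> (\<integral>w. (X n w)^2 \<partial>M) <= 2 * C ^ 4 * (1 / real (Suc n)) * t"
     unfolding Let_def X_def by blast
   next
    have "(%n. 2 * C ^ 4 * (1 / real (Suc n)) * t) ----> 2 * C ^ 4 * 0 * t"
     by (intro tendsto_intros LIMSEQ_Suc[OF lim_1_over_n])
    then show "(%n. 2 * C ^ 4 * (1 / real (Suc n)) * t) ----> 0" by simp
   qed
   then show ?thesis unfolding X_def by (simp add: abs_minus_commute)
  qed
  show "vanishes (%n w. energy (%s w. (\<Sum>i<k n. 2 * E (p n i) w * indicator {p n i<..p n (Suc i)} s * H s w) - 2 * E s w * H s w) t w)"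
  proof (rule vanishes_AE)
   show "ae_measurable M (energy (%s w. (\<Sum>i<k n. 2 * E (p n i) w * indicator {p n i<..p n (Suc i)} s * H s w) - 2 * E s w * H s w) t)" for n
    by (intro jm_energy jm_diff j SI_jm[OF SIn])
   show "AE w in M. (%n. energy (%s w. (\<Sum>i<k n. 2 * E (p n i) w * indicator {p n i<..p n (Suc i)} s * H s w) - 2 * E s w * H s w) t w) ----> 0"
    using SI_cont[OF SI] AE_space
   proof eventually_elim
    case (elim w)
    show ?case
    proof (rule ennreal_tendsto_0I)
     fix e :: real assume e: "e > 0"
     \<comment> \<open>If \<open>E\<close> oscillates by less than \<open>d\<close> on cells, the
       integrands differ by at most \<open>2 d C\<close>, so the energy is at most
       \<open>(2 d C)^2 t = d * (d * (4 C^2 t))\<close>, which the choice of \<open>d\<close> keeps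
       below \<open>e\<close>.\<close>
     define d where "d = min 1 (e / (4 * C^2 * t + 1))"
     have pos: "0 < 4 * C^2 * t + 1" using t by (simp add: add_nonneg_pos)
     have d: "0 < d" "d <= 1" "d * (4 * C^2 * t + 1) <= e"
     proof -
      show "0 < d" "d <= 1" using e pos unfolding d_def by auto
      have "d <= e / (4 * C^2 * t + 1)" unfolding d_def by simp
      then show "d * (4 * C^2 * t + 1) <= e" using pos by (simp add: pos_le_divide_eq)
     qed
     have "uniformly_continuous_on {0..t} (%t. E t w)"
      by (rule compact_uniformly_continuous) (auto intro: continuous_on_subset[OF elim(1)])
     then obtain \<delta> where \<delta>: "\<delta> > 0" "!!x y. x \<in> {0..t} ==> y \<in> {0..t} ==> \<bar>x - y\<bar> < \<delta> ==> \<bar>E x w - E y w\<bar> < d"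
      using d(1) unfolding uniformly_continuous_on_def dist_real_def by metis
     obtain N where N: "1 / real (Suc N) < \<delta>" using nat_approx_posE[OF \<delta>(1)] by blast
     show "eventually (%n. energy (%s w. (\<Sum>i<k n. 2 * E (p n i) w * indicator {p n i<..p n (Suc i)} s * H s w) - 2 * E s w * H s w) t w <= ennreal e) sequentially"
      using eventually_ge_at_top[of "max N (nat \<lceil>t\<rceil>)"]
     proof eventually_elim
      case (elim n)
      have n: "t <= real (Suc n)" using elim by linarith
      have "1 / real (Suc n) <= 1 / real (Suc N)" using elim by (intro divide_left_mono) auto
      then have mesh: "1 / real (Suc n) < \<delta>" using N by simp
      have "energy (%s w. (\<Sum>i<k n. 2 * E (p n i) w * indicator {p n i<..p n (Suc i)} s * H s w) - 2 * E s w * H s w) t w <= ennreal ((2 * d * C)^2 * t)"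
      proof (rule energy_bounded[OF t])
       fix s assume s: "0 <= s" "s <= t"
       have Hb: "\<bar>H s w\<bar> <= C" using D(3) \<open>w \<in> space M\<close> by auto
       show "\<bar>(\<Sum>i<k n. 2 * E (p n i) w * indicator {p n i<..p n (Suc i)} s * H s w) - 2 * E s w * H s w\<bar> <= 2 * d * C"
       \<comment> \<open>Cells are open on the left, so the step function is 0 at time 0; this
         matches the limit because \<open>E\<close> starts at 0.\<close>
       proof (cases "s = 0")
        case True
        have "(\<Sum>i<k n. (2 * E (p n i) w * H s w) * indicator {p n i<..p n (Suc i)} s) = 0"
         by (rule step_sum_outside) (use True g(1,3)[of n] in \<open>auto intro: less_imp_le\<close>)
        then show ?thesis using True simple_0[OF simple] d(1) D(2) by (simp add: mult_ac)
       next
        case False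
        then obtain i where i: "i < k n" "p n i < s" "s <= p n (Suc i)"
          "(\<Sum>j<k n. (2 * E (p n j) w * H s w) * indicator {p n j<..p n (Suc j)} s) = 2 * E (p n i) w * H s w"
         using step_sum[of "k n" "p n" s "%j. 2 * E (p n j) w * H s w"] g(1,2,3)[of n] s n by (auto intro: less_imp_le)
        have "\<bar>p n i - s\<bar> < \<delta>" using i g(5)[of n] mesh by fastforce
        then have "\<bar>E (p n i) w - E s w\<bar> < d" using \<delta>(2) g(6)[of n] i s by auto
        then have "\<bar>E (p n i) w - E s w\<bar> * \<bar>H s w\<bar> <= d * C" using Hb d by (intro mult_mono) auto
        moreover have "(\<Sum>i<k n. 2 * E (p n i) w * indicator {p n i<..p n (Suc i)} s * H s w) - 2 * E s w * H s w = 2 * ((E (p n i) w - E s w) * H s w)"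
         using i(4) by (simp add: mult_ac right_diff_distrib)
        ultimately show ?thesis by (simp add: abs_mult)
       qed
      qed
      also have "(2 * d * C)^2 * t = d * (d * (4 * C^2 * t))" by (simp add: power2_eq_square)
      also have "ennreal (d * (d * (4 * C^2 * t))) <= ennreal e"
      proof (rule ennreal_leI)
       have "d * (4 * C^2 * t) <= 1 * (4 * C^2 * t)" using d t by (intro mult_right_mono) auto
       then have "d * (d * (4 * C^2 * t)) <= d * (4 * C^2 * t + 1)" using d by (intro mult_left_mono) auto
       then show "d * (d * (4 * C^2 * t)) <= e" using d(3) by linarith
      qed
      finally show ?case .
     qed
    qed
   qed
  qed
 qed
qed

text \<open>It identifies \<open>energy H\<close> as the bracket of \<open>I\<close>. Along one
  almost surely convergent subsequence the simple integrals converge uniformly and the simple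
  integrands in energy, so integrand, square and bracket all pass to the limit.\<close>

lemma SI_square:
 assumes SI: "SI H I"
 shows "SI (%s w. 2 * I s w * H s w) (%t w. (I t w)^2 - enn2real (energy H t w))"
proof -
 obtain G E where GE: "!!m. simple (G m) (E m)" "!!t. t > 0 ==> vanishes (%m w. energy (%s w. G m s w - H s w) t w)"
    "!!t. t > 0 ==> vanishes (%m w. sup_norm (%s w. E m s w - I s w) t w)"
  using SI_simple_uniform[OF SI] by blast
 define X where "X m n w = energy (%s w. G n s w - H s w) (real (Suc m)) w + sup_norm (%s w. E n s w - I s w) (real (Suc m)) w" for m n w
 have "vanishes (X m)" for m unfolding X_def by (intro vanishes_add GE) auto
 from vanishes_AE_subseq[of X, OF this] obtain r where r: "AE w in M. \<forall>m. (%k. X m (r k) w) ----> 0" by blast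
 have sec: "AE w in M. \<forall>n. sec (G n) w \<and> sec (E n) w"
  using jm_sec[OF simple_jm[OF GE(1)]] jm_sec[OF SI_jm_I[OF SI_simple[OF GE(1)]]] by (simp add: AE_all_countable)
 have lim: "AE w in M. (%n. energy (%s w. 2 * E (r n) s w * G (r n) s w - 2 * I s w * H s w) t w) ----> 0 \<and>
   (%n. (E (r n) t w)^2 - enn2real (energy (G (r n)) t w)) ----> (I t w)^2 - enn2real (energy H t w)" if t: "0 <= t" for t
  using r SI_cont[OF SI] SI_energy_finite[OF SI] jm_sec[OF SI_jm[OF SI]] jm_sec[OF SI_jm_I[OF SI]] sec
 proof (eventually_elim, intro conjI)
  fix w assume r: "\<forall>m. (%k. X m (r k) w) ----> 0" and cont: "continuous_on {0..} (%t. I t w)"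
   and fin: "\<forall>t. energy H t w < \<infinity>" and sec: "sec H w" "sec I w" "\<forall>n. sec (G n) w \<and> sec (E n) w"
  define m where "m = nat \<lceil>t\<rceil>"
  have tm: "t <= real (Suc m)" unfolding m_def by linarith
  have Xm: "(%k. X m (r k) w) ----> 0" using r by blast
  have e0: "(%n. energy (%s w. G (r n) s w - H s w) t w) ----> 0"
   by (rule ennreal_squeeze_0[OF Xm]) (unfold X_def, intro add_increasing2 energy_mono tm zero_le)
  have s0: "(%n. sup_norm (%s w. E (r n) s w - I s w) (real (Suc m)) w) ----> 0"
   by (rule ennreal_squeeze_0[OF Xm]) (simp add: X_def)
  have s1: "(%n. sup_norm (%s w. E (r n) s w - I s w) t w) ----> 0"
   by (rule ennreal_squeeze_0[OF s0]) (use tm in \<open>auto simp: sup_norm_def intro!: SUP_subset_mono\<close>)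
  have "(%n. energy (%s w. E (r n) s w * G (r n) s w - I s w * H s w) t w) ----> 0"
   by (rule energy_mult_tendsto) (use sec fin sup_norm_finite[of I, OF cont] e0 s1 in auto)
  then have "(%n. ennreal (2^2) * energy (%s w. E (r n) s w * G (r n) s w - I s w * H s w) t w) ----> ennreal (2^2) * 0"
   by (intro tendsto_mult_ennreal tendsto_const) auto
  moreover have "energy (%s w. 2 * E (r n) s w * G (r n) s w - 2 * I s w * H s w) t w =
    ennreal (2^2) * energy (%s w. E (r n) s w * G (r n) s w - I s w * H s w) t w" for n
   by (subst energy_scale[symmetric]) (use sec in \<open>auto intro!: sec_diff sec_mult energy_cong simp: algebra_simps\<close>)
  ultimately show "(%n. energy (%s w. 2 * E (r n) s w * G (r n) s w - 2 * I s w * H s w) t w) ----> 0" by simp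
  have "(%n. enn2real (energy (G (r n)) t w)) ----> enn2real (energy H t w)"
   by (rule energy_tendsto[OF _ _ _ e0]) (use sec fin in auto)
  moreover have "(%n. E (r n) t w) ----> I t w" using sup_norm_tendsto_0D[OF s0 t tm] by (rule LIM_zero_cancel)
  ultimately show "(%n. (E (r n) t w)^2 - enn2real (energy (G (r n)) t w)) ----> (I t w)^2 - enn2real (energy H t w)"
   by (intro tendsto_diff tendsto_power)
 qed
 show ?thesis
 proof (rule SI_AE_limit[where H="%n s w. 2 * E (r n) s w * G (r n) s w" and I="%n t w. (E (r n) t w)^2 - enn2real (energy (G (r n)) t w)"])
  show "jm (%s w. 2 * I s w * H s w)" by (intro jm_mult jm_const SI_jm_I[OF SI] SI_jm[OF SI])
  show "AE w in M. continuous_on {0..} (%t. (I t w)^2 - enn2real (energy H t w))" by (rule SI_square_continuous[OF SI])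
 qed (use lim SI_square_simple[OF GE(1)] in simp_all)
qed

end

section \<open>Riemann sums and the smooth Ito formula\<close>

definition dy :: "nat => nat => real" where "dy n i = real i / 2 ^ n"

text \<open>Level \<open>n\<close> uses the \<open>n * 2 ^ n\<close> dyadic cells of
  \<open>[0, n]\<close>, so mesh and horizon improve together; taking \<open>min\<close> with
  \<open>t\<close> makes the cells beyond \<open>t\<close> contribute 0.\<close>

definition rs :: "(real => real) => (real => real) => nat => real => real" where
 "rs \<phi> X n t = (\<Sum>i<n * 2 ^ n. \<phi> (dy n i) * (X (min t (dy n (Suc i))) - X (min t (dy n i))))"

definition rsq :: "(real => real) => (real => real) => nat => real => real" where
 "rsq \<phi> X n t = (\<Sum>i<n * 2 ^ n. \<phi> (dy n i) * (X (min t (dy n (Suc i))) - X (min t (dy n i)))^2)"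

definition stp :: "(real => real) => nat => real => real" where
 "stp \<phi> n s = (\<Sum>i<n * 2 ^ n. \<phi> (dy n i) * indicator {dy n i<..dy n (Suc i)} s)"

lemma dy_0 [simp]: "dy n 0 = 0" unfolding dy_def by simp
lemma dy_nonneg [simp]: "0 <= dy n i" unfolding dy_def by simp
lemma dy_Suc: "dy n (Suc i) = dy n i + 1 / 2 ^ n" unfolding dy_def by (simp add: add_divide_distrib)
lemma dy_less [simp]: "dy n i < dy n (Suc i)" unfolding dy_Suc by simp
lemma dy_le [simp]: "dy n i <= dy n (Suc i)" by (simp add: dy_Suc)
lemma dy_last: "dy n (n * 2 ^ n) = real n" unfolding dy_def by simp

lemma dyadic_mesh: "0 < (\<delta> :: real) ==> eventually (%n. 1 / 2 ^ n < \<delta>) sequentially"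
proof -
 assume "0 < \<delta>"
 have "(%n. (1 / 2 :: real) ^ n) ----> 0" by (rule LIMSEQ_power_zero) simp
 then have "eventually (%n. (1 / 2) ^ n < \<delta>) sequentially" using \<open>0 < \<delta>\<close> by (rule order_tendstoD(2))
 then show ?thesis by (simp add: power_divide)
qed

lemma eventually_ge_real: "eventually (%n. (t :: real) <= real n) sequentially"
 using eventually_ge_at_top[of "nat \<lceil>t\<rceil>"] by eventually_elim linarith

lemma stp_eq:
 assumes "0 < s" "s <= real n"
 obtains i where "i < n * 2 ^ n" "dy n i < s" "s <= dy n (Suc i)" "!!\<phi>. stp \<phi> n s = \<phi> (dy n i)"
proof -
 obtain i where i: "i < n * 2 ^ n" "dy n i < s" "s <= dy n (Suc i)"
  using step_sum[of "n * 2 ^ n" "dy n" s "%_. 0"] assms by (auto simp: dy_last)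
 have "stp \<phi> n s = \<phi> (dy n i)" for \<phi>
 proof -
  obtain j where j: "j < n * 2 ^ n" "dy n j < s" "s <= dy n (Suc j)" "stp \<phi> n s = \<phi> (dy n j)"
   using step_sum[of "n * 2 ^ n" "dy n" s "%i. \<phi> (dy n i)"] assms unfolding stp_def by (auto simp: dy_last)
  have "dy n i < dy n (Suc j)" "dy n j < dy n (Suc i)" using i j by linarith+
  then have "i < Suc j" "j < Suc i" unfolding dy_def by (simp_all add: divide_less_cancel)
  then have "i = j" by simp
  then show ?thesis using j by simp
 qed
 with i show ?thesis by (rule that)
qed

lemma stp_nonpos: "s <= 0 ==> stp \<phi> n s = 0"
 unfolding stp_def by (rule step_sum_outside) auto

lemma stp_large: "real n < s ==> stp \<phi> n s = 0"
 unfolding stp_def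
proof (rule sum.neutral, intro ballI)
 fix i assume "real n < s" "i \<in> {..<n * 2 ^ n}"
 then have "real (Suc i) <= real (n * 2 ^ n)" by (intro of_nat_mono) simp
 then have "dy n (Suc i) <= dy n (n * 2 ^ n)" unfolding dy_def by (intro divide_right_mono) auto
 then show "\<phi> (dy n i) * indicator {dy n i<..dy n (Suc i)} s = 0" using \<open>real n < s\<close> by (simp add: dy_last indicator_def)
qed

lemma stp_bound:
 assumes "!!s. 0 <= s ==> s <= t ==> \<bar>\<phi> s\<bar> <= C" "0 <= C" "s <= t"
 shows "\<bar>stp \<phi> n s\<bar> <= C"
proof (cases "0 < s \<and> s <= real n")
 case True
 then obtain i where i: "dy n i < s" "stp \<phi> n s = \<phi> (dy n i)" by (metis stp_eq)
 show ?thesis unfolding i(2) by (rule assms(1)) (use i assms(3) in auto)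
next
 case False
 then show ?thesis using stp_nonpos[of s] stp_large[of n s] assms(2) by (cases "0 < s") auto
qed

text \<open>Cells are open on the left, so their left ends approach \<open>s\<close> from strictly
  below and left-continuity is enough. This matters for the indicator that a local time has not
  exceeded a level.\<close>

lemma stp_tendsto:
 assumes s: "0 < s" and cont: "continuous (at_left s) \<phi>"
 shows "(%n. stp \<phi> n s) ----> \<phi> s"
proof -
 define P where "P n i \<longleftrightarrow> dy n i < s \<and> s <= dy n (Suc i) \<and> stp \<phi> n s = \<phi> (dy n i)" for n i
 define l where "l n = (SOME i. P n i)" for n
 have l0: "P n (l n)" if "s <= real n" for n
 proof -
  have "\<exists>i. P n i" by (rule stp_eq[OF s that]) (auto simp: P_def)
  then show ?thesis unfolding l_def by (rule someI_ex)
 qed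
 note l = l0[unfolded P_def, THEN conjunct1] l0[unfolded P_def, THEN conjunct2, THEN conjunct1] l0[unfolded P_def, THEN conjunct2, THEN conjunct2]
 have "(%n. dy n (l n)) ----> s"
 proof (rule tendsto_sandwich[of "%n. s - (1/2)^n" _ _ "%_. s"])
  show "\<forall>\<^sub>F n in sequentially. s - (1 / 2) ^ n <= dy n (l n)" using eventually_ge_real[of s]
  proof eventually_elim
   case (elim n)
   have "s <= dy n (Suc (l n))" by (rule l(2)[OF elim])
   then show ?case unfolding dy_Suc power_divide power_one by linarith
  qed
  show "\<forall>\<^sub>F n in sequentially. dy n (l n) <= s" using eventually_ge_real[of s]
   by eventually_elim (rule less_imp_le[OF l(1)])
  have "(%n. s - (1/2::real)^n) ----> s - 0" by (intro tendsto_intros LIMSEQ_power_zero) simp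
  then show "(%n. s - (1/2::real)^n) ----> s" by simp
 qed simp
 moreover have "\<forall>\<^sub>F n in sequentially. dy n (l n) \<in> {..<s} \<and> dy n (l n) \<noteq> s" using eventually_ge_real[of s]

 proof eventually_elim
  case (elim n)
  show ?case using l(1)[OF elim] by simp
 qed
 ultimately have "filterlim (%n. dy n (l n)) (at_left s) sequentially"
  by (simp add: filterlim_at)
 then have "(%n. \<phi> (dy n (l n))) ----> \<phi> s"
  using cont unfolding continuous_within by (rule filterlim_compose[rotated])
 moreover have "\<forall>\<^sub>F n in sequentially. \<phi> (dy n (l n)) = stp \<phi> n s" using eventually_ge_real[of s]
  by eventually_elim (rule l(3)[symmetric])
 ultimately show ?thesis by (rule Lim_transform_eventually)
qed

lemma continuous_on_at_left: "continuous_on {0..} \<phi> ==> 0 < (s::real) ==> continuous (at_left s) \<phi>"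
proof -
 assume a: "continuous_on {0..} \<phi>" "0 < s"
 have "continuous_on {0<..} \<phi>" by (rule continuous_on_subset[OF a(1)]) auto
 then have "isCont \<phi> s" using a(2) by (simp add: continuous_on_eq_continuous_at)
 then show ?thesis by (rule continuous_at_imp_continuous_at_within)
qed

lemma dyadic_telescope:
 assumes "0 <= t" "t <= real n"
 shows "(\<Sum>i<n * 2 ^ n. h (min t (dy n (Suc i))) - h (min t (dy n i)) :: real) = h t - h 0"
 using sum_lessThan_telescope[of "%i. h (min t (dy n i))" "n * 2 ^ n"] assms by (simp add: dy_last)

lemma stp_measurable [measurable]: "stp \<phi> n \<in> borel_measurable borel"
 unfolding stp_def by measurable

lemma set_integral_split:
 fixes u :: "real => real"
 assumes "set_integrable lborel {0..q} u" "0 <= p" "p <= q"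
 shows "(LBINT s:{0..q}. u s) = (LBINT s:{0..p}. u s) + (LBINT s:{p<..q}. u s)" "set_integrable lborel {p<..q} u"
proof -
 show ic: "set_integrable lborel {p<..q} u" by (rule set_integrable_subset[OF assms(1)]) (use assms in auto)
 have ip: "set_integrable lborel {0..p} u" by (rule set_integrable_subset[OF assms(1)]) (use assms in auto)
 have sp: "{0..q} = {0..p} \<union> {p<..q}" using assms by auto
 show "(LBINT s:{0..q}. u s) = (LBINT s:{0..p}. u s) + (LBINT s:{p<..q}. u s)"
  unfolding sp by (rule set_integral_Un) (use ic ip in auto)
qed

lemma rs_integral:
 fixes u :: "real => real"
 assumes u: "!!t. 0 <= t ==> set_integrable lborel {0..t} u" and t: "0 <= t"
 shows "rs \<phi> (%t. LBINT s:{0..t}. u s) n t = (LBINT s:{0..t}. stp \<phi> n s * u s)"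
  and "set_integrable lborel {0..t} (%s. stp \<phi> n s * u s)"
proof -
 have cell: "set_integrable lborel {0..t} (%s. \<phi> (dy n i) * indicator {dy n i<..dy n (Suc i)} s * u s) \<and>
  (LBINT s:{0..t}. \<phi> (dy n i) * indicator {dy n i<..dy n (Suc i)} s * u s) =
   \<phi> (dy n i) * ((LBINT s:{0..min t (dy n (Suc i))}. u s) - (LBINT s:{0..min t (dy n i)}. u s))" for i
 proof -
  define l where "l = min t (dy n i)"
  define r where "r = min t (dy n (Suc i))"
  have lr: "0 <= l" "l <= r" "0 <= r" unfolding l_def r_def using t dy_le[of n i] dy_nonneg[of n i] by linarith+
  note ir = u[OF lr(3)]
  note 1 = set_integral_split(1)[OF ir lr(1,2)]
  note ic = set_integral_split(2)[OF ir lr(1,2)]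
  have e: "indicator {0..t} s * (\<phi> (dy n i) * indicator {dy n i<..dy n (Suc i)} s * u s) = \<phi> (dy n i) * (indicator {l<..r} s * u s)" for s
  proof (cases "dy n i < s")
   case True
   then have "0 <= s" using dy_nonneg[of n i] by linarith
   then show ?thesis by (auto simp: indicator_def l_def r_def)
  qed (auto simp: indicator_def l_def r_def)
  show ?thesis unfolding l_def[symmetric] r_def[symmetric] 1 using ic unfolding set_integrable_def set_lebesgue_integral_def by (simp add: e)
 qed
 have eq: "stp \<phi> n s * u s = (\<Sum>i<n * 2 ^ n. \<phi> (dy n i) * indicator {dy n i<..dy n (Suc i)} s * u s)" for s
  unfolding stp_def by (rule sum_distrib_right)
 show "set_integrable lborel {0..t} (%s. stp \<phi> n s * u s)"
  unfolding set_integrable_def eq scaleR_sum_right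
  by (rule Bochner_Integration.integrable_sum) (use cell in \<open>auto simp: set_integrable_def\<close>)
 show "rs \<phi> (%t. LBINT s:{0..t}. u s) n t = (LBINT s:{0..t}. stp \<phi> n s * u s)"
 proof -
  have "(LBINT s:{0..t}. stp \<phi> n s * u s) = (\<Sum>i<n * 2 ^ n. LBINT s:{0..t}. \<phi> (dy n i) * indicator {dy n i<..dy n (Suc i)} s * u s)"
   unfolding set_lebesgue_integral_def eq scaleR_sum_right
   by (rule Bochner_Integration.integral_sum) (use cell in \<open>auto simp: set_integrable_def\<close>)
  then show ?thesis unfolding rs_def using cell by simp
 qed
qed

lemma rs_integral_tendsto:
 fixes u :: "real => real"
 assumes u: "!!t. 0 <= t ==> set_integrable lborel {0..t} u" and t: "0 <= t"
  and \<phi>m: "(%s. indicator {0..t} s * \<phi> s * u s) \<in> borel_measurable borel"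
  and C: "!!s. 0 <= s ==> s <= t ==> \<bar>\<phi> s\<bar> <= C"
  and lim: "AE s in lborel. 0 < s \<and> s <= t \<and> u s \<noteq> 0 --> (%n. stp \<phi> n s) ----> \<phi> s"
 shows "(%n. rs \<phi> (%t. LBINT s:{0..t}. u s) n t) ----> (LBINT s:{0..t}. \<phi> s * u s)"
proof -
 have C0: "0 <= C" using C[of 0] t by auto
 have um: "(%s. indicator {0..t} s * u s) \<in> borel_measurable borel" using u[OF t] unfolding set_integrable_def by auto
 have "(%n. LBINT s:{0..t}. stp \<phi> n s * u s) ----> (LBINT s:{0..t}. \<phi> s * u s)"
  unfolding set_lebesgue_integral_def real_scaleR_def
 proof (rule integral_dominated_convergence[where w="%s. C * \<bar>indicator {0..t} s * u s\<bar>"])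
  show "(%s. indicator {0..t} s * (\<phi> s * u s)) \<in> borel_measurable lborel" using \<phi>m by (simp add: mult.assoc)
  show "(%s. indicator {0..t} s * (stp \<phi> n s * u s)) \<in> borel_measurable lborel" for n
  proof -
   have "(%s. stp \<phi> n s * (indicator {0..t} s * u s)) \<in> borel_measurable lborel" using um by measurable
   then show ?thesis by (simp add: mult.left_commute)
  qed
  show "integrable lborel (%s. C * \<bar>indicator {0..t} s * u s\<bar>)"
   using u[OF t] unfolding set_integrable_def by (intro integrable_mult_right integrable_abs) simp
  show "AE s in lborel. (%n. indicator {0..t} s * (stp \<phi> n s * u s)) ----> indicator {0..t} s * (\<phi> s * u s)"
   using lim AE_lborel_singleton[of 0]
  proof eventually_elim
   case (elim s)
   show ?case
   proof (cases "0 < s \<and> s <= t \<and> u s \<noteq> 0")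
    case True
    then show ?thesis using elim by (auto intro!: tendsto_intros)
   next
    case False
    then show ?thesis using elim(2) by (auto simp: indicator_def)
   qed
  qed
  show "AE s in lborel. norm (indicator {0..t} s * (stp \<phi> n s * u s)) <= C * \<bar>indicator {0..t} s * u s\<bar>" for n
  proof (rule AE_I2)
   fix s
   have "\<bar>stp \<phi> n s\<bar> * \<bar>u s\<bar> <= C * \<bar>u s\<bar>" if "s <= t" using stp_bound[OF C C0 that] by (intro mult_right_mono) auto
   then show "norm (indicator {0..t} s * (stp \<phi> n s * u s)) <= C * \<bar>indicator {0..t} s * u s\<bar>"
    by (auto simp: indicator_def abs_mult)
  qed
 qed
 then show ?thesis using rs_integral(1)[OF u t] by simp
qed

lemma rs_integral_tendsto_continuous:
 fixes u :: "real => real"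
 assumes u: "!!t. 0 <= t ==> set_integrable lborel {0..t} u" and t: "0 <= t" and \<phi>: "continuous_on {0..} \<phi>"
 shows "(%n. rs \<phi> (%t. LBINT s:{0..t}. u s) n t) ----> (LBINT s:{0..t}. \<phi> s * u s)"
proof -
 obtain C where C: "!!s. s \<in> {0..t} ==> \<bar>\<phi> s\<bar> <= C" by (rule continuous_path_bounded[OF \<phi>]) blast
 show ?thesis
 proof (rule rs_integral_tendsto[OF u t])
  have "(%s. indicator {0..} s *\<^sub>R \<phi> s) \<in> borel_measurable borel"
   by (rule borel_measurable_continuous_on_indicator[OF _ \<phi>]) simp
  moreover have "(%s. indicator {0..t} s * u s) \<in> borel_measurable borel" using u[OF t] unfolding set_integrable_def by auto
  ultimately have "(%s. (indicator {0..} s *\<^sub>R \<phi> s) * (indicator {0..t} s * u s)) \<in> borel_measurable borel" by (rule borel_measurable_times)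
  moreover have "(%s. (indicator {0..} s *\<^sub>R \<phi> s) * (indicator {0..t} s * u s)) = (%s. indicator {0..t} s * \<phi> s * u s)"
   by (auto simp: indicator_def)
  ultimately show "(%s. indicator {0..t} s * \<phi> s * u s) \<in> borel_measurable borel" by simp
  show "AE s in lborel. 0 < s \<and> s <= t \<and> u s \<noteq> 0 --> (%n. stp \<phi> n s) ----> \<phi> s"
   using stp_tendsto continuous_on_at_left[OF \<phi>] by auto
 qed (use C in auto)
qed

lemma dyadic_oscillation:
 fixes X :: "real => real"
 assumes X: "continuous_on {0..} X" and t: "0 <= t" and e: "0 < e"
 shows "eventually (%n. \<forall>i. \<bar>X (min t (dy n (Suc i))) - X (min t (dy n i))\<bar> < e) sequentially"
proof -
 have "uniformly_continuous_on {0..t} X"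
  by (rule compact_uniformly_continuous) (auto intro: continuous_on_subset[OF X])
 then obtain \<delta> where \<delta>: "\<delta> > 0" "!!x y. x \<in> {0..t} ==> y \<in> {0..t} ==> \<bar>x - y\<bar> < \<delta> ==> \<bar>X x - X y\<bar> < e"
  using e unfolding uniformly_continuous_on_def dist_real_def by metis
 show ?thesis using dyadic_mesh[OF \<delta>(1)]
 proof eventually_elim
  case (elim n)
  show ?case
  proof
   fix i
   show "\<bar>X (min t (dy n (Suc i))) - X (min t (dy n i))\<bar> < e"
   proof (rule \<delta>(2))
    show "\<bar>min t (dy n (Suc i)) - min t (dy n i)\<bar> < \<delta>"
    proof -
     have "(0::real) < 1 / 2 ^ n" by simp
     then show ?thesis using elim \<delta>(1) unfolding dy_Suc by linarith
    qed
   qed (use t in auto)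
  qed
 qed
qed

lemma variation_le_integral:
 fixes u :: "real => real"
 assumes u: "!!t. 0 <= t ==> set_integrable lborel {0..t} u" and t: "0 <= t"
 shows "(\<Sum>i<n * 2 ^ n. \<bar>(LBINT s:{0..min t (dy n (Suc i))}. u s) - (LBINT s:{0..min t (dy n i)}. u s)\<bar>) <= (LBINT s:{0..t}. \<bar>u s\<bar>)"
proof -
 have ua: "set_integrable lborel {0..t} (%s. \<bar>u s\<bar>)" if "0 <= t" for t using u[OF that] by (rule set_integrable_abs)
 have step: "\<bar>(LBINT s:{0..q}. u s) - (LBINT s:{0..p}. u s)\<bar> <= (LBINT s:{0..q}. \<bar>u s\<bar>) - (LBINT s:{0..p}. \<bar>u s\<bar>)" if pq: "0 <= p" "p <= q" for p q
 proof -
  have q: "0 <= q" using pq by simp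
  note 1 = set_integral_split(1)[OF u[OF q] pq]
  note 2 = set_integral_split(1)[OF ua[OF q] pq]
  note ic = set_integral_split(2)[OF u[OF q] pq]
  have "\<bar>LBINT s:{p<..q}. u s\<bar> <= (LBINT s:{p<..q}. \<bar>u s\<bar>)"
   using set_integral_norm_bound[OF ic] by simp
  then show ?thesis unfolding 1 2 by simp
 qed
 have "(\<Sum>i<n * 2 ^ n. \<bar>(LBINT s:{0..min t (dy n (Suc i))}. u s) - (LBINT s:{0..min t (dy n i)}. u s)\<bar>)
   <= (\<Sum>i<n * 2 ^ n. (LBINT s:{0..min t (dy n (Suc i))}. \<bar>u s\<bar>) - (LBINT s:{0..min t (dy n i)}. \<bar>u s\<bar>))"
 proof (rule sum_mono, rule step)
  show "min t (dy n i) <= min t (dy n (Suc i))" for i by (rule min.mono) auto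
 qed (use t in auto)
 also have "\<dots> = (LBINT s:{0..min t (real n)}. \<bar>u s\<bar>) - (LBINT s:{0..0}. \<bar>u s\<bar>)"
  using sum_lessThan_telescope[of "%i. LBINT s:{0..min t (dy n i)}. \<bar>u s\<bar>" "n * 2 ^ n"] t by (simp add: dy_last)
 also have "\<dots> <= (LBINT s:{0..t}. \<bar>u s\<bar>)"
 proof -
  have "0 <= (LBINT s:{0..0}. \<bar>u s\<bar>)" unfolding set_lebesgue_integral_def by (rule integral_nonneg_AE) auto
  moreover have "(LBINT s:{0..min t (real n)}. \<bar>u s\<bar>) <= (LBINT s:{0..t}. \<bar>u s\<bar>)"
   using step[of "min t (real n)" t] t by (smt (verit, best) min.cobounded1 of_nat_0_le_iff min_def)
  ultimately show ?thesis by simp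
 qed
 finally show ?thesis .
qed

lemma LIMSEQ_I_helper:
 fixes X :: "nat => real"
 assumes "!!e. e > 0 ==> eventually (%n. \<bar>X n\<bar> <= e) sequentially"
 shows "X ----> 0"
proof (rule tendstoI)
 fix e :: real assume "e > 0"
 then have "e / 2 > 0" by simp
 from assms[OF this] show "eventually (%n. dist (X n) 0 < e) sequentially"
  by eventually_elim (use \<open>e > 0\<close> in auto)
qed

lemma set_integral_point:
 fixes u :: "real => real"
 shows "(LBINT s:{a}. u s) = 0"
 unfolding set_lebesgue_integral_def
proof (rule integral_eq_zero_AE)
 show "AE s in lborel. indicator {a} s *\<^sub>R u s = 0"
  using AE_lborel_singleton[of a] by eventually_elim (auto simp: indicator_def)
qed

lemma Taylor2:
 fixes f f1 g :: "real => real"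
 assumes f: "!!x. (f has_real_derivative f1 x) (at x)" and f1: "!!x. (f1 has_real_derivative g x) (at x)"
 obtains \<xi> where "\<bar>\<xi> - x\<bar> <= \<bar>y - x\<bar>" "min x y <= \<xi>" "\<xi> <= max x y" "f y = f x + f1 x * (y - x) + 1/2 * g \<xi> * (y - x)^2"
proof (cases "x = y")
 case True
 then show ?thesis by (intro that[of x]) auto
next
 case False
 define diff where "diff m = (if m = 0 then f else if m = 1 then f1 else g)" for m :: nat
 have "\<exists>t. (if y < x then y < t \<and> t < x else x < t \<and> t < y) \<and>
   f y = (\<Sum>m<2. diff m x / fact m * (y - x) ^ m) + diff 2 t / fact 2 * (y - x) ^ 2"
  by (rule Taylor[where a="min x y" and b="max x y"]) (use f f1 False in \<open>auto simp: diff_def\<close>)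
 then obtain t where t: "if y < x then y < t \<and> t < x else x < t \<and> t < y"
   "f y = (\<Sum>m<2. diff m x / fact m * (y - x) ^ m) + diff 2 t / fact 2 * (y - x) ^ 2" by blast
 show ?thesis
  by (rule that[of t]) (use t in \<open>auto simp: diff_def numeral_2_eq_2 split: if_splits\<close>)
qed

text \<open>The absolutely continuous part \<open>B\<close> does not contribute:
  \<open>(dX)^2 - (dI)^2 = dB (dB + 2 dI)\<close>, where the second factor is at most
  \<open>3 d\<close> once the oscillations are below \<open>d\<close>, and the sum of
  \<open>\<bar>dB\<bar>\<close> is at most the total variation \<open>V\<close>.\<close>

lemma rsq_perturb:
 fixes I u :: "real => real"
 assumes u: "!!t. 0 <= t ==> set_integrable lborel {0..t} u" and I: "continuous_on {0..} I" and t: "0 <= t"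
  and X: "!!t. 0 <= t ==> X t = x0 + (LBINT s:{0..t}. u s) + I t"
  and C: "!!s. 0 <= s ==> s <= t ==> \<bar>\<phi> s\<bar> <= C"
 shows "(%n. rsq \<phi> X n t - rsq \<phi> I n t) ----> 0"
proof -
 define B where "B t = (LBINT s:{0..t}. u s)" for t
 have B: "continuous_on {0..} B" unfolding B_def by (rule indefinite_integral_continuous[OF u])
 define V where "V = (LBINT s:{0..t}. \<bar>u s\<bar>)"
 have V0: "0 <= V" unfolding V_def set_lebesgue_integral_def by (rule integral_nonneg_AE) auto
 have C0: "0 <= C" using C[of 0] t by auto
 show ?thesis
 proof (rule LIMSEQ_I_helper)
  fix e :: real assume e: "e > 0"
  define d where "d = e / (3 * C * V + 1)"
  have pos: "0 < 3 * C * V + 1" using C0 V0 by (simp add: add_nonneg_pos)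
  have d: "0 < d" "d * (3 * C * V + 1) = e" using e pos unfolding d_def by auto
  show "eventually (%n. \<bar>rsq \<phi> X n t - rsq \<phi> I n t\<bar> <= e) sequentially"
   using dyadic_oscillation[OF B t d(1)] dyadic_oscillation[OF I t d(1)]
  proof eventually_elim
   case (elim n)
   let ?dB = "%i. B (min t (dy n (Suc i))) - B (min t (dy n i))"
   let ?dI = "%i. I (min t (dy n (Suc i))) - I (min t (dy n i))"
   let ?dX = "%i. X (min t (dy n (Suc i))) - X (min t (dy n i))"
   have dX: "?dX i = ?dB i + ?dI i" for i using t by (simp add: X B_def)
   have "\<bar>rsq \<phi> X n t - rsq \<phi> I n t\<bar> = \<bar>\<Sum>i<n * 2 ^ n. \<phi> (dy n i) * ((?dX i)^2 - (?dI i)^2)\<bar>"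
    unfolding rsq_def by (simp add: sum_subtractf right_diff_distrib)
   also have "\<dots> <= (\<Sum>i<n * 2 ^ n. \<bar>\<phi> (dy n i) * ((?dX i)^2 - (?dI i)^2)\<bar>)" by (rule sum_abs)
   also have "\<dots> <= (\<Sum>i<n * 2 ^ n. 3 * C * d * \<bar>?dB i\<bar>)"
   proof (rule sum_mono)
    fix i
    show "\<bar>\<phi> (dy n i) * ((?dX i)^2 - (?dI i)^2)\<bar> <= 3 * C * d * \<bar>?dB i\<bar>"
    proof (cases "dy n i <= t")
     case True
     have "(?dX i)^2 - (?dI i)^2 = ?dB i * (?dB i + 2 * ?dI i)" unfolding dX by (simp add: power2_eq_square algebra_simps)
     then have "\<bar>\<phi> (dy n i) * ((?dX i)^2 - (?dI i)^2)\<bar> = \<bar>\<phi> (dy n i)\<bar> * (\<bar>?dB i\<bar> * \<bar>?dB i + 2 * ?dI i\<bar>)"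
      by (simp add: abs_mult)
     also have "\<dots> <= C * (\<bar>?dB i\<bar> * (3 * d))"
     proof (intro mult_mono C)
      have "\<bar>?dB i\<bar> < d" "\<bar>?dI i\<bar> < d" using elim by auto
      moreover have "\<bar>x + 2 * y\<bar> <= 3 * d" if "\<bar>x\<bar> < d" "\<bar>y\<bar> < d" for x y using that by linarith
      ultimately show "\<bar>?dB i + 2 * ?dI i\<bar> <= 3 * d" by blast
     qed (use True C0 d in auto)
     finally show ?thesis by (simp add: mult_ac)
    next
     case False
     then have "min t (dy n i) = t" "min t (dy n (Suc i)) = t" using dy_less[of n i] by linarith+
     then show ?thesis by simp
    qed
   qed
   also have "\<dots> = 3 * C * d * (\<Sum>i<n * 2 ^ n. \<bar>?dB i\<bar>)" by (simp add: sum_distrib_left)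
   also have "\<dots> <= 3 * C * d * V"
    unfolding V_def B_def using variation_le_integral[OF u t] C0 d by (intro mult_left_mono) auto
   also have "\<dots> <= e" using d by (simp add: algebra_simps)
   finally show ?case .
  qed
 qed
qed

text \<open>Ito's formula for a single path: once the quadratic sums of \<open>I\<close> behave like
  the bracket along a subsequence, which is the only probabilistic input, Taylor's formula
  determines the limit of the Riemann sums against \<open>I\<close>.\<close>

lemma riemann_ito_path:
 fixes I u w X f f1 g :: "real => real"
 assumes u: "!!t. 0 <= t ==> set_integrable lborel {0..t} u" and w: "!!t. 0 <= t ==> set_integrable lborel {0..t} w"
  and I: "continuous_on {0..} I" "I 0 = 0" and t: "0 <= t"
  and X: "!!t. 0 <= t ==> X t = x0 + (LBINT s:{0..t}. u s) + I t"
  and range: "!!t. 0 <= t ==> X t \<in> {\<alpha>..\<beta>}"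
  and f: "!!x. (f has_real_derivative f1 x) (at x)" and f1: "!!x. (f1 has_real_derivative g x) (at x)"
  and g: "continuous_on UNIV g" and r: "strict_mono r"
  and q1: "(%n. rsq (%_. 1) I (r n) t - rs (%_. 1) (%t. LBINT s:{0..t}. w s) (r n) t) ----> 0"
  and qg: "(%n. rsq (%s. g (X s)) I (r n) t - rs (%s. g (X s)) (%t. LBINT s:{0..t}. w s) (r n) t) ----> 0"
 shows "(%n. rs (%s. f1 (X s)) I (r n) t) ---->
   f (X t) - f x0 - (LBINT s:{0..t}. f1 (X s) * u s) - 1/2 * (LBINT s:{0..t}. g (X s) * w s)"
proof -
 define B where "B t = (LBINT s:{0..t}. u s)" for t
 have Bc: "continuous_on {0..} B" unfolding B_def by (rule indefinite_integral_continuous[OF u])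
 have Xc: "continuous_on {0..} X"
  by (rule continuous_on_eq[of _ "%t. x0 + B t + I t"]) (use X Bc I in \<open>auto simp: B_def intro!: continuous_intros\<close>)
 have X0: "X 0 = x0"
 proof -
  show ?thesis using X[of 0] I(2) by (simp add: set_integral_point)
 qed
 have f1c: "continuous_on UNIV f1" using f1 by (intro DERIV_continuous_on) auto
 have gX: "continuous_on {0..} (%s. g (X s))" by (rule continuous_on_compose2[OF g Xc]) auto
 have f1X: "continuous_on {0..} (%s. f1 (X s))" by (rule continuous_on_compose2[OF f1c Xc]) auto
 have rf: "filterlim r sequentially sequentially" by (rule filterlim_subseq[OF r])
 have A1: "(%n. rs (%_. 1) (%t. LBINT s:{0..t}. w s) (r n) t) ----> (LBINT s:{0..t}. w s)"
  using filterlim_compose[OF rs_integral_tendsto_continuous[OF w t, of "%_. 1"] rf] by simp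
 have Ag: "(%n. rs (%s. g (X s)) (%t. LBINT s:{0..t}. w s) (r n) t) ----> (LBINT s:{0..t}. g (X s) * w s)"
  using filterlim_compose[OF rs_integral_tendsto_continuous[OF w t gX] rf] .
 have Bf: "(%n. rs (%s. f1 (X s)) B (r n) t) ----> (LBINT s:{0..t}. f1 (X s) * u s)"
  unfolding B_def using filterlim_compose[OF rs_integral_tendsto_continuous[OF u t f1X] rf] .
 obtain Cg where Cg: "!!s. 0 <= s ==> s <= t ==> \<bar>g (X s)\<bar> <= Cg" by (rule continuous_path_bounded[OF gX]) auto
 have P1: "(%n. rsq (%_. 1) X (r n) t - rsq (%_. 1) I (r n) t) ----> 0"
  using filterlim_compose[OF rsq_perturb[OF u I(1) t X, of "%_. 1" 1] rf] by simp
 have Pg: "(%n. rsq (%s. g (X s)) X (r n) t - rsq (%s. g (X s)) I (r n) t) ----> 0"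
  using filterlim_compose[OF rsq_perturb[OF u I(1) t X Cg] rf] .
 have R1: "(%n. rsq (%_. 1) X (r n) t) ----> (LBINT s:{0..t}. w s)"
  using tendsto_add[OF tendsto_add[OF P1 q1] A1] by simp
 have Rg: "(%n. rsq (%s. g (X s)) X (r n) t) ----> (LBINT s:{0..t}. g (X s) * w s)"
  using tendsto_add[OF tendsto_add[OF Pg qg] Ag] by simp
 \<comment> \<open>The total second-order Taylor error. It is at most the oscillation of
   \<open>g\<close> over small steps times the quadratic sum \<open>rsq\<close>, which stays bounded
   because it converges.\<close>
 define E where "E n = f (X t) - f x0 - rs (%s. f1 (X s)) X n t - 1/2 * rsq (%s. g (X s)) X n t" for n
 have Eb: "eventually (%n. \<bar>E n\<bar> <= e * rsq (%_. 1) X n t) sequentially" if e: "e > 0" for e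
 proof -
  have "uniformly_continuous_on {\<alpha>..\<beta>} g"
   by (rule compact_uniformly_continuous) (auto intro: continuous_on_subset[OF g])
  then obtain \<delta> where \<delta>: "\<delta> > 0" "!!x y. x \<in> {\<alpha>..\<beta>} ==> y \<in> {\<alpha>..\<beta>} ==> \<bar>x - y\<bar> < \<delta> ==> \<bar>g x - g y\<bar> < e"
   using e unfolding uniformly_continuous_on_def dist_real_def by metis
  show ?thesis using dyadic_oscillation[OF Xc t \<delta>(1)] eventually_ge_real[of t]
  proof eventually_elim
   case (elim n)
   let ?x = "%i. X (min t (dy n i))" and ?y = "%i. X (min t (dy n (Suc i)))"
   have "f (X t) - f x0 = (\<Sum>i<n * 2 ^ n. f (?y i) - f (?x i))"
    using dyadic_telescope[OF t elim(2), of "%t. f (X t)"] X0 by simp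
   then have "E n = (\<Sum>i<n * 2 ^ n. (f (?y i) - f (?x i)) - f1 (X (dy n i)) * (?y i - ?x i) - 1/2 * (g (X (dy n i)) * (?y i - ?x i)^2))"
    unfolding E_def rs_def rsq_def by (simp add: sum_subtractf sum_divide_distrib)
   then have "\<bar>E n\<bar> <= (\<Sum>i<n * 2 ^ n. \<bar>(f (?y i) - f (?x i)) - f1 (X (dy n i)) * (?y i - ?x i) - 1/2 * (g (X (dy n i)) * (?y i - ?x i)^2)\<bar>)"
    by (simp only: sum_abs)
   also have "\<dots> <= (\<Sum>i<n * 2 ^ n. e * (1 * (?y i - ?x i)^2))"
   proof (rule sum_mono)
    fix i
    show "\<bar>(f (?y i) - f (?x i)) - f1 (X (dy n i)) * (?y i - ?x i) - 1/2 * (g (X (dy n i)) * (?y i - ?x i)^2)\<bar> <= e * (1 * (?y i - ?x i)^2)"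
    proof (cases "dy n i <= t")
     case True
     then have m: "min t (dy n i) = dy n i" by simp
     obtain \<xi> where \<xi>: "\<bar>\<xi> - ?x i\<bar> <= \<bar>?y i - ?x i\<bar>" "min (?x i) (?y i) <= \<xi>" "\<xi> <= max (?x i) (?y i)"
       "f (?y i) = f (?x i) + f1 (?x i) * (?y i - ?x i) + 1/2 * g \<xi> * (?y i - ?x i)^2"
      by (rule Taylor2[OF f f1])
     have xr: "?x i \<in> {\<alpha>..\<beta>}" "?y i \<in> {\<alpha>..\<beta>}" by (rule range, use t in simp)+
     then have "\<xi> \<in> {\<alpha>..\<beta>}" using \<xi>(2,3) by (auto simp: min_def max_def split: if_splits)
     moreover have "\<bar>\<xi> - ?x i\<bar> < \<delta>" using \<xi>(1) elim(1) by (meson order_le_less_trans)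
     ultimately have "\<bar>g \<xi> - g (?x i)\<bar> <= 2 * e" using \<delta>(2)[of \<xi> "?x i"] xr e by fastforce
     then have "\<bar>g \<xi> - g (?x i)\<bar> * (?y i - ?x i)^2 <= 2 * e * (?y i - ?x i)^2" by (rule mult_right_mono) simp
     moreover have eq: "(f (?y i) - f (?x i)) - f1 (X (dy n i)) * (?y i - ?x i) - 1/2 * (g (X (dy n i)) * (?y i - ?x i)^2)
       = 1/2 * ((g \<xi> - g (?x i)) * (?y i - ?x i)^2)" unfolding \<xi>(4) m by (simp add: algebra_simps)
     ultimately show ?thesis unfolding eq abs_mult by simp
    next
     case False
     then have "min t (dy n i) = t" "min t (dy n (Suc i)) = t" using dy_less[of n i] by linarith+
     then show ?thesis by simp
    qed
   qed
   also have "\<dots> = e * rsq (%_. 1) X n t" unfolding rsq_def by (simp add: sum_distrib_left)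
   finally show ?case .
  qed
 qed
 define A where "A = (LBINT s:{0..t}. w s)"
 have E0: "(%n. E (r n)) ----> 0"
 proof (rule LIMSEQ_I_helper)
  fix e :: real assume e: "e > 0"
  define d where "d = e / (\<bar>A\<bar> + 1)"
  have d: "0 < d" "d * (\<bar>A\<bar> + 1) = e" using e unfolding d_def by auto
  have "eventually (%n. rsq (%_. 1) X (r n) t < \<bar>A\<bar> + 1) sequentially"
   using R1 unfolding A_def[symmetric] by (rule order_tendstoD(2)) simp
  moreover have "eventually (%n. \<bar>E (r n)\<bar> <= d * rsq (%_. 1) X (r n) t) sequentially"
   using Eb[OF d(1)] rf by (rule eventually_compose_filterlim)
  ultimately show "eventually (%n. \<bar>E (r n)\<bar> <= e) sequentially"
  proof eventually_elim
   case (elim n)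
   have "d * rsq (%_. 1) X (r n) t <= d * (\<bar>A\<bar> + 1)" using elim d by (intro mult_left_mono) auto
   then show ?case using elim d by simp
  qed
 qed
 have split: "rs (%s. f1 (X s)) X n t = rs (%s. f1 (X s)) B n t + rs (%s. f1 (X s)) I n t" for n
  unfolding rs_def sum.distrib[symmetric] by (rule sum.cong) (use t in \<open>auto simp: X B_def algebra_simps\<close>)
 have "rs (%s. f1 (X s)) I n t = f (X t) - f x0 - rs (%s. f1 (X s)) B n t - 1/2 * rsq (%s. g (X s)) X n t - E n" for n
  unfolding E_def split by simp
 moreover have "(%n. f (X t) - f x0 - rs (%s. f1 (X s)) B (r n) t - 1/2 * rsq (%s. g (X s)) X (r n) t - E (r n)) ---->
   f (X t) - f x0 - (LBINT s:{0..t}. f1 (X s) * u s) - 1/2 * (LBINT s:{0..t}. g (X s) * w s) - 0"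
  by (intro tendsto_intros Bf Rg E0)
 ultimately show ?thesis by simp
qed

section \<open>Riemann sums against stochastic integrals, and Ito's formula for C^2
  functions\<close>

context bm_space
begin

lemma SI_riemann:
 assumes SI: "SI a I" and \<phi>: "!!s. 0 <= s ==> ae_measurable (F s) (\<phi> s)"
 shows "SI (%s w. stp (%r. \<phi> r w) n s * a s w) (%t w. rs (%r. \<phi> r w) (%r. I r w) n t)"
proof -
 have "SI (%s w. \<Sum>i<n * 2 ^ n. \<phi> (dy n i) w * indicator {dy n i<..dy n (Suc i)} s * a s w)
   (%t w. \<Sum>i<n * 2 ^ n. \<phi> (dy n i) w * (I (min t (dy n (Suc i))) w - I (min t (dy n i)) w))"
  by (rule SI_sum[OF _ SI_restrict[OF SI]]) (auto intro: \<phi>)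
 then show ?thesis unfolding stp_def rs_def by (simp only: sum_distrib_right)
qed

lemma riemann_energy:
 assumes SI: "SI a I" and jm: "jm \<phi>" and \<phi>: "!!s. 0 <= s ==> ae_measurable (F s) (\<phi> s)"
  and lim: "AE w in M. \<forall>t\<ge>0. (\<exists>C. \<forall>s\<in>{0..t}. \<bar>\<phi> s w\<bar> <= C) \<and>
    (AE s in lborel. 0 < s \<and> s <= t \<and> a s w \<noteq> 0 --> (%n. stp (%r. \<phi> r w) n s) ----> \<phi> s w)"
  and t: "0 <= t"
 shows "AE w in M. (%n. energy (%s w. stp (%r. \<phi> r w) n s * a s w - \<phi> s w * a s w) t w) ----> 0"
 using lim SI_energy_finite[OF SI] jm_sec[OF SI_jm[OF SI]] jm_sec[OF jm]
proof eventually_elim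
 case (elim w)
 then obtain C where C: "\<forall>s\<in>{0..t}. \<bar>\<phi> s w\<bar> <= C" using t by blast
 have L: "AE s in lborel. 0 < s \<and> s <= t \<and> a s w \<noteq> 0 --> (%n. stp (%r. \<phi> r w) n s) ----> \<phi> s w" using elim(1) t by blast
 have C0: "0 <= C" using C t by (meson abs_ge_zero atLeastAtMost_iff order_refl order_trans)
 have s2: "sec (%s w. (2 * C) * a s w) w" by (rule sec_scale[OF elim(3)])
 show ?case
 proof (rule energy_dominated[where G="%s w. (2 * C) * a s w", OF _ s2])
  show "sec (%s w. stp (%r. \<phi> r w) n s * a s w - \<phi> s w * a s w) w" for n
   by (intro sec_diff sec_mult sec_borel elim stp_measurable)
  show "energy (%s w. (2 * C) * a s w) t w < \<infinity>"
   using energy_scale[OF elim(3), of "2 * C" t] elim(2) by (simp add: ennreal_mult_less_top)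
  fix n s assume s: "0 <= s" "s <= t"
  have "\<bar>stp (%r. \<phi> r w) n s\<bar> <= C" by (rule stp_bound[OF _ C0 s(2)]) (use C in auto)
  moreover have "\<bar>\<phi> s w\<bar> <= C" using C s by auto
  ultimately have "\<bar>stp (%r. \<phi> r w) n s - \<phi> s w\<bar> <= \<bar>2 * C\<bar>" by linarith
  then have "\<bar>stp (%r. \<phi> r w) n s - \<phi> s w\<bar> * \<bar>a s w\<bar> <= \<bar>2 * C\<bar> * \<bar>a s w\<bar>" by (rule mult_right_mono) simp
  then show "\<bar>stp (%r. \<phi> r w) n s * a s w - \<phi> s w * a s w\<bar> <= \<bar>2 * C * a s w\<bar>"
   unfolding abs_mult[symmetric] by (simp add: left_diff_distrib)
 next
  show "AE s in lborel. s \<in> {0..t} --> (%n. stp (%r. \<phi> r w) n s * a s w - \<phi> s w * a s w) ----> 0"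
   using L AE_lborel_singleton[of "0::real"]
  proof eventually_elim
   case (elim s)
   show ?case
   proof (intro impI)
    assume s: "s \<in> {0..t}"
    show "(%n. stp (%r. \<phi> r w) n s * a s w - \<phi> s w * a s w) ----> 0"
    proof (cases "a s w = 0")
     case False
     then have "(%n. stp (%r. \<phi> r w) n s) ----> \<phi> s w" using elim s by auto
     then have "(%n. stp (%r. \<phi> r w) n s * a s w - \<phi> s w * a s w) ----> \<phi> s w * a s w - \<phi> s w * a s w"
      by (intro tendsto_intros)
     then show ?thesis by simp
    qed simp
   qed
  qed
 qed
qed

lemma continuous_riemann_condition:
 fixes \<phi> a :: "real => 'a => real"
 assumes "AE w in M. continuous_on {0..} (%s. \<phi> s w)"
 shows "AE w in M. \<forall>t\<ge>0. (\<exists>C. \<forall>s\<in>{0..t}. \<bar>\<phi> s w\<bar> <= C) \<and>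
    (AE s in lborel. 0 < s \<and> s <= t \<and> a s w \<noteq> 0 --> (%n. stp (%r. \<phi> r w) n s) ----> \<phi> s w)"
 using assms
proof eventually_elim
 case (elim w)
 show ?case
 proof (intro allI impI conjI)
  fix t :: real
  show "\<exists>C. \<forall>s\<in>{0..t}. \<bar>\<phi> s w\<bar> <= C" by (rule continuous_path_bounded[OF elim]) blast
  show "AE s in lborel. 0 < s \<and> s <= t \<and> a s w \<noteq> 0 --> (%n. stp (%r. \<phi> r w) n s) ----> \<phi> s w"
   using stp_tendsto continuous_on_at_left[OF elim] by (intro AE_I2) auto
 qed
qed

text \<open>On a cell \<open>(dI)^2 = d(I^2) - 2 I dI\<close>, and \<open>I^2\<close> minus the
  bracket is the integral of \<open>2 I a\<close>. The difference in question is therefore itself a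
  stochastic integral, with integrand \<open>K n\<close>, the difference of two step approximations
  of the same process \<open>2 \<phi> I a\<close>.\<close>

lemma bracket_approximation:
 assumes SI: "SI a I" and \<phi>: "!!s. 0 <= s ==> ae_measurable (F s) (\<phi> s)"
  and cont: "AE w in M. continuous_on {0..} (%s. \<phi> s w)" and t: "0 < t"
 shows "vanishes (%n w. sup_norm (%t w. rsq (%r. \<phi> r w) (%r. I r w) n t - rs (%r. \<phi> r w) (%r. enn2real (energy a r w)) n t) t w)"
proof -
 let ?A = "%t w. enn2real (energy a t w)"
 have \<phi>I: "ae_measurable (F s) (%w. 2 * \<phi> s w * I s w)" if "0 <= s" for s
  by (intro ae_measurable_mult ae_measurable_const \<phi> SI_ae_measurable[OF SI] that)
 have cI: "AE w in M. continuous_on {0..} (%s. 2 * \<phi> s w * I s w)"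
  using cont SI_cont[OF SI] by eventually_elim (intro continuous_intros)
 define K where "K n s w = stp (%r. \<phi> r w) n s * (2 * I s w * a s w) - stp (%r. 2 * \<phi> r w * I r w) n s * a s w" for n s w
 define J where "J n t w = rs (%r. \<phi> r w) (%r. (I r w)^2 - ?A r w) n t - rs (%r. 2 * \<phi> r w * I r w) (%r. I r w) n t" for n t w
 have SIn: "SI (K n) (J n)" for n
  unfolding K_def[abs_def] J_def[abs_def] by (rule SI_diff[OF SI_riemann[OF SI_square[OF SI] \<phi>] SI_riemann[OF SI \<phi>I]])
 have J: "J n t w = rsq (%r. \<phi> r w) (%r. I r w) n t - rs (%r. \<phi> r w) (%r. ?A r w) n t" for n t w
  unfolding J_def rs_def rsq_def sum_subtractf[symmetric]
 proof (rule sum.cong[OF refl])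
  fix i
  show "\<phi> (dy n i) w * ((I (min t (dy n (Suc i))) w)^2 - ?A (min t (dy n (Suc i))) w - ((I (min t (dy n i)) w)^2 - ?A (min t (dy n i)) w)) -
     2 * \<phi> (dy n i) w * I (dy n i) w * (I (min t (dy n (Suc i))) w - I (min t (dy n i)) w) =
     \<phi> (dy n i) w * (I (min t (dy n (Suc i))) w - I (min t (dy n i)) w)^2 - \<phi> (dy n i) w * (?A (min t (dy n (Suc i))) w - ?A (min t (dy n i)) w)"
  proof (cases "dy n i <= t")
   case True
   then have "min t (dy n i) = dy n i" by simp
   then show ?thesis by (simp add: power2_eq_square algebra_simps)
  next
   case False
   then have "min t (dy n i) = t" "min t (dy n (Suc i)) = t" using dy_less[of n i] by linarith+
   then show ?thesis by simp
  qed
 qed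
 have "vanishes (%n w. energy (K n) t w)"
 proof (rule vanishes_AE)
  show "ae_measurable M (energy (K n) t)" for n by (rule jm_energy[OF SI_jm[OF SIn]])
  have j: "jm \<phi>" by (rule jm_continuous[OF ae_measurable_F[OF \<phi>] cont])
  have t0: "0 <= t" using t by simp
  let ?f = "%s w. \<phi> s w * (2 * I s w * a s w)"
  let ?P = "%n s w. stp (%r. \<phi> r w) n s * (2 * I s w * a s w) - ?f s w"
  let ?Q = "%n s w. stp (%r. 2 * \<phi> r w * I r w) n s * a s w - 2 * \<phi> s w * I s w * a s w"
  have jf: "jm ?f" by (intro jm_mult j jm_const SI_jm_I[OF SI] SI_jm[OF SI])
  have "AE w in M. \<forall>t. energy (K n) t w <= 2 * energy (?P n) t w + 2 * energy (%s w. ?f s w - stp (%r. 2 * \<phi> r w * I r w) n s * a s w) t w" for n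
   unfolding K_def[abs_def] 
   by (rule energy_diff_AE[OF SI_jm[OF SI_riemann[OF SI_square[OF SI]]] jf SI_jm[OF SI_riemann[OF SI]]]) (rule \<phi> \<phi>I, assumption)+
  then have "AE w in M. \<forall>n. \<forall>t. energy (K n) t w <= 2 * energy (?P n) t w + 2 * energy (%s w. ?f s w - stp (%r. 2 * \<phi> r w * I r w) n s * a s w) t w" by (simp add: AE_all_countable)
  then have "AE w in M. \<forall>n. energy (K n) t w <= 2 * energy (?P n) t w + 2 * energy (?Q n) t w"
   unfolding energy_minus_commute[of ?f] by eventually_elim (simp add: mult_ac)
  moreover have "AE w in M. (%n. energy (?P n) t w) ----> 0"
   by (rule riemann_energy[OF SI_square[OF SI] j _ continuous_riemann_condition[OF cont] t0]) (rule \<phi>)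
  moreover have "AE w in M. (%n. energy (?Q n) t w) ----> 0"
   by (rule riemann_energy[OF SI jm_mult[OF jm_mult[OF jm_const j] SI_jm_I[OF SI]] _ continuous_riemann_condition[OF cI] t0]) (rule \<phi>I)
  ultimately show "AE w in M. (%n. energy (K n) t w) ----> 0"
  proof eventually_elim
   case (elim w)
   have "(%n. 2 * energy (?P n) t w + 2 * energy (?Q n) t w) ----> 2 * 0 + 2 * 0"
    by (intro tendsto_add tendsto_mult_ennreal tendsto_const elim) auto
   then have L: "(%n. 2 * energy (?P n) t w + 2 * energy (?Q n) t w) ----> 0" by simp
   show ?case by (rule ennreal_squeeze_0[OF L]) (use elim in blast)
  qed
 qed
 from SI_vanishes[OF SIn this t] show ?thesis unfolding J .
qed

lemma sup_norm_AE_subseq: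
 assumes "!!t. 0 < t ==> vanishes (%n w. sup_norm (X n) t w)" "!!t. 0 < t ==> vanishes (%n w. sup_norm (Y n) t w)"
 shows "\<exists>r. strict_mono (r :: nat => nat) \<and> (AE w in M. \<forall>t\<ge>0. (%n. X (r n) t w) ----> 0 \<and> (%n. Y (r n) t w) ----> 0)"
proof -
 have "vanishes (%n w. sup_norm (X n) (real (Suc m)) w + sup_norm (Y n) (real (Suc m)) w)" for m
  by (intro vanishes_add assms) auto
 from vanishes_AE_subseq[of "%m n w. sup_norm (X n) (real (Suc m)) w + sup_norm (Y n) (real (Suc m)) w", OF this]
 obtain r where r: "strict_mono (r :: nat => nat)"
  "AE w in M. \<forall>m. (%k. sup_norm (X (r k)) (real (Suc m)) w + sup_norm (Y (r k)) (real (Suc m)) w) ----> 0" by blast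
 have "AE w in M. \<forall>t\<ge>0. (%n. X (r n) t w) ----> 0 \<and> (%n. Y (r n) t w) ----> 0" using r(2)
 proof eventually_elim
  case (elim w)
  show ?case
  proof (intro allI impI)
   fix t :: real assume t: "0 <= t"
   define m where "m = nat \<lceil>t\<rceil>"
   have tm: "t <= real (Suc m)" unfolding m_def by linarith
   have L: "(%k. sup_norm (X (r k)) (real (Suc m)) w + sup_norm (Y (r k)) (real (Suc m)) w) ----> 0" using elim by blast
   have 1: "(%k. sup_norm (X (r k)) (real (Suc m)) w) ----> 0"
    by (rule ennreal_squeeze_0[OF L]) simp
   have 2: "(%k. sup_norm (Y (r k)) (real (Suc m)) w) ----> 0"
    by (rule ennreal_squeeze_0[OF L]) simp
   show "(%n. X (r n) t w) ----> 0 \<and> (%n. Y (r n) t w) ----> 0"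
    using sup_norm_tendsto_0D[OF 1 t tm] sup_norm_tendsto_0D[OF 2 t tm] by simp
  qed
 qed
 with r(1) show ?thesis by blast
qed

text \<open>Recognises a continuous process as a stochastic integral from its pathwise Riemann sums.
  It is used twice: for Ito's formula, and for stopping at a level of the local time.\<close>

lemma SI_riemann_limit:
 assumes SI: "SI a I" and jm: "jm \<phi>" and \<phi>: "!!s. 0 <= s ==> ae_measurable (F s) (\<phi> s)"
  and lim: "AE w in M. \<forall>t\<ge>0. (\<exists>C. \<forall>s\<in>{0..t}. \<bar>\<phi> s w\<bar> <= C) \<and>
    (AE s in lborel. 0 < s \<and> s <= t \<and> a s w \<noteq> 0 --> (%n. stp (%r. \<phi> r w) n s) ----> \<phi> s w)"
  and r: "strict_mono r" and J: "AE w in M. continuous_on {0..} (%t. J t w)"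
  and conv: "AE w in M. \<forall>t\<ge>0. (%n. rs (%s. \<phi> s w) (%s. I s w) (r n) t) ----> J t w"
 shows "SI (%s w. \<phi> s w * a s w) J"
proof (rule SI_AE_limit)
 show "SI (%s w. stp (%q. \<phi> q w) (r n) s * a s w) (%t w. rs (%q. \<phi> q w) (%q. I q w) (r n) t)" for n
  by (rule SI_riemann[OF SI \<phi>])
 show "jm (%s w. \<phi> s w * a s w)" by (intro jm_mult jm SI_jm[OF SI])
 fix t :: real assume t: "0 <= t"
 have "AE w in M. (%n. energy (%s w. stp (%q. \<phi> q w) n s * a s w - \<phi> s w * a s w) t w) ----> 0"
  by (rule riemann_energy[OF SI jm _ lim t]) (rule \<phi>)
 then show "AE w in M. (%n. energy (%s w. stp (%q. \<phi> q w) (r n) s * a s w - \<phi> s w * a s w) t w) ----> 0"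
  by eventually_elim (drule LIMSEQ_subseq_LIMSEQ[OF _ r], simp add: comp_def)
 show "AE w in M. (%n. rs (%q. \<phi> q w) (%q. I q w) (r n) t) ----> J t w"
  using conv by eventually_elim (use t in blast)
qed (rule J)

lemma progressive_integral:
 assumes b: "progressively_measurable F b" and t: "0 <= t"
 shows "(%w. LBINT s:{0..t}. b s w) \<in> borel_measurable (F t)"
proof -
 have P: "(%(s, w). b s w) \<in> borel_measurable (restrict_space borel {0..t} \<Otimes>\<^sub>M F t)"
  using assms unfolding progressively_measurable_def by simp
 have "(%z. (max 0 (min (snd z) t), fst z)) \<in> measurable (F t \<Otimes>\<^sub>M lborel) (restrict_space borel {0..t} \<Otimes>\<^sub>M F t)"
 proof (rule measurable_Pair)
  show "(%z. max 0 (min (snd z) t)) \<in> F t \<Otimes>\<^sub>M lborel \<rightarrow>\<^sub>M restrict_space borel {0..t}"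
   by (rule measurable_restrict_space2) (use t in auto)
 qed simp
 from measurable_compose[OF this P]
 have "(%z. b (max 0 (min (snd z) t)) (fst z)) \<in> borel_measurable (F t \<Otimes>\<^sub>M lborel)" by simp
 then have "(%z. indicator {0..t} (snd z) * b (max 0 (min (snd z) t)) (fst z)) \<in> borel_measurable (F t \<Otimes>\<^sub>M lborel)"
  by measurable
 then have "(%(w, s). indicator {0..t} s * b (max 0 (min s t)) w) \<in> borel_measurable (F t \<Otimes>\<^sub>M lborel)" by (simp add: split_beta')
 from lborel.borel_measurable_lebesgue_integral[OF this]
 have "(%w. \<integral>s. indicator {0..t} s * b (max 0 (min s t)) w \<partial>lborel) \<in> borel_measurable (F t)" .
 moreover have "(LBINT s:{0..t}. b s w) = (\<integral>s. indicator {0..t} s * b (max 0 (min s t)) w \<partial>lborel)" for w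
  unfolding set_lebesgue_integral_def by (rule Bochner_Integration.integral_cong) (auto simp: indicator_def)
 ultimately show ?thesis by simp
qed

end

text \<open>Models the diffusion stopped on leaving a compact interval; compactness makes continuous
  functions and primitives bounded along the path.\<close>

locale bounded_ito = bm_space +
 fixes X b a I :: "real => 'a => real" and x0 \<alpha> \<beta> :: real
 assumes range_nonempty: "\<alpha> < \<beta>" and SI_I: "SI a I" and b_progressive: "progressively_measurable F b"
  and b_integrable: "AE w in M. \<forall>t\<ge>0. set_integrable lborel {0..t} (%s. b s w)"
  and X_eq: "AE w in M. \<forall>t\<ge>0. X t w = x0 + (LBINT s:{0..t}. b s w) + I t w"
  and X_range: "AE w in M. \<forall>t\<ge>0. X t w \<in> {\<alpha>..\<beta>}"
begin

lemma X_adapted: "0 <= t ==> ae_measurable (F t) (X t)"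
proof -
 assume t: "0 <= t"
 have "ae_measurable (F t) (%w. x0 + (LBINT s:{0..t}. b s w) + I t w)"
  by (intro ae_measurable_add ae_measurable_const SI_ae_measurable[OF SI_I] t ae_measurableI progressive_integral[OF b_progressive])
 then show ?thesis by (rule ae_measurable_cong) (use X_eq in \<open>eventually_elim, simp add: t\<close>)
qed

lemma X_continuous: "AE w in M. continuous_on {0..} (%t. X t w)"
 using X_eq b_integrable SI_cont[OF SI_I]
proof eventually_elim
 case (elim w)
 have "continuous_on {0..} (%t. x0 + (LBINT s:{0..t}. b s w) + I t w)"
  by (intro continuous_intros elim indefinite_integral_continuous) (use elim in auto)
 then show ?case by (rule continuous_on_eq) (use elim in auto)
qed

lemma X_jm: "jm X"
 by (rule jm_continuous) (auto intro: ae_measurable_F X_adapted X_continuous)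

lemma b_jm: "jm b"
 by (rule jm_progressive[OF b_progressive])

lemma a_jm: "jm a"
 by (rule SI_jm[OF SI_I])

lemma a_integrable: "AE w in M. (\<forall>t\<ge>0. set_integrable lborel {0..t} (%s. (a s w)^2)) \<and> (\<forall>t\<ge>0. enn2real (energy a t w) = (LBINT s:{0..t}. (a s w)^2))"
 using jm_sec[OF a_jm] SI_energy_finite[OF SI_I]
 by eventually_elim (use energy_finite_integral in blast)

lemma composed_integrable:
 assumes [measurable]: "g \<in> borel_measurable borel" and C: "\<forall>x\<in>{\<alpha>..\<beta>}. \<bar>g x\<bar> <= C"
  and u: "jm u" "AE w in M. \<forall>t\<ge>0. set_integrable lborel {0..t} (%s. u s w)"
 shows "AE w in M. \<forall>t\<ge>0. set_integrable lborel {0..t} (%s. g (X s w) * u s w)"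
 using jm_sec[OF jm_mult[OF jm_comp[OF X_jm assms(1)] u(1)]] u(2) X_range
proof eventually_elim
 case (elim w)
 show ?case
 proof (intro allI impI)
  fix t :: real assume t: "0 <= t"
  have i: "integrable lborel (%s. C * (indicator {0..t} s *\<^sub>R u s w))"
   using elim(2) t unfolding set_integrable_def by (intro integrable_mult_right) blast
  show "set_integrable lborel {0..t} (%s. g (X s w) * u s w)" unfolding set_integrable_def
  proof (rule Bochner_Integration.integrable_bound[OF i])
   show "(%s. indicator {0..t} s *\<^sub>R (g (X s w) * u s w)) \<in> borel_measurable lborel"
    using sec_measurable[OF elim(1), of t] by simp
   show "AE s in lborel. norm (indicator {0..t} s *\<^sub>R (g (X s w) * u s w)) <= norm (C * (indicator {0..t} s *\<^sub>R u s w))"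
   proof (rule AE_I2)
    fix s
    show "norm (indicator {0..t} s *\<^sub>R (g (X s w) * u s w)) <= norm (C * (indicator {0..t} s *\<^sub>R u s w))"
    proof (cases "s \<in> {0..t}")
     case True
     then have "\<bar>g (X s w)\<bar> <= \<bar>C\<bar>" using C elim(3) by fastforce
     then have "\<bar>g (X s w)\<bar> * \<bar>u s w\<bar> <= \<bar>C\<bar> * \<bar>u s w\<bar>" by (rule mult_right_mono) simp
     then show ?thesis using True by (simp add: abs_mult)
    qed simp
   qed
  qed
 qed
qed

lemma continuous_bounded_on_range:
 "continuous_on UNIV (h :: real => real) ==> \<exists>C. \<forall>x\<in>{\<alpha>..\<beta>}. \<bar>h x\<bar> <= C"
proof -
 assume h: "continuous_on UNIV h"
 have "compact (h ` {\<alpha>..\<beta>})" by (rule compact_continuous_image) (auto intro: continuous_on_subset[OF h])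
 then show ?thesis using compact_imp_bounded bounded_iff by (metis imageI real_norm_def)
qed

text \<open>One subsequence is taken along which the quadratic sums with weights \<open>1\<close>
  and \<open>g (X s)\<close> both converge almost surely at all times; the pathwise formula then
  feeds \<open>SI_riemann_limit\<close>.\<close>

theorem ito_C2:
 assumes f: "!!x. (f has_real_derivative f1 x) (at x)" and f1: "!!x. (f1 has_real_derivative g x) (at x)"
  and g: "continuous_on UNIV g"
 shows "SI (%s w. f1 (X s w) * a s w)
   (%t w. f (X t w) - f x0 - (LBINT s:{0..t}. f1 (X s w) * b s w) - 1/2 * (LBINT s:{0..t}. g (X s w) * (a s w)^2))"
proof -
 have fc: "continuous_on UNIV f" using f by (intro DERIV_continuous_on) auto
 have f1c: "continuous_on UNIV f1" using f1 by (intro DERIV_continuous_on) auto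
 have bor: "f1 \<in> borel_measurable borel" "g \<in> borel_measurable borel"
  using f1c g by (auto intro: borel_measurable_continuous_onI)
 have ad: "ae_measurable (F s) (%w. h (X s w))" if "0 <= s" "h \<in> borel_measurable borel" for s and h :: "real => real"
  by (rule ae_measurable_comp[OF X_adapted[OF that(1)] that(2)])
 have Xc: "AE w in M. continuous_on {0..} (%s. h (X s w))" if "continuous_on UNIV h" for h :: "real => real"
  using X_continuous by eventually_elim (rule continuous_on_compose2[OF that], auto)
 have v1: "vanishes (%n w. sup_norm (%t w. rsq (%r. 1) (%r. I r w) n t - rs (%r. 1) (%r. enn2real (energy a r w)) n t) t w)" if "0 < t" for t
  by (rule bracket_approximation[OF SI_I _ _ that]) (auto intro: ae_measurable_const)
 have vg: "vanishes (%n w. sup_norm (%t w. rsq (%r. g (X r w)) (%r. I r w) n t - rs (%r. g (X r w)) (%r. enn2real (energy a r w)) n t) t w)" if "0 < t" for t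
  by (rule bracket_approximation[OF SI_I ad[OF _ bor(2)] Xc[OF g] that])
 from sup_norm_AE_subseq[OF v1 vg] obtain r where r: "strict_mono (r :: nat => nat)"
  "AE w in M. \<forall>t\<ge>0. (%n. rsq (%r. 1) (%r. I r w) (r n) t - rs (%r. 1) (%r. enn2real (energy a r w)) (r n) t) ----> 0 \<and>
    (%n. rsq (%r. g (X r w)) (%r. I r w) (r n) t - rs (%r. g (X r w)) (%r. enn2real (energy a r w)) (r n) t) ----> 0" by blast
 obtain C1 where C1: "\<forall>x\<in>{\<alpha>..\<beta>}. \<bar>f1 x\<bar> <= C1" using continuous_bounded_on_range[OF f1c] by blast
 obtain Cg where Cg: "\<forall>x\<in>{\<alpha>..\<beta>}. \<bar>g x\<bar> <= Cg" using continuous_bounded_on_range[OF g] by blast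
 have ai: "AE w in M. \<forall>t\<ge>0. set_integrable lborel {0..t} (%s. (a s w)^2)" using a_integrable by eventually_elim simp
 have a2: "jm (%s w. (a s w)^2)" by (rule jm_comp[OF a_jm]) simp
 show ?thesis
 proof (rule SI_riemann_limit[OF SI_I _ _ _ r(1)])
  show "jm (%s w. f1 (X s w))" by (rule jm_comp[OF X_jm bor(1)])
  show "ae_measurable (F s) (%w. f1 (X s w))" if "0 <= s" for s by (rule ad[OF that bor(1)])
  show "AE w in M. \<forall>t\<ge>0. (\<exists>C. \<forall>s\<in>{0..t}. \<bar>f1 (X s w)\<bar> <= C) \<and>
    (AE s in lborel. 0 < s \<and> s <= t \<and> a s w \<noteq> 0 --> (%n. stp (%r. f1 (X r w)) n s) ----> f1 (X s w))"
   by (rule continuous_riemann_condition[OF Xc[OF f1c]])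
  show "AE w in M. continuous_on {0..} (%t. f (X t w) - f x0 - (LBINT s:{0..t}. f1 (X s w) * b s w) - 1/2 * (LBINT s:{0..t}. g (X s w) * (a s w)^2))"
   using Xc[OF fc] composed_integrable[OF bor(1) C1 b_jm b_integrable] composed_integrable[OF bor(2) Cg a2 ai]
  proof eventually_elim
   case (elim w)
   show ?case by (intro continuous_intros elim indefinite_integral_continuous) (use elim in auto)
  qed
  show "AE w in M. \<forall>t\<ge>0. (%n. rs (%s. f1 (X s w)) (%s. I s w) (r n) t) ---->
    f (X t w) - f x0 - (LBINT s:{0..t}. f1 (X s w) * b s w) - 1/2 * (LBINT s:{0..t}. g (X s w) * (a s w)^2)"
   using r(2) X_eq X_range b_integrable a_integrable SI_cont[OF SI_I] SI_0[OF SI_I]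
  proof eventually_elim
   case (elim w)
   have rsA: "rs \<phi> (%r. enn2real (energy a r w)) n t = rs \<phi> (%r. LBINT s:{0..r}. (a s w)^2) n t" if "0 <= t" for \<phi> n t
    unfolding rs_def using elim(5) that by simp
   show ?case
   proof (intro allI impI)
    fix t :: real assume t: "0 <= t"
    show "(%n. rs (%s. f1 (X s w)) (%s. I s w) (r n) t) ---->
     f (X t w) - f x0 - (LBINT s:{0..t}. f1 (X s w) * b s w) - 1/2 * (LBINT s:{0..t}. g (X s w) * (a s w)^2)"
     by (rule riemann_ito_path[OF _ _ elim(6,7) t _ _ f f1 g r(1)])
       (use elim(1-5) t in \<open>auto simp: rsA\<close>)
   qed
  qed
 qed
qed

end

section \<open>The Ito formula for integrable second derivatives\<close>

text \<open>A primitive that is defined on the whole line: 0 below \<open>\<alpha>\<close> and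
  constant above \<open>\<beta>\<close>, so that it can be iterated and composed with processes
  without domain conditions.\<close>

definition prim :: "real => real => (real => real) => real => real" where
 "prim \<alpha> \<beta> g x = (LBINT v:{\<alpha>..min \<beta> x}. g v)"

lemma prim_below: "x < \<alpha> ==> prim \<alpha> \<beta> g x = 0"
 unfolding prim_def by (simp add: set_lebesgue_integral_def)

lemma continuous_on_prim:
 assumes g: "set_integrable lborel {\<alpha>..\<beta>} g" and ab: "\<alpha> <= \<beta>"
 shows "continuous_on A (prim \<alpha> \<beta> g)"
proof -
 have "g integrable_on {\<alpha>..\<beta>}" using set_borel_integral_eq_integral(1)[OF g] .
 then have c: "continuous_on {\<alpha>..\<beta>} (%t. integral {\<alpha>..t} g)" by (rule indefinite_integral_continuous_1)
 have "continuous_on A (%x. integral {\<alpha>..max \<alpha> (min \<beta> x)} g)"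
  by (rule continuous_on_compose2[OF c]) (use ab in \<open>auto intro!: continuous_intros\<close>)
 moreover have "integral {\<alpha>..max \<alpha> (min \<beta> x)} g = prim \<alpha> \<beta> g x" for x
 proof (cases "x < \<alpha>")
  case True
  then show ?thesis using ab by (simp add: prim_below)
 next
  case False
  then have m: "max \<alpha> (min \<beta> x) = min \<beta> x" using ab by simp
  have "set_integrable lborel {\<alpha>..min \<beta> x} g" by (rule set_integrable_subset[OF g]) auto
  then show ?thesis unfolding m prim_def using set_borel_integral_eq_integral(2) by metis
 qed
 ultimately show ?thesis by simp
qed

lemma prim_bound:
 assumes g: "set_integrable lborel {\<alpha>..\<beta>} g"
 shows "\<bar>prim \<alpha> \<beta> g x\<bar> <= (LBINT v:{\<alpha>..\<beta>}. \<bar>g v\<bar>)"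
proof -
 have i: "set_integrable lborel {\<alpha>..min \<beta> x} g" by (rule set_integrable_subset[OF g]) auto
 have "\<bar>prim \<alpha> \<beta> g x\<bar> <= (LBINT v:{\<alpha>..min \<beta> x}. \<bar>g v\<bar>)"
  unfolding prim_def using set_integral_norm_bound[OF i] by simp
 also have "\<dots> <= (LBINT v:{\<alpha>..\<beta>}. \<bar>g v\<bar>)"
  unfolding set_lebesgue_integral_def
  by (rule integral_mono) (use set_integrable_abs[OF i] set_integrable_abs[OF g] in \<open>auto simp: set_integrable_def indicator_def\<close>)
 finally show ?thesis .
qed

lemma prim_linear:
 assumes "set_integrable lborel {\<alpha>..\<beta>} g" "set_integrable lborel {\<alpha>..\<beta>} h"
 shows "prim \<alpha> \<beta> (%v. c * g v + d * h v) = (%x. c * prim \<alpha> \<beta> g x + d * prim \<alpha> \<beta> h x)"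
proof
 fix x
 have "set_integrable lborel {\<alpha>..min \<beta> x} g" "set_integrable lborel {\<alpha>..min \<beta> x} h"
  by (rule set_integrable_subset[OF assms(1)] set_integrable_subset[OF assms(2)], auto)+
 then show "prim \<alpha> \<beta> (%v. c * g v + d * h v) x = c * prim \<alpha> \<beta> g x + d * prim \<alpha> \<beta> h x"
  unfolding prim_def by (subst set_integral_add(2)) auto
qed

lemma set_integrable_continuous:
 "continuous_on UNIV g ==> set_integrable lborel {\<alpha>..\<beta>} (g :: real => real)"
 by (rule borel_integrable_atLeastAtMost') (rule continuous_on_subset, auto)

lemma prim_integrable:
 assumes "set_integrable lborel {\<alpha>..\<beta>} g" "\<alpha> <= \<beta>" shows "set_integrable lborel {\<alpha>..\<beta>} (prim \<alpha> \<beta> g)"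
 by (rule set_integrable_continuous[OF continuous_on_prim[OF assms]])

lemma prim_diff_bound:
 assumes g: "set_integrable lborel {\<alpha>..\<beta>} g" and h: "set_integrable lborel {\<alpha>..\<beta>} h" and ab: "\<alpha> <= \<beta>"
 shows "\<bar>prim \<alpha> \<beta> g x - prim \<alpha> \<beta> h x\<bar> <= (LBINT v:{\<alpha>..\<beta>}. \<bar>g v - h v\<bar>)"
  and "\<bar>prim \<alpha> \<beta> (prim \<alpha> \<beta> g) x - prim \<alpha> \<beta> (prim \<alpha> \<beta> h) x\<bar> <= (\<beta> - \<alpha>) * (LBINT v:{\<alpha>..\<beta>}. \<bar>g v - h v\<bar>)"
proof -
 have d: "set_integrable lborel {\<alpha>..\<beta>} (%v. g v - h v)" using g h by (rule set_integral_diff(1))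
 have eq: "prim \<alpha> \<beta> (%v. g v - h v) = (%x. prim \<alpha> \<beta> g x - prim \<alpha> \<beta> h x)"
  using prim_linear[OF g h, of 1 "-1"] by simp
 show 1: "\<bar>prim \<alpha> \<beta> g x - prim \<alpha> \<beta> h x\<bar> <= (LBINT v:{\<alpha>..\<beta>}. \<bar>g v - h v\<bar>)" for x
  using prim_bound[OF d, of x] unfolding eq .
 note pg = prim_integrable[OF g ab] and ph = prim_integrable[OF h ab]
 have eq2: "prim \<alpha> \<beta> (%v. prim \<alpha> \<beta> g v - prim \<alpha> \<beta> h v) = (%x. prim \<alpha> \<beta> (prim \<alpha> \<beta> g) x - prim \<alpha> \<beta> (prim \<alpha> \<beta> h) x)"
  using prim_linear[OF pg ph, of 1 "-1"] by simp
 have dp: "set_integrable lborel {\<alpha>..\<beta>} (%v. prim \<alpha> \<beta> g v - prim \<alpha> \<beta> h v)" using pg ph by (rule set_integral_diff(1))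
 have "\<bar>prim \<alpha> \<beta> (prim \<alpha> \<beta> g) x - prim \<alpha> \<beta> (prim \<alpha> \<beta> h) x\<bar> <= (LBINT v:{\<alpha>..\<beta>}. \<bar>prim \<alpha> \<beta> g v - prim \<alpha> \<beta> h v\<bar>)"
  using prim_bound[OF dp, of x] unfolding eq2 .
 also have "\<dots> <= (LBINT v:{\<alpha>..\<beta>}. (LBINT v:{\<alpha>..\<beta>}. \<bar>g v - h v\<bar>))"
  by (rule set_integral_mono[OF set_integrable_abs[OF dp] set_integrable_continuous 1]) auto
 also have "\<dots> = (\<beta> - \<alpha>) * (LBINT v:{\<alpha>..\<beta>}. \<bar>g v - h v\<bar>)"
  using ab by (simp add: set_integral_const)
 finally show "\<bar>prim \<alpha> \<beta> (prim \<alpha> \<beta> g) x - prim \<alpha> \<beta> (prim \<alpha> \<beta> h) x\<bar> <= (\<beta> - \<alpha>) * (LBINT v:{\<alpha>..\<beta>}. \<bar>g v - h v\<bar>)" .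
qed

lemma primitive_derivative:
 fixes g :: "real => real"
 assumes "continuous_on UNIV g"
 shows "((%u. LBINT v=ereal a..ereal u. g v) has_real_derivative g x) (at x)"
proof -
 have "((%u. LBINT v=ereal a..ereal u. g v) has_vector_derivative g x) (at x within {min a x - 1..max a x + 1})"
  by (rule interval_integral_FTC2) (auto intro: continuous_on_subset[OF assms])
 then have "((%u. LBINT v=ereal a..ereal u. g v) has_vector_derivative g x) (at x within {min a x - 1<..<max a x + 1})"
  by (rule has_vector_derivative_within_subset) auto
 then have "((%u. LBINT v=ereal a..ereal u. g v) has_vector_derivative g x) (at x)"
  by (subst (asm) has_vector_derivative_within_open) auto
 then show ?thesis by (simp add: has_real_derivative_iff_has_vector_derivative)
qed

lemma interval_integral_prim:
 fixes g :: "real => real"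
 assumes "x \<in> {\<alpha>..\<beta>}" shows "(LBINT v=ereal \<alpha>..ereal x. g v) = prim \<alpha> \<beta> g x"
 using assms unfolding prim_def by (simp add: interval_integral_Icc min_absorb2)

lemma prim_cong: "(!!v. v \<in> {\<alpha>..\<beta>} ==> g v = h v) ==> prim \<alpha> \<beta> g = prim \<alpha> \<beta> h"
 unfolding prim_def by (intro ext set_lebesgue_integral_cong) auto

context bounded_ito
begin

abbreviation "pr \<equiv> prim \<alpha> \<beta>"

text \<open>Ito's formula for the function with second derivative \<open>g\<close>, phrased in terms
  of \<open>g\<close> so that linear combinations and monotone limits of \<open>g\<close> can be
  taken. Finiteness of the integral of \<open>g (X s)\<close> against the bracket belongs to the
  claim, because for unbounded \<open>g\<close> it is not obvious.\<close>

definition ito_for :: "(real => real) => bool" where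
 "ito_for g \<longleftrightarrow> g \<in> borel_measurable borel \<and> set_integrable lborel {\<alpha>..\<beta>} g \<and>
  (AE w in M. \<forall>t\<ge>0. set_integrable lborel {0..t} (%s. g (X s w) * (a s w)^2)) \<and>
  SI (%s w. pr g (X s w) * a s w)
   (%t w. pr (pr g) (X t w) - pr (pr g) x0 - (LBINT s:{0..t}. pr g (X s w) * b s w) - 1/2 * (LBINT s:{0..t}. g (X s w) * (a s w)^2))"

lemma ab: "\<alpha> <= \<beta>" using range_nonempty by simp

lemma x0_range: "x0 \<in> {\<alpha>..\<beta>}"
proof -
 have "AE w in M. x0 \<in> {\<alpha>..\<beta>}" using X_eq X_range SI_0[OF SI_I]
 proof eventually_elim
  case (elim w)
  then show ?case by (metis add.right_neutral atLeastAtMost_singleton order_refl set_integral_point)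
 qed
 then show ?thesis by simp
qed

lemma pr_borel: "set_integrable lborel {\<alpha>..\<beta>} g ==> pr g \<in> borel_measurable borel"
 by (rule borel_measurable_continuous_onI) (rule continuous_on_prim[OF _ ab])

lemma pr_b_integrable:
 "set_integrable lborel {\<alpha>..\<beta>} g ==> AE w in M. \<forall>t\<ge>0. set_integrable lborel {0..t} (%s. pr g (X s w) * b s w)"
 by (rule composed_integrable[OF pr_borel _ b_jm b_integrable]) (use prim_bound in blast)+

lemma ito_for_continuous:
 assumes g: "continuous_on UNIV g" shows "ito_for g"
proof -
 define f1 where "f1 u = (LBINT v=ereal \<alpha>..ereal u. g v)" for u
 define f where "f u = (LBINT v=ereal \<alpha>..ereal u. f1 v)" for u
 have f1: "(f1 has_real_derivative g x) (at x)" for x unfolding f1_def by (rule primitive_derivative[OF g])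
 then have f1c: "continuous_on UNIV f1" by (intro DERIV_continuous_on) auto
 have f: "(f has_real_derivative f1 x) (at x)" for x unfolding f_def by (rule primitive_derivative[OF f1c])
 have e1: "f1 x = pr g x" if "x \<in> {\<alpha>..\<beta>}" for x unfolding f1_def by (rule interval_integral_prim[OF that])
 have e: "f x = pr (pr g) x" if "x \<in> {\<alpha>..\<beta>}" for x
  unfolding f_def interval_integral_prim[OF that] using prim_cong[of \<alpha> \<beta> f1 "pr g"] e1 by simp
 have gb: "g \<in> borel_measurable borel" using g by (rule borel_measurable_continuous_onI)
 obtain C where C: "\<forall>x\<in>{\<alpha>..\<beta>}. \<bar>g x\<bar> <= C" using continuous_bounded_on_range[OF g] by blast
 have a2: "jm (%s w. (a s w)^2)" by (rule jm_comp[OF a_jm]) simp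
 have ai: "AE w in M. \<forall>t\<ge>0. set_integrable lborel {0..t} (%s. (a s w)^2)" using a_integrable by eventually_elim simp
 show ?thesis unfolding ito_for_def
 proof (intro conjI gb set_integrable_continuous[OF g] composed_integrable[OF gb C a2 ai])
  show "SI (%s w. pr g (X s w) * a s w)
   (%t w. pr (pr g) (X t w) - pr (pr g) x0 - (LBINT s:{0..t}. pr g (X s w) * b s w) - 1/2 * (LBINT s:{0..t}. g (X s w) * (a s w)^2))"
  proof (rule SI_cong[OF ito_C2[OF f f1 g]])
   show "AE w in M. \<forall>s\<ge>0. f1 (X s w) * a s w = pr g (X s w) * a s w"
    using X_range by eventually_elim (simp add: e1)
   show "AE w in M. \<forall>t\<ge>0. f (X t w) - f x0 - (LBINT s:{0..t}. f1 (X s w) * b s w) - 1/2 * (LBINT s:{0..t}. g (X s w) * (a s w)^2)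
    = pr (pr g) (X t w) - pr (pr g) x0 - (LBINT s:{0..t}. pr g (X s w) * b s w) - 1/2 * (LBINT s:{0..t}. g (X s w) * (a s w)^2)"
    using X_range
   proof eventually_elim
    case (elim w)
    have "(LBINT s:{0..t}. f1 (X s w) * b s w) = (LBINT s:{0..t}. pr g (X s w) * b s w)" for t
     by (rule set_lebesgue_integral_cong) (use elim e1 in auto)
    then show ?case using elim e x0_range by simp
   qed
  qed
 qed
qed

lemma ito_for_linear:
 assumes g: "ito_for g" and h: "ito_for h"
 shows "ito_for (%x. c * g x + d * h x)"
proof -
 have gi: "set_integrable lborel {\<alpha>..\<beta>} g" "set_integrable lborel {\<alpha>..\<beta>} h" using g h unfolding ito_for_def by auto
 have p1: "pr (%x. c * g x + d * h x) = (%x. c * pr g x + d * pr h x)" by (rule prim_linear[OF gi])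
 have p2: "pr (%x. c * pr g x + d * pr h x) = (%x. c * pr (pr g) x + d * pr (pr h) x)"
  by (rule prim_linear[OF prim_integrable[OF gi(1) ab] prim_integrable[OF gi(2) ab]])
 have bor: "g \<in> borel_measurable borel" "h \<in> borel_measurable borel" using g h unfolding ito_for_def by auto
 have ga: "AE w in M. \<forall>t\<ge>0. set_integrable lborel {0..t} (%s. g (X s w) * (a s w)^2)" using g unfolding ito_for_def by blast
 have ha: "AE w in M. \<forall>t\<ge>0. set_integrable lborel {0..t} (%s. h (X s w) * (a s w)^2)" using h unfolding ito_for_def by blast
 show ?thesis unfolding ito_for_def
 proof (intro conjI)
  show "(%x. c * g x + d * h x) \<in> borel_measurable borel" using bor by measurable
  show "set_integrable lborel {\<alpha>..\<beta>} (%x. c * g x + d * h x)" using gi by auto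
  show "AE w in M. \<forall>t\<ge>0. set_integrable lborel {0..t} (%s. (c * g (X s w) + d * h (X s w)) * (a s w)^2)"
   using ga ha
  proof eventually_elim
   case (elim w)
   show ?case
   proof (intro allI impI)
    fix t :: real assume "0 <= t"
    then have "set_integrable lborel {0..t} (%s. c * (g (X s w) * (a s w)^2) + d * (h (X s w) * (a s w)^2))" using elim by auto
    then show "set_integrable lborel {0..t} (%s. (c * g (X s w) + d * h (X s w)) * (a s w)^2)" by (simp add: algebra_simps)
   qed
  qed
  have SIg: "SI (%s w. pr g (X s w) * a s w)
   (%t w. pr (pr g) (X t w) - pr (pr g) x0 - (LBINT s:{0..t}. pr g (X s w) * b s w) - 1/2 * (LBINT s:{0..t}. g (X s w) * (a s w)^2))"
   using g unfolding ito_for_def by blast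
  have SIh: "SI (%s w. pr h (X s w) * a s w)
   (%t w. pr (pr h) (X t w) - pr (pr h) x0 - (LBINT s:{0..t}. pr h (X s w) * b s w) - 1/2 * (LBINT s:{0..t}. h (X s w) * (a s w)^2))"
   using h unfolding ito_for_def by blast
  show "SI (%s w. pr (%x. c * g x + d * h x) (X s w) * a s w)
   (%t w. pr (pr (%x. c * g x + d * h x)) (X t w) - pr (pr (%x. c * g x + d * h x)) x0 -
    (LBINT s:{0..t}. pr (%x. c * g x + d * h x) (X s w) * b s w) - 1/2 * (LBINT s:{0..t}. (c * g (X s w) + d * h (X s w)) * (a s w)^2))"
   unfolding p1 p2
  proof (rule SI_cong[OF SI_add[OF SI_scale[OF SIg, of c] SI_scale[OF SIh, of d]]])
   show "AE w in M. \<forall>t\<ge>0. c * (pr (pr g) (X t w) - pr (pr g) x0 - (LBINT s:{0..t}. pr g (X s w) * b s w) - 1/2 * (LBINT s:{0..t}. g (X s w) * (a s w)^2)) +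
     d * (pr (pr h) (X t w) - pr (pr h) x0 - (LBINT s:{0..t}. pr h (X s w) * b s w) - 1/2 * (LBINT s:{0..t}. h (X s w) * (a s w)^2)) =
     c * pr (pr g) (X t w) + d * pr (pr h) (X t w) - (c * pr (pr g) x0 + d * pr (pr h) x0) -
     (LBINT s:{0..t}. (c * pr g (X s w) + d * pr h (X s w)) * b s w) - 1/2 * (LBINT s:{0..t}. (c * g (X s w) + d * h (X s w)) * (a s w)^2)"
    using ga ha pr_b_integrable[OF gi(1)] pr_b_integrable[OF gi(2)]
   proof eventually_elim
    case (elim w)
    show ?case
    proof (intro allI impI)
     fix t :: real assume t: "0 <= t"
     have 1: "(LBINT s:{0..t}. (c * pr g (X s w) + d * pr h (X s w)) * b s w) = c * (LBINT s:{0..t}. pr g (X s w) * b s w) + d * (LBINT s:{0..t}. pr h (X s w) * b s w)"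
     proof -
      have "(LBINT s:{0..t}. c * (pr g (X s w) * b s w) + d * (pr h (X s w) * b s w)) = c * (LBINT s:{0..t}. pr g (X s w) * b s w) + d * (LBINT s:{0..t}. pr h (X s w) * b s w)"
       using elim t by (subst set_integral_add(2)) auto
      then show ?thesis by (simp add: algebra_simps)
     qed
     have 2: "(LBINT s:{0..t}. (c * g (X s w) + d * h (X s w)) * (a s w)^2) = c * (LBINT s:{0..t}. g (X s w) * (a s w)^2) + d * (LBINT s:{0..t}. h (X s w) * (a s w)^2)"
     proof -
      have "(LBINT s:{0..t}. c * (g (X s w) * (a s w)^2) + d * (h (X s w) * (a s w)^2)) = c * (LBINT s:{0..t}. g (X s w) * (a s w)^2) + d * (LBINT s:{0..t}. h (X s w) * (a s w)^2)"
       using elim t by (subst set_integral_add(2)) auto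
      then show ?thesis by (simp add: algebra_simps)
     qed
     show "c * (pr (pr g) (X t w) - pr (pr g) x0 - (LBINT s:{0..t}. pr g (X s w) * b s w) - 1/2 * (LBINT s:{0..t}. g (X s w) * (a s w)^2)) +
     d * (pr (pr h) (X t w) - pr (pr h) x0 - (LBINT s:{0..t}. pr h (X s w) * b s w) - 1/2 * (LBINT s:{0..t}. h (X s w) * (a s w)^2)) =
     c * pr (pr g) (X t w) + d * pr (pr h) (X t w) - (c * pr (pr g) x0 + d * pr (pr h) x0) -
     (LBINT s:{0..t}. (c * pr g (X s w) + d * pr h (X s w)) * b s w) - 1/2 * (LBINT s:{0..t}. (c * g (X s w) + d * h (X s w)) * (a s w)^2)"
      unfolding 1 2 by (simp add: algebra_simps)
    qed
   qed
  qed (simp add: algebra_simps)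
 qed
qed

text \<open>For a monotone limit the point is that the limiting bracket term is finite: it is bounded in
 probability because all other terms of the formula are.\<close>

lemma ito_for_limit:
 fixes g :: "nat => real => real"
 assumes g: "!!n. ito_for (g n)" and g0: "!!n x. 0 <= g n x" and gmono: "!!n x. g n x <= g (Suc n) x"
  and lim: "!!x. (%n. g n x) ----> h x" and hb: "h \<in> borel_measurable borel"
  and hi: "set_integrable lborel {\<alpha>..\<beta>} h"
 shows "ito_for h"
proof -
 have lin: "k <= K' ==> \<bar>x - 1/2 * A\<bar> <= d ==> \<bar>x\<bar> <= P + k ==> A <= 2 * (P + K' + d)" for k K' x A d P :: real
  unfolding abs_le_iff by (simp add: field_simps)
 have gb: "g n \<in> borel_measurable borel" and gi: "set_integrable lborel {\<alpha>..\<beta>} (g n)" for n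
  using g[of n] unfolding ito_for_def by auto
 have ginc: "incseq (%n. g n x)" for x using gmono by (rule incseq_SucI)
 have gh: "g n x <= h x" for n x using incseq_le[OF ginc lim] .
 have h0: "0 <= h x" for x using g0[of 0 x] gh[of 0 x] by simp
 define G where "G = (LBINT v:{\<alpha>..\<beta>}. \<bar>h v\<bar>)"
 \<comment> \<open>The L^1 distance of \<open>g n\<close> from \<open>h\<close> bounds the
   difference of the first primitives uniformly, and \<open>\<beta> - \<alpha>\<close> times it that
   of the second primitives.\<close>
 define \<delta> where "\<delta> n = (LBINT v:{\<alpha>..\<beta>}. \<bar>g n v - h v\<bar>)" for n
 have "\<delta> ----> (LBINT v:{\<alpha>..\<beta>}. 0)" unfolding \<delta>_def
 proof (rule set_integral_dominated[OF hi set_integrable_abs[OF set_integral_diff(1)[OF gi hi]]])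
  show "(%n. \<bar>g n v - h v\<bar>) ----> 0" for v by (rule tendsto_rabs_zero[OF LIM_zero[OF lim]])
  show "\<bar>\<bar>g n v - h v\<bar>\<bar> <= h v" for n v using g0[of n v] gh[of n v] by linarith
 qed
 then have \<delta>: "\<delta> ----> 0" by simp
 have \<delta>0: "0 <= \<delta> n" for n unfolding \<delta>_def set_lebesgue_integral_def by (rule integral_nonneg_AE) auto
 have G0: "0 <= G" unfolding G_def set_lebesgue_integral_def by (rule integral_nonneg_AE) auto
 have gG: "(LBINT v:{\<alpha>..\<beta>}. \<bar>g n v\<bar>) <= G" for n unfolding G_def
  by (rule set_integral_mono[OF set_integrable_abs[OF gi] set_integrable_abs[OF hi]]) (use g0 gh h0 in auto)
 have p1: "\<bar>pr (g n) x\<bar> <= G" for n x using prim_bound[OF gi[of n], of x] gG[of n] by linarith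
 have p2: "\<bar>pr (pr (g n)) x\<bar> <= (\<beta> - \<alpha>) * G" for n x
 proof -
  have "\<bar>pr (pr (g n)) x\<bar> <= (LBINT v:{\<alpha>..\<beta>}. \<bar>pr (g n) v\<bar>)" by (rule prim_bound[OF prim_integrable[OF gi ab]])
  also have "\<dots> <= (LBINT v:{\<alpha>..\<beta>}. G)"
   by (rule set_integral_mono[OF set_integrable_abs[OF prim_integrable[OF gi ab]] set_integrable_continuous]) (use p1 in auto)
  also have "\<dots> = (\<beta> - \<alpha>) * G" using ab by (simp add: set_integral_const)
  finally show ?thesis .
 qed
 \<comment> \<open>The square root turns the bracket term into an energy, to which monotone
   convergence in \<open>ennreal\<close> applies before finiteness is known.\<close>
 define H where "H n s w = sqrt (g n (X s w)) * a s w" for n s w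
 define H' where "H' s w = sqrt (h (X s w)) * a s w" for s w
 have jH: "jm (H n)" for n unfolding H_def[abs_def]
  by (intro jm_mult a_jm jm_comp[OF X_jm]) (use gb in measurable)
 have jH': "jm H'" unfolding H'_def[abs_def]
  by (intro jm_mult a_jm jm_comp[OF X_jm]) (use hb in measurable)
 have H2: "(H n s w)^2 = g n (X s w) * (a s w)^2" for n s w unfolding H_def using g0 by (simp add: power_mult_distrib)
 have H'2: "(H' s w)^2 = h (X s w) * (a s w)^2" for s w unfolding H'_def using h0 by (simp add: power_mult_distrib)
 have HH: "\<bar>H n s w\<bar> <= \<bar>H (Suc n) s w\<bar>" "\<bar>H n s w\<bar> <= \<bar>H' s w\<bar>" for n s w
  unfolding H_def H'_def abs_mult using gmono gh g0 h0 by (auto intro!: mult_right_mono)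
 have inc: "incseq (%n. energy (H n) t w)" for t w
  by (rule incseq_SucI) (rule energy_le, rule HH)
 have ga: "AE w in M. \<forall>t\<ge>0. set_integrable lborel {0..t} (%s. g n (X s w) * (a s w)^2)" for n
  using g[of n] unfolding ito_for_def by blast
 have enA: "AE w in M. \<forall>t\<ge>0. energy (H n) t w = ennreal (LBINT s:{0..t}. g n (X s w) * (a s w)^2)" for n
  using ga[of n]
 proof eventually_elim
  case (elim w)
  show ?case
  proof (intro allI impI)
   fix t :: real assume t: "0 <= t"
   have "energy (H n) t w = (\<integral>\<^sup>+s. ennreal (indicator {0..t} s *\<^sub>R (g n (X s w) * (a s w)^2)) \<partial>lborel)"
    unfolding energy_def H2 by (rule nn_integral_cong) (auto simp: indicator_def)
   also have "\<dots> = ennreal (LBINT s:{0..t}. g n (X s w) * (a s w)^2)"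
    unfolding set_lebesgue_integral_def
    by (rule nn_integral_eq_integral) (use elim t g0 in \<open>auto simp: set_integrable_def indicator_def\<close>)
   finally show "energy (H n) t w = ennreal (LBINT s:{0..t}. g n (X s w) * (a s w)^2)" .
  qed
 qed
 define K where "K n t w = pr (pr (g n)) (X t w) - pr (pr (g n)) x0 - (LBINT s:{0..t}. pr (g n) (X s w) * b s w)" for n t w
 define In where "In n t w = K n t w - 1/2 * (LBINT s:{0..t}. g n (X s w) * (a s w)^2)" for n t w
 have SIn: "SI (%s w. pr (g n) (X s w) * a s w) (In n)" for n
  using g[of n] unfolding ito_for_def In_def[abs_def] K_def by blast
 have Kb: "AE w in M. \<forall>t\<ge>0. \<forall>n. \<bar>K n t w\<bar> <= 2 * ((\<beta> - \<alpha>) * G) + G * (LBINT s:{0..t}. \<bar>b s w\<bar>)"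
 proof -
  have "AE w in M. \<forall>n. \<forall>t\<ge>0. set_integrable lborel {0..t} (%s. pr (g n) (X s w) * b s w)"
   using pr_b_integrable[OF gi] by (simp add: AE_all_countable)
  then show ?thesis using b_integrable
  proof eventually_elim
   case (elim w)
   show ?case
   proof (intro allI impI)
    fix t :: real and n assume t: "0 <= t"
    have bi: "set_integrable lborel {0..t} (%s. b s w)" using elim t by auto
    have pbi: "set_integrable lborel {0..t} (%s. pr (g n) (X s w) * b s w)" using elim t by blast
    have "\<bar>LBINT s:{0..t}. pr (g n) (X s w) * b s w\<bar> <= (LBINT s:{0..t}. \<bar>pr (g n) (X s w) * b s w\<bar>)"
     using set_integral_norm_bound[OF pbi] by simp
    also have "\<dots> <= (LBINT s:{0..t}. G * \<bar>b s w\<bar>)"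
     by (rule set_integral_mono[OF set_integrable_abs[OF pbi]]) (use set_integrable_abs[OF bi] p1 in \<open>auto simp: abs_mult intro: mult_right_mono\<close>)
    finally have "\<bar>LBINT s:{0..t}. pr (g n) (X s w) * b s w\<bar> <= G * (LBINT s:{0..t}. \<bar>b s w\<bar>)" by simp
    then show "\<bar>K n t w\<bar> <= 2 * ((\<beta> - \<alpha>) * G) + G * (LBINT s:{0..t}. \<bar>b s w\<bar>)"
     unfolding K_def using p2[of n "X t w"] p2[of n x0] by linarith
   qed
  qed
 qed
 have sup: "(SUP n. energy (H n) t w) = energy H' t w" if s: "!!n. sec (H n) w" for t w
 proof -
  have lim2: "(SUP n. ennreal ((indicator {0..t} s * H n s w)^2)) = ennreal ((indicator {0..t} s * H' s w)^2)" for s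
  proof (rule LIMSEQ_unique[OF LIMSEQ_SUP])
   show "incseq (%n. ennreal ((indicator {0..t} s * H n s w)^2))"
    by (rule incseq_SucI, rule ennreal_leI) (use HH(1) in \<open>auto simp: indicator_def abs_le_square_iff\<close>)
   show "(%n. ennreal ((indicator {0..t} s * H n s w)^2)) ----> ennreal ((indicator {0..t} s * H' s w)^2)"
    unfolding H_def H'_def by (intro tendsto_intros lim)
  qed
  have "(SUP n. energy (H n) t w) = (\<integral>\<^sup>+s. (SUP n. ennreal ((indicator {0..t} s * H n s w)^2)) \<partial>lborel)"
   unfolding energy_alt
  proof (rule nn_integral_monotone_convergence_SUP[symmetric])
   show "incseq (%n s. ennreal ((indicator {0..t} s * H n s w)^2))"
    by (rule incseq_SucI, rule le_funI, rule ennreal_leI) (use HH(1) in \<open>auto simp: indicator_def abs_le_square_iff\<close>)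
   show "(%s. ennreal ((indicator {0..t} s * H n s w)^2)) \<in> borel_measurable lborel" for n
    using sec_measurable[OF s, of t n] by measurable
  qed
  then show ?thesis unfolding lim2 energy_alt .
 qed
 have fin: "AE w in M. energy H' (real (Suc m)) w < \<infinity>" for m
 proof (rule AE_from_bad_sets)
  fix e :: real assume e: "e > 0"
  define T where "T = real (Suc m)"
  have T: "0 < T" unfolding T_def by simp
  \<comment> \<open>The probability \<open>e\<close> is split into a quarter for the energy of
    \<open>a\<close>, one for the variation of the drift and one for the maximal inequality.\<close>
  have e4: "0 < e/4" using e by simp
  have "AE w in M. energy a T w < \<infinity>" using SI_energy_finite[OF SI_I] by eventually_elim simp
  from AE_finite_bound[OF jm_energy[OF a_jm] this e4] obtain K0 where K0: "0 <= K0" "mostly (e/4) (%w. energy a T w <= ennreal K0)" by blast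
  have "progressively_measurable F (%s w. \<bar>b s w\<bar>)" using b_progressive unfolding progressively_measurable_def by (auto simp: split_beta')
  then have "ae_measurable M (%w. LBINT s:{0..T}. \<bar>b s w\<bar>)" using T
   by (intro ae_measurable_F[OF ae_measurableI, OF progressive_integral]) auto
  then have "ae_measurable M (%w. ennreal (LBINT s:{0..T}. \<bar>b s w\<bar>))"
   by (rule ae_measurable_comp[where \<phi>=ennreal]) simp
  moreover have "AE w in M. ennreal (LBINT s:{0..T}. \<bar>b s w\<bar>) < \<infinity>" by simp
  ultimately obtain K1 where K1: "0 <= K1" "mostly (e/4) (%w. ennreal (LBINT s:{0..T}. \<bar>b s w\<bar>) <= ennreal K1)"
   using AE_finite_bound[OF _ _ e4] by blast
  define D where "D = G^2 * K0"
  have D0: "0 <= D" unfolding D_def using K0(1) by simp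
  \<comment> \<open>The stochastic integrals have energy at most \<open>D\<close>, so the maximal
    inequality costs \<open>8 D / d^2\<close>; this \<open>d\<close> makes it at most
    \<open>e / 4\<close>, uniformly in \<open>n\<close>.\<close>
  define d where "d = sqrt (32 * D / e) + 1"
  have n: "0 <= 32 * D / e" using D0 e by simp
  have d: "0 < d" unfolding d_def using n by (intro add_nonneg_pos) auto
  have "32 * D / e = (sqrt (32 * D / e))^2" using n by simp
  also have "\<dots> <= d^2" unfolding d_def using n by (intro power_mono) auto
  finally have dD: "8 * D / d^2 <= e / 4" using e d by (simp add: field_simps)
  \<comment> \<open>Solves \<open>In = K - 1/2 * A\<close> for the bracket term \<open>A\<close>,
    using \<open>d\<close> as bound for \<open>In\<close> and the estimate \<open>Kb\<close> for
    \<open>K\<close>.\<close>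
  define L where "L = 2 * (2 * ((\<beta> - \<alpha>) * G) + G * K1 + d)"
  have L: "mostly e (%w. energy (H n) T w <= ennreal L)" for n
  proof -
   have "AE w in M. energy a T w <= ennreal K0 --> energy (%s w. pr (g n) (X s w) * a s w) T w <= ennreal D"
    using jm_sec[OF a_jm]
   proof (eventually_elim, intro impI)
    fix w assume w: "sec a w" "energy a T w <= ennreal K0"
    have "energy (%s w. pr (g n) (X s w) * a s w) T w <= energy (%s w. G * a s w) T w"
     by (rule energy_le) (use p1 G0 in \<open>auto simp: abs_mult intro!: mult_right_mono\<close>)
    also have "\<dots> <= ennreal (G^2) * ennreal K0" unfolding energy_scale[OF w(1)] by (rule mult_left_mono[OF w(2)]) simp
    finally show "energy (%s w. pr (g n) (X s w) * a s w) T w <= ennreal D" unfolding D_def using K0(1) by (simp add: ennreal_mult)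
   qed
   note I = SI_maximal[OF SIn T mostly_mono[OF K0(2) this order_refl] D0 d]
   show ?thesis
   proof (rule mostly_mono[OF mostly_conj[OF I K1(2)]])
    show "AE w in M. (\<forall>s\<in>{0..T}. \<bar>In n s w\<bar> <= d) \<and> ennreal (LBINT s:{0..T}. \<bar>b s w\<bar>) <= ennreal K1 --> energy (H n) T w <= ennreal L"
     using Kb enA[of n]
    proof (eventually_elim, intro impI, elim conjE)
     fix w assume w: "\<forall>t\<ge>0. \<forall>n. \<bar>K n t w\<bar> <= 2 * ((\<beta> - \<alpha>) * G) + G * (LBINT s:{0..t}. \<bar>b s w\<bar>)"
       "\<forall>t\<ge>0. energy (H n) t w = ennreal (LBINT s:{0..t}. g n (X s w) * (a s w)^2)" "\<forall>s\<in>{0..T}. \<bar>In n s w\<bar> <= d"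
       "ennreal (LBINT s:{0..T}. \<bar>b s w\<bar>) <= ennreal K1"
     have 1: "\<bar>In n T w\<bar> <= d" and 3: "\<bar>K n T w\<bar> <= 2 * ((\<beta> - \<alpha>) * G) + G * (LBINT s:{0..T}. \<bar>b s w\<bar>)" using w T by auto
     have "G * (LBINT s:{0..T}. \<bar>b s w\<bar>) <= G * K1" using w(4) K1(1) G0 by (intro mult_left_mono) (simp_all add: ennreal_le_iff)
     then have "(LBINT s:{0..T}. g n (X s w) * (a s w)^2) <= L" using 1 3 unfolding In_def L_def by (intro lin)
     then show "energy (H n) T w <= ennreal L" using w(2) T by (simp add: ennreal_leI)
    qed
   qed (use e dD in linarith)
  qed
  have "mostly e (%w. \<forall>n. energy (H n) T w <= ennreal L)"
  proof (rule mostly_all[OF jm_energy[OF jH]])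
   fix N d assume "(0 :: real) < d"
   then show "mostly (e + d) (%w. \<forall>n\<le>N. energy (H n) T w <= ennreal L)"
    by (intro mostly_mono[OF L[of N] AE_I2]) (auto intro: order_trans[OF incseqD[OF inc]])
  qed
  then show "mostly e (%w. energy H' (real (Suc m)) w < \<infinity>)"
  proof (rule mostly_mono[OF _ _ order_refl])
   have "AE w in M. \<forall>n. sec (H n) w" using jm_sec[OF jH] by (simp add: AE_all_countable)
   then show "AE w in M. (\<forall>n. energy (H n) T w <= ennreal L) --> energy H' (real (Suc m)) w < \<infinity>"
   proof (eventually_elim, intro impI)
    fix w assume "\<forall>n. sec (H n) w" "\<forall>n. energy (H n) T w <= ennreal L"
    then have "energy H' T w <= ennreal L" by (subst sup[symmetric]) (auto intro: SUP_least)
    then show "energy H' (real (Suc m)) w < \<infinity>" unfolding T_def using ennreal_less_top infinity_ennreal_def order_le_less_trans by metis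
   qed
  qed
 qed
 have finH: "AE w in M. \<forall>t. energy H' t w < \<infinity>"
 proof -
  have "AE w in M. \<forall>m. energy H' (real (Suc m)) w < \<infinity>" using fin by (simp add: AE_all_countable)
  then show ?thesis
  proof eventually_elim
   case (elim w)
   have "energy H' t w <= energy H' (real (Suc (nat \<lceil>t\<rceil>))) w" for t by (rule energy_mono) linarith
   then show ?case using elim order_le_less_trans by blast
  qed
 qed
 have ha: "AE w in M. \<forall>t\<ge>0. set_integrable lborel {0..t} (%s. h (X s w) * (a s w)^2)"
  using finH jm_sec[OF jH']
 proof eventually_elim
  case (elim w)
  show ?case using energy_finite_integral(1)[OF elim(2)] elim(1) unfolding H'2 by blast
 qed
 define J where "J t w = pr (pr h) (X t w) - pr (pr h) x0 - (LBINT s:{0..t}. pr h (X s w) * b s w) - 1/2 * (LBINT s:{0..t}. h (X s w) * (a s w)^2)" for t w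
 have "AE w in M. \<forall>n. \<forall>t\<ge>0. set_integrable lborel {0..t} (%s. pr (g n) (X s w) * b s w)"
  using pr_b_integrable[OF gi] by (simp add: AE_all_countable)
 moreover have "AE w in M. \<forall>n. \<forall>t\<ge>0. set_integrable lborel {0..t} (%s. g n (X s w) * (a s w)^2)"
  using ga by (simp add: AE_all_countable)
 ultimately have conv: "AE w in M. (%n. In n t w) ----> J t w" if t: "0 <= t" for t
  using pr_b_integrable[OF hi] ha b_integrable
 proof eventually_elim
  case (elim w)
  have bi: "set_integrable lborel {0..t} (%s. b s w)" using elim t by auto
  have pgi: "set_integrable lborel {0..t} (%s. pr (g n) (X s w) * b s w)" for n using elim(1) t by blast
  have phi: "set_integrable lborel {0..t} (%s. pr h (X s w) * b s w)" using elim(3) t by blast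
  have gai: "set_integrable lborel {0..t} (%s. g n (X s w) * (a s w)^2)" for n using elim(2) t by blast
  have hai: "set_integrable lborel {0..t} (%s. h (X s w) * (a s w)^2)" using elim(4) t by blast
  have \<delta>c: "(%n. c * \<delta> n) ----> 0" for c using tendsto_mult_right_zero[OF \<delta>] .
  have pp: "(%n. pr (pr (g n)) x) ----> pr (pr h) x" for x
   by (rule LIM_zero_cancel, rule Lim_null_comparison[OF _ \<delta>c[of "\<beta> - \<alpha>"]])
    (use prim_diff_bound(2)[OF gi hi ab] in \<open>auto simp: \<delta>_def\<close>)
  have pb: "(%n. LBINT s:{0..t}. pr (g n) (X s w) * b s w) ----> (LBINT s:{0..t}. pr h (X s w) * b s w)"
  proof (rule LIM_zero_cancel, rule Lim_null_comparison[OF always_eventually \<delta>c], rule allI)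
   fix n
   note di = set_integral_diff[OF pgi phi]
   have "norm ((LBINT s:{0..t}. pr (g n) (X s w) * b s w) - (LBINT s:{0..t}. pr h (X s w) * b s w)) <= (LBINT s:{0..t}. norm (pr (g n) (X s w) * b s w - pr h (X s w) * b s w))"
    unfolding di(2)[symmetric] by (rule set_integral_norm_bound[OF di(1)])
   also have "\<dots> <= (LBINT s:{0..t}. \<bar>b s w\<bar> * \<delta> n)"
   proof (rule set_integral_mono)
    show "set_integrable lborel {0..t} (%s. norm (pr (g n) (X s w) * b s w - pr h (X s w) * b s w))" using set_integrable_abs[OF di(1)] by simp
    show "set_integrable lborel {0..t} (%s. \<bar>b s w\<bar> * \<delta> n)" using set_integrable_abs[OF bi] by auto
    fix s
    have "\<bar>pr (g n) (X s w) - pr h (X s w)\<bar> <= \<delta> n" unfolding \<delta>_def by (rule prim_diff_bound(1)[OF gi hi ab])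
    from mult_left_mono[OF this abs_ge_zero[of "b s w"]] show "norm (pr (g n) (X s w) * b s w - pr h (X s w) * b s w) <= \<bar>b s w\<bar> * \<delta> n"
     by (simp add: abs_mult[symmetric] right_diff_distrib mult.commute)
   qed
   finally show "norm ((LBINT s:{0..t}. pr (g n) (X s w) * b s w) - (LBINT s:{0..t}. pr h (X s w) * b s w)) <= (LBINT s:{0..t}. \<bar>b s w\<bar>) * \<delta> n" by simp
  qed
  have pa: "(%n. LBINT s:{0..t}. g n (X s w) * (a s w)^2) ----> (LBINT s:{0..t}. h (X s w) * (a s w)^2)"
   by (rule set_integral_dominated[OF hai gai]) (use g0 gh in \<open>auto simp: abs_mult intro!: tendsto_intros lim mult_right_mono\<close>)
  show ?case unfolding In_def K_def J_def by (intro tendsto_intros pp pb pa)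
 qed
 have "SI (%s w. pr h (X s w) * a s w) J"
 proof (rule SI_AE_limit[OF SIn])
  show "jm (%s w. pr h (X s w) * a s w)" by (intro jm_mult a_jm jm_comp[OF X_jm] pr_borel hi)
  show "AE w in M. continuous_on {0..} (%t. J t w)"
   using X_continuous pr_b_integrable[OF hi] ha
  proof eventually_elim
   case (elim w)
   have "continuous_on {0..} (%t. pr (pr h) (X t w))"
    by (rule continuous_on_compose2[OF continuous_on_prim[OF prim_integrable[OF hi ab] ab] elim(1), of UNIV]) auto
   then show ?case unfolding J_def
    by (intro continuous_intros indefinite_integral_continuous) (use elim in auto)
  qed
  fix t :: real assume t: "0 <= t"
  show "AE w in M. (%n. energy (%s w. pr (g n) (X s w) * a s w - pr h (X s w) * a s w) t w) ----> 0"
   using jm_sec[OF a_jm] SI_energy_finite[OF SI_I]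
  proof eventually_elim
   case (elim w)
   have "(%n. ennreal (\<delta> n)) ----> ennreal 0" by (rule tendsto_ennrealI[OF \<delta>])
   then have "(%n. ennreal (\<delta> n) * ennreal (\<delta> n) * energy a t w) ----> 0 * 0 * energy a t w"
    using elim(2)[rule_format, of t] by (intro tendsto_mult_ennreal tendsto_const) auto
   then have L: "(%n. ennreal (\<delta> n) * ennreal (\<delta> n) * energy a t w) ----> 0" by simp
   show ?case
   proof (rule ennreal_squeeze_0[OF L])
    fix n
    have "sup_norm (%s w. pr (g n) (X s w) - pr h (X s w)) t w <= ennreal (\<delta> n)"
     unfolding sup_norm_le_iff[OF \<delta>0] unfolding \<delta>_def by (intro ballI prim_diff_bound(1)[OF gi hi ab])
    then show "energy (%s w. pr (g n) (X s w) * a s w - pr h (X s w) * a s w) t w <= ennreal (\<delta> n) * ennreal (\<delta> n) * energy a t w"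
     unfolding left_diff_distrib[symmetric] by (intro order_trans[OF energy_mult_le[OF elim(1)]] mult_mono) auto
   qed
  qed
 qed (rule conv)
 then show ?thesis unfolding ito_for_def J_def[abs_def] using hb hi ha by blast
qed

lemma bounded_set_integrable:
 fixes g :: "real => real"
 assumes "g \<in> borel_measurable borel" "!!x. \<bar>g x\<bar> <= C"
 shows "set_integrable lborel {\<alpha>..\<beta>} g"
 unfolding set_integrable_def
 by (rule Bochner_Integration.integrable_bound[OF set_integrable_continuous[of "%_. C", unfolded set_integrable_def]])
  (use assms in \<open>auto simp: indicator_def intro: order_trans[OF _ abs_ge_self]\<close>)

text \<open>A Dynkin argument over open half-lines, whose indicators are increasing limits of
  continuous ramps. Complements use linearity, and countable disjoint unions use the monotone limit
  again.\<close>

lemma ito_for_indicator: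
 assumes A: "A \<in> sets borel" shows "ito_for (indicator A)"
proof -
 have lin: "ito_for (%x. c * g x + d * h x)" if "ito_for g" "ito_for h" for c d :: real and g h using ito_for_linear[OF that] .
 have "{a<..} \<inter> {b<..} = {max a b<..}" for a b :: real by auto
 then have "Int_stable (range greaterThan :: real set set)" by (auto simp: Int_stable_def)
 moreover have "range greaterThan \<subseteq> Pow (UNIV :: real set)" by simp
 moreover have "A \<in> sigma_sets UNIV (range greaterThan)" using A unfolding borel_Ioi by simp
 ultimately show ?thesis
 proof (induction rule: sigma_sets_induct_disjoint)
  case (basic A)
  then obtain c where A: "A = {c<..}" by auto
  show ?case unfolding A
  proof (rule ito_for_limit[where g="%n x. min 1 (real n * max 0 (x - c))"])
   show "ito_for (%x. min 1 (real n * max 0 (x - c)))" for n by (intro ito_for_continuous continuous_intros)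
   fix x
   show "min 1 (real n * max 0 (x - c)) <= min 1 (real (Suc n) * max 0 (x - c))" for n
    by (intro min.mono order_refl mult_right_mono) auto
   show "(%n. min 1 (real n * max 0 (x - c))) ----> indicator {c<..} x"
   proof (cases "x <= c")
    case True
    then show ?thesis using True by simp
   next
    case False
    have "\<forall>\<^sub>F n in sequentially. 1 / (x - c) <= real n" by (rule eventually_ge_real)
    then have "\<forall>\<^sub>F n in sequentially. min 1 (real n * max 0 (x - c)) = indicator {c<..} x"
     by eventually_elim (use False in \<open>auto simp: divide_le_eq\<close>)
    then show ?thesis by (rule tendsto_eventually)
   qed
  qed (auto intro: bounded_set_integrable[where C=1])
 next
  case empty
  show ?case using ito_for_continuous[of "%_. 0"] by (simp add: fun_eq_iff)
 next
  case (compl A)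
  have "(%x. 1 * (%_. 1) x + - 1 * indicator A x) = (indicator (UNIV - A) :: real => real)"
   by (auto simp: fun_eq_iff indicator_def)
  then show ?case using lin[OF ito_for_continuous[of "%_. 1"] compl.IH, of 1 "-1"] by simp
 next
  case (union A)
  have fin: "ito_for (indicator (\<Union>i<n. A i))" for n
  proof (induction n)
   case 0
   then show ?case using ito_for_continuous[of "%_. 0"] by (simp add: fun_eq_iff)
  next
   case (Suc n)
   have "(%x. 1 * indicator (\<Union>i<n. A i) x + 1 * indicator (A n) x) = (indicator (\<Union>i<Suc n. A i) :: real => real)"
   proof
    fix x
    have "\<not> (x \<in> (\<Union>i<n. A i) \<and> x \<in> A n)" using union.hyps(1) unfolding disjoint_family_on_def
      by (metis IntI UNIV_I UN_E empty_iff lessThan_iff less_irrefl)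
    then show "1 * indicator (\<Union>i<n. A i) x + 1 * indicator (A n) x = (indicator (\<Union>i<Suc n. A i) x :: real)"
     by (auto simp: indicator_def lessThan_Suc)
   qed
   then show ?case using lin[OF Suc union.IH[of n], of 1 1] by simp
  qed
  have b: "(\<Union>i. A i) \<in> sets borel" using union.hyps(2) unfolding borel_Ioi by (auto intro: sigma_sets.Union)
  show ?case
  proof (rule ito_for_limit[OF fin])
   show "indicator (\<Union>i<n. A i) x <= (indicator (\<Union>i<Suc n. A i) x :: real)" for n x
    by (auto simp: indicator_def less_Suc_eq)
   show "(%n. indicator (\<Union>i<n. A i) x :: real) ----> indicator (\<Union>i. A i) x" for x
    by (rule LIMSEQ_indicator_UN)
  qed (use b in \<open>auto intro: bounded_set_integrable[where C=1]\<close>)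
 qed
qed

text \<open>The induction runs over the implication from integrability to the formula;
  \<open>dom\<close> passes integrability down to the smaller functions that build
  \<open>g\<close>.\<close>

lemma ito_for_nonneg:
 assumes "g \<in> borel_measurable borel" "!!x. 0 <= g x" and gi: "set_integrable lborel {\<alpha>..\<beta>} g"
 shows "ito_for g"
proof -
 have dom: "set_integrable lborel {\<alpha>..\<beta>} u" if "set_integrable lborel {\<alpha>..\<beta>} v" "u \<in> borel_measurable borel" "!!x. 0 <= u x" "!!x. u x <= v x" for u v :: "real => real"
  unfolding set_integrable_def
  by (rule Bochner_Integration.integrable_bound[OF that(1)[unfolded set_integrable_def]])
   (use that in \<open>auto simp: indicator_def intro: order_trans[OF _ abs_ge_self]\<close>)
 from assms(1,2) have "set_integrable lborel {\<alpha>..\<beta>} g --> ito_for g"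
 proof (induction rule: borel_measurable_induct_real)
  case (set A) then show ?case using ito_for_indicator by auto
 next
  case (mult u c)
  show ?case
  proof (cases "c = 0")
   case True
   then show ?thesis using ito_for_continuous[of "%_. 0"] by simp
  next
   case False
   show ?thesis
   proof
    assume "set_integrable lborel {\<alpha>..\<beta>} (%x. c * u x)"
    then have "set_integrable lborel {\<alpha>..\<beta>} (%x. 1/c * (c * u x))" by (intro set_integrable_mult_right) auto
    then have "ito_for u" using mult.IH False by simp
    from ito_for_linear[OF this this, of c 0] show "ito_for (%x. c * u x)" by simp
   qed
  qed
 next
  case (add u v)
  show ?case
  proof
   assume i: "set_integrable lborel {\<alpha>..\<beta>} (%x. v x + u x)"
   have "ito_for u" "ito_for v" using add dom[OF i] by auto
   from ito_for_linear[OF this(2,1), of 1 1] show "ito_for (%x. v x + u x)" by simp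
  qed
 next
  case (seq U)
  show ?case
  proof
   assume i: "set_integrable lborel {\<alpha>..\<beta>} g"
   have lim: "(%i. U i x) ----> g x" for x using seq by simp
   have inc: "incseq (%i. U i x)" for x using \<open>incseq U\<close> by (auto simp: incseq_def le_fun_def)
   have "U j x <= g x" for j x by (rule incseq_le[OF inc lim])
   then have it: "ito_for (U j)" for j using seq dom[OF i] by auto
   show "ito_for g"
    by (rule ito_for_limit[OF it seq(2) _ lim _ i]) (use inc borel_measurable_LIMSEQ_real[OF lim seq(1)] in \<open>auto simp: incseq_Suc_iff\<close>)
  qed
 qed
 then show ?thesis using gi by blast
qed

lemma ito_for_integrable:
 assumes [measurable]: "g \<in> borel_measurable borel" and gi: "set_integrable lborel {\<alpha>..\<beta>} g"
 shows "ito_for g"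
proof -
 have pn: "set_integrable lborel {\<alpha>..\<beta>} (%x. max 0 (g x))" "set_integrable lborel {\<alpha>..\<beta>} (%x. max 0 (- g x))"
  unfolding set_integrable_def
  by (rule Bochner_Integration.integrable_bound[OF gi[unfolded set_integrable_def]], auto simp: indicator_def)+
 from ito_for_linear[OF ito_for_nonneg[OF _ _ pn(1)] ito_for_nonneg[OF _ _ pn(2)], of 1 "-1"]
 have "ito_for (%x. 1 * max 0 (g x) + - 1 * max 0 (- g x))" by simp
 moreover have "(%x. 1 * max 0 (g x) + - 1 * max 0 (- g x)) = g" by (auto simp: fun_eq_iff)
 ultimately show ?thesis by simp
qed

end

section \<open>Stopping at a level of an increasing path, realised by Riemann sums\<close>

lemma rs_step:
 assumes s: "0 <= \<sigma>" and t: "0 <= t" and f: "continuous_on {0..} f"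
 shows "(%n. rs (%u. if u <= \<sigma> then 1 else 0) f n t) ----> f (min t \<sigma>) - f 0"
proof -
 \<comment> \<open>The largest index of a dyadic time not after \<open>\<sigma>\<close>; the sum
   telescopes up to the dyadic time with index \<open>Suc (k n)\<close>, which tends to
   \<open>\<sigma>\<close> from the right.\<close>
 define k where "k n = nat \<lfloor>\<sigma> * 2 ^ n\<rfloor>" for n
 have dk: "dy n i <= \<sigma> \<longleftrightarrow> i <= k n" for n i
  unfolding dy_def k_def using s by (simp add: divide_le_eq le_nat_iff le_floor_iff)
 have tel: "(\<Sum>i<m. (if i <= k then 1 else 0) * (h (Suc i) - h i)) = h (min m (Suc k)) - (h 0 :: real)" for m k h
 proof (induction m)
  case (Suc m)
  show ?case
  proof (cases "m <= k")
   case True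
   then have "min m (Suc k) = m" "min (Suc m) (Suc k) = Suc m" by auto
   then show ?thesis using Suc True by simp
  next
   case False
   then have "min m (Suc k) = Suc k" "min (Suc m) (Suc k) = Suc k" by auto
   then show ?thesis using Suc False by simp
  qed
 qed simp
 have rs: "rs (%u. if u <= \<sigma> then 1 else 0) f n t = f (min t (dy n (min (n * 2 ^ n) (Suc (k n))))) - f 0" for n
  unfolding rs_def dk tel[where h="%i. f (min t (dy n i))"] using t by simp
 have "(%n. min t (dy n (min (n * 2 ^ n) (Suc (k n))))) ----> min t \<sigma>"
 proof (rule tendsto_min[OF tendsto_const tendsto_sandwich])
  show "\<forall>\<^sub>F n in sequentially. \<sigma> <= dy n (min (n * 2 ^ n) (Suc (k n)))"
   using eventually_ge_real[of \<sigma>]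
  proof eventually_elim
   case (elim n)
   have "\<sigma> < dy n (Suc (k n))" using dk[of n "Suc (k n)"] by simp
   then show ?case using elim by (simp add: min_def dy_last)
  qed
  show "\<forall>\<^sub>F n in sequentially. dy n (min (n * 2 ^ n) (Suc (k n))) <= \<sigma> + 1 / 2 ^ n"
  proof (intro always_eventually allI)
   fix n
   have "dy n (min (n * 2 ^ n) (Suc (k n))) <= dy n (Suc (k n))" unfolding dy_def by (intro divide_right_mono) auto
   also have "\<dots> <= \<sigma> + 1 / 2 ^ n" unfolding dy_Suc using dk by simp
   finally show "dy n (min (n * 2 ^ n) (Suc (k n))) <= \<sigma> + 1 / 2 ^ n" .
  qed
  show "(%n. \<sigma> + 1 / 2 ^ n) ----> \<sigma>" using LIMSEQ_divide_realpow_zero[of 2 1] tendsto_add[OF tendsto_const, of _ 0 _ \<sigma>] by simp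
 qed auto
 then have "(%n. f (min t (dy n (min (n * 2 ^ n) (Suc (k n)))))) ----> f (min t \<sigma>)"
  by (rule continuous_on_tendsto_compose[OF f]) (use s t in auto)
 then show ?thesis unfolding rs by (intro tendsto_diff tendsto_const)
qed

text \<open>Time frozen when \<open>L\<close> first exceeds \<open>\<eta>\<close>, defined path by
  path. The case distinction keeps \<open>Sup\<close> away from unbounded sets. The stopped integral
  will be the integral with the indicator of \<open>L s <= \<eta>\<close> inserted, so no
  stopping-time property of the freezing time has to be shown.\<close>

definition clock :: "(real => real) => real => real => real" where
 "clock L \<eta> t = (if \<forall>s\<ge>0. L s <= \<eta> then t else min t (Sup {s. 0 <= s \<and> L s <= \<eta>}))"

locale increasing_path =
 fixes L :: "real => real" and \<eta> :: real
 assumes mono: "!!s t. 0 <= s ==> s <= t ==> L s <= L t" and cont: "continuous_on {0..} L" and L0: "L 0 <= \<eta>"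
begin

lemma clock_cases:
 obtains "!!s. 0 <= s ==> L s <= \<eta>" "clock L \<eta> = (%t. t)"
 | \<sigma> where "0 <= \<sigma>" "!!s. 0 <= s ==> L s <= \<eta> \<longleftrightarrow> s <= \<sigma>" "clock L \<eta> = (%t. min t \<sigma>)"
proof (cases "\<forall>s\<ge>0. L s <= \<eta>")
 case True
 show ?thesis by (rule that(1)) (use True in \<open>auto simp: clock_def\<close>)
next
 case False
 then obtain u where u: "0 <= u" "\<not> L u <= \<eta>" by blast
 define E where "E = {s. 0 <= s \<and> L s <= \<eta>}"
 have ub: "s <= u" if "s \<in> E" for s using mono[of u s] u that unfolding E_def by force
 have E0: "0 \<in> E" unfolding E_def using L0 by simp
 have "closed ({0..} \<inter> L -` {..\<eta>})" by (rule continuous_closed_preimage[OF cont]) auto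
 moreover have "E = {0..} \<inter> L -` {..\<eta>}" unfolding E_def by auto
 ultimately have "closed E" by simp
 then have S: "Sup E \<in> E" using E0 ub by (intro closed_contains_Sup) (auto simp: bdd_above_def)
 have le: "s <= Sup E" if "s \<in> E" for s using that ub by (intro cSup_upper) (auto simp: bdd_above_def)
 show ?thesis
 proof (rule that(2)[of "Sup E"])
  show "0 <= Sup E" using S unfolding E_def by simp
  show "L s <= \<eta> \<longleftrightarrow> s <= Sup E" if "0 <= s" for s
   using le[of s] S mono[OF that, of "Sup E"] that unfolding E_def by force
  show "clock L \<eta> = (%t. min t (Sup E))" unfolding clock_def E_def by (simp only: False if_False)
 qed
qed

lemma clock:
 shows "continuous_on A (clock L \<eta>)" and "0 <= t ==> 0 <= clock L \<eta> t" and "0 <= t ==> L (clock L \<eta> t) <= \<eta>"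
  and "0 <= t ==> L t <= \<eta> ==> clock L \<eta> t = t"
proof -
 show "continuous_on A (clock L \<eta>)" by (cases rule: clock_cases) (simp_all add: continuous_intros)
 show "0 <= clock L \<eta> t" "L (clock L \<eta> t) <= \<eta>" if t: "0 <= t"
  by (cases rule: clock_cases, simp_all add: t)+
 show "clock L \<eta> t = t" if "0 <= t" "L t <= \<eta>"
  by (cases rule: clock_cases) (use that in simp_all)
qed

lemma clock_riemann:
 assumes f: "continuous_on {0..} f" and t: "0 <= t"
 shows "(%n. rs (%u. if L u <= \<eta> then 1 else 0) f n t) ----> f (clock L \<eta> t) - f 0"
proof (cases rule: clock_cases)
 case 1
 have "rs (%u. if L u <= \<eta> then 1 else 0) f n t = rs (%u. 1) f n t" for n unfolding rs_def by (simp add: 1(1))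
 moreover have "\<forall>\<^sub>F n in sequentially. rs (%u. 1) f n t = f t - f 0"
  using eventually_ge_real[of t] by eventually_elim (use dyadic_telescope[OF t] in \<open>simp add: rs_def\<close>)
 ultimately show ?thesis using 1(2) by (simp add: tendsto_eventually)
next
 case (2 \<sigma>)
 have "rs (%u. if L u <= \<eta> then 1 else 0) f n t = rs (%u. if u <= \<sigma> then 1 else 0) f n t" for n
  unfolding rs_def by (simp add: 2(2))
 then show ?thesis using rs_step[OF 2(1) t f] 2(3) by simp
qed

text \<open>For an increasing continuous path the times with \<open>L u <= \<eta>\<close> form an
  initial interval closed at its right end, so the indicator is left-continuous.\<close>

lemma clock_stp:
 assumes s: "0 < s" shows "(%n. stp (%u. if L u <= \<eta> then 1 else 0) n s) ----> (if L s <= \<eta> then 1 else 0)"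
proof (rule stp_tendsto[OF s])
 have "\<forall>\<^sub>F u in at_left s. (if L u <= \<eta> then 1 else 0 :: real) = (if L s <= \<eta> then 1 else 0)"
 proof (cases "L s <= \<eta>")
  case True
  have "\<forall>\<^sub>F u in at_left s. 0 < u \<and> u < s" using s by (auto simp: eventually_at_left_field)
  then show ?thesis
  proof eventually_elim
   case (elim u)
   then have "L u <= L s" by (intro mono) auto
   then show ?case using True by simp
  qed
 next
  case False
  have "(L \<longlongrightarrow> L s) (at_left s)" using continuous_on_at_left[OF cont s] by (simp add: continuous_within)
  then have "\<forall>\<^sub>F u in at_left s. \<eta> < L u" using False by (intro order_tendstoD) auto
  then show ?thesis by eventually_elim (use False in auto)
 qed
 then show "continuous (at_left s) (%u. if L u <= \<eta> then 1 else 0 :: real)"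
  unfolding continuous_within by (rule tendsto_eventually)
qed

end

lemma prim_cutoff: "prim \<alpha> \<beta> (%v. indicator {..y} v * f v) x = prim \<alpha> \<beta> f (min x y)"
 unfolding prim_def set_lebesgue_integral_def by (rule Bochner_Integration.integral_cong) (auto simp: indicator_def)

lemma prim_tail:
 assumes "\<alpha> <= y" "x <= \<beta>" shows "prim \<alpha> \<beta> (indicator {y<..}) x = max 0 (x - y)"
proof -
 have "prim \<alpha> \<beta> (indicator {y<..}) x = (LINT v|lborel. indicator {y<..x} v)"
  unfolding prim_def set_lebesgue_integral_def using assms
  by (intro Bochner_Integration.integral_cong) (auto simp: indicator_def)
 then show ?thesis by (auto simp: max_def)
qed

lemma prim_ramp:
 assumes "\<alpha> <= y" "x <= \<beta>" "0 < e" shows "prim \<alpha> \<beta> (%v. 1/e * indicator {y<..y+e} v) x = max 0 (min 1 ((x - y)/e))"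
proof -
 have "prim \<alpha> \<beta> (%v. 1/e * indicator {y<..y+e} v) x = (LINT v|lborel. 1/e * indicator {y<..min x (y+e)} v)"
  unfolding prim_def set_lebesgue_integral_def using assms
  by (intro Bochner_Integration.integral_cong) (auto simp: indicator_def)
 also have "\<dots> = 1/e * max 0 (min x (y + e) - y)" by (auto simp: max_def)
 also have "\<dots> = max 0 (min 1 ((x - y)/e))"
  using assms(3) by (cases "x <= y"; cases "x <= y + e") (auto simp: max_def min_def field_simps)
 finally show ?thesis .
qed

lemma ramp_tendsto: "(%n. max 0 (min 1 ((x - y) / (1 / real (Suc n))))) ----> indicator {y<..} x"
proof (cases "x <= y")
 case True
 then have "(x - y) / (1 / real (Suc n)) <= 0" for n by (intro divide_nonpos_nonneg) auto
 then have "max 0 (min 1 ((x - y) / (1 / real (Suc n)))) = 0" for n by (meson max.absorb1 min.coboundedI2)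
 then show ?thesis using True by simp
next
 case False
 have "\<forall>\<^sub>F n in sequentially. 1 / (x - y) <= real n" by (rule eventually_ge_real)
 then have "\<forall>\<^sub>F n in sequentially. max 0 (min 1 ((x - y) / (1 / real (Suc n)))) = indicator {y<..} x"
  by eventually_elim (use False in \<open>auto simp: divide_le_eq algebra_simps\<close>)
 then show ?thesis by (rule tendsto_eventually)
qed

section \<open>Local time\<close>

text \<open>Here \<open>q\<close> stands for \<open>2 \<mu> / \<sigma>^2\<close>, so
  \<open>drift\<close> expresses the relation between the two coefficients of the equation, and
  \<open>\<rho>_eq\<close> is the integrated form of the equation
  \<open>\<rho>' = - q \<rho>\<close> for the scale density.\<close>

locale bounded_local_time = bounded_ito +
 fixes y :: real and Iy \<Lambda> :: "real => 'a => real" and q \<rho> :: "real => real"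
 assumes y_range: "\<alpha> < y" "y < \<beta>"
  and SI_sgn: "SI (%s w. sgn_left (X s w - y) * a s w) Iy"
  and tanaka: "AE w in M. \<forall>t\<ge>0. \<Lambda> t w = \<bar>X t w - y\<bar> - \<bar>x0 - y\<bar> - ((LBINT s:{0..t}. sgn_left (X s w - y) * b s w) + Iy t w)"
  and drift: "AE w in M. \<forall>s\<ge>0. b s w = 1/2 * q (X s w) * (a s w)^2"
  and \<rho>_pos: "!!x. 0 < \<rho> x" and \<rho>_borel: "\<rho> \<in> borel_measurable borel"
  and q_borel: "q \<in> borel_measurable borel" and q_integrable: "set_integrable lborel {\<alpha>..\<beta>} (%v. q v * \<rho> v)"
  and \<rho>_integrable: "set_integrable lborel {\<alpha>..\<beta>} \<rho>"
  and \<rho>_eq: "!!x. x \<in> {\<alpha>..\<beta>} ==> \<rho> x = \<rho> \<alpha> - pr (%v. q v * \<rho> v) x"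
begin

lemma sgn_left_eq: "sgn_left (x - y) = 2 * indicator {y<..} x - 1"
 by (simp add: sgn_left_def indicator_def)

lemma sgn_borel: "(%x. sgn_left (x - y)) \<in> borel_measurable borel"
 unfolding sgn_left_eq by measurable

lemma sgn_b_integrable: "AE w in M. \<forall>t\<ge>0. set_integrable lborel {0..t} (%s. sgn_left (X s w - y) * b s w)"
 by (rule composed_integrable[OF sgn_borel _ b_jm b_integrable, of 1]) (simp add: sgn_left_def)

lemma local_time_continuous: "AE w in M. continuous_on {0..} (%t. \<Lambda> t w)"
 using tanaka X_continuous sgn_b_integrable SI_cont[OF SI_sgn]
proof eventually_elim
 case (elim w)
 have "continuous_on {0..} (%t. \<bar>X t w - y\<bar> - \<bar>x0 - y\<bar> - ((LBINT s:{0..t}. sgn_left (X s w - y) * b s w) + Iy t w))"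
  by (intro continuous_intros elim indefinite_integral_continuous) (use elim in auto)
 then show ?case by (rule continuous_on_eq) (use elim in auto)
qed

text \<open>\<open>ramp k\<close> tends to the Dirac mass at \<open>y\<close>.\<close>

definition ramp :: "nat => real => real" where
 "ramp k v = 1 / (1 / real (Suc k)) * indicator {y<..y + 1 / real (Suc k)} v"

lemma ramp_borel: "ramp k \<in> borel_measurable borel"
 unfolding ramp_def[abs_def] by measurable

lemma ramp_integrable: "set_integrable lborel {\<alpha>..\<beta>} (ramp k)"
 by (rule bounded_set_integrable[OF ramp_borel, of _ "real (Suc k)"]) (simp add: ramp_def indicator_def)

lemma prim_ramp_eq: "x <= \<beta> ==> pr (ramp k) x = max 0 (min 1 ((x - y) / (1 / real (Suc k))))"
 unfolding ramp_def[abs_def] by (rule prim_ramp) (use y_range in auto)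

lemma prim_ramp_tendsto: "x <= \<beta> ==> (%k. pr (ramp k) x) ----> indicator {y<..} x"
 using ramp_tendsto by (simp add: prim_ramp_eq)

lemma prim_prim_ramp_tendsto: "x <= \<beta> ==> (%k. pr (pr (ramp k)) x) ----> max 0 (x - y)"
proof -
 assume x: "x <= \<beta>"
 have "(%k. pr (pr (ramp k)) x) ----> pr (indicator {y<..}) x"
  unfolding prim_def[of _ _ "prim _ _ _"] prim_def[of _ _ "indicator _"] set_lebesgue_integral_def
 proof (rule integral_dominated_convergence[where w="%v. indicator {\<alpha>..\<beta>} v *\<^sub>R (1::real)"])
  show "(%v. indicator {\<alpha>..min \<beta> x} v *\<^sub>R pr (ramp k) v) \<in> borel_measurable lborel" for k
   using pr_borel[OF ramp_integrable] by measurable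
  show "integrable lborel (%v. indicator {\<alpha>..\<beta>} v *\<^sub>R (1::real))"
   using set_integrable_continuous[of "%_. 1"] unfolding set_integrable_def by simp
  show "AE v in lborel. (%k. indicator {\<alpha>..min \<beta> x} v *\<^sub>R pr (ramp k) v) ----> indicator {\<alpha>..min \<beta> x} v *\<^sub>R indicator {y<..} v"
   by (intro AE_I2) (auto simp: indicator_def[of "{\<alpha>..min \<beta> x}"] intro: prim_ramp_tendsto)
  show "AE v in lborel. norm (indicator {\<alpha>..min \<beta> x} v *\<^sub>R pr (ramp k) v) <= indicator {\<alpha>..\<beta>} v *\<^sub>R 1" for k
   by (intro AE_I2) (auto simp: indicator_def prim_ramp_eq)
 qed measurable
 then show ?thesis using x y_range by (simp add: prim_tail)
qed

lemma SI_upper: "SI (%s w. indicator {y<..} (X s w) * a s w) (%t w. 1/2 * Iy t w + 1/2 * I t w)"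
 by (rule SI_cong[OF SI_add[OF SI_scale[OF SI_sgn, of "1/2"] SI_scale[OF SI_I, of "1/2"]]])
  (simp_all add: sgn_left_eq algebra_simps)

text \<open>Half the sum of Tanaka's formula and the equation for \<open>X\<close>: this replaces
  \<open>\<bar>x - y\<bar>\<close> by its positive-part version and \<open>sgn_left\<close> by an
  indicator.\<close>

lemma tanaka_upper:
 "AE w in M. \<forall>t\<ge>0. 1/2 * Iy t w + 1/2 * I t w =
   max 0 (X t w - y) - max 0 (x0 - y) - (LBINT s:{0..t}. indicator {y<..} (X s w) * b s w) - 1/2 * \<Lambda> t w"
 using tanaka X_eq sgn_b_integrable b_integrable
proof eventually_elim
 case (elim w)
 show ?case
 proof (intro allI impI)
  fix t :: real assume t: "0 <= t"
  have "(LBINT s:{0..t}. indicator {y<..} (X s w) * b s w) = (LBINT s:{0..t}. 1/2 * (sgn_left (X s w - y) * b s w) + 1/2 * b s w)"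
   unfolding sgn_left_eq by (rule arg_cong[where f="set_lebesgue_integral lborel {0..t}"]) (simp add: fun_eq_iff algebra_simps)
  also have "\<dots> = 1/2 * (LBINT s:{0..t}. sgn_left (X s w - y) * b s w) + 1/2 * (LBINT s:{0..t}. b s w)"
   using elim(3,4) t by (subst set_integral_add(2)) auto
  finally have 1: "(LBINT s:{0..t}. indicator {y<..} (X s w) * b s w) =
   1/2 * (LBINT s:{0..t}. sgn_left (X s w - y) * b s w) + 1/2 * (LBINT s:{0..t}. b s w)" .
  have m: "max 0 z = 1/2 * \<bar>z\<bar> + 1/2 * z" for z :: real by (simp add: max_def)
  have "X t w = x0 + (LBINT s:{0..t}. b s w) + I t w" using elim(2) t by blast
  moreover have "\<Lambda> t w = \<bar>X t w - y\<bar> - \<bar>x0 - y\<bar> - ((LBINT s:{0..t}. sgn_left (X s w - y) * b s w) + Iy t w)"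
   using elim(1) t by blast
  ultimately show "1/2 * Iy t w + 1/2 * I t w =
    max 0 (X t w - y) - max 0 (x0 - y) - (LBINT s:{0..t}. indicator {y<..} (X s w) * b s w) - 1/2 * \<Lambda> t w"
   unfolding 1 m by argo
 qed
qed

text \<open>Ito's formula with second derivative \<open>ramp k\<close> is compared with Tanaka's
  formula: first primitives tend boundedly to the indicator of \<open>{y<..}\<close> and second ones
  to the positive part, so all other terms converge and the bracket term must tend to the local
  time. This gives access to the sign and support of local time, which Tanaka's formula
  hides.\<close>

lemma occupation:
 "\<exists>r. strict_mono (r :: nat => nat) \<and>
   (AE w in M. \<forall>t\<ge>0. (%n. LBINT s:{0..t}. ramp (r n) (X s w) * (a s w)^2) ----> \<Lambda> t w)"
proof -
 define J where "J k t w = pr (pr (ramp k)) (X t w) - pr (pr (ramp k)) x0 - (LBINT s:{0..t}. pr (ramp k) (X s w) * b s w) - 1/2 * (LBINT s:{0..t}. ramp k (X s w) * (a s w)^2)" for k t w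
 define D where "D k s w = pr (ramp k) (X s w) * a s w - indicator {y<..} (X s w) * a s w" for k s w
 have SIJ: "SI (%s w. pr (ramp k) (X s w) * a s w) (J k)" for k
  using ito_for_integrable[OF ramp_borel ramp_integrable] unfolding ito_for_def J_def[abs_def] by blast
 have SID: "SI (D k) (%t w. J k t w - (1/2 * Iy t w + 1/2 * I t w))" for k
  unfolding D_def[abs_def] by (rule SI_diff[OF SIJ SI_upper])
 have v: "vanishes (%k. sup_norm (%t w. J k t w - (1/2 * Iy t w + 1/2 * I t w)) t)" if t: "0 < t" for t
 proof (rule SI_vanishes[OF SID _ t], rule vanishes_AE)
  show "ae_measurable M (energy (D k) t)" for k by (rule jm_energy[OF SI_jm[OF SID]])
  have "AE w in M. \<forall>k. sec (D k) w" using jm_sec[OF SI_jm[OF SID]] by (simp add: AE_all_countable)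
  then show "AE w in M. (%k. energy (D k) t w) ----> 0"
   using jm_sec[OF a_jm] X_range SI_energy_finite[OF SI_I]
  proof eventually_elim
   case (elim w)
   show ?case
   proof (rule energy_dominated[of D w a])
    show "\<bar>D k s w\<bar> <= \<bar>a s w\<bar>" if "0 <= s" "s <= t" for k s
    proof -
     have "X s w <= \<beta>" using elim(3) that by auto
     then have "\<bar>pr (ramp k) (X s w) - indicator {y<..} (X s w)\<bar> <= 1"
      unfolding prim_ramp_eq[OF \<open>X s w <= \<beta>\<close>] by (simp add: indicator_def)
     then have "\<bar>pr (ramp k) (X s w) - indicator {y<..} (X s w)\<bar> * \<bar>a s w\<bar> <= 1 * \<bar>a s w\<bar>" by (rule mult_right_mono) simp
     then show ?thesis unfolding D_def by (simp add: abs_mult left_diff_distrib[symmetric])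
    qed
    show "AE s in lborel. s \<in> {0..t} --> (%k. D k s w) ----> 0"
    proof (intro AE_I2 impI)
     fix s assume "s \<in> {0..t}"
     then have "X s w <= \<beta>" using elim(3) by auto
     then have "(%k. D k s w) ----> indicator {y<..} (X s w) * a s w - indicator {y<..} (X s w) * a s w"
      unfolding D_def by (intro tendsto_intros prim_ramp_tendsto)
     then show "(%k. D k s w) ----> 0" by simp
    qed
   qed (use elim in blast)+
  qed
 qed
 from sup_norm_AE_subseq[OF v v] obtain r where r: "strict_mono (r :: nat => nat)"
  "AE w in M. \<forall>t\<ge>0. (%n. J (r n) t w - (1/2 * Iy t w + 1/2 * I t w)) ----> 0" by fastforce
 have pb: "AE w in M. \<forall>k. \<forall>t\<ge>0. set_integrable lborel {0..t} (%s. pr (ramp k) (X s w) * b s w)"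
  using pr_b_integrable[OF ramp_integrable] by (simp add: AE_all_countable)
 have "AE w in M. \<forall>t\<ge>0. (%n. LBINT s:{0..t}. ramp (r n) (X s w) * (a s w)^2) ----> \<Lambda> t w"
  using r(2) tanaka_upper X_range pb b_integrable
 proof eventually_elim
  case (elim w)
  show ?case
  proof (intro allI impI)
   fix t :: real assume t: "0 <= t"
   have bi: "set_integrable lborel {0..t} (%s. b s w)" using elim(5) t by blast
   have pbi: "set_integrable lborel {0..t} (%s. pr (ramp k) (X s w) * b s w)" for k using elim(4) t by blast
   have L: "(%k. LBINT s:{0..t}. pr (ramp k) (X s w) * b s w) ----> (LBINT s:{0..t}. indicator {y<..} (X s w) * b s w)"
   proof (rule set_integral_dominated[OF set_integrable_abs[OF bi] pbi])
    fix s k assume "s \<in> {0..t}"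
    then have "X s w <= \<beta>" using elim(3) by auto
    then show "(%k. pr (ramp k) (X s w) * b s w) ----> indicator {y<..} (X s w) * b s w" by (intro tendsto_intros prim_ramp_tendsto)
    have "\<bar>pr (ramp k) (X s w)\<bar> <= 1" using \<open>X s w <= \<beta>\<close> by (simp add: prim_ramp_eq)
    then have "\<bar>pr (ramp k) (X s w)\<bar> * \<bar>b s w\<bar> <= 1 * \<bar>b s w\<bar>" by (rule mult_right_mono) simp
    then show "\<bar>pr (ramp k) (X s w) * b s w\<bar> <= \<bar>b s w\<bar>" by (simp add: abs_mult)
   qed
   have Xt: "X t w <= \<beta>" using elim(3) t by auto
   have "(%n. 2 * (pr (pr (ramp (r n))) (X t w) - pr (pr (ramp (r n))) x0 - (LBINT s:{0..t}. pr (ramp (r n)) (X s w) * b s w) -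
      (1/2 * Iy t w + 1/2 * I t w) - (J (r n) t w - (1/2 * Iy t w + 1/2 * I t w)))) ---->
     2 * (max 0 (X t w - y) - max 0 (x0 - y) - (LBINT s:{0..t}. indicator {y<..} (X s w) * b s w) - (1/2 * Iy t w + 1/2 * I t w) - 0)"
    by (intro tendsto_intros LIMSEQ_subseq_LIMSEQ[OF L r(1), unfolded comp_def] elim(1)[rule_format, OF t]
      LIMSEQ_subseq_LIMSEQ[OF prim_prim_ramp_tendsto r(1), unfolded comp_def] Xt) (use x0_range in simp)
   moreover have "2 * (max 0 (X t w - y) - max 0 (x0 - y) - (LBINT s:{0..t}. indicator {y<..} (X s w) * b s w) - (1/2 * Iy t w + 1/2 * I t w) - 0) = \<Lambda> t w"
    using elim(2) t by simp
   ultimately show "(%n. LBINT s:{0..t}. ramp (r n) (X s w) * (a s w)^2) ----> \<Lambda> t w"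
    unfolding J_def by simp
  qed
 qed
 then show ?thesis using r(1) by blast
qed

text \<open>The occupation integrals have these properties because \<open>ramp\<close> is
  nonnegative and vanishes at \<open>y\<close> and below; they survive the limit.\<close>

lemma local_time_increasing:
 "AE w in M. \<Lambda> 0 w = 0 \<and> (\<forall>s t. 0 <= s --> s <= t --> \<Lambda> s w <= \<Lambda> t w) \<and>
   (\<forall>t\<ge>0. (\<forall>s\<in>{0..t}. X s w <= y) --> \<Lambda> t w = 0)"
proof -
 obtain r :: "nat => nat" where
  r: "AE w in M. \<forall>t\<ge>0. (%n. LBINT s:{0..t}. ramp (r n) (X s w) * (a s w)^2) ----> \<Lambda> t w" using occupation by blast
 have ii: "AE w in M. \<forall>k. \<forall>t\<ge>0. set_integrable lborel {0..t} (%s. ramp k (X s w) * (a s w)^2)"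
  using ito_for_integrable[OF ramp_borel ramp_integrable] unfolding ito_for_def by (simp add: AE_all_countable)
 show ?thesis using r ii
 proof eventually_elim
  case (elim w)
  note L = elim(1)[rule_format]
  have "\<Lambda> 0 w = 0" using L[of 0] by (simp add: set_integral_point LIMSEQ_const_iff)
  moreover have "\<Lambda> s w <= \<Lambda> t w" if "0 <= s" "s <= t" for s t
  proof (rule LIMSEQ_le[OF L L])
   have "(LBINT s:{0..s}. ramp (r n) (X s w) * (a s w)^2) <= (LBINT s:{0..t}. ramp (r n) (X s w) * (a s w)^2)" for n
    unfolding set_lebesgue_integral_def
   proof (rule integral_mono)
    show "integrable lborel (%u. indicator {0..s} u *\<^sub>R (ramp (r n) (X u w) * (a u w)^2))"
     "integrable lborel (%u. indicator {0..t} u *\<^sub>R (ramp (r n) (X u w) * (a u w)^2))"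
     using elim(2) that unfolding set_integrable_def by auto
    show "indicator {0..s} u *\<^sub>R (ramp (r n) (X u w) * (a u w)^2) <= indicator {0..t} u *\<^sub>R (ramp (r n) (X u w) * (a u w)^2)" for u
     using that by (auto simp: indicator_def ramp_def)
   qed
   then show "\<exists>N. \<forall>n\<ge>N. (LBINT s:{0..s}. ramp (r n) (X s w) * (a s w)^2) <= (LBINT s:{0..t}. ramp (r n) (X s w) * (a s w)^2)" by blast
  qed (use that in auto)
  moreover have "\<Lambda> t w = 0" if t: "0 <= t" "\<forall>s\<in>{0..t}. X s w <= y" for t
  proof -
   have "(LBINT s:{0..t}. ramp (r n) (X s w) * (a s w)^2) = (LBINT s:{0..t}. 0)" for n
   proof (rule set_lebesgue_integral_cong)
    have "ramp (r n) (X s w) = 0" if "s \<in> {0..t}" for s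
     using t(2)[rule_format, OF that] by (simp add: ramp_def)
    then show "\<forall>s. s \<in> {0..t} --> ramp (r n) (X s w) * (a s w)^2 = 0" by simp
   qed simp
   then show ?thesis using L[OF t(1)] by (simp add: LIMSEQ_const_iff)
  qed
  ultimately show ?case by blast
 qed
qed

text \<open>\<open>U\<close> is the scale function below \<open>y\<close>, normalised to vanish above \<open>y\<close>; its drift along \<open>X\<close> is
 carried by the local time at \<open>y\<close> only.\<close>

definition U :: "real => real" where "U x = pr \<rho> y - pr \<rho> (min x y)"

lemma U_nonneg: "0 <= U x" and U_le: "U x <= pr \<rho> y" and U_above: "y <= x ==> U x = 0"
proof -
 have mono: "pr \<rho> u <= pr \<rho> v" if "u <= v" for u v
  unfolding prim_def set_lebesgue_integral_def
 proof (rule integral_mono)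
  have "set_integrable lborel {\<alpha>..min \<beta> w} \<rho>" for w by (rule set_integrable_subset[OF \<rho>_integrable]) auto
  then have "integrable lborel (%x. indicator {\<alpha>..min \<beta> w} x *\<^sub>R \<rho> x)" for w unfolding set_integrable_def .
  then show "integrable lborel (%x. indicator {\<alpha>..min \<beta> u} x *\<^sub>R \<rho> x)" "integrable lborel (%x. indicator {\<alpha>..min \<beta> v} x *\<^sub>R \<rho> x)" by blast+
  show "indicator {\<alpha>..min \<beta> u} x *\<^sub>R \<rho> x <= indicator {\<alpha>..min \<beta> v} x *\<^sub>R \<rho> x" for x
   using that \<rho>_pos[of x] by (auto simp: indicator_def)
 qed
 have "0 <= pr \<rho> v" for v
  unfolding prim_def set_lebesgue_integral_def by (rule Bochner_Integration.integral_nonneg) (simp add: \<rho>_pos less_imp_le)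
 then show "0 <= U x" "U x <= pr \<rho> y" using mono[of "min x y" y] unfolding U_def by auto
 show "y <= x ==> U x = 0" unfolding U_def by (simp add: min_def)
qed

lemma continuous_U: "continuous_on A U"
 unfolding U_def by (intro continuous_intros continuous_on_compose2[OF continuous_on_prim[OF \<rho>_integrable ab, of UNIV]]) auto

text \<open>The absolutely continuous part of the second derivative of \<open>U\<close>. What
  remains is the jump of \<open>U'\<close> at \<open>y\<close>, of size \<open>\<rho> y\<close>,
  which Tanaka's formula turns into local time.\<close>

definition cutoff :: "real => real" where "cutoff v = indicator {..y} v * (q v * \<rho> v)"

lemma cut_borel: "cutoff \<in> borel_measurable borel"
 unfolding cutoff_def[abs_def] using q_borel \<rho>_borel by measurable

lemma cut_integrable: "set_integrable lborel {\<alpha>..\<beta>} cutoff"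
 using q_integrable unfolding set_integrable_def cutoff_def
 by (rule Bochner_Integration.integrable_bound) (use q_borel \<rho>_borel in \<open>auto simp: indicator_def\<close>)

lemma prim_cut: "x \<in> {\<alpha>..\<beta>} ==> pr cutoff x = \<rho> \<alpha> - \<rho> (min x y)"
 unfolding cutoff_def[abs_def] prim_cutoff using \<rho>_eq[of "min x y"] y_range by auto

lemma prim_prim_cut:
 assumes x: "x \<in> {\<alpha>..\<beta>}"
 shows "pr (pr cutoff) x = \<rho> \<alpha> * (x - \<alpha>) - pr \<rho> (min x y) - \<rho> y * max 0 (x - y)"
proof -
 have i1: "set_integrable lborel {\<alpha>..\<beta>} (%_. 1 :: real)" by (rule set_integrable_continuous) simp
 have i2: "set_integrable lborel {\<alpha>..\<beta>} (%v. indicator {..y} v * \<rho> v)"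
  using \<rho>_integrable unfolding set_integrable_def
  by (rule Bochner_Integration.integrable_bound) (use \<rho>_borel in \<open>auto simp: indicator_def\<close>)
 have i3: "set_integrable lborel {\<alpha>..\<beta>} (indicator {y<..} :: real => real)" by (rule bounded_set_integrable[of _ 1]) auto
 have i4: "set_integrable lborel {\<alpha>..\<beta>} (%v. \<rho> \<alpha> * 1 + - 1 * (indicator {..y} v * \<rho> v))"
  using i1 i2 by (intro set_integral_add(1) set_integrable_mult_right) auto
 have eq: "pr (pr cutoff) = pr (%v. 1 * (\<rho> \<alpha> * 1 + - 1 * (indicator {..y} v * \<rho> v)) + (- \<rho> y) * indicator {y<..} v)"
  by (rule prim_cong) (auto simp: prim_cut min_def indicator_def)
 have "pr (pr cutoff) x = 1 * (\<rho> \<alpha> * pr (%_. 1) x + - 1 * pr (%v. indicator {..y} v * \<rho> v) x) + (- \<rho> y) * pr (indicator {y<..}) x"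
  unfolding eq prim_linear[OF i4 i3] prim_linear[OF i1 i2] ..
 also have "pr (%_. 1) x = x - \<alpha>" using x by (simp add: prim_def set_lebesgue_integral_def)
 finally show ?thesis using x y_range by (simp add: prim_cutoff prim_tail)
qed

text \<open>By \<open>prim_prim_cut\<close>, \<open>U\<close> is, up to a constant, the second
  primitive of \<open>cutoff\<close> minus \<open>\<rho> \<alpha>\<close> times the identity plus
  \<open>\<rho> y\<close> times the positive part of \<open>x - y\<close>. The same combination is
  formed of Ito's formula, the equation for \<open>X\<close> and Tanaka's formula.\<close>

lemma SI_scale_local_time: "\<exists>K. SI K (%t w. U (X t w) - U x0 - 1/2 * \<rho> y * \<Lambda> t w)"
proof -
 have cutoff: "ito_for cutoff" by (rule ito_for_integrable[OF cut_borel cut_integrable])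
 have SIc: "SI (%s w. pr cutoff (X s w) * a s w)
   (%t w. pr (pr cutoff) (X t w) - pr (pr cutoff) x0 - (LBINT s:{0..t}. pr cutoff (X s w) * b s w) - 1/2 * (LBINT s:{0..t}. cutoff (X s w) * (a s w)^2))"
  using cutoff unfolding ito_for_def by blast
 have ci: "AE w in M. \<forall>t\<ge>0. set_integrable lborel {0..t} (%s. cutoff (X s w) * (a s w)^2)" using cutoff unfolding ito_for_def by blast
 have ui: "AE w in M. \<forall>t\<ge>0. set_integrable lborel {0..t} (%s. indicator {y<..} (X s w) * b s w)"
  by (rule composed_integrable[OF _ _ b_jm b_integrable, of _ 1]) auto
 have "SI (%s w. (pr cutoff (X s w) * a s w + - \<rho> \<alpha> * a s w) + \<rho> y * (indicator {y<..} (X s w) * a s w))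
   (%t w. U (X t w) - U x0 - 1/2 * \<rho> y * \<Lambda> t w)"
 proof (rule SI_cong[OF SI_add[OF SI_add[OF SIc SI_scale[OF SI_I, of "- \<rho> \<alpha>"]] SI_scale[OF SI_upper, of "\<rho> y"]]])
  show "AE w in M. \<forall>t\<ge>0. (pr (pr cutoff) (X t w) - pr (pr cutoff) x0 - (LBINT s:{0..t}. pr cutoff (X s w) * b s w) - 1/2 * (LBINT s:{0..t}. cutoff (X s w) * (a s w)^2) +
    - \<rho> \<alpha> * I t w) + \<rho> y * (1/2 * Iy t w + 1/2 * I t w) = U (X t w) - U x0 - 1/2 * \<rho> y * \<Lambda> t w"
   using tanaka_upper X_eq X_range drift ci ui pr_b_integrable[OF cut_integrable] b_integrable
  proof eventually_elim
   case (elim w)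
   show ?case
   proof (intro allI impI)
    fix t :: real assume t: "0 <= t"
    have b: "set_integrable lborel {0..t} (%s. b s w)" using elim(8) t by blast
    have pb: "set_integrable lborel {0..t} (%s. pr cutoff (X s w) * b s w)" using elim(7) t by blast
    have ub: "set_integrable lborel {0..t} (%s. indicator {y<..} (X s w) * b s w)" using elim(6) t by blast
    have ca: "set_integrable lborel {0..t} (%s. cutoff (X s w) * (a s w)^2)" using elim(5) t by blast
    \<comment> \<open>All drift terms cancel pointwise: below \<open>y\<close> the factor of
      \<open>b\<close> adds up to \<open>- \<rho>\<close>, which \<open>cutoff\<close> compensates
      by the form of the drift; above \<open>y\<close> the factor is 0 and \<open>cutoff\<close>
      vanishes.\<close>
    have "0 = (LBINT s:{0..t}. (pr cutoff (X s w) * b s w + 1/2 * (cutoff (X s w) * (a s w)^2)) + (\<rho> y * (indicator {y<..} (X s w) * b s w) - \<rho> \<alpha> * b s w))"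
    proof -
     have "(LBINT s:{0..t}. (pr cutoff (X s w) * b s w + 1/2 * (cutoff (X s w) * (a s w)^2)) + (\<rho> y * (indicator {y<..} (X s w) * b s w) - \<rho> \<alpha> * b s w)) = (LBINT s:{0..t}. 0)"
     proof (rule set_lebesgue_integral_cong)
      show "\<forall>s. s \<in> {0..t} --> (pr cutoff (X s w) * b s w + 1/2 * (cutoff (X s w) * (a s w)^2)) + (\<rho> y * (indicator {y<..} (X s w) * b s w) - \<rho> \<alpha> * b s w) = 0"
      proof (intro allI impI)
       fix s assume s: "s \<in> {0..t}"
       have Xs: "X s w \<in> {\<alpha>..\<beta>}" and bs: "b s w = 1/2 * q (X s w) * (a s w)^2" using elim(3,4) s by auto
       show "(pr cutoff (X s w) * b s w + 1/2 * (cutoff (X s w) * (a s w)^2)) + (\<rho> y * (indicator {y<..} (X s w) * b s w) - \<rho> \<alpha> * b s w) = 0"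
        by (cases "X s w <= y") (simp_all add: bs prim_cut[OF Xs] cutoff_def min_def field_simps)
      qed
     qed simp
     then show ?thesis by simp
    qed
    also have "\<dots> = (LBINT s:{0..t}. pr cutoff (X s w) * b s w) + 1/2 * (LBINT s:{0..t}. cutoff (X s w) * (a s w)^2) +
      (\<rho> y * (LBINT s:{0..t}. indicator {y<..} (X s w) * b s w) - \<rho> \<alpha> * (LBINT s:{0..t}. b s w))"
     using b pb ub ca by (subst set_integral_add(2) set_integral_diff(2) | simp)+
    finally have Z: "0 = (LBINT s:{0..t}. pr cutoff (X s w) * b s w) + 1/2 * (LBINT s:{0..t}. cutoff (X s w) * (a s w)^2) +
      (\<rho> y * (LBINT s:{0..t}. indicator {y<..} (X s w) * b s w) - \<rho> \<alpha> * (LBINT s:{0..t}. b s w))" .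
    have Xt: "X t w \<in> {\<alpha>..\<beta>}" using elim(3) t by blast
    have I: "I t w = X t w - x0 - (LBINT s:{0..t}. b s w)" using elim(2) t by simp
    have T: "1/2 * Iy t w + 1/2 * I t w = max 0 (X t w - y) - max 0 (x0 - y) - (LBINT s:{0..t}. indicator {y<..} (X s w) * b s w) - 1/2 * \<Lambda> t w"
     using elim(1) t by blast
    show "(pr (pr cutoff) (X t w) - pr (pr cutoff) x0 - (LBINT s:{0..t}. pr cutoff (X s w) * b s w) - 1/2 * (LBINT s:{0..t}. cutoff (X s w) * (a s w)^2) +
     - \<rho> \<alpha> * I t w) + \<rho> y * (1/2 * Iy t w + 1/2 * I t w) = U (X t w) - U x0 - 1/2 * \<rho> y * \<Lambda> t w"
     unfolding T unfolding I prim_prim_cut[OF Xt] prim_prim_cut[OF x0_range] U_def using Z by (simp add: algebra_simps)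
   qed
  qed
 qed simp
 then show ?thesis by blast
qed

lemma local_time_adapted: "0 <= s ==> ae_measurable (F s) (\<Lambda> s)"
proof -
 assume s: "0 <= s"
 obtain K where K: "SI K (%t w. U (X t w) - U x0 - 1/2 * \<rho> y * \<Lambda> t w)" using SI_scale_local_time by blast
 have Ub: "U \<in> borel_measurable borel" by (rule borel_measurable_continuous_onI[OF continuous_U])
 have "ae_measurable (F s) (%w. (2 / \<rho> y) * (U (X s w) - U x0 - (U (X s w) - U x0 - 1/2 * \<rho> y * \<Lambda> s w)))"
  by (intro ae_measurable_mult ae_measurable_diff ae_measurable_const ae_measurable_comp[OF X_adapted[OF s] Ub] SI_ae_measurable[OF K s])
 then show ?thesis by (rule ae_measurable_cong) (use \<rho>_pos[of y] in simp)
qed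

text \<open>The negative of the local martingale in \<open>SI_scale_local_time\<close>, raised by
  \<open>C = pr \<rho> y - U x0\<close>, equals \<open>pr \<rho> y - U\<close> plus a nonnegative
  multiple of the local time, so it is nonnegative and a supermartingale.\<close>

theorem local_time_bound:
 assumes t: "0 < t"
 shows "(\<integral>\<^sup>+w. ennreal (\<rho> y / 2 * \<Lambda> t w) \<partial>M) <= ennreal (pr \<rho> y)"
proof -
 obtain K where K: "SI K (%t w. U (X t w) - U x0 - 1/2 * \<rho> y * \<Lambda> t w)" using SI_scale_local_time by blast
 define C where "C = pr \<rho> y - U x0"
 have "(\<integral>\<^sup>+w. ennreal (\<rho> y / 2 * \<Lambda> t w) \<partial>M) <= (\<integral>\<^sup>+w. ennreal (C + - 1 * (U (X t w) - U x0 - 1/2 * \<rho> y * \<Lambda> t w)) \<partial>M)"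
  unfolding C_def using U_le by (intro nn_integral_mono ennreal_leI) (simp add: algebra_simps)
 also have "\<dots> <= ennreal C"
 proof (rule SI_supermartingale[OF SI_scale[OF K, of "- 1"] t])
  show "0 <= C" unfolding C_def using U_le by simp
  show "AE w in M. \<forall>s\<in>{0..t}. 0 <= C + - 1 * (U (X s w) - U x0 - 1/2 * \<rho> y * \<Lambda> s w)"
   using local_time_increasing
  proof eventually_elim
   case (elim w)
   show ?case
   proof
    fix s assume "s \<in> {0..t}"
    then have "\<Lambda> 0 w <= \<Lambda> s w" using elim by auto
    then have "0 <= 1/2 * \<rho> y * \<Lambda> s w" using elim \<rho>_pos[of y] by simp
    then show "0 <= C + - 1 * (U (X s w) - U x0 - 1/2 * \<rho> y * \<Lambda> s w)"
     unfolding C_def using U_le[of "X s w"] by simp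
   qed
  qed
 qed
 also have "\<dots> <= ennreal (pr \<rho> y)" unfolding C_def using U_nonneg[of x0] by (intro ennreal_leI) simp
 finally show ?thesis .
qed

text \<open>For \<open>y <= x0\<close> the process \<open>U (X t)\<close> starts at 0. Stopped when
  the local time exceeds \<open>\<eta>\<close>, the local martingale is bounded below by
  \<open>- \<rho> y * \<eta> / 2\<close>, and this constant is then the bound for the mean. On the
  event considered no stopping has occurred.\<close>

theorem small_local_time_bound:
 assumes t: "0 < t" and \<eta>: "0 <= \<eta>" and yx: "y <= x0"
 shows "(\<integral>\<^sup>+w. ennreal (U (X t w)) * indicator {w. \<Lambda> t w <= \<eta>} w \<partial>M) <= ennreal (\<rho> y * \<eta> / 2)"
proof -
 define N where "N t w = U (X t w) - U x0 - 1/2 * \<rho> y * \<Lambda> t w" for t w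
 obtain K where K: "SI K N" unfolding N_def using SI_scale_local_time by blast
 have Ux: "U x0 = 0" using U_above yx by blast
 have good: "AE w in M. increasing_path (%t. \<Lambda> t w) \<eta> \<and> \<Lambda> 0 w = 0"
  using local_time_increasing local_time_continuous
  by eventually_elim (use \<eta> in \<open>auto simp: increasing_path_def\<close>)
 define \<phi> where "\<phi> s w = (if \<Lambda> s w <= \<eta> then 1 else 0 :: real)" for s w
 define J where "J t w = N (clock (%t. \<Lambda> t w) \<eta> t) w" for t w
 have step: "(%x. if x <= \<eta> then 1 else 0 :: real) \<in> borel_measurable borel" by measurable
 have \<phi>m: "ae_measurable (F s) (\<phi> s)" if "0 <= s" for s
  unfolding \<phi>_def[abs_def] by (rule ae_measurable_comp[OF local_time_adapted[OF that] step])
 have \<phi>jm: "jm \<phi>" unfolding \<phi>_def[abs_def]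
  by (rule jm_comp[OF jm_continuous step]) (auto intro: ae_measurable_F local_time_adapted local_time_continuous)
 \<comment> \<open>The stopped process is again a stochastic integral: its integrand carries the
   adapted, left-continuous factor \<open>\<phi>\<close>, and its Riemann sums converge to the value
   at the \<open>clock\<close> time.\<close>
 have SIJ: "SI (%s w. \<phi> s w * K s w) J"
 proof (rule SI_riemann_limit[OF K \<phi>jm \<phi>m _ strict_mono_id])
  show "AE w in M. \<forall>t\<ge>0. (\<exists>C. \<forall>s\<in>{0..t}. \<bar>\<phi> s w\<bar> <= C) \<and>
    (AE s in lborel. 0 < s \<and> s <= t \<and> K s w \<noteq> 0 --> (%n. stp (%r. \<phi> r w) n s) ----> \<phi> s w)"
   using good
  proof eventually_elim
   case (elim w)
   interpret increasing_path "%t. \<Lambda> t w" \<eta> using elim by blast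
   have "\<bar>\<phi> s w\<bar> <= 1" for s unfolding \<phi>_def by simp
   then show ?case using clock_stp unfolding \<phi>_def by blast
  qed
  show "AE w in M. continuous_on {0..} (%t. J t w)"
   using good SI_cont[OF K]
  proof eventually_elim
   case (elim w)
   interpret increasing_path "%t. \<Lambda> t w" \<eta> using elim by blast
   show ?case unfolding J_def by (rule continuous_on_compose2[OF elim(2) clock(1)]) (use clock(2) in auto)
  qed
  show "AE w in M. \<forall>t\<ge>0. (%n. rs (%s. \<phi> s w) (%s. N s w) (id n) t) ----> J t w"
   using good SI_cont[OF K] SI_0[OF K]
  proof eventually_elim
   case (elim w)
   interpret increasing_path "%t. \<Lambda> t w" \<eta> using elim by blast
   show ?case using clock_riemann[OF elim(2)] elim(3) unfolding \<phi>_def J_def by simp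
  qed
 qed
 define C where "C = \<rho> y * \<eta> / 2"
 have C0: "0 <= C" unfolding C_def using \<eta> \<rho>_pos[of y] by simp
 have "AE w in M. ennreal (U (X t w)) * indicator {w. \<Lambda> t w <= \<eta>} w <= ennreal (C + J t w)"
  using good
 proof eventually_elim
  case (elim w)
  interpret increasing_path "%t. \<Lambda> t w" \<eta> using elim by blast
  show ?case
  proof (cases "\<Lambda> t w <= \<eta>")
   case True
   have "\<rho> y * \<Lambda> t w <= \<rho> y * \<eta>" using True \<rho>_pos[of y] by simp
   then have "U (X t w) <= C + J t w" unfolding J_def N_def C_def Ux using clock(4)[of t] True t by simp
   then show ?thesis using True by (simp add: ennreal_leI)
  qed simp
 qed
 then have "(\<integral>\<^sup>+w. ennreal (U (X t w)) * indicator {w. \<Lambda> t w <= \<eta>} w \<partial>M) <= (\<integral>\<^sup>+w. ennreal (C + J t w) \<partial>M)"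
  by (rule nn_integral_mono_AE)
 also have "\<dots> <= ennreal C"
 proof (rule SI_supermartingale[OF SIJ t C0])
  show "AE w in M. \<forall>s\<in>{0..t}. 0 <= C + J s w"
   using good
  proof eventually_elim
   case (elim w)
   interpret increasing_path "%t. \<Lambda> t w" \<eta> using elim by blast
   show ?case
   proof
    fix s assume "s \<in> {0..t}"
    then have "\<rho> y * \<Lambda> (clock (%t. \<Lambda> t w) \<eta> s) w <= \<rho> y * \<eta>" using clock(3)[of s] \<rho>_pos[of y] by simp
    then show "0 <= C + J s w" unfolding C_def J_def N_def Ux
     using U_nonneg[of "X (clock (%t. \<Lambda> t w) \<eta> s) w"] by simp
   qed
  qed
 qed
 finally show ?thesis unfolding C_def .
qed

end

section \<open>Exponentials of primitives and random integrals\<close>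

text \<open>Over a fine partition the squares of the increments of \<open>v\<close> sum to at most
  the largest increment times the total one, which tends to 0. This takes the place of
  differentiation for functions that are only absolutely continuous.\<close>

lemma quadratic_increments_constant:
 fixes G v :: "real => real"
 assumes inc: "!!x y. \<alpha> <= x ==> x <= y ==> y <= \<beta> ==> v x <= v y \<and> \<bar>G y - G x\<bar> <= C * (v y - v x)^2"
  and v: "continuous_on UNIV v" and C: "0 <= C" and x: "x \<in> {\<alpha>..\<beta>}"
 shows "G x = G \<alpha>"
proof -
 define t where "t = x - \<alpha>"
 have t: "0 <= t" unfolding t_def using x by simp
 have b: "\<bar>G x - G \<alpha>\<bar> <= C * e * (v x - v \<alpha>)" if e: "0 < e" for e
 proof -
  have "continuous_on {0..} (%s. v (\<alpha> + s))" by (rule continuous_on_compose2[OF v]) (auto intro!: continuous_intros)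
  from eventually_conj[OF dyadic_oscillation[OF this t e] eventually_ge_real[of t]]
  obtain n where n: "!!i. \<bar>v (\<alpha> + min t (dy n (Suc i))) - v (\<alpha> + min t (dy n i))\<bar> < e" "t <= real n"
   by (auto simp: eventually_sequentially)
  have tel: "(\<Sum>i<n * 2 ^ n. h (\<alpha> + min t (dy n (Suc i))) - h (\<alpha> + min t (dy n i))) = h x - h \<alpha>" for h :: "real => real"
   using dyadic_telescope[OF t n(2), of "%s. h (\<alpha> + s)"] by (simp add: t_def)
  have "\<bar>G x - G \<alpha>\<bar> <= (\<Sum>i<n * 2 ^ n. \<bar>G (\<alpha> + min t (dy n (Suc i))) - G (\<alpha> + min t (dy n i))\<bar>)"
   unfolding tel[symmetric] by (rule sum_abs)
  also have "\<dots> <= (\<Sum>i<n * 2 ^ n. C * e * (v (\<alpha> + min t (dy n (Suc i))) - v (\<alpha> + min t (dy n i))))"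
  proof (rule sum_mono)
   fix i
   define w where "w = v (\<alpha> + min t (dy n (Suc i))) - v (\<alpha> + min t (dy n i))"
   have "min t (dy n i) <= min t (dy n (Suc i))" by (intro min.mono) auto
   then have 1: "0 <= w" "\<bar>G (\<alpha> + min t (dy n (Suc i))) - G (\<alpha> + min t (dy n i))\<bar> <= C * w^2"
    using inc[of "\<alpha> + min t (dy n i)" "\<alpha> + min t (dy n (Suc i))"] t x unfolding w_def t_def by (auto simp: min_def split: if_splits)
   have "w * w <= e * w" using n(1)[of i] 1(1) unfolding w_def by (intro mult_right_mono) auto
   then have "C * w^2 <= C * (e * w)" unfolding power2_eq_square using C by (intro mult_left_mono) auto
   then show "\<bar>G (\<alpha> + min t (dy n (Suc i))) - G (\<alpha> + min t (dy n i))\<bar> <= C * e * w" using 1 by simp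
  qed
  also have "\<dots> = C * e * (v x - v \<alpha>)" unfolding sum_distrib_left[symmetric] tel ..
  finally show ?thesis .
 qed
 have "((%e. C * e * (v x - v \<alpha>)) \<longlongrightarrow> C * 0 * (v x - v \<alpha>)) (at_right 0)" by (intro tendsto_intros)
 moreover have "\<forall>\<^sub>F e in at_right 0. \<bar>G x - G \<alpha>\<bar> <= C * e * (v x - v \<alpha>)"
  using eventually_at_right_less[of "0::real"] by eventually_elim (rule b)
 ultimately have "\<bar>G x - G \<alpha>\<bar> <= C * 0 * (v x - v \<alpha>)" by (intro tendsto_lowerbound) auto
 then show ?thesis by simp
qed

lemma prim_increment:
 assumes f: "set_integrable lborel {\<alpha>..\<beta>} f" and "\<alpha> <= x" "x <= y" "y <= \<beta>"
 shows "prim \<alpha> \<beta> f y - prim \<alpha> \<beta> f x = (LBINT u:{x<..y}. f u)"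
proof -
 have "{\<alpha>..y} = {\<alpha>..x} \<union> {x<..y}" using assms by auto
 moreover have "set_integrable lborel {\<alpha>..x} f" "set_integrable lborel {x<..y} f"
  by (rule set_integrable_subset[OF f], use assms in auto)+
 ultimately have "(LBINT u:{\<alpha>..y}. f u) = (LBINT u:{\<alpha>..x}. f u) + (LBINT u:{x<..y}. f u)"
  using set_integral_Un[of "{\<alpha>..x}" "{x<..y}" lborel f] by (simp add: ivl_disj_int)
 then show ?thesis unfolding prim_def using assms by (simp add: min_absorb2)
qed

lemma set_integrable_mult_bounded:
 fixes q g :: "real => real"
 assumes q: "set_integrable lborel {\<alpha>..\<beta>} q" and g: "continuous_on {\<alpha>..\<beta>} g"
 shows "set_integrable lborel {\<alpha>..\<beta>} (%u. q u * g u)"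
proof -
 obtain C where C: "\<forall>u\<in>{\<alpha>..\<beta>}. norm (g u) <= C"
  using compact_imp_bounded[OF compact_continuous_image[OF g compact_Icc]] bounded_iff by (metis imageI)
 show ?thesis unfolding set_integrable_def
 proof (rule Bochner_Integration.integrable_bound)
 show "integrable lborel (%u. C * (indicator {\<alpha>..\<beta>} u *\<^sub>R q u))"
  using q unfolding set_integrable_def by (rule integrable_mult_right)
 have "(%u. (indicator {\<alpha>..\<beta>} u *\<^sub>R q u) * (indicator {\<alpha>..\<beta>} u *\<^sub>R g u)) \<in> borel_measurable lborel"
  using q borel_measurable_continuous_on_indicator[OF _ g] unfolding set_integrable_def by (intro borel_measurable_times) auto
 then show "(%u. indicator {\<alpha>..\<beta>} u *\<^sub>R (q u * g u)) \<in> borel_measurable lborel"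
  by (rule measurable_cong[THEN iffD1, rotated]) (simp add: indicator_def)
 show "AE u in lborel. norm (indicator {\<alpha>..\<beta>} u *\<^sub>R (q u * g u)) <= norm (C * (indicator {\<alpha>..\<beta>} u *\<^sub>R q u))"
 proof (rule AE_I2)
  fix u
  show "norm (indicator {\<alpha>..\<beta>} u *\<^sub>R (q u * g u)) <= norm (C * (indicator {\<alpha>..\<beta>} u *\<^sub>R q u))"
  proof (cases "u \<in> {\<alpha>..\<beta>}")
   case True
   then have "\<bar>g u\<bar> <= \<bar>C\<bar>" using C by force
   then have "\<bar>g u\<bar> * \<bar>q u\<bar> <= \<bar>C\<bar> * \<bar>q u\<bar>" by (rule mult_right_mono) simp
   then show ?thesis using True by (simp add: abs_mult mult.commute)
  qed simp
 qed
qed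
qed

text \<open>The equation \<open>\<rho>' = - q \<rho>\<close> in integrated form. Since
  \<open>q\<close> is only integrable there may be no derivative at some points; instead the sum of
  \<open>exp (- p)\<close> and the integral of \<open>q exp (- p)\<close> is shown to have
  increments of second order in the variation \<open>v\<close> of \<open>p\<close>.\<close>

lemma exp_prim:
 assumes q: "set_integrable lborel {\<alpha>..\<beta>} q" and x: "x \<in> {\<alpha>..\<beta>}"
 shows "exp (- prim \<alpha> \<beta> q x) = 1 - prim \<alpha> \<beta> (%u. q u * exp (- prim \<alpha> \<beta> q u)) x"
proof -
 have ab: "\<alpha> <= \<beta>" using x by simp
 define p where "p = prim \<alpha> \<beta> q"
 define v where "v = prim \<alpha> \<beta> (%u. \<bar>q u\<bar>)"
 define K where "K = (LBINT v:{\<alpha>..\<beta>}. \<bar>q v\<bar>)"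
 have aq: "set_integrable lborel {\<alpha>..\<beta>} (%u. \<bar>q u\<bar>)" by (rule set_integrable_abs[OF q])
 have pc: "continuous_on UNIV p" unfolding p_def by (rule continuous_on_prim[OF q ab])
 have vc: "continuous_on UNIV v" unfolding v_def by (rule continuous_on_prim[OF aq ab])
 have pK: "\<bar>p u\<bar> <= K" for u unfolding p_def K_def by (rule prim_bound[OF q])
 have eK: "exp (- p u) <= exp K" for u using pK[of u] by simp
 have tang: "exp (- p u) - exp (- p w) <= exp (- p u) * (p w - p u)" for u w
 proof -
  have "exp (- p u) * (1 + (p u - p w)) <= exp (- p u) * exp (p u - p w)"
   by (intro mult_left_mono exp_ge_add_one_self) auto
  also have "\<dots> = exp (- p w)" by (simp add: exp_add[symmetric])
  finally show ?thesis by (simp add: algebra_simps)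
 qed
 have lip: "\<bar>exp (- p u) - exp (- p w)\<bar> <= exp K * \<bar>p w - p u\<bar>" for u w
 proof -
  have "exp (- p u) * z <= exp K * \<bar>z\<bar>" for u z
   by (rule order_trans[OF mult_left_mono[OF abs_ge_self] mult_right_mono[OF eK abs_ge_zero]]) simp
  then have "exp (- p u) - exp (- p w) <= exp K * \<bar>p w - p u\<bar>" "exp (- p w) - exp (- p u) <= exp K * \<bar>p u - p w\<bar>"
   using order_trans[OF tang] by blast+
  then show ?thesis by (intro abs_leI) (simp_all add: abs_minus_commute)
 qed
 have qe: "set_integrable lborel {\<alpha>..\<beta>} (%u. q u * exp (- p u))"
  by (intro set_integrable_mult_bounded[OF q] continuous_intros continuous_on_subset[OF pc]) auto
 define G where "G x = exp (- p x) + prim \<alpha> \<beta> (%u. q u * exp (- p u)) x" for x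
 have "G x = G \<alpha>"
 proof (rule quadratic_increments_constant[OF _ vc _ x])
  show "0 <= 2 * exp K" by simp
  fix a c assume ac: "\<alpha> <= a" "a <= c" "c <= \<beta>"
  have i: "set_integrable lborel {a<..c} f" if "set_integrable lborel {\<alpha>..\<beta>} f" for f :: "real => real"
   by (rule set_integrable_subset[OF that]) (use ac in auto)
  define w where "w = (LBINT u:{a<..c}. \<bar>q u\<bar>)"
  have w: "v c - v a = w" unfolding v_def w_def by (rule prim_increment[OF aq ac])
  have w0: "0 <= w" unfolding w_def set_lebesgue_integral_def by (rule Bochner_Integration.integral_nonneg) simp
  have pw: "\<bar>p u - p a\<bar> <= w" if "u \<in> {a<..c}" for u
  proof -
   have "\<bar>p u - p a\<bar> = \<bar>LBINT u:{a<..u}. q u\<bar>"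
    unfolding p_def by (subst prim_increment[OF q]) (use ac that in auto)
   also have "\<dots> <= (LBINT u:{a<..u}. \<bar>q u\<bar>)"
    using set_integral_norm_bound[OF set_integrable_subset[OF q, of "{a<..u}"]] ac that by force
   also have "\<dots> = v u - v a" unfolding v_def by (subst prim_increment[OF aq]) (use ac that in auto)
   also have "\<dots> <= v c - v a"
   proof -
    have "0 <= (LBINT u:{u<..c}. \<bar>q u\<bar>)" unfolding set_lebesgue_integral_def by (rule Bochner_Integration.integral_nonneg) simp
    also have "\<dots> = v c - v u" unfolding v_def by (subst prim_increment[OF aq]) (use ac that in auto)
    finally show ?thesis by simp
   qed
   finally show ?thesis unfolding w .
  qed
  have pc: "\<bar>p c - p a\<bar> <= w" using pw[of c] ac w0 by (cases "a = c") auto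
  \<comment> \<open>The second-order remainder of the exponential at \<open>p a\<close>, plus the
    error of freezing \<open>exp (- p u)\<close> at \<open>a\<close> in the integral; each is at
    most \<open>exp K * w * w\<close>.\<close>
  have "G c - G a = (exp (- p c) - exp (- p a) + exp (- p a) * (p c - p a)) + (LBINT u:{a<..c}. q u * (exp (- p u) - exp (- p a)))"
  proof -
   have "(LBINT u:{a<..c}. q u * (exp (- p u) - exp (- p a))) = (LBINT u:{a<..c}. q u * exp (- p u) - exp (- p a) * q u)"
    by (simp add: algebra_simps)
   also have "\<dots> = (LBINT u:{a<..c}. q u * exp (- p u)) - (LBINT u:{a<..c}. exp (- p a) * q u)"
    by (rule set_integral_diff(2)[OF i[OF qe]]) (use i[OF q] in auto)
   also have "(LBINT u:{a<..c}. exp (- p a) * q u) = exp (- p a) * (p c - p a)"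
    unfolding p_def prim_increment[OF q ac] by simp
   also have "(LBINT u:{a<..c}. q u * exp (- p u)) = prim \<alpha> \<beta> (%u. q u * exp (- p u)) c - prim \<alpha> \<beta> (%u. q u * exp (- p u)) a"
    by (rule prim_increment[OF qe ac, symmetric])
   finally show ?thesis unfolding G_def by simp
  qed
  moreover have "\<bar>exp (- p c) - exp (- p a) + exp (- p a) * (p c - p a)\<bar> <= exp K * w * w"
  proof -
   have "\<bar>exp (- p c) - exp (- p a) + exp (- p a) * (p c - p a)\<bar> <= \<bar>exp (- p a) - exp (- p c)\<bar> * \<bar>p c - p a\<bar>"
    unfolding abs_mult[symmetric] using tang[of a c] tang[of c a] by (simp add: algebra_simps abs_if)
   also have "\<dots> <= (exp K * w) * w"
    by (rule mult_mono[OF order_trans[OF lip mult_left_mono[OF pc]] pc]) (use w0 in auto)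
   finally show ?thesis .
  qed
  moreover have "\<bar>LBINT u:{a<..c}. q u * (exp (- p u) - exp (- p a))\<bar> <= exp K * w * w"
  proof -
   have j: "set_integrable lborel {a<..c} (%u. q u * (exp (- p u) - exp (- p a)))"
    using set_integral_diff(1)[OF i[OF qe] set_integrable_mult_right[OF i[OF q], of "exp (- p a)"]] by (simp add: algebra_simps)
   have "\<bar>LBINT u:{a<..c}. q u * (exp (- p u) - exp (- p a))\<bar> <= (LBINT u:{a<..c}. \<bar>q u * (exp (- p u) - exp (- p a))\<bar>)"
    using set_integral_norm_bound[OF j] by simp
   also have "\<dots> <= (LBINT u:{a<..c}. exp K * w * \<bar>q u\<bar>)"
   proof (rule set_integral_mono[OF set_integrable_abs[OF j]])
    show "set_integrable lborel {a<..c} (%u. exp K * w * \<bar>q u\<bar>)" using i[OF aq] by simp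
    fix u assume u: "u \<in> {a<..c}"
    have "\<bar>exp (- p u) - exp (- p a)\<bar> <= exp K * w"
     by (rule order_trans[OF lip mult_left_mono]) (use pw[OF u] in \<open>auto simp: abs_minus_commute\<close>)
    then have "\<bar>exp (- p u) - exp (- p a)\<bar> * \<bar>q u\<bar> <= exp K * w * \<bar>q u\<bar>" by (rule mult_right_mono) simp
    then show "\<bar>q u * (exp (- p u) - exp (- p a))\<bar> <= exp K * w * \<bar>q u\<bar>" by (simp add: abs_mult mult.commute)
   qed
   also have "\<dots> = exp K * w * w" unfolding w_def by simp
   finally show ?thesis .
  qed
  ultimately have "\<bar>G c - G a\<bar> <= 2 * exp K * w^2" by (simp add: power2_eq_square)
  then show "v a <= v c \<and> \<bar>G c - G a\<bar> <= 2 * exp K * (v c - v a)^2" unfolding w using w w0 by simp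
 qed
 moreover have "prim \<alpha> \<beta> f \<alpha> = 0" for f unfolding prim_def using ab by (simp add: min_def set_integral_point)
 ultimately show ?thesis unfolding G_def p_def by simp
qed

section \<open>Finiteness and divergence of random integrals over a level parameter\<close>

context prob_space
begin

lemma integral_finite_of_mean:
 assumes \<nu>: "sigma_finite_measure \<nu>" and h: "(%(y, w). h y w) \<in> borel_measurable (\<nu> \<Otimes>\<^sub>M M)" and D: "D \<in> sets \<nu>"
  and mean: "!!y. y \<in> D ==> (\<integral>\<^sup>+w. h y w \<partial>M) <= g y" and fin: "(\<integral>\<^sup>+y\<in>D. g y \<partial>\<nu>) < \<infinity>"
 shows "AE w in M. (\<integral>\<^sup>+y\<in>D. h y w \<partial>\<nu>) < \<infinity>"
proof -
 interpret \<nu>: sigma_finite_measure \<nu> by (rule \<nu>)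
 interpret P: pair_sigma_finite \<nu> M by unfold_locales
 have m: "(%(y, w). h y w * indicator D y) \<in> borel_measurable (\<nu> \<Otimes>\<^sub>M M)"
  using h D by (auto simp: split_beta' intro!: borel_measurable_times)
 have sw: "(%(w, y). h y w * indicator D y) \<in> borel_measurable (M \<Otimes>\<^sub>M \<nu>)"
  using measurable_pair_swap[OF m] by (simp add: split_beta')
 have "(\<integral>\<^sup>+w. (\<integral>\<^sup>+y\<in>D. h y w \<partial>\<nu>) \<partial>M) = (\<integral>\<^sup>+y. (\<integral>\<^sup>+w. h y w * indicator D y \<partial>M) \<partial>\<nu>)"
  using P.Fubini[OF m] by simp
 also have "\<dots> <= (\<integral>\<^sup>+y\<in>D. g y \<partial>\<nu>)"
 proof (rule nn_integral_mono)
  show "(\<integral>\<^sup>+w. h y w * indicator D y \<partial>M) <= g y * indicator D y" for y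
   using mean[of y] by (cases "y \<in> D") auto
 qed
 finally have "(\<integral>\<^sup>+w. (\<integral>\<^sup>+y\<in>D. h y w \<partial>\<nu>) \<partial>M) \<noteq> \<infinity>" using fin by auto
 moreover have "(%w. \<integral>\<^sup>+y\<in>D. h y w \<partial>\<nu>) \<in> borel_measurable M"
  using \<nu>.borel_measurable_nn_integral[OF sw] by simp
 ultimately have "AE w in M. (\<integral>\<^sup>+y\<in>D. h y w \<partial>\<nu>) \<noteq> \<infinity>" by (intro nn_integral_noteq_infinite)
 then show ?thesis by eventually_elim (simp add: top.not_eq_extremum)
qed

text \<open>Jeulin's argument: if \<open>h y\<close> is uniformly unlikely to be small compared to \<open>g y\<close>, then on any event \<open>A\<close>
 of probability \<open>p\<close> the mean of \<open>h y\<close> is at least \<open>p^2 g y / 2\<close>.\<close>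

lemma integral_infinite_of_tail:
 fixes g :: "'b => real"
 assumes \<nu>: "sigma_finite_measure \<nu>" and h: "(%(y, w). h y w) \<in> borel_measurable (\<nu> \<Otimes>\<^sub>M M)" and D: "D \<in> sets \<nu>"
  and g: "!!y. y \<in> D ==> 0 < g y" and B: "B \<in> events"
  and tail: "!!y \<eta>. y \<in> D ==> 0 < \<eta> ==> g y * prob {w\<in>B. h y w <= ennreal \<eta>} <= \<eta> / 2"
  and gb: "g \<in> borel_measurable \<nu>" and inf: "(\<integral>\<^sup>+y\<in>D. ennreal (g y) \<partial>\<nu>) = \<infinity>"
 shows "AE w in M. w \<in> B --> (\<integral>\<^sup>+y\<in>D. h y w \<partial>\<nu>) = \<infinity>"
proof -
 interpret \<nu>: sigma_finite_measure \<nu> by (rule \<nu>)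
 interpret P: pair_sigma_finite \<nu> M by unfold_locales
 have m: "(%(y, w). h y w * indicator D y) \<in> borel_measurable (\<nu> \<Otimes>\<^sub>M M)"
  using h D by (auto simp: split_beta' intro!: borel_measurable_times)
 have sw: "(%(w, y). h y w * indicator D y) \<in> borel_measurable (M \<Otimes>\<^sub>M \<nu>)"
  using measurable_pair_swap[OF m] by (simp add: split_beta')
 have I[measurable]: "(%w. \<integral>\<^sup>+y\<in>D. h y w \<partial>\<nu>) \<in> borel_measurable M"
  using \<nu>.borel_measurable_nn_integral[OF sw] by simp
 have "AE w in M. \<not> (w \<in> B \<and> (\<integral>\<^sup>+y\<in>D. h y w \<partial>\<nu>) <= of_nat N)" for N :: nat
 proof -
  \<comment> \<open>If the integral were finite with positive probability on \<open>B\<close>, some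
    such event would have positive probability \<open>p\<close>; Fubini over it yields infinity
    below \<open>N\<close>.\<close>
  define A where "A = {w\<in>space M. w \<in> B \<and> (\<integral>\<^sup>+y\<in>D. h y w \<partial>\<nu>) <= of_nat N}"
  have A[measurable]: "A \<in> events" unfolding A_def using B by measurable
  define p where "p = prob A"
  have "p = 0"
  proof (rule ccontr)
   assume "p \<noteq> 0"
   then have p: "0 < p" unfolding p_def using measure_nonneg[of M A] by linarith
   have low: "ennreal (p^2 / 2) * ennreal (g y) <= (\<integral>\<^sup>+w\<in>A. h y w \<partial>M)" if y: "y \<in> D" for y
   proof -
    have "y \<in> space \<nu>" using y sets.sets_into_space[OF D] by blast
    then have ly[measurable]: "h y \<in> borel_measurable M" using measurable_Pair2[OF h] by simp
    \<comment> \<open>For this threshold the tail bound leaves probability at most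
      \<open>p / 2\<close> for \<open>h y\<close> to be small, so at least half of \<open>A\<close>
      contributes \<open>\<eta>\<close> each.\<close>
    define \<eta> where "\<eta> = p * g y"
    have \<eta>: "0 < \<eta>" unfolding \<eta>_def using p g[OF y] by simp
    define E where "E = {w\<in>space M. w \<in> B \<and> h y w <= ennreal \<eta>}"
    have E[measurable]: "E \<in> events" unfolding E_def using B by measurable
    have "E = {w\<in>B. h y w <= ennreal \<eta>}" unfolding E_def using sets.sets_into_space[OF B] by auto
    then have "g y * prob E <= g y * (p / 2)" using tail[OF y \<eta>] unfolding \<eta>_def by (simp add: mult.commute)
    then have "prob E <= p / 2" using g[OF y] by simp
    moreover have "prob (A - E) >= p - prob E" unfolding p_def
     using finite_measure_mono[of A "(A - E) \<union> E"] prob_Un_le[of "A - E" E "prob (A - E)" "prob E"] A E by auto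
    ultimately have pe: "p / 2 <= prob (A - E)" by simp
    have "ennreal (p^2 / 2) * ennreal (g y) = ennreal \<eta> * ennreal (p / 2)"
     unfolding \<eta>_def using p g[OF y] by (simp add: ennreal_mult[symmetric] power2_eq_square algebra_simps)
    also have "\<dots> <= ennreal \<eta> * emeasure M (A - E)"
     unfolding emeasure_eq_measure using pe by (intro mult_left_mono ennreal_leI) auto
    also have "\<dots> = (\<integral>\<^sup>+w. ennreal \<eta> * indicator (A - E) w \<partial>M)" by (subst nn_integral_cmult_indicator) auto
    also have "\<dots> <= (\<integral>\<^sup>+w\<in>A. h y w \<partial>M)"
     by (rule nn_integral_mono) (auto simp: A_def E_def indicator_def)
    finally show ?thesis .
   qed
   have "\<infinity> = ennreal (p^2 / 2) * (\<integral>\<^sup>+y\<in>D. ennreal (g y) \<partial>\<nu>)"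
    unfolding inf using p by (simp add: ennreal_mult_top)
   also have "\<dots> = (\<integral>\<^sup>+y. ennreal (p^2 / 2) * (ennreal (g y) * indicator D y) \<partial>\<nu>)"
    by (rule nn_integral_cmult[symmetric]) (use gb D in measurable)
   also have "\<dots> <= (\<integral>\<^sup>+y. (\<integral>\<^sup>+w. h y w * indicator D y * indicator A w \<partial>M) \<partial>\<nu>)"
   proof (rule nn_integral_mono)
    show "ennreal (p^2 / 2) * (ennreal (g y) * indicator D y) <= (\<integral>\<^sup>+w. h y w * indicator D y * indicator A w \<partial>M)" for y
     using low[of y] by (cases "y \<in> D") auto
   qed
   also have "\<dots> = (\<integral>\<^sup>+w. (\<integral>\<^sup>+y. h y w * indicator D y * indicator A w \<partial>\<nu>) \<partial>M)"
   proof -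
    have "(%(y, w). h y w * indicator D y * indicator A w) \<in> borel_measurable (\<nu> \<Otimes>\<^sub>M M)"
     using m A by (auto simp: split_beta' intro!: borel_measurable_times)
    from P.Fubini[OF this] show ?thesis by simp
   qed
   also have "\<dots> <= (\<integral>\<^sup>+w. of_nat N \<partial>M)"
   proof (rule nn_integral_mono)
    show "(\<integral>\<^sup>+y. h y w * indicator D y * indicator A w \<partial>\<nu>) <= of_nat N" for w
     by (cases "w \<in> A") (auto simp: A_def)
   qed
   also have "\<dots> = of_nat N" by (simp add: emeasure_space_1)
   finally show False by (simp add: top_unique)
  qed
  then have "AE w in M. w \<notin> A" using prob_eq_0[OF A] unfolding p_def by simp
  then show ?thesis unfolding A_def by eventually_elim (use sets.sets_into_space[OF B] in auto)
 qed
 then have "AE w in M. \<forall>N. \<not> (w \<in> B \<and> (\<integral>\<^sup>+y\<in>D. h y w \<partial>\<nu>) <= of_nat N)" unfolding AE_all_countable by blast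
 then show ?thesis
 proof eventually_elim
  case (elim w)
  show ?case
  proof (intro impI, rule ccontr)
   assume "w \<in> B" and n: "(\<integral>\<^sup>+y\<in>D. h y w \<partial>\<nu>) \<noteq> \<infinity>"
   then obtain N :: nat where "(\<integral>\<^sup>+y\<in>D. h y w \<partial>\<nu>) < of_nat N"
    using ennreal_Ex_less_of_nat[of "\<integral>\<^sup>+y\<in>D. h y w \<partial>\<nu>"] by (auto simp: top.not_eq_extremum)
   then show False using elim \<open>w \<in> B\<close> by (meson less_imp_le)
  qed
 qed
qed

lemma vanishes_measure:
 assumes "!!n. X n \<in> borel_measurable M" "!!e::real. 0 < e ==> (%n. prob {w\<in>space M. ennreal e < X n w}) ----> 0"
 shows "vanishes X"
 unfolding vanishes_def
proof (intro allI impI)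
 fix e :: real assume e: "e > 0"
 have "\<forall>\<^sub>F n in sequentially. prob {w\<in>space M. ennreal e < X n w} < e" by (rule order_tendstoD(2)[OF assms(2)[OF e] e])
 then obtain N where N: "!!n. n >= N ==> prob {w\<in>space M. ennreal e < X n w} < e" unfolding eventually_sequentially by blast
 show "\<exists>N. \<forall>n\<ge>N. \<exists>B\<in>events. prob B <= e \<and> (\<forall>w\<in>space M - B. X n w <= ennreal e)"
 proof (intro exI allI impI)
  fix n assume "N <= n"
  show "\<exists>B\<in>events. prob B <= e \<and> (\<forall>w\<in>space M - B. X n w <= ennreal e)"
   by (rule bexI[of _ "{w\<in>space M. ennreal e < X n w}"])
    (use N[OF \<open>N <= n\<close>] assms(1)[of n] in \<open>auto simp: not_less\<close>)
 qed
qed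

end

section \<open>Integrals in the sense of \<open>ito_integral\<close> satisfy
  \<open>SI\<close>\<close>

context bm_space
begin

lemma elementary_simple:
 assumes "elementary F k p \<xi>"
 shows "simple (elementary_process k p \<xi>) (elementary_integral W k p \<xi>)"
proof -
 have p: "0 <= p i" if "i <= k" for i
  using that assms unfolding elementary_def by (induction i) (auto intro: order_trans)
 have "simple (elementary_process j p \<xi>) (elementary_integral W j p \<xi>)" if "j <= k" for j
  using that
 proof (induction j)
  case 0
  then show ?case using simple.zero by (simp add: elementary_process_def[abs_def] elementary_integral_def[abs_def])
 next
  case (Suc j)
  obtain C where C: "\<forall>w\<in>space (F (p j)). \<bar>\<xi> j w\<bar> <= C" and m: "\<xi> j \<in> borel_measurable (F (p j))" "p j <= p (Suc j)"
   using assms Suc.prems unfolding elementary_def by (auto simp: Suc_le_eq)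
  have "simple (%s w. elementary_process j p \<xi> s w + \<xi> j w * indicator {p j<..p (Suc j)} s)
   (%t w. elementary_integral W j p \<xi> t w + \<xi> j w * (W (min t (p (Suc j))) w - W (min t (p j)) w))"
   by (rule simple.step[of _ _ "p j" "p (Suc j)" "\<xi> j" C]) (use Suc p[of j] C m in \<open>auto simp: space_F\<close>)
  then show ?case unfolding elementary_process_def[abs_def] elementary_integral_def[abs_def] sum.lessThan_Suc .
 qed
 then show ?thesis by simp
qed

lemma SI_ito_integral:
 assumes "ito_integral M F W H I" shows "SI H I"
proof -
 from assms obtain k p \<xi> where H: "progressively_measurable F H" and I: "!!t. 0 <= t ==> I t \<in> borel_measurable M"
  "AE w in M. continuous_on {0..} (%t. I t w)" and el: "!!n. elementary F (k n) (p n) (\<xi> n)"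
  and lim: "!!t e. 0 <= t ==> 0 < e ==> (%n. prob {w\<in>space M. ennreal e <
     (\<integral>\<^sup>+s\<in>{0..t}. ennreal ((elementary_process (k n) (p n) (\<xi> n) s w - H s w)^2) \<partial>lborel)}) ----> 0 \<and>
    (%n. prob {w\<in>space M. e < \<bar>elementary_integral W (k n) (p n) (\<xi> n) t w - I t w\<bar>}) ----> 0"
  unfolding ito_integral_def by blast
 define G where "G n = elementary_process (k n) (p n) (\<xi> n)" for n
 define E where "E n = elementary_integral W (k n) (p n) (\<xi> n)" for n
 have GE: "simple (G n) (E n)" for n unfolding G_def E_def by (rule elementary_simple[OF el])
 have v1: "vanishes (%n w. energy (%s w. G n s w - H s w) t w)" if t: "0 <= t" for t
 proof (rule vanishes_measure)
  fix n
  \<comment> \<open>Clipping the time does not change the energy up to \<open>t\<close>, and makes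
    the integrand jointly measurable on the whole line.\<close>
  have "(%(s, w). G n s w - H (max 0 (min s t)) w) \<in> borel_measurable (borel \<Otimes>\<^sub>M M)"
   using simple_jointly_measurable[OF GE] progressive_clip[OF H t] by (simp add: split_beta')
  then have "(%(w, s). ennreal ((G n s w - H (max 0 (min s t)) w)^2) * indicator {0..t} s) \<in> borel_measurable (M \<Otimes>\<^sub>M lborel)"
   by (subst measurable_pair_swap_iff) (simp add: split_beta')
  from lborel.borel_measurable_nn_integral[OF this]
  have "(%w. \<integral>\<^sup>+s\<in>{0..t}. ennreal ((G n s w - H (max 0 (min s t)) w)^2) \<partial>lborel) \<in> borel_measurable M" .
  moreover have "(\<integral>\<^sup>+s\<in>{0..t}. ennreal ((G n s w - H (max 0 (min s t)) w)^2) \<partial>lborel) = energy (%s w. G n s w - H s w) t w" for w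
   unfolding energy_def by (rule nn_integral_cong) (auto simp: indicator_def)
  ultimately show "(%w. energy (%s w. G n s w - H s w) t w) \<in> borel_measurable M" by simp
 qed (use lim[OF t] in \<open>simp add: energy_def G_def\<close>)
 have v2: "vanishes (%n w. ennreal \<bar>E n t w - I t w\<bar>)" if t: "0 <= t" for t
 proof (rule vanishes_measure)
  show "(%w. ennreal \<bar>E n t w - I t w\<bar>) \<in> borel_measurable M" for n
   using measurable_F[OF simple_adapted[OF GE t]] I(1)[OF t] by measurable
 qed (use lim[OF t] in \<open>simp add: E_def ennreal_less_iff\<close>)
 show ?thesis unfolding SI_def
  by (intro conjI jm_progressive[OF H] I(2), rule exI[of _ G], rule exI[of _ E]) (use GE v1 v2 in simp)
qed

end

section \<open>Paths up to the exit time\<close>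

lemma exit_time_inside: "0 <= t ==> ereal t < exit_time Y a b w ==> Y t w \<in> {a<..<b}"
proof (rule ccontr)
 assume "0 <= t" "ereal t < exit_time Y a b w" "Y t w \<notin> {a<..<b}"
 then have "exit_time Y a b w <= ereal t" unfolding exit_time_def by (intro Inf_lower) auto
 then show False using \<open>ereal t < _\<close> by simp
qed

lemma exit_time_le: "0 <= t ==> Y t w \<notin> {a<..<b} ==> exit_time Y a b w <= ereal t"
 unfolding exit_time_def by (intro Inf_lower) auto

text \<open>Deterministic analysis of one continuous path with values in the closed interval; the
  compact intervals from \<open>av n\<close> to \<open>bv n\<close> exhaust its interior and contain
  the starting point.\<close>

locale exit_path =
 fixes Y :: "real => 'a => ereal" and w :: 'a and l r :: ereal and x0 :: real and av bv :: "nat => real"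
 assumes cont: "continuous_on {0..} (%t. Y t w)" and start: "Y 0 w = ereal x0"
  and range: "!!t. 0 <= t ==> Y t w \<in> {l..r}"
  and av: "decseq av" "!!n. l < ereal (av n)" "!!n. av n < x0" "(%n. ereal (av n)) ----> l"
  and bv: "incseq bv" "!!n. ereal (bv n) < r" "!!n. x0 < bv n" "(%n. ereal (bv n)) ----> r"
begin

abbreviation "\<tau> a b \<equiv> exit_time Y a b w"
abbreviation "\<zeta> \<equiv> exit_time Y l r w"
abbreviation "\<tau>n n \<equiv> exit_time Y (ereal (av n)) (ereal (bv n)) w"

lemma lx: "l < ereal x0" "ereal x0 < r"
 using av(2)[of 0] av(3)[of 0] bv(2)[of 0] bv(3)[of 0] by (meson ereal_less(2) less_ereal.simps(1) order_less_trans)+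

lemma left_limit: "0 < t ==> ((%s. Y s w) \<longlongrightarrow> Y t w) (at_left t)"
proof -
 assume t: "0 < t"
 have "((%s. Y s w) \<longlongrightarrow> Y t w) (at t within {0..})" using cont t unfolding continuous_on_def by auto
 then have "((%s. Y s w) \<longlongrightarrow> Y t w) (at t within {0<..<t})" by (rule tendsto_within_subset) auto
 moreover have "at_left t = at t within {0<..<t}" using t by (intro at_within_nhd[of _ "{0<..}"]) auto
 ultimately show ?thesis by simp
qed

lemma eventually_inside: "0 <= t ==> Y t w \<in> {a<..<b} ==> \<forall>\<^sub>F s in at t within {0..}. Y s w \<in> {a<..<b}"
 using cont unfolding continuous_on_def by (auto dest!: bspec[of _ _ t] topological_tendstoD[OF _ open_greaterThanLessThan, of _ _ _ a b])

lemma exit_pos: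
 assumes "a < ereal x0" "ereal x0 < b" shows "0 < \<tau> a b"
proof -
 have "\<forall>\<^sub>F t in at 0 within {0..}. Y t w \<in> {a<..<b}"
  by (rule eventually_inside) (use assms start in auto)
 then obtain d where d: "0 < d" "!!t. 0 < t ==> t < d ==> Y t w \<in> {a<..<b}"
  unfolding eventually_at by (auto simp: dist_real_def)
 have "ereal d <= \<tau> a b" unfolding exit_time_def
 proof (rule Inf_greatest)
  fix x assume "x \<in> {ereal t |t. 0 <= t \<and> Y t w \<notin> {a<..<b}}"
  then obtain t where t: "x = ereal t" "0 <= t" "Y t w \<notin> {a<..<b}" by blast
  have "t \<noteq> 0" using t(3) start assms by auto
  then show "ereal d <= x" using d(2)[of t] t by (cases "t < d") auto
 qed
 then show ?thesis using d(1) by (metis ereal_less(2) less_le_trans)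
qed

lemma exit_cases:
 assumes ab: "a < ereal x0" "ereal x0 < b"
 obtains "\<tau> a b = \<infinity>" | T where "\<tau> a b = ereal T" "0 < T" "Y T w \<in> {a..b}" "Y T w \<notin> {a<..<b}"
proof (cases "\<tau> a b")
 case (real T)
 have T: "0 < T" using exit_pos[OF ab] real by simp
 have in_: "\<forall>\<^sub>F s in at_left T. 0 <= s \<and> s < T" using T by (auto simp: eventually_at_left_field)
 have "\<forall>\<^sub>F s in at_left T. Y s w \<in> {a..b}"
  using in_ by eventually_elim (use exit_time_inside[of _ Y a b w] real in fastforce)
 then have cl: "Y T w \<in> {a..b}"
  by (intro Lim_in_closed_set[OF _ _ _ left_limit[OF T]]) (simp_all add: trivial_limit_at_left_real)
 have "Y T w \<notin> {a<..<b}"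
 proof
  assume Yin: "Y T w \<in> {a<..<b}"
  then have "\<forall>\<^sub>F t in at T within {0..}. Y t w \<in> {a<..<b}"
   using eventually_inside T by simp
  then obtain d where d: "0 < d" "!!t. 0 <= t ==> t \<noteq> T ==> \<bar>t - T\<bar> < d ==> Y t w \<in> {a<..<b}"
   unfolding eventually_at by (auto simp: dist_real_def)
  have "ereal (T + d) <= \<tau> a b" unfolding exit_time_def
  proof (rule Inf_greatest)
   fix x assume "x \<in> {ereal t |t. 0 <= t \<and> Y t w \<notin> {a<..<b}}"
   then obtain t where t: "x = ereal t" "0 <= t" "Y t w \<notin> {a<..<b}" by blast
   have "T <= t" using exit_time_le[of t Y w a b] t real by simp
   then show "ereal (T + d) <= x" using d(2)[of t] t Yin by (cases "t < T + d"; cases "t = T") auto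
  qed
  then show False using real d(1) by simp
 qed
 then show ?thesis using that(2) real T cl by blast
qed (use that(1) exit_pos[OF ab] in auto)

lemma stopped_range:
 assumes ab: "a < ereal x0" "ereal x0 < b" and t: "0 <= t"
 shows "Y (real_of_ereal (min (ereal t) (\<tau> a b))) w \<in> {a..b}"
proof (cases rule: exit_cases[OF ab])
 case 1
 then show ?thesis using exit_time_inside[of t Y a b w] t by auto
next
 case (2 T)
 then show ?thesis using exit_time_inside[of t Y a b w] t by (cases "t < T") (auto simp: min_def)
qed

lemma zeta_pos: "0 < \<zeta>"
 by (rule exit_pos[OF lx])

text \<open>Up to a time before \<open>\<zeta>\<close> the path attains a minimum and a maximum
  inside the open interval; from some \<open>n\<close> on these lie strictly between
  \<open>av n\<close> and \<open>bv n\<close>.\<close>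

lemma eventually_before:
 assumes t: "0 <= t" "ereal t < \<zeta>" shows "\<exists>N. \<forall>n\<ge>N. ereal t < \<tau>n n"
proof -
 obtain t' where t': "t < t'" "ereal t' < \<zeta>" using t(2) ereal_dense2 less_ereal.simps(1) by blast
 have "compact {0..t'}" "{0..t'} \<noteq> {}" "continuous_on {0..t'} (%t. Y t w)" using t t' by (auto intro: continuous_on_subset[OF cont])
 then obtain p q where p: "p \<in> {0..t'}" "!!s. s \<in> {0..t'} ==> Y p w <= Y s w" and q: "q \<in> {0..t'}" "!!s. s \<in> {0..t'} ==> Y s w <= Y q w"
  using continuous_attains_inf continuous_attains_sup by metis
 have "Y u w \<in> {l<..<r}" if u: "u \<in> {0..t'}" for u
  using exit_time_inside[of u Y l r w] u le_less_trans[OF _ t'(2), of "ereal u"] by auto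
 then have "l < Y p w" "Y q w < r" using p q by auto
 from eventually_conj[OF order_tendstoD(2)[OF av(4) this(1)] order_tendstoD(1)[OF bv(4) this(2)]]
 obtain N where N: "!!n. n >= N ==> ereal (av n) < Y p w \<and> Y q w < ereal (bv n)" unfolding eventually_sequentially by blast
 have "ereal t < \<tau>n n" if n: "n >= N" for n
 proof -
  have "ereal t' <= \<tau>n n" unfolding exit_time_def
  proof (rule Inf_greatest)
   fix x assume "x \<in> {ereal t |t. 0 <= t \<and> Y t w \<notin> {ereal (av n)<..<ereal (bv n)}}"
   then obtain s where s: "x = ereal s" "0 <= s" "Y s w \<notin> {ereal (av n)<..<ereal (bv n)}" by blast
   have "\<not> s <= t'"
   proof
    assume "s <= t'"
    then have "Y p w <= Y s w" "Y s w <= Y q w" using p(2) q(2) s(2) by auto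
    then show False using N[OF n] s(3) by (meson greaterThanLessThan_iff le_less_trans less_le_trans)
   qed
   then show "ereal t' <= x" using s(1) by simp
  qed
  then show ?thesis using t'(1) by (meson less_ereal.simps(1) less_le_trans)
 qed
 then show ?thesis by blast
qed

text \<open>Real times strictly before \<open>\<zeta>\<close> that converge to it. The cap
  \<open>n\<close> keeps them finite if the compact interval is never left, and makes them the value
  at time \<open>n\<close> of the stopped clock.\<close>

definition u :: "nat => real" where "u n = real_of_ereal (min (ereal (real n)) (\<tau>n n))"

lemma tau_n_pos: "0 < \<tau>n n" by (rule exit_pos) (use av bv in auto)

lemma u_eq: "ereal (u n) = min (ereal (real n)) (\<tau>n n)" and u_nonneg: "0 <= u n"
proof -
 have "0 <= min (ereal (real n)) (\<tau>n n)" using tau_n_pos[of n] by simp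
 moreover have "min (ereal (real n)) (\<tau>n n) \<noteq> \<infinity>" by (metis PInfty_neq_ereal(1) min.cobounded1 ereal_infty_less_eq(1))
 ultimately show "ereal (u n) = min (ereal (real n)) (\<tau>n n)" "0 <= u n"
  unfolding u_def by (auto simp: ereal_real real_of_ereal_pos)
qed

text \<open>At a finite \<open>\<zeta>\<close> the path sits at an end point, away from the compact
  interval \<open>[av n, bv n]\<close>; by continuity it has left that interval strictly
  earlier.\<close>

lemma u_less: "ereal (u n) < \<zeta>"
proof (cases rule: exit_cases[OF lx])
 case 1
 then show ?thesis by simp
next
 case (2 T)
 have "Y T w \<notin> {ereal (av n)..ereal (bv n)}" using 2(4) av(2)[of n] bv(2)[of n] by (auto intro: less_le_trans le_less_trans)
 then have "\<forall>\<^sub>F s in at_left T. Y s w \<in> - {ereal (av n)..ereal (bv n)}"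
  by (intro topological_tendstoD[OF left_limit[OF 2(2)]]) auto
 moreover have "\<forall>\<^sub>F s in at_left T. 0 <= s \<and> s < T" using 2(2) by (auto simp: eventually_at_left_field)
 ultimately have "\<forall>\<^sub>F s in at_left T. 0 <= s \<and> s < T \<and> Y s w \<notin> {ereal (av n)..ereal (bv n)}" by eventually_elim auto
 then obtain s where s: "0 <= s" "s < T" "Y s w \<notin> {ereal (av n)..ereal (bv n)}"
  using eventually_happens'[OF trivial_limit_at_left_real] by blast
 have "\<tau>n n <= ereal s" by (rule exit_time_le) (use s in auto)
 then have "ereal (u n) <= ereal s" unfolding u_eq by (rule min.coboundedI2)
 then show ?thesis using 2(1) s(2) by simp
qed

lemma u_eventually: "0 <= t ==> ereal t < \<zeta> ==> \<forall>\<^sub>F n in sequentially. t < u n"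
proof -
 assume t: "0 <= t" "ereal t < \<zeta>"
 obtain N where N: "\<forall>n\<ge>N. ereal t < \<tau>n n" using eventually_before[OF t] by blast
 show ?thesis using eventually_ge_at_top[of N] eventually_gt_at_top[of "nat \<lceil>t\<rceil>"]
 proof eventually_elim
  case (elim n)
  have "ereal t < ereal (u n)" unfolding u_eq using N elim by (simp, linarith)
  then show ?case by simp
 qed
qed

lemma u_filterlim: "filterlim (%n. ereal (u n)) (at_left \<zeta>) sequentially"
 unfolding filterlim_at
proof
 show "\<forall>\<^sub>F n in sequentially. ereal (u n) \<in> {..<\<zeta>} \<and> ereal (u n) \<noteq> \<zeta>" using u_less by (simp add: less_imp_neq)
 show "(%n. ereal (u n)) ----> \<zeta>"
 proof (rule order_tendstoI)
  fix a assume "a < \<zeta>"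
  then obtain t where t: "max a 0 < ereal t" "ereal t < \<zeta>" using ereal_dense2[of "max a 0" \<zeta>] zeta_pos by auto
  then have t0: "0 <= t" by simp
  show "\<forall>\<^sub>F n in sequentially. a < ereal (u n)" using u_eventually[OF t0 t(2)]
   by eventually_elim (use t in \<open>auto intro: less_trans\<close>)
 next
  fix a assume "\<zeta> < a"
  then show "\<forall>\<^sub>F n in sequentially. ereal (u n) < a" using less_trans[OF u_less] by simp
 qed
qed

lemma at_left_zeta: "at_left \<zeta> \<noteq> bot"
 using u_filterlim by (auto simp: filterlim_def bot_unique filtermap_bot_iff)

lemma tends_along: "tends_at_exit Y l r l w ==> (%n. Y (u n) w) ----> l"
 unfolding tends_at_exit_def by (drule filterlim_compose[OF _ u_filterlim]) simp

text \<open>Near \<open>\<zeta>\<close> the path lies below \<open>x0\<close>, and before that it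
  stays in a compact subinterval. Levels above the resulting \<open>bv m\<close> are never
  reached.\<close>

lemma bounded_above_of_tends:
 assumes "tends_at_exit Y l r l w"
 shows "\<exists>m. \<forall>t\<ge>0. ereal t < \<zeta> --> Y t w <= ereal (bv m)"
proof -
 have "\<forall>\<^sub>F t in at_left \<zeta>. Y (real_of_ereal t) w < ereal x0"
  using order_tendstoD(2)[OF assms[unfolded tends_at_exit_def] lx(1)] .
 then obtain c where c: "c < \<zeta>" "!!t. c < t ==> t < \<zeta> ==> Y (real_of_ereal t) w < ereal x0"
  unfolding eventually_at_left[OF zeta_pos] by blast
 obtain t where t: "max c 0 < ereal t" "ereal t < \<zeta>" using ereal_dense2[of "max c 0" \<zeta>] zeta_pos c(1) by auto
 then have t0: "0 <= t" by simp
 obtain m where m: "ereal t < \<tau>n m" using eventually_before[OF t0 t(2)] by blast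
 have "Y s w <= ereal (bv m)" if s: "0 <= s" "ereal s < \<zeta>" for s
 proof (cases "s <= t")
  case True
  then have "ereal s < \<tau>n m" using le_less_trans[OF _ m, of "ereal s"] by simp
  then show ?thesis using exit_time_inside[OF s(1)] by fastforce
 next
  case False
  then have "c < ereal s" using t(1) by (auto intro: less_trans)
  then have "Y s w < ereal x0" using c(2)[of "ereal s"] s by simp
  then show ?thesis using less_trans[of _ "ereal x0" "ereal (bv m)"] bv(3)[of m] by (simp add: less_imp_le)
 qed
 then show ?thesis by blast
qed

text \<open>\<open>Lim\<close> has a meaning only if a limit exists; monotonicity provides one, as a
  supremum over all times before \<open>\<zeta>\<close>, which the sequence \<open>u\<close> attains
  in the limit.\<close>

lemma increasing_limit:
 fixes g :: "real => ennreal"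
 assumes g: "!!s t. 0 <= s ==> s <= t ==> ereal t < \<zeta> ==> g s <= g t"
 shows "(%n. g (u n)) ----> Lim (at_left \<zeta>) (%t. g (real_of_ereal t))"
  and "g (u n) <= Lim (at_left \<zeta>) (%t. g (real_of_ereal t))"
proof -
 define S where "S = (SUP t\<in>{t. 0 <= t \<and> ereal t < \<zeta>}. g t)"
 have pos: "\<forall>\<^sub>F x in at_left \<zeta>. ereal t < x \<and> x < \<zeta>" if "ereal t < \<zeta>" for t
  using that by (auto simp: eventually_at_left[OF zeta_pos])
 have fin: "ereal (real_of_ereal x) = x" if "ereal t < x" "x < \<zeta>" for t x
  using that by (cases x) auto
 have lim: "((%x. g (real_of_ereal x)) \<longlongrightarrow> S) (at_left \<zeta>)"
 proof (rule order_tendstoI)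
  fix a assume "a < S"
  then obtain t where t: "0 <= t" "ereal t < \<zeta>" "a < g t" unfolding S_def less_SUP_iff by blast
  show "\<forall>\<^sub>F x in at_left \<zeta>. a < g (real_of_ereal x)" using pos[OF t(2)]
  proof eventually_elim
   case (elim x)
   have "ereal (real_of_ereal x) = x" using fin elim by blast
   then have "t <= real_of_ereal x" "ereal (real_of_ereal x) < \<zeta>" using elim by (auto simp flip: ereal_less_eq(3))
   then show ?case using g[OF t(1)] t(3) by (meson less_le_trans)
  qed
 next
  fix a assume a: "S < a"
  show "\<forall>\<^sub>F x in at_left \<zeta>. g (real_of_ereal x) < a" using pos[OF zeta_pos[unfolded zero_ereal_def]]
  proof eventually_elim
   case (elim x)
   have "ereal (real_of_ereal x) = x" using fin[of 0 x] elim by (simp add: zero_ereal_def)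
   then have "0 <= real_of_ereal x" "ereal (real_of_ereal x) < \<zeta>" using elim by (auto simp flip: ereal_less_eq(3))
   then have "g (real_of_ereal x) <= S" unfolding S_def by (intro SUP_upper) auto
   then show ?case using a by simp
  qed
 qed
 have L: "Lim (at_left \<zeta>) (%t. g (real_of_ereal t)) = S" by (rule tendsto_Lim[OF at_left_zeta lim])
 show "(%n. g (u n)) ----> Lim (at_left \<zeta>) (%t. g (real_of_ereal t))"
  unfolding L using filterlim_compose[OF lim u_filterlim] by simp
 show "g (u n) <= Lim (at_left \<zeta>) (%t. g (real_of_ereal t))"
  unfolding L S_def by (intro SUP_upper) (use u_nonneg u_less in auto)
qed

end

section \<open>The scale function\<close>

locale scale_setting =
 fixes l r :: ereal and \<mu> \<sigma> :: "real => real" and c :: real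
 assumes \<mu>_borel: "\<mu> \<in> borel_measurable (restrict_space borel (einterval l r))"
  and \<sigma>_borel: "\<sigma> \<in> borel_measurable (restrict_space borel (einterval l r))"
  and \<mu>_integrable: "locally_integrable_on (einterval l r) (%x. \<mu> x / (\<sigma> x)^2)"
  and c_in: "c \<in> einterval l r" and scale_finite: "scale_fun \<mu> \<sigma> c l > -\<infinity>"
begin

abbreviation "J \<equiv> einterval l r"

text \<open>This function and \<open>\<rho>\<close> are extended beyond J, by 0 and 1, to be Borel
  on the whole line with \<open>\<rho>\<close> positive everywhere.\<close>

definition q :: "real => real" where "q x = (if x \<in> J then 2 * \<mu> x / (\<sigma> x)^2 else 0)"
definition \<rho> :: "real => real" where "\<rho> x = (if x \<in> J then scale_density \<mu> \<sigma> c x else 1)"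
text \<open>This is \<open>s(y) - s(l)\<close>, written as one nonnegative integral so that no
  infinite values have to be subtracted; \<open>g\<close> is then the quotient in the
  dichotomy.\<close>

definition G :: "real => ennreal" where "G y = (\<integral>\<^sup>+x\<in>einterval l y. ennreal (\<rho> x) \<partial>lborel)"
definition g :: "real => real" where "g y = enn2real (G y) / \<rho> y"

lemma J_open: "open J" by (rule open_einterval)

lemma J_Icc: "x \<in> J ==> y \<in> J ==> z \<in> {x..y} ==> z \<in> J"
 using less_le_trans[of l "ereal x" "ereal z"] le_less_trans[of "ereal z" "ereal y" r] by (auto simp: einterval_def)

lemma \<rho>_pos: "0 < \<rho> x" unfolding \<rho>_def scale_density_def by simp

lemma q_borel: "q \<in> borel_measurable borel"
proof -
 have "(%x. 2 * \<mu> x / (\<sigma> x)^2) \<in> borel_measurable (restrict_space borel J)" using \<mu>_borel \<sigma>_borel by measurable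
 then have "(%x. if x \<in> J then 2 * \<mu> x / (\<sigma> x)^2 else 0) \<in> borel_measurable borel"
  by (subst measurable_If_restrict_space_iff) auto
 then show ?thesis unfolding q_def[abs_def] .
qed

lemma q_integrable: "x \<in> J ==> y \<in> J ==> set_integrable lborel {x..y} q"
proof -
 assume xy: "x \<in> J" "y \<in> J"
 have "{x..y} \<subseteq> J" using J_Icc[OF xy] by blast
 then have "set_integrable lborel {x..y} (%x. \<mu> x / (\<sigma> x)^2)"
  using \<mu>_integrable compact_Icc unfolding locally_integrable_on_def by blast
 then have "set_integrable lborel {x..y} (%x. 2 * (\<mu> x / (\<sigma> x)^2))" by (rule set_integrable_mult_right)
 then show ?thesis
  by (rule set_integrable_cong[OF refl refl, THEN iffD1, rotated]) (use J_Icc[OF xy] in \<open>auto simp: q_def\<close>)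
qed

lemma \<rho>_exp:
 assumes ab: "\<alpha> \<in> J" "\<beta> \<in> J" and x: "x \<in> {\<alpha>..\<beta>}" shows "\<rho> x = \<rho> \<alpha> * exp (- prim \<alpha> \<beta> q x)"
proof -
 have xJ: "x \<in> J" using J_Icc[OF ab x] .
 have eq: "scale_density \<mu> \<sigma> c z = exp (- (LBINT y=ereal c..ereal z. q y))" if z: "z \<in> J" for z
 proof -
  have "w \<in> J" if w: "w \<in> einterval (min (ereal c) (ereal z)) (max (ereal c) (ereal z))" for w
   by (rule J_Icc[of "min c z" "max c z"]) (use w c_in z in \<open>auto simp: einterval_def min_def max_def split: if_splits\<close>)
  then have "(LBINT y=ereal c..ereal z. 2 * \<mu> y / (\<sigma> y)^2) = (LBINT y=ereal c..ereal z. q y)"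
   by (intro interval_integral_cong) (simp add: q_def)
  then show ?thesis unfolding scale_density_def by simp
 qed
 define m M where "m = min c (min \<alpha> x)" and "M = max c (max \<alpha> x)"
 have mM: "m \<in> J" "M \<in> J" unfolding m_def M_def using c_in ab(1) xJ by (auto simp: min_def max_def)
 have "set_integrable lborel (einterval (ereal m) (ereal M)) q"
  by (rule set_integrable_subset[OF q_integrable[OF mM]]) (auto simp: einterval_def)
 then have "interval_lebesgue_integrable lborel (min (ereal c) (min (ereal \<alpha>) (ereal x))) (max (ereal c) (max (ereal \<alpha>) (ereal x))) q"
 proof -
  have "min (ereal c) (min (ereal \<alpha>) (ereal x)) = ereal m" "max (ereal c) (max (ereal \<alpha>) (ereal x)) = ereal M" "m <= M"
   by (auto simp: m_def M_def min_def max_def)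
  then show ?thesis using \<open>set_integrable lborel (einterval (ereal m) (ereal M)) q\<close>
   by (simp add: interval_lebesgue_integrable_def)
 qed
 from interval_integral_sum[OF this]
 have "(LBINT y=ereal c..ereal x. q y) = (LBINT y=ereal c..ereal \<alpha>. q y) + prim \<alpha> \<beta> q x"
  using interval_integral_prim[OF x, of q] by simp
 then show ?thesis unfolding \<rho>_def using xJ ab by (simp add: eq exp_add[symmetric])
qed

text \<open>Supplies the analytic hypotheses of \<open>bounded_local_time\<close> on every compact
  subinterval; the last item is \<open>exp_prim\<close> scaled by
  \<open>\<rho> \<alpha>\<close>.\<close>

lemma
 assumes ab: "\<alpha> \<in> J" "\<beta> \<in> J"
 shows continuous_\<rho>_Icc: "continuous_on {\<alpha>..\<beta>} \<rho>"
  and \<rho>_integrable: "set_integrable lborel {\<alpha>..\<beta>} \<rho>"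
  and q\<rho>_integrable: "set_integrable lborel {\<alpha>..\<beta>} (%v. q v * \<rho> v)"
  and \<rho>_eq: "x \<in> {\<alpha>..\<beta>} ==> \<rho> x = \<rho> \<alpha> - prim \<alpha> \<beta> (%v. q v * \<rho> v) x"
proof -
 have pc: "continuous_on {\<alpha>..\<beta>} (prim \<alpha> \<beta> q)"
 proof (cases "\<alpha> <= \<beta>")
  case True
  then show ?thesis by (rule continuous_on_prim[OF q_integrable[OF ab]])
 qed simp
 have "continuous_on {\<alpha>..\<beta>} (%x. \<rho> \<alpha> * exp (- prim \<alpha> \<beta> q x))" by (intro continuous_intros pc)
 then show c: "continuous_on {\<alpha>..\<beta>} \<rho>" by (rule continuous_on_eq) (simp add: \<rho>_exp[OF ab, symmetric])
 show "set_integrable lborel {\<alpha>..\<beta>} \<rho>" using c by (rule borel_integrable_atLeastAtMost')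
 show "set_integrable lborel {\<alpha>..\<beta>} (%v. q v * \<rho> v)" by (rule set_integrable_mult_bounded[OF q_integrable[OF ab] c])
 assume x: "x \<in> {\<alpha>..\<beta>}"
 have i: "set_integrable lborel {\<alpha>..\<beta>} (%v. q v * exp (- prim \<alpha> \<beta> q v))"
  by (intro set_integrable_mult_bounded q_integrable ab continuous_intros pc)
 have "prim \<alpha> \<beta> (%v. q v * \<rho> v) = prim \<alpha> \<beta> (%v. \<rho> \<alpha> * (q v * exp (- prim \<alpha> \<beta> q v)) + 0 * (q v * exp (- prim \<alpha> \<beta> q v)))"
  by (rule prim_cong) (subst \<rho>_exp[OF ab], assumption, simp)
 then show "\<rho> x = \<rho> \<alpha> - prim \<alpha> \<beta> (%v. q v * \<rho> v) x"
  unfolding prim_linear[OF i i] using \<rho>_exp[OF ab x] exp_prim[OF q_integrable[OF ab] x] by (simp add: algebra_simps)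
qed

lemma continuous_\<rho>: "continuous_on J \<rho>"
proof (rule continuous_at_imp_continuous_on, rule ballI)
 fix x assume x: "x \<in> J"
 obtain e where e: "0 < e" "cball x e \<subseteq> J" using open_contains_cball[of J] J_open x by blast
 have "continuous_on {x - e..x + e} \<rho>" by (rule continuous_\<rho>_Icc) (use e in \<open>auto simp: dist_real_def\<close>)
 then show "isCont \<rho> x" by (rule continuous_on_interior) (use e in auto)
qed

lemma \<rho>_borel: "\<rho> \<in> borel_measurable borel"
proof -
 have "continuous_on J (%x. scale_density \<mu> \<sigma> c x)" using continuous_\<rho> by (rule continuous_on_eq) (simp add: \<rho>_def)
 then have "(%x. if x \<in> J then scale_density \<mu> \<sigma> c x else 1) \<in> borel_measurable borel"
  by (intro borel_measurable_continuous_on_if) auto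
 then show ?thesis unfolding \<rho>_def[abs_def] .
qed

lemma G_borel: "G \<in> borel_measurable borel"
proof -
 have "(%(y, x). ennreal (\<rho> x) * (if l < ereal x \<and> x < y then 1 else 0)) \<in> borel_measurable (borel \<Otimes>\<^sub>M lborel)"
  using \<rho>_borel by measurable
 from lborel.borel_measurable_nn_integral[OF this]
 have "(%y. \<integral>\<^sup>+x. ennreal (\<rho> x) * (if l < ereal x \<and> x < y then 1 else 0) \<partial>lborel) \<in> borel_measurable borel" .
 then show ?thesis unfolding G_def[abs_def] einterval_def indicator_def[of "Collect _"] of_bool_def by simp
qed

lemma g_borel: "g \<in> borel_measurable borel"
 unfolding g_def[abs_def] using G_borel \<rho>_borel by measurable

lemma G_split:
 assumes y: "y \<in> J" and z: "z \<in> J" and yz: "y <= z"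
 shows "G z = G y + (\<integral>\<^sup>+x\<in>einterval (ereal y) (ereal z). ennreal (\<rho> x) \<partial>lborel)"
proof -
 have "G z = (\<integral>\<^sup>+x. ennreal (\<rho> x) * indicator (einterval l (ereal y)) x + ennreal (\<rho> x) * indicator (einterval (ereal y) (ereal z)) x \<partial>lborel)"
  unfolding G_def
 proof (rule nn_integral_cong_AE)
  have "AE x in lborel. x \<noteq> y" by (rule AE_lborel_singleton)
  then show "AE x in lborel. ennreal (\<rho> x) * indicator (einterval l (ereal z)) x =
   ennreal (\<rho> x) * indicator (einterval l (ereal y)) x + ennreal (\<rho> x) * indicator (einterval (ereal y) (ereal z)) x"
  proof eventually_elim
   case (elim x)
   have "l < ereal y" using y by (simp add: einterval_def)
   then have "y < x ==> l < ereal x" using less_trans[of l "ereal y" "ereal x"] by simp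
   then show ?case using elim yz by (cases "x < y") (auto simp: einterval_def indicator_def)
  qed
 qed
 also have "\<dots> = G y + (\<integral>\<^sup>+x\<in>einterval (ereal y) (ereal z). ennreal (\<rho> x) \<partial>lborel)"
  unfolding G_def by (rule nn_integral_add) (use \<rho>_borel in measurable)
 finally show ?thesis .
qed

lemma inner_finite: "y \<in> J ==> z \<in> J ==> (\<integral>\<^sup>+x\<in>einterval (ereal y) (ereal z). ennreal (\<rho> x) \<partial>lborel) < \<infinity>"
proof -
 assume yz: "y \<in> J" "z \<in> J"
 have "(\<integral>\<^sup>+x\<in>einterval (ereal y) (ereal z). ennreal (\<rho> x) \<partial>lborel) <= (\<integral>\<^sup>+x. ennreal (indicator {y..z} x *\<^sub>R \<rho> x) \<partial>lborel)"
  by (rule nn_integral_mono) (auto simp: einterval_def indicator_def)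
 also have "\<dots> < \<infinity>" using \<rho>_integrable[OF yz] \<rho>_pos
  unfolding set_integrable_def integrable_iff_bounded by (simp add: abs_mult abs_of_pos less_imp_le)
 finally show ?thesis .
qed

lemma scale_density_\<rho>: "B \<subseteq> J ==> (\<integral>\<^sup>+x\<in>B. ennreal (scale_density \<mu> \<sigma> c x) \<partial>lborel) = (\<integral>\<^sup>+x\<in>B. ennreal (\<rho> x) \<partial>lborel)"
 by (rule nn_integral_cong) (auto simp: \<rho>_def indicator_def)

lemma inner_subset: "y \<in> J ==> z \<in> J ==> einterval (ereal y) (ereal z) \<subseteq> J"
 using J_Icc[of y z] by (auto simp: einterval_def)

lemma left_subset: "y \<in> J ==> einterval l (ereal y) \<subseteq> J"
 using less_trans[of _ "ereal y" r] by (auto simp: einterval_def)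

lemma scale_fun_left: "scale_fun \<mu> \<sigma> c l = - enn2ereal (G c)"
proof -
 have "\<not> ereal c <= l" using c_in by (simp add: einterval_def not_le)
 then show ?thesis using scale_density_\<rho>[OF left_subset[OF c_in]] unfolding scale_fun_def G_def by simp
qed

lemma G_finite: "y \<in> J ==> G y < \<infinity>"
proof -
 assume y: "y \<in> J"
 have c: "G c < \<infinity>" using scale_finite unfolding scale_fun_left by (cases "G c") auto
 show ?thesis
 proof (cases "y <= c")
  case True
  then show ?thesis using G_split[OF y c_in] c by (simp add: less_top[symmetric])
 next
  case False
  then show ?thesis using G_split[OF c_in y] c inner_finite[OF c_in y] by (simp add: ennreal_add_less_top)
 qed
qed

lemma scale_ratio:
 assumes y: "y \<in> J"
 shows "(scale_fun \<mu> \<sigma> c (ereal y) - scale_fun \<mu> \<sigma> c l) / ereal (scale_density \<mu> \<sigma> c y) = ereal (g y)"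
proof -
 have Gr: "enn2ereal (G z) = ereal (enn2real (G z))" if "z \<in> J" for z
  using G_finite[OF that] by (cases "G z") (auto simp: enn2ereal_ennreal)
 have "scale_fun \<mu> \<sigma> c (ereal y) - scale_fun \<mu> \<sigma> c l = ereal (enn2real (G y))"
 proof (cases "c <= y")
  case True
  define I where "I = (\<integral>\<^sup>+x\<in>einterval (ereal c) (ereal y). ennreal (\<rho> x) \<partial>lborel)"
  have I: "I < \<infinity>" unfolding I_def by (rule inner_finite[OF c_in y])
  have "scale_fun \<mu> \<sigma> c (ereal y) = enn2ereal I"
   unfolding scale_fun_def I_def using True scale_density_\<rho>[OF inner_subset[OF c_in y]] by simp
  moreover have "G y = G c + I" unfolding I_def by (rule G_split[OF c_in y True])
  ultimately show ?thesis unfolding scale_fun_left using I G_finite[OF c_in]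
   by (cases I; cases "G c") (auto simp: enn2ereal_ennreal ennreal_plus[symmetric] simp del: ennreal_plus)
 next
  case False
  define I where "I = (\<integral>\<^sup>+x\<in>einterval (ereal y) (ereal c). ennreal (\<rho> x) \<partial>lborel)"
  have I: "I < \<infinity>" unfolding I_def by (rule inner_finite[OF y c_in])
  have "scale_fun \<mu> \<sigma> c (ereal y) = - enn2ereal I"
   unfolding scale_fun_def I_def using False scale_density_\<rho>[OF inner_subset[OF y c_in]] by simp
  moreover have "G c = G y + I" unfolding I_def by (rule G_split[OF y c_in]) (use False in simp)
  ultimately show ?thesis unfolding scale_fun_left using I G_finite[OF y]
   by (cases I; cases "G y") (auto simp: enn2ereal_ennreal ennreal_plus[symmetric] simp del: ennreal_plus)
 qed
 then show ?thesis unfolding g_def using y \<rho>_pos[of y] by (simp add: \<rho>_def)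
qed

lemma prim_le_G:
 assumes "\<alpha> \<in> J" "\<beta> \<in> J" shows "ennreal (prim \<alpha> \<beta> \<rho> y) <= G y"
proof -
 have i: "set_integrable lborel {\<alpha>..min \<beta> y} \<rho>" by (rule set_integrable_subset[OF \<rho>_integrable[OF assms]]) auto
 have "ennreal (prim \<alpha> \<beta> \<rho> y) = (\<integral>\<^sup>+x. ennreal (indicator {\<alpha>..min \<beta> y} x *\<^sub>R \<rho> x) \<partial>lborel)"
  unfolding prim_def set_lebesgue_integral_def
  by (rule nn_integral_eq_integral[symmetric]) (use i \<rho>_pos in \<open>auto simp: set_integrable_def less_imp_le\<close>)
 also have "\<dots> <= G y" unfolding G_def
 proof (rule nn_integral_mono_AE)
  have "AE x in lborel. x \<noteq> y" by (rule AE_lborel_singleton)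
  then show "AE x in lborel. ennreal (indicator {\<alpha>..min \<beta> y} x *\<^sub>R \<rho> x) <= ennreal (\<rho> x) * indicator (einterval l (ereal y)) x"
   by eventually_elim (use assms less_le_trans[of l "ereal \<alpha>"] in \<open>auto simp: einterval_def indicator_def\<close>)
 qed
 finally show ?thesis .
qed

lemma G_pos: "y \<in> J ==> 0 < enn2real (G y)"
proof -
 assume y: "y \<in> J"
 have "G y \<noteq> 0"
 proof
  assume "G y = 0"
  then have "AE x in lborel. ennreal (\<rho> x) * indicator (einterval l (ereal y)) x = 0"
   unfolding G_def by (subst (asm) nn_integral_0_iff_AE) (use \<rho>_borel in measurable)
  then have "AE x in lborel. x \<notin> einterval l (ereal y)"
  proof eventually_elim
   case (elim x)
   have "ennreal (\<rho> x) \<noteq> 0" using \<rho>_pos[of x] by simp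
   then show ?case using elim by (auto simp: indicator_def)
  qed
  then have "emeasure lborel (einterval l (ereal y)) = 0" by (subst (asm) AE_iff_measurable[of "einterval l (ereal y)"]) auto
  moreover have "l < ereal y" using y by (simp add: einterval_def)
  then obtain z where "l < ereal z" "z < y" using ereal_dense2 by force
  then have "{z<..<y} \<subseteq> einterval l (ereal y)" "0 < emeasure lborel {z<..<y}" using less_trans[of l "ereal z"] by (auto simp: einterval_def)
  ultimately show False using emeasure_mono[of "{z<..<y}" "einterval l (ereal y)" lborel] by simp
 qed
 then show ?thesis using G_finite[OF y] by (simp add: enn2real_positive_iff zero_less_iff_neq_zero)
qed

lemma g_pos: "y \<in> J ==> 0 < g y"
 unfolding g_def using G_pos \<rho>_pos by simp

end

section \<open>Local time at the exit time\<close>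

definition dyadic :: "int => nat => real" where "dyadic i k = real_of_int i / 2 ^ k"

text \<open>The summand 1 puts the grid point strictly above \<open>y\<close>, so the grid points
  approach \<open>y\<close> within \<open>at_right y\<close>, the side on which local time is
  continuous.\<close>

definition dyadic_above :: "real => nat => int" where "dyadic_above y k = \<lfloor>y * 2 ^ k\<rfloor> + 1"

abbreviation "grid_above y k \<equiv> dyadic (dyadic_above y k) k"

lemma dyadic_above: "y < grid_above y k" "grid_above y k <= y + 1 / 2 ^ k"
proof -
 have "y * 2 ^ k < real_of_int (dyadic_above y k)" "real_of_int (dyadic_above y k) <= y * 2 ^ k + 1"
  unfolding dyadic_above_def by linarith+
 then show "y < grid_above y k" "grid_above y k <= y + 1 / 2 ^ k"
  unfolding dyadic_def by (simp_all add: field_simps)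
qed

lemma dyadic_above_tendsto: "filterlim (%k. grid_above y k) (at_right y) sequentially"
 unfolding filterlim_at
proof
 show "\<forall>\<^sub>F k in sequentially. grid_above y k \<in> {y<..} \<and> grid_above y k \<noteq> y"
  using dyadic_above(1)[of y] by (auto simp: less_imp_neq[symmetric] intro!: always_eventually)
 have "(%k. y + 1 / 2 ^ k) ----> y + 0" by (intro tendsto_intros LIMSEQ_divide_realpow_zero) simp
 then have u: "(%k. y + 1 / 2 ^ k) ----> y" by simp
 have l: "\<forall>\<^sub>F k in sequentially. y <= grid_above y k" using dyadic_above(1) by (simp add: less_imp_le)
 have "\<forall>\<^sub>F k in sequentially. grid_above y k <= y + 1 / 2 ^ k" using dyadic_above(2) by simp
 from tendsto_sandwich[OF l this tendsto_const u] show "(%k. grid_above y k) ----> y" .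
qed

locale exiting_diffusion = scale_setting l r \<mu> \<sigma> c + bm_space M F W
 for l r \<mu> \<sigma> c and M :: "'a measure" and F W +
 fixes x0 :: real and Y :: "real => 'a => ereal" and L :: "real => real => 'a => real" and av bv :: "nat => real"
 assumes \<sigma>_nonzero: "!!x. x \<in> J ==> \<sigma> x \<noteq> 0"
  and solution: "sde_solution M F W l r \<mu> \<sigma> x0 Y" and local_time: "local_time_version M F W l r \<mu> \<sigma> x0 Y L"
  and av: "decseq av" "!!n. l < ereal (av n)" "!!n. av n < x0" "(%n. ereal (av n)) ----> l"
  and bv: "incseq bv" "!!n. ereal (bv n) < r" "!!n. x0 < bv n" "(%n. ereal (bv n)) ----> r"
begin

definition \<tau> :: "nat => 'a => ereal" where "\<tau> n = exit_time Y (ereal (av n)) (ereal (bv n))"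
definition X :: "nat => real => 'a => real" where "X n t w = real_of_ereal (stop_at (\<tau> n) Y t w)"
definition \<Lambda> :: "nat => real => real => 'a => real" where "\<Lambda> n y = stop_at (\<tau> n) (%t. L t y)"
definition u :: "nat => 'a => real" where "u n w = real_of_ereal (min (ereal (real n)) (\<tau> n w))"

abbreviation "good w \<equiv> exit_path Y w l r x0 av bv"
abbreviation "\<zeta> w \<equiv> exit_time Y l r w"

lemma good_AE: "AE w in M. good w"
proof -
 have "AE w in M. w \<in> space M" by simp
 moreover have "AE w in M. \<forall>t\<ge>0. Y t w \<in> {l..r}" "AE w in M. Y 0 w = ereal x0"
  "\<forall>w\<in>space M. continuous_on {0..} (%t. Y t w)" using solution unfolding sde_solution_def by blast+
 ultimately show ?thesis using av bv
  by (auto simp: exit_path_def elim!: eventually_mono)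
qed

lemma level_in: "av n < y ==> y < bv n ==> y \<in> J"
 using less_trans[of l "ereal (av n)" "ereal y"] less_trans[of "ereal y" "ereal (bv n)" r] av(2) bv(2) by (auto simp: einterval_def)

lemma level_eventually: "y \<in> J ==> \<forall>\<^sub>F n in sequentially. av n < y \<and> y < bv n"
 using eventually_conj[OF order_tendstoD(2)[OF av(4)] order_tendstoD(1)[OF bv(4)]] by (fastforce simp: einterval_def)

lemma av_in: "av n \<in> J" and bv_in: "bv n \<in> J"
 using less_trans[of "ereal (av n)" "ereal (bv n)" r] less_trans[of l "ereal (av n)" "ereal (bv n)"] av(2,3)[of n] bv(2,3)[of n]
 by (auto simp: einterval_def)

lemma X_good:
 assumes "good w" "0 <= t"
 shows "X n t w \<in> {av n..bv n}" "ereal (X n t w) = Y (real_of_ereal (min (ereal t) (\<tau> n w))) w" "X n 0 w = x0"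
proof -
 interpret P: exit_path Y w l r x0 av bv by fact
 have "Y (real_of_ereal (min (ereal t) (\<tau> n w))) w \<in> {ereal (av n)..ereal (bv n)}"
  unfolding \<tau>_def by (rule P.stopped_range) (use assms av bv in auto)
 then show "X n t w \<in> {av n..bv n}" "ereal (X n t w) = Y (real_of_ereal (min (ereal t) (\<tau> n w))) w"
  unfolding X_def stop_at_def by (cases "Y (real_of_ereal (min (ereal t) (\<tau> n w))) w"; simp)+
 have "min (ereal 0) (\<tau> n w) = 0" using P.tau_n_pos[of n] unfolding \<tau>_def by (simp add: min_absorb1 less_imp_le flip: zero_ereal_def)
 then show "X n 0 w = x0" unfolding X_def stop_at_def using P.start by simp
qed

text \<open>The factor \<open>\<sigma>^2\<close> cancels: before the exit
  \<open>b = \<mu> = 1/2 * q * \<sigma>^2\<close>, and afterwards both coefficients are 0. The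
  coefficient processes and integrals are hidden, as later arguments involve only \<open>X n\<close>
  and \<open>\<Lambda> n y\<close>.\<close>

lemma bounded_local_time_ex:
 assumes y: "av n < y" "y < bv n"
 shows "\<exists>b a I Iy. bounded_local_time M F W (X n) b a I x0 (av n) (bv n) y Iy (\<Lambda> n y) q \<rho>"
proof -
 define b where "b = coeff_until (\<tau> n) \<mu> Y"
 define a where "a = coeff_until (\<tau> n) \<sigma> Y"
 have ip: "ito_process M F W (X n) b a"
  using solution av(2,3)[of n] bv(2,3)[of n] unfolding sde_solution_def Let_def b_def a_def X_def[abs_def] \<tau>_def by blast
 have "ito_local_time M F W (X n) b a y (\<Lambda> n y)"
  using local_time level_in[OF y] av(2,3)[of n] bv(2,3)[of n] unfolding local_time_version_def Let_def b_def a_def X_def[abs_def] \<Lambda>_def \<tau>_def by blast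
 then obtain Iy where Iy: "ito_integral M F W (%s w. sgn_left (X n s w - y) * a s w) Iy"
  "AE w in M. \<forall>t\<ge>0. \<Lambda> n y t w = \<bar>X n t w - y\<bar> - \<bar>X n 0 w - y\<bar> - ((LBINT s:{0..t}. sgn_left (X n s w - y) * b s w) + Iy t w)"
  unfolding ito_local_time_def by blast
 obtain I where I: "progressively_measurable F b" "AE w in M. \<forall>t\<ge>0. set_integrable lborel {0..t} (%s. b s w)"
  "ito_integral M F W a I" "AE w in M. \<forall>t\<ge>0. X n t w = X n 0 w + (LBINT s:{0..t}. b s w) + I t w"
  using ip unfolding ito_process_def by blast
 have "bounded_local_time M F W (X n) b a I x0 (av n) (bv n) y Iy (\<Lambda> n y) q \<rho>"
 proof unfold_locales
  show "av n < bv n" using av(3)[of n] bv(3)[of n] by simp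
  show "SI a I" "SI (%s w. sgn_left (X n s w - y) * a s w) Iy" by (intro SI_ito_integral I(3) Iy(1))+
  show "AE w in M. \<forall>t\<ge>0. X n t w = x0 + (LBINT s:{0..t}. b s w) + I t w"
   using I(4) good_AE by eventually_elim (simp add: X_good)
  show "AE w in M. \<forall>t\<ge>0. \<Lambda> n y t w = \<bar>X n t w - y\<bar> - \<bar>x0 - y\<bar> - ((LBINT s:{0..t}. sgn_left (X n s w - y) * b s w) + Iy t w)"
   using Iy(2) good_AE by eventually_elim (simp add: X_good)
  show "AE w in M. \<forall>t\<ge>0. X n t w \<in> {av n..bv n}" using good_AE by eventually_elim (use X_good in blast)
  show "AE w in M. \<forall>s\<ge>0. b s w = 1/2 * q (X n s w) * (a s w)^2"
   using good_AE
  proof eventually_elim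
   case (elim w)
   show ?case
   proof (intro allI impI)
    fix s :: real assume s: "0 <= s"
    show "b s w = 1/2 * q (X n s w) * (a s w)^2"
    proof (cases "ereal s < \<tau> n w")
     case True
     then have m: "min (ereal s) (\<tau> n w) = ereal s" by simp
     have Xs: "X n s w = real_of_ereal (Y s w)" unfolding X_def stop_at_def m by simp
     have "X n s w \<in> J" using J_Icc[OF av_in bv_in] X_good(1)[OF elim s] by blast
     then show ?thesis using True \<sigma>_nonzero[of "X n s w"] unfolding b_def a_def coeff_until_def q_def Xs by simp
    qed (simp add: b_def a_def coeff_until_def)
   qed
  qed
  show "x \<in> {av n..bv n} ==> \<rho> x = \<rho> (av n) - prim (av n) (bv n) (%v. q v * \<rho> v) x" for x
   by (rule \<rho>_eq[OF av_in bv_in])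
 qed (use y I \<rho>_pos \<rho>_borel q_borel q\<rho>_integrable[OF av_in bv_in] \<rho>_integrable[OF av_in bv_in] in auto)
 then show ?thesis by blast
qed

lemma \<Lambda>_at: "\<Lambda> n y (real n) w = L (u n w) y w"
 unfolding \<Lambda>_def stop_at_def u_def by simp

text \<open>Each level has its own null set, so the properties are first collected for the countably
  many dyadic levels; right-continuity in the level extends what is needed to all others.\<close>

lemma local_time_facts:
 "AE w in M. \<forall>i k n. av n < dyadic i k --> dyadic i k < bv n -->
   (\<forall>s t. 0 <= s --> s <= t --> \<Lambda> n (dyadic i k) s w <= \<Lambda> n (dyadic i k) t w) \<and>
   (\<forall>t\<ge>0. (\<forall>s\<in>{0..t}. X n s w <= dyadic i k) --> \<Lambda> n (dyadic i k) t w = 0)"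
 unfolding AE_all_countable
proof (intro allI)
 fix i k n
 show "AE w in M. av n < dyadic i k --> dyadic i k < bv n -->
   (\<forall>s t. 0 <= s --> s <= t --> \<Lambda> n (dyadic i k) s w <= \<Lambda> n (dyadic i k) t w) \<and>
   (\<forall>t\<ge>0. (\<forall>s\<in>{0..t}. X n s w <= dyadic i k) --> \<Lambda> n (dyadic i k) t w = 0)"
 proof (cases "av n < dyadic i k \<and> dyadic i k < bv n")
  case True
  from bounded_local_time_ex[OF conjunct1[OF True] conjunct2[OF True]] obtain b a I Iy
   where "bounded_local_time M F W (X n) b a I x0 (av n) (bv n) (dyadic i k) Iy (\<Lambda> n (dyadic i k)) q \<rho>" by (elim exE)
  from bounded_local_time.local_time_increasing[OF this] show ?thesis by eventually_elim blast
 qed auto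
qed

text \<open>A measurable version of the local time at a dyadic level and at the time
  \<open>u n\<close>. The guard on the level lets the choice succeed for every index, so
  \<open>Z\<close> is measurable throughout.\<close>

definition Z :: "nat => int => nat => 'a => real" where
 "Z n i k = (SOME f. f \<in> borel_measurable M \<and> (av n < dyadic i k \<and> dyadic i k < bv n --> (AE w in M. L (u n w) (dyadic i k) w = f w)))"

lemma Z: "Z n i k \<in> borel_measurable M"
 and Z_AE: "av n < dyadic i k ==> dyadic i k < bv n ==> AE w in M. L (u n w) (dyadic i k) w = Z n i k w"
proof -
 have "\<exists>f. f \<in> borel_measurable M \<and> (av n < dyadic i k \<and> dyadic i k < bv n --> (AE w in M. L (u n w) (dyadic i k) w = f w))"
 proof (cases "av n < dyadic i k \<and> dyadic i k < bv n")
  case True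
  from bounded_local_time_ex[OF conjunct1[OF True] conjunct2[OF True]] obtain b a I Iy
   where "bounded_local_time M F W (X n) b a I x0 (av n) (bv n) (dyadic i k) Iy (\<Lambda> n (dyadic i k)) q \<rho>" by (elim exE)
  from ae_measurable_F[OF bounded_local_time.local_time_adapted[OF this, of "real n"]]
  have "ae_measurable M (\<Lambda> n (dyadic i k) (real n))" by simp
  moreover have "\<Lambda> n (dyadic i k) (real n) = (%w. L (u n w) (dyadic i k) w)" by (rule ext) (rule \<Lambda>_at)
  ultimately have "ae_measurable M (%w. L (u n w) (dyadic i k) w)" by simp
  then show ?thesis unfolding ae_measurable_def by blast
 qed (auto intro!: exI[of _ "%_. 0"])
 from someI_ex[OF this] show "Z n i k \<in> borel_measurable M"
  "av n < dyadic i k ==> dyadic i k < bv n ==> AE w in M. L (u n w) (dyadic i k) w = Z n i k w"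
  unfolding Z_def[symmetric] by blast+
qed

text \<open>A jointly measurable version of \<open>L\<^sup>y\<^sub>\<zeta>\<close>, obtained from right-continuity in \<open>y\<close>.\<close>

definition Hn :: "nat => real => 'a => ennreal" where
 "Hn n y w = limsup (%k. ennreal (Z n (dyadic_above y k) k w))"
definition H :: "real => 'a => ennreal" where "H y w = liminf (%n. Hn n y w)"

lemma Hn_measurable: "(%(y, w). Hn n y w) \<in> borel_measurable (borel \<Otimes>\<^sub>M M)"
proof -
 have "(%z. Z n (dyadic_above (fst z) k) k (snd z)) \<in> borel_measurable (borel \<Otimes>\<^sub>M M)" for k
 proof (rule measurable_compose_countable[where f="%i z. Z n i k (snd z)" and g="%z. dyadic_above (fst z) k"])
  show "(%z. Z n i k (snd z)) \<in> borel_measurable (borel \<Otimes>\<^sub>M M)" for i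
   by (rule measurable_compose[OF measurable_snd Z])
  show "(%z. dyadic_above (fst z) k) \<in> borel \<Otimes>\<^sub>M M \<rightarrow>\<^sub>M count_space UNIV" unfolding dyadic_above_def by measurable
 qed
 then show ?thesis unfolding Hn_def split_beta' by measurable
qed

lemma H_measurable: "(%(y, w). H y w) \<in> borel_measurable (borel \<Otimes>\<^sub>M M)"
 using Hn_measurable unfolding H_def split_beta' by measurable

text \<open>Gathers every almost sure property used later, so that the identification of
  \<open>H\<close> with the local time at \<open>\<zeta>\<close> is an argument about a single
  path.\<close>

definition regular :: "'a => bool" where
 "regular w \<longleftrightarrow> good w \<and>
   (\<forall>i k n. av n < dyadic i k --> dyadic i k < bv n -->
    (\<forall>s t. 0 <= s --> s <= t --> \<Lambda> n (dyadic i k) s w <= \<Lambda> n (dyadic i k) t w) \<and>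
    (\<forall>t\<ge>0. (\<forall>s\<in>{0..t}. X n s w <= dyadic i k) --> \<Lambda> n (dyadic i k) t w = 0)) \<and>
   (\<forall>i k n. av n < dyadic i k --> dyadic i k < bv n --> L (u n w) (dyadic i k) w = Z n i k w) \<and>
   (\<forall>t\<ge>0. ereal t < \<zeta> w --> (\<forall>y\<in>J. continuous (at_right y) (%z. L t z w)))"

lemma regular_AE: "AE w in M. regular w"
proof -
 have "AE w in M. \<forall>i k n. av n < dyadic i k --> dyadic i k < bv n --> L (u n w) (dyadic i k) w = Z n i k w"
  unfolding AE_all_countable using Z_AE by fastforce
 moreover have "AE w in M. \<forall>t\<ge>0. ereal t < \<zeta> w --> (\<forall>y\<in>J. continuous (at_right y) (%z. L t z w))"
  using conjunct2[OF local_time[unfolded local_time_version_def]] by eventually_elim blast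
 ultimately show ?thesis using good_AE local_time_facts unfolding regular_def by eventually_elim blast
qed

section \<open>Identification of the jointly measurable version along a regular path\<close>

context
 fixes w assumes regular: "regular w"
begin

interpretation P: exit_path Y w l r x0 av bv using regular unfolding regular_def by blast

lemma u_P: "P.u n = u n w" unfolding P.u_def u_def \<tau>_def ..

lemma right_limit:
 assumes "y \<in> J" "0 <= t" "ereal t < \<zeta> w" shows "(%k. L t (grid_above y k) w) ----> L t y w"
proof -
 have "((%z. L t z w) \<longlongrightarrow> L t y w) (at_right y)" using regular assms unfolding regular_def continuous_within by blast
 from filterlim_compose[OF this dyadic_above_tendsto] show ?thesis .
qed

lemma dyadic_eventually: "y < z ==> \<forall>\<^sub>F k in sequentially. grid_above y k < z"
 using filterlim_mono[OF dyadic_above_tendsto at_within_le_nhds order_refl, of y] by (rule order_tendstoD(2))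

lemma dyadic_in: "y \<in> J ==> \<forall>\<^sub>F k in sequentially. grid_above y k \<in> J"
proof -
 assume "y \<in> J"
 then have "\<forall>\<^sub>F n in sequentially. av n < y \<and> y < bv n" by (rule level_eventually)
 from eventually_happens'[OF sequentially_bot this] obtain n where n: "av n < y" "y < bv n" by blast
 show ?thesis using dyadic_eventually[OF n(2)]
 proof eventually_elim
  case (elim k)
  have "av n < grid_above y k" using n(1) dyadic_above(1)[of y k] by simp
  then show ?case using elim by (rule level_in)
 qed
qed

text \<open>At a dyadic level choose \<open>n\<close> so large that \<open>t\<close> precedes the
  exit from the compact interval, where \<open>L\<close> and \<open>\<Lambda> n\<close> agree; then
  let dyadic levels decrease to \<open>y\<close>.\<close>

lemma L_mono:
 assumes y: "y \<in> J" and st: "0 <= s" "s <= t" "ereal t < \<zeta> w" shows "L s y w <= L t y w"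
proof -
 have d: "L s (dyadic i k) w <= L t (dyadic i k) w" if i: "dyadic i k \<in> J" for i k
 proof -
  have "0 <= t" using st by simp
  from P.eventually_before[OF this st(3), folded \<tau>_def] obtain N where N: "!!n. n >= N ==> ereal t < \<tau> n w" by blast
  obtain n where n: "av n < dyadic i k" "dyadic i k < bv n" "n >= N"
   using eventually_happens'[OF sequentially_bot eventually_conj[OF level_eventually[OF i] eventually_ge_at_top[of N]]] by blast
  have "ereal s < \<tau> n w" using le_less_trans[OF _ N[OF n(3)], of "ereal s"] st by simp
  then have "\<Lambda> n (dyadic i k) s w = L s (dyadic i k) w" "\<Lambda> n (dyadic i k) t w = L t (dyadic i k) w"
   using N[OF n(3)] unfolding \<Lambda>_def stop_at_def by auto
  moreover have "\<Lambda> n (dyadic i k) s w <= \<Lambda> n (dyadic i k) t w" using regular n st unfolding regular_def by blast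
  ultimately show ?thesis by simp
 qed
 have "ereal s < \<zeta> w" using le_less_trans[OF _ st(3), of "ereal s"] st by simp
 then show ?thesis
  using dyadic_in[OF y]
  by (intro tendsto_le[OF sequentially_bot right_limit[OF y] right_limit[OF y]])
   (use st d in \<open>auto elim!: eventually_mono\<close>)
qed

lemma
 assumes y: "y \<in> J"
 shows L_tendsto: "(%n. ennreal (L (u n w) y w)) ----> local_time_at_exit Y l r L y w"
  and L_le: "ennreal (L (u n w) y w) <= local_time_at_exit Y l r L y w"
proof -
 have m: "ennreal (L s y w) <= ennreal (L t y w)" if "0 <= s" "s <= t" "ereal t < \<zeta> w" for s t
  by (rule ennreal_leI[OF L_mono[OF y that]])
 show "(%n. ennreal (L (u n w) y w)) ----> local_time_at_exit Y l r L y w"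
  using P.increasing_limit(1)[of "%t. ennreal (L t y w)", OF m] unfolding local_time_at_exit_def u_P .
 show "ennreal (L (u n w) y w) <= local_time_at_exit Y l r L y w"
  using P.increasing_limit(2)[of "%t. ennreal (L t y w)", OF m] unfolding local_time_at_exit_def u_P .
qed

lemma Hn_eq: "av n < y ==> y < bv n ==> Hn n y w = ennreal (L (u n w) y w)"
proof -
 assume y: "av n < y" "y < bv n"
 have u: "0 <= u n w" "ereal (u n w) < \<zeta> w" using P.u_nonneg[of n] P.u_less[of n] unfolding u_P by auto
 have "(%k. ennreal (L (u n w) (grid_above y k) w)) ----> ennreal (L (u n w) y w)"
  by (intro tendsto_ennrealI right_limit u level_in[OF y])
 moreover have "\<forall>\<^sub>F k in sequentially. ennreal (L (u n w) (grid_above y k) w) = ennreal (Z n (dyadic_above y k) k w)"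
  using dyadic_eventually[OF y(2)]
 proof eventually_elim
  case (elim k)
  have "av n < grid_above y k" using y(1) dyadic_above(1)[of y k] by simp
  then have "L (u n w) (grid_above y k) w = Z n (dyadic_above y k) k w" using regular elim unfolding regular_def by blast
  then show ?case by simp
 qed
 ultimately have "(%k. ennreal (Z n (dyadic_above y k) k w)) ----> ennreal (L (u n w) y w)" by (rule Lim_transform_eventually)
 then show ?thesis unfolding Hn_def by (rule lim_imp_Limsup[OF sequentially_bot])
qed

lemma H_eq: "y \<in> J ==> H y w = local_time_at_exit Y l r L y w"
proof -
 assume y: "y \<in> J"
 have "\<forall>\<^sub>F n in sequentially. ennreal (L (u n w) y w) = Hn n y w"
  using level_eventually[OF y] by eventually_elim (simp add: Hn_eq)
 then have "(%n. Hn n y w) ----> local_time_at_exit Y l r L y w" by (rule Lim_transform_eventually[OF L_tendsto[OF y]])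
 then show ?thesis unfolding H_def by (rule lim_imp_Liminf[OF sequentially_bot])
qed

text \<open>Every dyadic level above \<open>y\<close> dominates the path up to the time
  \<open>u n\<close>, so its local time is 0; the limit from the right covers \<open>y\<close>
  itself.\<close>

lemma local_time_at_exit_above:
 assumes m: "!!t. 0 <= t ==> ereal t < \<zeta> w ==> Y t w <= ereal (bv m)" and y: "y \<in> J" "bv m <= y"
 shows "local_time_at_exit Y l r L y w = 0"
proof -
 have "L (u n w) y w = 0" if n: "av n < y" "y < bv n" for n
 proof -
  have u: "0 <= u n w" "ereal (u n w) < \<zeta> w" using P.u_nonneg[of n] P.u_less[of n] unfolding u_P by auto
  have Xb: "X n s w <= bv m" if s: "s \<in> {0..real n}" for s
  proof -
   define v where "v = real_of_ereal (min (ereal s) (\<tau> n w))"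
   have t0: "0 < \<tau> n w" using P.tau_n_pos[of n] unfolding \<tau>_def .
   then have ve: "ereal v = min (ereal s) (\<tau> n w)" unfolding v_def using s by (cases "\<tau> n w") (auto simp: min_def)
   have "ereal v <= ereal (u n w)" unfolding ve P.u_eq[of n, unfolded u_P, folded \<tau>_def] using s by (intro min.mono) auto
   then have "ereal v < \<zeta> w" using u(2) by (rule le_less_trans)
   moreover have "0 <= ereal v" unfolding ve using s t0 by (simp add: zero_ereal_def[symmetric] less_imp_le)
   ultimately have "Y v w <= ereal (bv m)" using m[of v] by simp
   moreover have "good w" "0 <= s" using regular s unfolding regular_def by auto
   ultimately have "ereal (X n s w) <= ereal (bv m)" using X_good(2)[of w s n] unfolding v_def by simp
   then show ?thesis by simp
  qed
  have "\<forall>\<^sub>F k in sequentially. L (u n w) (grid_above y k) w = 0"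
   using dyadic_eventually[OF n(2)]
  proof eventually_elim
   case (elim k)
   have "y < grid_above y k" by (rule dyadic_above)
   then have "av n < grid_above y k" "\<forall>s\<in>{0..real n}. X n s w <= grid_above y k"
    using Xb n y by (auto intro: order_trans[OF Xb] simp del: atLeastAtMost_iff)
   then have "\<Lambda> n (grid_above y k) (real n) w = 0"
    using regular elim of_nat_0_le_iff unfolding regular_def by blast
   then show ?case unfolding \<Lambda>_at .
  qed
  then have "(%k. L (u n w) (grid_above y k) w) ----> 0" by (rule tendsto_eventually)
  from LIMSEQ_unique[OF right_limit[OF y(1) u] this] show ?thesis .
 qed
 then have "\<forall>\<^sub>F n in sequentially. ennreal (L (u n w) y w) = 0"
  using level_eventually[OF y(1)] by (auto elim!: eventually_mono)
 from LIMSEQ_unique[OF L_tendsto[OF y(1)] tendsto_eventually[OF this]] show ?thesis .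
qed

end

end

section \<open>The dichotomy\<close>

context exiting_diffusion
begin

lemma start_in: "x0 \<in> J" by (rule level_in[of 0]) (use av(3) bv(3) in auto)

lemma Hn_random: "Hn n y \<in> borel_measurable M"
 using measurable_Pair2[OF Hn_measurable, of y n] by simp

lemma H_random: "H y \<in> borel_measurable M"
 using measurable_Pair2[OF H_measurable, of y] by simp

lemma Hn_\<Lambda>: "av n < y ==> y < bv n ==> AE w in M. Hn n y w = ennreal (\<Lambda> n y (real n) w)"
 using regular_AE by eventually_elim (simp add: Hn_eq \<Lambda>_at)

lemma G_real: "y \<in> J ==> G y = ennreal (enn2real (G y))"
 using G_finite[of y] by simp

text \<open>The bound for the process stopped inside the compact interval is at most
  \<open>G y\<close>, whatever \<open>n\<close>; Fatou's lemma carries it to the exit time.\<close>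

lemma mean_bound:
 assumes y: "y \<in> J" shows "(\<integral>\<^sup>+w. H y w \<partial>M) <= ennreal (2 * g y)"
proof -
 have b: "(\<integral>\<^sup>+w. Hn n y w \<partial>M) <= ennreal (2 * g y)" if n: "av n < y" "y < bv n" "0 < n" for n
 proof -
  from bounded_local_time_ex[OF n(1,2)] obtain b a I Iy where
   B: "bounded_local_time M F W (X n) b a I x0 (av n) (bv n) y Iy (\<Lambda> n y) q \<rho>" by (elim exE)
  have "ennreal (\<rho> y / 2) * (\<integral>\<^sup>+w. Hn n y w \<partial>M) = (\<integral>\<^sup>+w. ennreal (\<rho> y / 2) * Hn n y w \<partial>M)"
   by (rule nn_integral_cmult[symmetric]) (rule Hn_random)
  also have "\<dots> = (\<integral>\<^sup>+w. ennreal (\<rho> y / 2 * \<Lambda> n y (real n) w) \<partial>M)"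
  proof (rule nn_integral_cong_AE)
   show "AE w in M. ennreal (\<rho> y / 2) * Hn n y w = ennreal (\<rho> y / 2 * \<Lambda> n y (real n) w)"
    using Hn_\<Lambda>[OF n(1,2)]
   proof eventually_elim
    case (elim w)
    show ?case unfolding elim by (rule ennreal_mult'[symmetric]) (use \<rho>_pos[of y] in simp)
   qed
  qed
  also have "\<dots> <= ennreal (prim (av n) (bv n) \<rho> y)"
   by (rule bounded_local_time.local_time_bound[OF B]) (use n(3) in simp)
  also have "\<dots> <= ennreal (enn2real (G y))" using prim_le_G[OF av_in bv_in] G_real[OF y] by simp
  finally have "ennreal (2 / \<rho> y) * (ennreal (\<rho> y / 2) * (\<integral>\<^sup>+w. Hn n y w \<partial>M)) <= ennreal (2 / \<rho> y) * ennreal (enn2real (G y))"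
   by (rule mult_left_mono) simp
  moreover have "ennreal (2 / \<rho> y) * ennreal (\<rho> y / 2) = 1" using \<rho>_pos[of y] by (simp add: ennreal_mult[symmetric])
  ultimately show ?thesis using \<rho>_pos[of y] by (simp add: mult.assoc[symmetric] ennreal_mult[symmetric] g_def)
 qed
 have "(\<integral>\<^sup>+w. H y w \<partial>M) <= liminf (%n. \<integral>\<^sup>+w. Hn n y w \<partial>M)"
  unfolding H_def by (rule nn_integral_liminf) (rule Hn_random)
 also have "\<dots> <= limsup (%n. \<integral>\<^sup>+w. Hn n y w \<partial>M)" by (rule Liminf_le_Limsup) simp
 also have "\<dots> <= ennreal (2 * g y)"
  by (rule Limsup_bounded) (use eventually_conj[OF level_eventually[OF y] eventually_gt_at_top[of 0]] b in \<open>auto elim!: eventually_mono\<close>)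
 finally show ?thesis .
qed

definition V :: "nat => 'a => real" where
 "V n = (SOME f. f \<in> borel_measurable M \<and> (AE w in M. X n (real n) w = f w))"

lemma V: "V n \<in> borel_measurable M" and V_AE: "AE w in M. X n (real n) w = V n w"
proof -
 from bounded_local_time_ex[OF av(3)[of n] bv(3)[of n]] obtain b a I Iy where
  "bounded_local_time M F W (X n) b a I x0 (av n) (bv n) x0 Iy (\<Lambda> n x0) q \<rho>" by (elim exE)
 then have "bounded_ito M F W (X n) b a I x0 (av n) (bv n)" unfolding bounded_local_time_def by blast
 from ae_measurable_F[OF bounded_ito.X_adapted[OF this of_nat_0_le_iff]]
 have "\<exists>f. f \<in> borel_measurable M \<and> (AE w in M. X n (real n) w = f w)" unfolding ae_measurable_def by blast
 from someI_ex[OF this] show "V n \<in> borel_measurable M" "AE w in M. X n (real n) w = V n w" unfolding V_def[symmetric] by blast+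
qed

text \<open>Convergence at \<open>\<zeta>\<close> involves uncountably many times and is not known
  to be an event. This event is defined by the countable sequence of positions at the times
  \<open>u n\<close>, and contains almost every path tending to \<open>l\<close>.\<close>

definition to_left :: "'a set" where
 "to_left = {w\<in>space M. limsup (%n. ereal (V n w)) = l \<and> liminf (%n. ereal (V n w)) = l}"

lemma to_left_event: "to_left \<in> events"
 unfolding to_left_def using V by measurable

lemma to_left_tendsto: "w \<in> to_left ==> (%n. ereal (V n w)) ----> l"
 unfolding to_left_def by (intro Liminf_eq_Limsup) auto

lemma tends_to_left: "AE w in M. tends_at_exit Y l r l w --> w \<in> to_left"
proof -
 have "AE w in M. \<forall>n. X n (real n) w = V n w" using V_AE by (simp add: AE_all_countable)
 then show ?thesis using good_AE AE_space
 proof eventually_elim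
  case (elim w)
  interpret P: exit_path Y w l r x0 av bv by (rule elim)
  have eq: "ereal (V n w) = Y (P.u n) w" for n
   using X_good(2)[OF elim(2), of "real n" n] elim(1) unfolding P.u_def \<tau>_def by simp
  show ?case
  proof
   assume "tends_at_exit Y l r l w"
   then have "(%n. ereal (V n w)) ----> l" unfolding eq by (rule P.tends_along)
   then show "w \<in> to_left" unfolding to_left_def using elim(3) lim_imp_Liminf lim_imp_Limsup sequentially_bot by blast
  qed
 qed
qed

text \<open>A lower bound for the function \<open>U\<close> of each stopped process that does not
  refer to the interval; it stands for \<open>s(y) - s(v)\<close> below \<open>y\<close> and is 0
  above.\<close>

definition scale_gap :: "real => real => ennreal" where
 "scale_gap y v = (\<integral>\<^sup>+x\<in>einterval (ereal v) (ereal y). ennreal (\<rho> x) \<partial>lborel)"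

lemma scale_gap_borel: "scale_gap y \<in> borel_measurable borel"
proof -
 have "(%(v, x). ennreal (\<rho> x) * (if v < x \<and> x < y then 1 else 0)) \<in> borel_measurable (borel \<Otimes>\<^sub>M lborel)"
  using \<rho>_borel by measurable
 from lborel.borel_measurable_nn_integral[OF this]
 have "(%v. \<integral>\<^sup>+x. ennreal (\<rho> x) * (if v < x \<and> x < y then 1 else 0) \<partial>lborel) \<in> borel_measurable borel" .
 then show ?thesis unfolding scale_gap_def[abs_def] einterval_def indicator_def[of "Collect _"] of_bool_def by simp
qed

lemma scale_gap_le:
 assumes v: "v \<in> {av n..bv n}" and y: "av n < y" "y < bv n"
 shows "scale_gap y v <= ennreal (prim (av n) (bv n) \<rho> y - prim (av n) (bv n) \<rho> (min v y))"
proof (cases "v <= y")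
 case True
 have i: "set_integrable lborel {v<..y} \<rho>"
  by (rule set_integrable_subset[OF \<rho>_integrable[OF av_in bv_in, of n n]]) (use v y in auto)
 have "scale_gap y v <= (\<integral>\<^sup>+x. ennreal (indicator {v<..y} x *\<^sub>R \<rho> x) \<partial>lborel)"
  unfolding scale_gap_def by (rule nn_integral_mono) (auto simp: einterval_def indicator_def)
 also have "\<dots> = ennreal (LBINT x:{v<..y}. \<rho> x)"
  unfolding set_lebesgue_integral_def
  by (rule nn_integral_eq_integral) (use i \<rho>_pos in \<open>auto simp: set_integrable_def less_imp_le\<close>)
 also have "(LBINT x:{v<..y}. \<rho> x) = prim (av n) (bv n) \<rho> y - prim (av n) (bv n) \<rho> v"
  by (rule prim_increment[OF \<rho>_integrable[OF av_in bv_in], symmetric]) (use v y True in auto)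
 finally show ?thesis using True by (simp add: min_absorb1)
next
 case False
 then have "einterval (ereal v) (ereal y) = {}" by (auto simp: einterval_def)
 then show ?thesis unfolding scale_gap_def by simp
qed

text \<open>Fatou's lemma again: every point of \<open>(l, y)\<close> eventually lies to the right
  of \<open>v n\<close>.\<close>

lemma scale_gap_liminf:
 assumes v: "(%n. ereal (v n)) ----> l"
 shows "G y <= liminf (%n. scale_gap y (v n))"
proof -
 have "G y <= (\<integral>\<^sup>+x. liminf (%n. ennreal (\<rho> x) * indicator (einterval (ereal (v n)) (ereal y)) x) \<partial>lborel)"
  unfolding G_def
 proof (rule nn_integral_mono)
  fix x
  show "ennreal (\<rho> x) * indicator (einterval l (ereal y)) x <= liminf (%n. ennreal (\<rho> x) * indicator (einterval (ereal (v n)) (ereal y)) x)"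
  proof (cases "x \<in> einterval l (ereal y)")
   case True
   then have "\<forall>\<^sub>F n in sequentially. ereal (v n) < ereal x" by (intro order_tendstoD(2)[OF v]) (simp add: einterval_def)
   then have "\<forall>\<^sub>F n in sequentially. ennreal (\<rho> x) * indicator (einterval l (ereal y)) x <= ennreal (\<rho> x) * indicator (einterval (ereal (v n)) (ereal y)) x"
    by eventually_elim (use True in \<open>auto simp: einterval_def indicator_def\<close>)
   then show ?thesis by (rule Liminf_bounded)
  qed simp
 qed
 also have "\<dots> <= liminf (%n. scale_gap y (v n))"
  unfolding scale_gap_def by (rule nn_integral_liminf) (use \<rho>_borel in measurable)
 finally show ?thesis .
qed

text \<open>On the event in question \<open>Hn <= H <= \<eta>\<close> for all large
  \<open>n\<close>, while the scale gap of the stopped path becomes at least \<open>G y\<close> in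
  the limit. Fatou's lemma and \<open>small_local_time_bound\<close> give \<open>G y\<close> times
  the probability at most \<open>\<rho> y * \<eta> / 2\<close>; division by \<open>\<rho> y\<close>
  produces \<open>g y\<close>.\<close>

lemma tail_bound:
 assumes y: "y \<in> J" "y <= x0" and \<eta>: "0 < \<eta>"
 shows "g y * prob {w\<in>to_left. H y w <= ennreal \<eta>} <= \<eta> / 2"
proof -
 define A where "A = {w\<in>to_left. H y w <= ennreal \<eta>}"
 have "{w\<in>space M. w \<in> to_left \<and> H y w <= ennreal \<eta>} \<in> events" using to_left_event H_random by measurable
 moreover have "{w\<in>space M. w \<in> to_left \<and> H y w <= ennreal \<eta>} = A"
  unfolding A_def using sets.sets_into_space[OF to_left_event] by auto
 ultimately have A[measurable]: "A \<in> events" by simp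
 \<comment> \<open>A measurable minorant, built from the versions \<open>V n\<close> and
   \<open>Hn n\<close>, of the integrand in \<open>small_local_time_bound\<close>.\<close>
 define f where "f n w = scale_gap y (V n w) * indicator {w. Hn n y w <= ennreal \<eta>} w" for n w
 have fm: "f n \<in> borel_measurable M" for n
 proof -
  have "(%w. scale_gap y (V n w)) \<in> borel_measurable M" by (rule measurable_compose[OF V scale_gap_borel])
  then have "(%w. scale_gap y (V n w) * (if Hn n y w <= ennreal \<eta> then 1 else 0)) \<in> borel_measurable M" using Hn_random by measurable
  then show ?thesis unfolding f_def[abs_def] indicator_def of_bool_def by simp
 qed
 have b: "(\<integral>\<^sup>+w. f n w \<partial>M) <= ennreal (\<rho> y * \<eta> / 2)" if n: "av n < y" "y < bv n" "0 < n" for n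
 proof -
  from bounded_local_time_ex[OF n(1,2)] obtain b a I Iy where
   B: "bounded_local_time M F W (X n) b a I x0 (av n) (bv n) y Iy (\<Lambda> n y) q \<rho>" by (elim exE)
  define U where "U x = prim (av n) (bv n) \<rho> y - prim (av n) (bv n) \<rho> (min x y)" for x
  have U: "bounded_local_time.U (av n) (bv n) y \<rho> = U" unfolding U_def bounded_local_time.U_def[OF B] ..
  have "AE w in M. f n w <= ennreal (U (X n (real n) w)) * indicator {w. \<Lambda> n y (real n) w <= \<eta>} w"
   using good_AE V_AE[of n] Hn_\<Lambda>[OF n(1,2)]
  proof eventually_elim
   case (elim w)
   have "scale_gap y (V n w) <= ennreal (U (X n (real n) w))"
    using scale_gap_le[OF X_good(1)[OF elim(1), of "real n" n] n(1,2)] elim(2) unfolding U_def by simp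
   moreover have "Hn n y w <= ennreal \<eta> \<longleftrightarrow> \<Lambda> n y (real n) w <= \<eta>" unfolding elim(3) using \<eta> by (simp add: ennreal_le_iff2)
   ultimately show ?case unfolding f_def by (auto simp: indicator_def)
  qed
  then have "(\<integral>\<^sup>+w. f n w \<partial>M) <= (\<integral>\<^sup>+w. ennreal (U (X n (real n) w)) * indicator {w. \<Lambda> n y (real n) w <= \<eta>} w \<partial>M)"
   by (rule nn_integral_mono_AE)
  also have "\<dots> <= ennreal (\<rho> y * \<eta> / 2)"
   using bounded_local_time.small_local_time_bound[OF B, of "real n" \<eta>] n(3) \<eta> y(2) unfolding U by simp
  finally show ?thesis .
 qed
 have "G y * emeasure M A = (\<integral>\<^sup>+w. G y * indicator A w \<partial>M)" by (simp add: nn_integral_cmult_indicator)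
 also have "\<dots> <= (\<integral>\<^sup>+w. liminf (%n. f n w) \<partial>M)"
 proof (rule nn_integral_mono_AE)
  show "AE w in M. G y * indicator A w <= liminf (%n. f n w)"
   using regular_AE
  proof eventually_elim
   case (elim w)
   show ?case
   proof (cases "w \<in> A")
    case True
    have "\<forall>\<^sub>F n in sequentially. Hn n y w <= ennreal \<eta>"
     using level_eventually[OF y(1)]
    proof eventually_elim
     case (elim n)
     have "Hn n y w <= H y w" using L_le[OF \<open>regular w\<close> y(1), of n] elim
      by (simp add: Hn_eq[OF \<open>regular w\<close>] H_eq[OF \<open>regular w\<close> y(1)])
     then show ?case using True unfolding A_def by (auto intro: order_trans)
    qed
    then have "\<forall>\<^sub>F n in sequentially. scale_gap y (V n w) <= f n w" by eventually_elim (simp add: f_def)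
    then have "liminf (%n. scale_gap y (V n w)) <= liminf (%n. f n w)" by (rule Liminf_mono)
    moreover have "G y <= liminf (%n. scale_gap y (V n w))"
     by (rule scale_gap_liminf[OF to_left_tendsto]) (use True in \<open>simp add: A_def\<close>)
    ultimately show ?thesis using True by simp
   qed simp
  qed
 qed
 also have "\<dots> <= liminf (%n. \<integral>\<^sup>+w. f n w \<partial>M)" by (rule nn_integral_liminf) (rule fm)
 also have "\<dots> <= limsup (%n. \<integral>\<^sup>+w. f n w \<partial>M)" by (rule Liminf_le_Limsup) simp
 also have "\<dots> <= ennreal (\<rho> y * \<eta> / 2)"
  by (rule Limsup_bounded) (use eventually_conj[OF level_eventually[OF y(1)] eventually_gt_at_top[of 0]] b in \<open>auto elim!: eventually_mono\<close>)
 finally have "ennreal (enn2real (G y) * prob A) <= ennreal (\<rho> y * \<eta> / 2)"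
  using G_real[OF y(1)] by (simp add: emeasure_eq_measure ennreal_mult)
 then have "enn2real (G y) * prob A <= \<rho> y * \<eta> / 2" using \<rho>_pos[of y] \<eta> by (simp add: ennreal_le_iff)
 then have "enn2real (G y) * prob A / \<rho> y <= \<eta> / 2" using \<rho>_pos[of y] by (simp add: divide_le_eq mult.commute)
 then show ?thesis unfolding g_def A_def by simp
qed

text \<open>The numerator \<open>G\<close> increases, and the continuous positive
  \<open>\<rho>\<close> attains its minimum on the compact interval.\<close>

lemma g_bounded:
 assumes "z \<in> J" "w \<in> J" shows "\<exists>C. \<forall>x\<in>{z..w}. g x <= C"
proof (cases "z <= w")
 case True
 obtain p where p: "p \<in> {z..w}" "!!x. x \<in> {z..w} ==> \<rho> p <= \<rho> x"
  using continuous_attains_inf[OF compact_Icc _ continuous_\<rho>_Icc[OF assms]] True by (metis atLeastatMost_empty_iff)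
 have "g x <= enn2real (G w) / \<rho> p" if x: "x \<in> {z..w}" for x
  unfolding g_def
 proof (rule frac_le)
  show "enn2real (G x) <= enn2real (G w)"
   by (rule enn2real_mono) (use G_split[OF J_Icc[OF assms x] assms(2)] x G_finite[OF assms(2)] in auto)
 qed (use p x \<rho>_pos in auto)
 then show ?thesis by blast
qed auto

end

locale exiting_diffusion_measure = exiting_diffusion +
 fixes \<nu> :: "real measure"
 assumes \<nu>: "locally_finite_measure_on J \<nu>"
begin

abbreviation "f \<equiv> %x. (scale_fun \<mu> \<sigma> c (ereal x) - scale_fun \<mu> \<sigma> c l) / ereal (scale_density \<mu> \<sigma> c x)"

lemma sets_\<nu>: "sets \<nu> = sets (restrict_space borel J)" and compact_\<nu>: "compact K ==> K \<subseteq> J ==> emeasure \<nu> K < \<infinity>"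
 using \<nu> unfolding locally_finite_measure_on_def by auto

lemma space_\<nu>: "space \<nu> = J"
 using sets_eq_imp_space_eq[OF sets_\<nu>] by (simp add: space_restrict_space)

lemma sets_\<nu>I: "B \<in> sets borel ==> B \<subseteq> J ==> B \<in> sets \<nu>"
 unfolding sets_\<nu> sets_restrict_space by (auto intro!: image_eqI[of _ _ B])

lemma borel_\<nu>: "k \<in> borel_measurable borel ==> k \<in> borel_measurable \<nu>"
 using measurable_restrict_space1[of k borel borel J] measurable_cong_sets[OF sets_\<nu> refl] by blast

lemma \<nu>_sigma_finite: "sigma_finite_measure \<nu>"
proof
 have Icc: "{av n..bv n} \<subseteq> J" for n using J_Icc[OF av_in bv_in] by blast
 have "(\<Union>n. {av n..bv n}) = J"
 proof (intro subset_antisym subsetI)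
  fix y assume "y \<in> J"
  then obtain n where "av n < y" "y < bv n"
   using eventually_happens'[OF sequentially_bot level_eventually] by blast
  then show "y \<in> (\<Union>n. {av n..bv n})" by (intro UN_I[of n]) auto
 qed (use Icc in blast)
 then show "\<exists>A. countable A \<and> A \<subseteq> sets \<nu> \<and> \<Union> A = space \<nu> \<and> (\<forall>a\<in>A. emeasure \<nu> a \<noteq> \<infinity>)"
  using compact_\<nu>[OF compact_Icc Icc] sets_\<nu>I[OF _ Icc]
  by (intro exI[of _ "range (%n. {av n..bv n})"]) (auto simp: space_\<nu> less_top)
qed

lemma H_joint: "(%(y, w). H y w) \<in> borel_measurable (\<nu> \<Otimes>\<^sub>M M)"
proof -
 have "(%z. (fst z, snd z)) \<in> \<nu> \<Otimes>\<^sub>M M \<rightarrow>\<^sub>M borel \<Otimes>\<^sub>M M"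
  by (intro measurable_Pair measurable_snd measurable_compose[OF measurable_fst borel_\<nu>]) simp
 from measurable_compose[OF this H_measurable] show ?thesis by (simp add: split_beta')
qed

lemma f_eq: "x \<in> J ==> f x = ereal (g x)" by (rule scale_ratio)

lemma f_integral:
 assumes "z \<in> J"
 shows "(\<integral>\<^sup>+x\<in>einterval l (ereal z). e2ennreal \<bar>f x\<bar> \<partial>\<nu>) = (\<integral>\<^sup>+x\<in>einterval l (ereal z). ennreal (g x) \<partial>\<nu>)"
proof (rule nn_integral_cong)
 fix x assume "x \<in> space \<nu>"
 then have "x \<in> J" unfolding space_\<nu> .
 then have "e2ennreal \<bar>f x\<bar> = ennreal (g x)" using g_pos[of x] by (simp only: f_eq abs_ereal.simps) (simp add: ennreal.abs_eq[symmetric] e2ennreal_ereal)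
 then show "e2ennreal \<bar>f x\<bar> * indicator (einterval l (ereal z)) x = ennreal (g x) * indicator (einterval l (ereal z)) x" by simp
qed

lemma f_borel: "f \<in> borel_measurable (restrict_space borel J)"
proof -
 have "(%x. ereal (g x)) \<in> borel_measurable (restrict_space borel J)"
  by (rule measurable_restrict_space1) (use g_borel in measurable)
 then show ?thesis by (rule measurable_cong[THEN iffD1, rotated]) (simp add: space_restrict_space f_eq)
qed

lemma L1_iff: "f \<in> L1_loc_left l r \<nu> \<longleftrightarrow> (\<exists>z\<in>J. (\<integral>\<^sup>+x\<in>einterval l (ereal z). ennreal (g x) \<partial>\<nu>) < \<infinity>)"
 unfolding L1_loc_left_def using f_borel f_integral by auto

text \<open>The mean of the integral over \<open>(l, bv m)\<close> is finite for each
  \<open>m\<close>; a path tending to \<open>l\<close> stays below some \<open>bv m\<close>, so its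
  whole integral is one of these countably many.\<close>

theorem finite_case:
 assumes "f \<in> L1_loc_left l r \<nu>"
 shows "AE w in M. tends_at_exit Y l r l w --> (\<integral>\<^sup>+y. local_time_at_exit Y l r L y w \<partial>\<nu>) < \<infinity>"
proof -
 obtain z where z: "z \<in> J" "(\<integral>\<^sup>+x\<in>einterval l (ereal z). ennreal (g x) \<partial>\<nu>) < \<infinity>" using assms L1_iff by blast
 define D where "D m = einterval l (ereal (bv m))" for m
 have D: "D m \<in> sets \<nu>" for m unfolding D_def by (rule sets_\<nu>I[OF _ left_subset[OF bv_in]]) simp
 have gm: "(%x. ennreal (g x)) \<in> borel_measurable \<nu>" by (rule borel_\<nu>) (use g_borel in measurable)
 \<comment> \<open>Integrability near \<open>l\<close> covers the part below \<open>z\<close>; on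
   \<open>{z..bv m}\<close> the function \<open>g\<close> is bounded and \<open>\<nu>\<close> is
   finite by local finiteness.\<close>
 have fin: "(\<integral>\<^sup>+x\<in>D m. ennreal (2 * g x) \<partial>\<nu>) < \<infinity>" for m
 proof -
  obtain C where C: "!!x. x \<in> {z..bv m} ==> g x <= C" using g_bounded[OF z(1) bv_in] by blast
  have Icc: "{z..bv m} \<subseteq> J" using J_Icc[OF z(1) bv_in] by blast
  have "(\<integral>\<^sup>+x\<in>D m. ennreal (2 * g x) \<partial>\<nu>) <=
   (\<integral>\<^sup>+x. 2 * (ennreal (g x) * indicator (einterval l (ereal z)) x) + ennreal (2 * C) * indicator {z..bv m} x \<partial>\<nu>)"
  proof (rule nn_integral_mono)
   fix x assume "x \<in> space \<nu>"
   then have "0 < g x" unfolding space_\<nu> by (rule g_pos)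
   then show "ennreal (2 * g x) * indicator (D m) x <= 2 * (ennreal (g x) * indicator (einterval l (ereal z)) x) + ennreal (2 * C) * indicator {z..bv m} x"
    using C[of x] by (cases "x < z") (auto simp: D_def einterval_def indicator_def ennreal_mult intro!: mult_left_mono ennreal_leI)
  qed
  also have "\<dots> = 2 * (\<integral>\<^sup>+x\<in>einterval l (ereal z). ennreal (g x) \<partial>\<nu>) + ennreal (2 * C) * emeasure \<nu> {z..bv m}"
   using sets_\<nu>I[OF _ left_subset[OF z(1)]] sets_\<nu>I[OF _ Icc] gm
   by (subst nn_integral_add) (auto simp: nn_integral_cmult nn_integral_cmult_indicator)
  also have "\<dots> < \<infinity>" using z(2) compact_\<nu>[OF compact_Icc Icc] by (auto simp: ennreal_mult_less_top ennreal_add_less_top less_top)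
  finally show ?thesis .
 qed
 have "AE w in M. (\<integral>\<^sup>+y\<in>D m. H y w \<partial>\<nu>) < \<infinity>" for m
  by (rule integral_finite_of_mean[OF \<nu>_sigma_finite H_joint D _ fin]) (rule mean_bound, use left_subset[OF bv_in] D_def in blast)
 then have "AE w in M. \<forall>m. (\<integral>\<^sup>+y\<in>D m. H y w \<partial>\<nu>) < \<infinity>" unfolding AE_all_countable by blast
 then show ?thesis using regular_AE
 proof eventually_elim
  case (elim w)
  interpret P: exit_path Y w l r x0 av bv using elim(2) unfolding regular_def by blast
  show ?case
  proof
   assume "tends_at_exit Y l r l w"
   from P.bounded_above_of_tends[OF this] obtain m where m: "!!t. 0 <= t ==> ereal t < \<zeta> w ==> Y t w <= ereal (bv m)" by blast
   have "(\<integral>\<^sup>+y. local_time_at_exit Y l r L y w \<partial>\<nu>) = (\<integral>\<^sup>+y\<in>D m. H y w \<partial>\<nu>)"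
   proof (rule nn_integral_cong)
    fix y assume "y \<in> space \<nu>"
    then have y: "y \<in> J" unfolding space_\<nu> .
    show "local_time_at_exit Y l r L y w = H y w * indicator (D m) y"
    proof (cases "y < bv m")
     case True
     then have "y \<in> D m" using y unfolding D_def by (simp add: einterval_def)
     then show ?thesis by (simp add: H_eq[OF elim(2) y])
    next
     case False
     then have "y \<notin> D m" "local_time_at_exit Y l r L y w = 0"
      using local_time_at_exit_above[OF elim(2) m y] unfolding D_def by (auto simp: einterval_def)
     then show ?thesis by simp
    qed
   qed
   then show "(\<integral>\<^sup>+y. local_time_at_exit Y l r L y w \<partial>\<nu>) < \<infinity>" using elim(1) by simp
  qed
 qed
qed

text \<open>Divergence holds on \<open>(l, z)\<close> for every \<open>z\<close> in J, in particular
  for \<open>z = x0\<close>, which confines the levels to those below the starting point, where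
  \<open>tail_bound\<close> is available.\<close>

theorem infinite_case:
 assumes "f \<notin> L1_loc_left l r \<nu>"
 shows "AE w in M. tends_at_exit Y l r l w --> (\<integral>\<^sup>+y. local_time_at_exit Y l r L y w \<partial>\<nu>) = \<infinity>"
proof -
 define D where "D = einterval l (ereal x0)"
 have DJ: "D \<subseteq> J" unfolding D_def by (rule left_subset[OF start_in])
 have D: "D \<in> sets \<nu>" by (rule sets_\<nu>I[OF _ DJ]) (simp add: D_def)
 have inf: "(\<integral>\<^sup>+y\<in>D. ennreal (g y) \<partial>\<nu>) = \<infinity>"
  using assms start_in unfolding L1_iff D_def by (auto simp: not_less top_unique)
 have "AE w in M. w \<in> to_left --> (\<integral>\<^sup>+y\<in>D. H y w \<partial>\<nu>) = \<infinity>"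
 proof (rule integral_infinite_of_tail[OF \<nu>_sigma_finite H_joint D _ to_left_event _ borel_\<nu>[OF g_borel] inf])
  show "0 < g y" if "y \<in> D" for y using g_pos that DJ by blast
  show "g y * prob {w\<in>to_left. H y w <= ennreal \<eta>} <= \<eta> / 2" if "y \<in> D" "0 < \<eta>" for y \<eta>
   by (rule tail_bound) (use that DJ in \<open>auto simp: D_def einterval_def\<close>)
 qed
 then show ?thesis using tends_to_left regular_AE
 proof eventually_elim
  case (elim w)
  have "(\<integral>\<^sup>+y\<in>D. H y w \<partial>\<nu>) <= (\<integral>\<^sup>+y. local_time_at_exit Y l r L y w \<partial>\<nu>)"
   by (rule nn_integral_mono) (simp add: space_\<nu> H_eq[OF elim(3)] indicator_def)
  then show ?case using elim by (auto simp: top_unique)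
 qed
qed

end

theorem theorem6p4:
  fixes M :: "'a measure" and F :: "real \<Rightarrow> 'a measure" and W :: "real \<Rightarrow> 'a \<Rightarrow> real"
    and l r :: ereal and \<mu> \<sigma> :: "real \<Rightarrow> real" and x0 c :: real
    and Y :: "real \<Rightarrow> 'a \<Rightarrow> ereal" and L :: "real \<Rightarrow> real \<Rightarrow> 'a \<Rightarrow> real"
    and \<nu> :: "real measure"
  assumes "l < r"
    and "\<mu> \<in> borel_measurable (restrict_space borel (einterval l r))"
    and "\<sigma> \<in> borel_measurable (restrict_space borel (einterval l r))"
    and "\<forall>x\<in>einterval l r. \<sigma> x \<noteq> 0"
    and "locally_integrable_on (einterval l r) (\<lambda>x. 1 / (\<sigma> x)\<^sup>2)"
    and "locally_integrable_on (einterval l r) (\<lambda>x. \<mu> x / (\<sigma> x)\<^sup>2)"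
    and "filtered_prob_space M F"
    and "brownian_motion M F W"
    and "x0 \<in> einterval l r"
    and "sde_solution M F W l r \<mu> \<sigma> x0 Y"
    and "local_time_version M F W l r \<mu> \<sigma> x0 Y L"
    and "c \<in> einterval l r"
    and "locally_finite_measure_on (einterval l r) \<nu>"
    and "scale_fun \<mu> \<sigma> c l > -\<infinity>"
  shows
    "((\<lambda>x. (scale_fun \<mu> \<sigma> c (ereal x) - scale_fun \<mu> \<sigma> c l) / ereal (scale_density \<mu> \<sigma> c x))
        \<in> L1_loc_left l r \<nu> \<longrightarrow>
      (AE \<omega> in M. tends_at_exit Y l r l \<omega> \<longrightarrow>
         (\<integral>\<^sup>+y. local_time_at_exit Y l r L y \<omega> \<partial>\<nu>) < \<infinity>)) \<and>
     ((\<lambda>x. (scale_fun \<mu> \<sigma> c (ereal x) - scale_fun \<mu> \<sigma> c l) / ereal (scale_density \<mu> \<sigma> c x))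
        \<notin> L1_loc_left l r \<nu> \<longrightarrow>
      (AE \<omega> in M. tends_at_exit Y l r l \<omega> \<longrightarrow>
         (\<integral>\<^sup>+y. local_time_at_exit Y l r L y \<omega> \<partial>\<nu>) = \<infinity>))"
proof -
 have x0: "l < ereal x0" "ereal x0 < r" using assms(9) by (auto simp: einterval_def)
 \<comment> \<open>Real sequences strictly inside J on either side of \<open>x0\<close> that exhaust
   J; \<open>Y\<close> stopped between them is an Ito process.\<close>
 obtain av :: "nat => real" where av: "decseq av" "!!n. l < ereal (av n)" "!!n. ereal (av n) < ereal x0" "(%n. ereal (av n)) ----> l"
  using ereal_decseq_approx[OF x0(1)] by blast
 obtain bv :: "nat => real" where bv: "incseq bv" "!!n. ereal x0 < ereal (bv n)" "!!n. ereal (bv n) < r" "(%n. ereal (bv n)) ----> r"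
  using ereal_incseq_approx[OF x0(2)] by blast
 interpret exiting_diffusion_measure l r \<mu> \<sigma> c M F W x0 Y L av bv \<nu>
  by unfold_locales (use assms av bv in auto)
 show ?thesis using finite_case infinite_case by blast
qed

end
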